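(* Let $z_0=(u_0,F_0,\theta_0,m_0)\in\mathcal{SM}_\mu$, and let $(u,F,\theta,m)$, with pressure $\pi$, be a solution of the magnetoviscoelastic system (MVE) given in the context with initial value $z_0$, on its maximal interval of existence $[0,T_+(z_0))$, having the regularity $(u,F,\theta,m)\in\mathbb E_{1,\mu}(J_T)$, $\pi\in L_{p,\mu}(J_T;\dot H^1_p(\Omega))$ for every $T\in(0,T_+(z_0))$ and satisfying $\theta(t,x)\ge\min_{\overline\Omega}\theta_0$ for $(t,x)\in[0,T_+(z_0))\times\overline\Omega$. Then the following properties hold. (a) (First law of thermodynamics) The total energy $$\mathsf E=\int_\Omega\Big(\tfrac12|u|^2+\tfrac12|F|^2+\tfrac12|\nabla m|^2+\theta\Big)\,dx$$ is preserved along the solution $(u,F,\theta,m)$. (b) (Second law of thermodynamics) The total entropy $$\mathsf N=\int_\Omega(1+\ln\theta)\,dx$$ is non-decreasing along the solution $(u,F,\theta,m)$. In fact, the entropy production rate $$r=\frac1\theta\Big[\mu_{\rm vis}(\theta)|\nabla u|^2+\kappa(\theta)|\nabla F|^2+\alpha(\theta)\big|\Delta m+|\nabla m|^2m\big|^2-\frac{q\cdot\nabla\theta}{\theta}\Big]$$ is always non-negative, i.e. $r\ge0$.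
   Context: Setting. $\Omega\subset\mathbb R^3$ is a bounded domain with $C^3$ boundary and outward unit normal $\nu$; $\mathbb M^3=\mathbb R^{3\times3}$. Coefficients: $\mu_{\rm vis},\kappa,\alpha,\beta\in C^5(\mathbb R)$, $K\in C^5(\mathbb R^3\times\mathbb M^3\times\mathbb R\times\mathbb R^3;\mathrm{sym}(\mathbb M^3))$ (values in symmetric matrices), with $\mu_{\rm vis}\ge\underline\mu$, $\kappa\ge\underline\kappa$, $\alpha\ge\underline\alpha$, $K\ge\underline c\,I_3$ for given positive constants $\underline\mu,\underline\kappa,\underline\alpha,\underline c$. The numbers $p,\mu$ satisfy $p>5$ and $\frac12+\frac5{2p}<\mu\le1$. Conventions. $[\nabla u]_{ij}=\partial_iu_j$; for a matrix field $A$, $[\nabla\cdot A]_i=\partial_jA_{ji}$ (summation convention); $\nabla\cdot(\kappa\nabla F)=\partial_j(\kappa\,\partial_jF)$; $|\nabla F|^2=\partial_jF:\partial_jF$, where $A:B=\mathrm{Tr}(AB^{\mathsf T})$; $[\nabla m\odot\nabla m]_{ij}=\partial_im\cdot\partial_jm$; $u\cdot\nabla w=u_j\partial_jw$; $\dot H^1_p(\Omega)$ is the homogeneous Sobolev space of locally integrable functions (modulo constants) with gradient in $L_p(\Omega)$. System (MVE) for velocity $u$ ($\mathbb R^3$-valued), pressure $\pi$, deformation tensor $F$ ($\mathbb M^3$-valued), temperature $\theta$ (scalar), magnetization $m$ ($\mathbb R^3$-valued): in $\Omega$, $\partial_tu+u\cdot\nabla u-\nabla\cdot(\mu_{\rm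 vis}(\theta)\nabla u)+\nabla\pi=-\nabla\cdot(\nabla m\odot\nabla m)+\nabla\cdot(FF^{\mathsf T})$, $\ \nabla\cdot u=0$, $\partial_tF+u\cdot\nabla F-\nabla\cdot(\kappa(\theta)\nabla F)=(\nabla u)^{\mathsf T}F$, $\partial_t\theta+u\cdot\nabla\theta+\nabla\cdot q=\mu_{\rm vis}(\theta)|\nabla u|^2+\kappa(\theta)|\nabla F|^2+\alpha(\theta)|\Delta m+|\nabla m|^2m|^2$, with $q=-K(u,F,\theta,m)\nabla\theta$, $\partial_tm+u\cdot\nabla m=-\alpha(\theta)m\times(m\times\Delta m)-\beta(\theta)m\times\Delta m$, $\ |m|=1$; on $\partial\Omega$: $u=0$, $F=0$, $q\cdot\nu=0$, $\partial_\nu m=0$; and $(u,F,\theta,m)(0)=(u_0,F_0,\theta_0,m_0)$. Spaces. $J_T=(0,T)$; $L_{p,\mu}(J_T;X)=\{f:\ t^{1-\mu}f\in L_p(J_T;X)\}$; $W^1_{p,\mu}(J_T;X)=\{f\in W^1_{1,loc}(J_T;X):f,\partial_tf\in L_{p,\mu}(J_T;X)\}$. $L_{p,\sigma}(\Omega;\mathbb R^3)=P_H L_p(\Omega;\mathbb R^3)$ with $P_H$ the Helmholtz projection. $X_0=L_{p,\sigma}(\Omega;\mathbb R^3)\times L_p(\Omega;\mathbb M^3)\times L_p(\Omega)\times W^1_p(\Omega;\mathbb R^3)$; $X_1=\{u\in W^2_p\cap L_{p,\sigma}:u|_{\partial\Omega}=0\}\times\{F\in W^2_p(\Omega;\mathbb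 M^3):F|_{\partial\Omega}=0\}\times W^2_p(\Omega)\times\{m\in W^3_p(\Omega;\mathbb R^3):\partial_\nu m=0\text{ on }\partial\Omega\}$; $X_{\gamma,\mu}=(X_0,X_1)_{\mu-1/p,p}$ (real interpolation); $\mathbb E_{1,\mu}(J_T)=W^1_{p,\mu}(J_T;X_0)\cap L_{p,\mu}(J_T;X_1)$. State manifold: $\mathcal{SM}_\mu=\{z=(u,F,\theta,m)\in X_{\gamma,\mu}:\theta>0,\ |m|=1,\ \nu\cdot(K(z)\nabla\theta)=0\text{ on }\partial\Omega\}$. *)

theory Defs
  imports "HOL-Analysis.Analysis"
begin

primrec Ck_on :: "nat \<Rightarrow> ('a::euclidean_space \<Rightarrow> 'b::real_normed_vector) \<Rightarrow> 'a set \<Rightarrow> bool" where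
  "Ck_on 0 f S = continuous_on S f"
| "Ck_on (Suc k) f S =
     (\<exists>f'. (\<forall>x\<in>S. (f has_derivative f' x) (at x)) \<and> (\<forall>v. Ck_on k (\<lambda>x. f' x v) S))"

definition test_function :: "'a::euclidean_space set \<Rightarrow> ('a \<Rightarrow> real) \<Rightarrow> bool" where
  "test_function S \<phi> \<longleftrightarrow>
     (\<forall>k. Ck_on k \<phi> UNIV) \<and> (\<exists>C. compact C \<and> C \<subseteq> S \<and> (\<forall>x. x \<notin> C \<longrightarrow> \<phi> x = 0))"

definition local_defining_function ::
    "nat \<Rightarrow> 'a::euclidean_space set \<Rightarrow> 'a \<Rightarrow> 'a set \<Rightarrow> ('a \<Rightarrow> real) \<Rightarrow> bool" where
  "local_defining_function k \<Omega> x U \<psi> \<longleftrightarrow>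
     open U \<and> x \<in> U \<and> Ck_on k \<psi> U \<and> (\<forall>y\<in>U. frechet_derivative \<psi> (at y) \<noteq> (\<lambda>_. 0)) \<and>
     \<Omega> \<inter> U = {y \<in> U. \<psi> y < 0} \<and> frontier \<Omega> \<inter> U = {y \<in> U. \<psi> y = 0}"

definition Ck_boundary :: "nat \<Rightarrow> 'a::euclidean_space set \<Rightarrow> bool" where
  "Ck_boundary k \<Omega> \<longleftrightarrow> (\<forall>x\<in>frontier \<Omega>. \<exists>U \<psi>. local_defining_function k \<Omega> x U \<psi>)"

text \<open>The normalised gradient of any local defining function; a defining function is negative
  inside \<open>\<Omega>\<close>, so this vector points outwards.\<close>

definition outward_normal :: "'a::euclidean_space set \<Rightarrow> 'a \<Rightarrow> 'a" where
  "outward_normal \<Omega> x =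
     (THE n. norm n = 1 \<and>
        (\<exists>U \<psi> c. local_defining_function 1 \<Omega> x U \<psi> \<and> c > 0 \<and>
           (\<psi> has_derivative (\<lambda>h. c * (n \<bullet> h))) (at x)))"

text \<open>Function spaces on \<open>\<Omega>\<close> are sets of representatives, together with a (semi)norm. All
  spaces below are invariant under changes on null sets and outside \<open>\<Omega>\<close>.\<close>

definition Lp :: "real \<Rightarrow> (real^3) set \<Rightarrow> (real^3 \<Rightarrow> 'b::euclidean_space) set" where
  "Lp p \<Omega> = {f. f \<in> borel_measurable (lebesgue_on \<Omega>) \<and>
                 integrable (lebesgue_on \<Omega>) (\<lambda>x. norm (f x) powr p)}"

definition Lp_norm :: "real \<Rightarrow> (real^3) set \<Rightarrow> (real^3 \<Rightarrow> 'b::euclidean_space) \<Rightarrow> real" where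
  "Lp_norm p \<Omega> f = (\<integral>x. norm (f x) powr p \<partial>lebesgue_on \<Omega>) powr (1 / p)"

definition locally_integrable_on :: "(real^3 \<Rightarrow> 'b::euclidean_space) \<Rightarrow> (real^3) set \<Rightarrow> bool" where
  "locally_integrable_on f \<Omega> \<longleftrightarrow> (\<forall>C. compact C \<and> C \<subseteq> \<Omega> \<longrightarrow> integrable (lebesgue_on C) f)"

definition has_weak_partial ::
    "(real^3) set \<Rightarrow> 3 \<Rightarrow> (real^3 \<Rightarrow> 'b::euclidean_space) \<Rightarrow> (real^3 \<Rightarrow> 'b) \<Rightarrow> bool" where
  "has_weak_partial \<Omega> i f g \<longleftrightarrow>
     locally_integrable_on f \<Omega> \<and> locally_integrable_on g \<Omega> \<and>
     (\<forall>\<phi>. test_function \<Omega> \<phi> \<longrightarrow>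
        (\<integral>x. frechet_derivative \<phi> (at x) (axis i 1) *\<^sub>R f x \<partial>lebesgue_on \<Omega>) =
        - (\<integral>x. \<phi> x *\<^sub>R g x \<partial>lebesgue_on \<Omega>))"

definition weak_partial ::
    "(real^3) set \<Rightarrow> 3 \<Rightarrow> (real^3 \<Rightarrow> 'b::euclidean_space) \<Rightarrow> real^3 \<Rightarrow> 'b" where
  "weak_partial \<Omega> i f = (SOME g. has_weak_partial \<Omega> i f g)"

text \<open>\<open>weak_grad \<Omega> f x $ i\<close> is the \<open>i\<close>-th partial derivative, so for a vector field \<open>u\<close> one has
  \<open>weak_grad \<Omega> u x $ i $ j\<close> = \<open>\<partial>\<^sub>i u\<^sub>j\<close>. The divergence contracts with the first
  index: \<open>weak_div \<Omega> A x $ i\<close> = \<open>\<partial>\<^sub>j A\<^sub>j\<^sub>i\<close>. Euclidean norms of gradients are Frobenius norms.\<close>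

definition weak_grad ::
    "(real^3) set \<Rightarrow> (real^3 \<Rightarrow> 'b::euclidean_space) \<Rightarrow> real^3 \<Rightarrow> 'b^3" where
  "weak_grad \<Omega> f x = (\<chi> i. weak_partial \<Omega> i f x)"

definition weak_div ::
    "(real^3) set \<Rightarrow> (real^3 \<Rightarrow> 'b::euclidean_space^3) \<Rightarrow> real^3 \<Rightarrow> 'b" where
  "weak_div \<Omega> A x = (\<Sum>j\<in>UNIV. weak_partial \<Omega> j (\<lambda>y. A y $ j) x)"

definition weak_laplacian ::
    "(real^3) set \<Rightarrow> (real^3 \<Rightarrow> 'b::euclidean_space) \<Rightarrow> real^3 \<Rightarrow> 'b" where
  "weak_laplacian \<Omega> f = weak_div \<Omega> (weak_grad \<Omega> f)"

definition advection ::
    "(real^3) set \<Rightarrow> (real^3 \<Rightarrow> real^3) \<Rightarrow> (real^3 \<Rightarrow> 'b::euclidean_space) \<Rightarrow> real^3 \<Rightarrow> 'b" where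
  "advection \<Omega> u w x = (\<Sum>j\<in>UNIV. (u x $ j) *\<^sub>R weak_partial \<Omega> j w x)"

primrec Sobolev :: "nat \<Rightarrow> real \<Rightarrow> (real^3) set \<Rightarrow> (real^3 \<Rightarrow> 'b::euclidean_space) set" where
  "Sobolev 0 p \<Omega> = Lp p \<Omega>"
| "Sobolev (Suc k) p \<Omega> =
     {f \<in> Lp p \<Omega>. \<forall>i. \<exists>g \<in> Sobolev k p \<Omega>. has_weak_partial \<Omega> i f g}"

primrec Sobolev_norm ::
    "nat \<Rightarrow> real \<Rightarrow> (real^3) set \<Rightarrow> (real^3 \<Rightarrow> 'b::euclidean_space) \<Rightarrow> real" where
  "Sobolev_norm 0 p \<Omega> f = Lp_norm p \<Omega> f"
| "Sobolev_norm (Suc k) p \<Omega> f =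
     Lp_norm p \<Omega> f + (\<Sum>i\<in>UNIV. Sobolev_norm k p \<Omega> (weak_partial \<Omega> i f))"

definition homogeneous_H1 :: "real \<Rightarrow> (real^3) set \<Rightarrow> (real^3 \<Rightarrow> real) set" where
  "homogeneous_H1 p \<Omega> =
     {f. locally_integrable_on f \<Omega> \<and> (\<forall>i. \<exists>g \<in> Lp p \<Omega>. has_weak_partial \<Omega> i f g)}"

text \<open>The constants are factored out by the seminorm.\<close>

definition homogeneous_H1_norm :: "real \<Rightarrow> (real^3) set \<Rightarrow> (real^3 \<Rightarrow> real) \<Rightarrow> real" where
  "homogeneous_H1_norm p \<Omega> f = Lp_norm p \<Omega> (weak_grad \<Omega> f)"

text \<open>\<open>g\<close> = \<open>P\<^sub>H f\<close>: the difference \<open>f - g\<close> is the gradient of the solution of the weak Neumann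
  problem with right-hand side \<open>f\<close>, tested with the homogeneous space for the dual exponent.\<close>

definition Helmholtz_projection ::
    "real \<Rightarrow> (real^3) set \<Rightarrow> (real^3 \<Rightarrow> real^3) \<Rightarrow> (real^3 \<Rightarrow> real^3) \<Rightarrow> bool" where
  "Helmholtz_projection p \<Omega> f g \<longleftrightarrow>
     (\<exists>h \<in> homogeneous_H1 p \<Omega>.
        (AE x in lebesgue_on \<Omega>. g x = f x - weak_grad \<Omega> h x) \<and>
        (\<forall>\<psi> \<in> homogeneous_H1 (p / (p - 1)) \<Omega>.
           (\<integral>x. f x \<bullet> weak_grad \<Omega> \<psi> x \<partial>lebesgue_on \<Omega>) =
           (\<integral>x. weak_grad \<Omega> h x \<bullet> weak_grad \<Omega> \<psi> x \<partial>lebesgue_on \<Omega>)))"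

definition Lp_sigma :: "real \<Rightarrow> (real^3) set \<Rightarrow> (real^3 \<Rightarrow> real^3) set" where
  "Lp_sigma p \<Omega> = {g \<in> Lp p \<Omega>. \<exists>f \<in> Lp p \<Omega>. Helmholtz_projection p \<Omega> f g}"

text \<open>All boundary values below are those of \<open>W\<^sup>1\<^sub>p\<close> functions with \<open>p > 3\<close>, whose trace is the
  restriction to the boundary of the representative that is continuous up to the boundary.\<close>

definition continuous_representative ::
    "(real^3) set \<Rightarrow> (real^3 \<Rightarrow> 'b::euclidean_space) \<Rightarrow> (real^3 \<Rightarrow> 'b) \<Rightarrow> bool" where
  "continuous_representative \<Omega> f g \<longleftrightarrow>
     continuous_on (closure \<Omega>) g \<and> (AE x in lebesgue_on \<Omega>. g x = f x)"

definition zero_on_boundary :: "(real^3) set \<Rightarrow> (real^3 \<Rightarrow> 'b::euclidean_space) \<Rightarrow> bool" where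
  "zero_on_boundary \<Omega> f \<longleftrightarrow>
     (\<exists>g. continuous_representative \<Omega> f g \<and> (\<forall>x\<in>frontier \<Omega>. g x = 0))"

definition zero_normal_component_on_boundary ::
    "(real^3) set \<Rightarrow> (real^3 \<Rightarrow> 'b::euclidean_space^3) \<Rightarrow> bool" where
  "zero_normal_component_on_boundary \<Omega> A \<longleftrightarrow>
     (\<exists>G. continuous_representative \<Omega> A G \<and>
        (\<forall>x\<in>frontier \<Omega>. (\<Sum>j\<in>UNIV. (outward_normal \<Omega> x $ j) *\<^sub>R (G x $ j)) = 0))"

text \<open>The Bochner theory is relative to a function space with carrier \<open>X\<close> and (semi)norm \<open>N\<close>,
  since Sobolev spaces are not types; it follows the construction of the library's Bochner
  integral by approximation with simple functions.\<close>

definition simple_into ::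
    "real set \<Rightarrow> ('a \<Rightarrow> 'b::real_vector) set \<Rightarrow> (real \<Rightarrow> 'a \<Rightarrow> 'b) \<Rightarrow> bool" where
  "simple_into J X s \<longleftrightarrow>
     finite (s ` J) \<and> s ` J \<subseteq> X \<and> (\<forall>a. {t \<in> J. s t = a} \<in> sets lebesgue)"

definition simple_integral ::
    "real set \<Rightarrow> (real \<Rightarrow> 'a \<Rightarrow> 'b::real_vector) \<Rightarrow> 'a \<Rightarrow> 'b" where
  "simple_integral J s x = (\<Sum>a\<in>s ` J. measure lebesgue {t \<in> J. s t = a} *\<^sub>R a x)"

definition strongly_measurable ::
    "('a \<Rightarrow> 'b::real_vector) set \<Rightarrow> (('a \<Rightarrow> 'b) \<Rightarrow> real) \<Rightarrow> real set \<Rightarrow> (real \<Rightarrow> 'a \<Rightarrow> 'b) \<Rightarrow> bool" where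
  "strongly_measurable X N J f \<longleftrightarrow>
     (\<exists>s. (\<forall>n. simple_into J X (s n)) \<and>
        (AE t in lebesgue_on J. f t \<in> X \<and> (\<lambda>n. N (\<lambda>x. s n t x - f t x)) \<longlonglongrightarrow> 0))"

definition has_Bochner_integral_in ::
    "('a \<Rightarrow> 'b::real_vector) set \<Rightarrow> (('a \<Rightarrow> 'b) \<Rightarrow> real) \<Rightarrow> real set \<Rightarrow>
     (real \<Rightarrow> 'a \<Rightarrow> 'b) \<Rightarrow> ('a \<Rightarrow> 'b) \<Rightarrow> bool" where
  "has_Bochner_integral_in X N J f v \<longleftrightarrow>
     strongly_measurable X N J f \<and> v \<in> X \<and>
     (\<exists>s. (\<forall>n. simple_into J X (s n)) \<and>
        (\<lambda>n. \<integral>\<^sup>+t. ennreal (N (\<lambda>x. s n t x - f t x)) \<partial>lebesgue_on J) \<longlonglongrightarrow> 0 \<and>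
        (\<lambda>n. N (\<lambda>x. simple_integral J (s n) x - v x)) \<longlonglongrightarrow> 0)"

definition L1_loc_in ::
    "('a \<Rightarrow> 'b::real_vector) set \<Rightarrow> (('a \<Rightarrow> 'b) \<Rightarrow> real) \<Rightarrow> real set \<Rightarrow> (real \<Rightarrow> 'a \<Rightarrow> 'b) set" where
  "L1_loc_in X N J =
     {f. \<forall>a b. {a..b} \<subseteq> J \<longrightarrow>
        strongly_measurable X N {a..b} f \<and> integrable (lebesgue_on {a..b}) (\<lambda>t. N (f t))}"

definition has_weak_time_derivative ::
    "('a \<Rightarrow> 'b::real_vector) set \<Rightarrow> (('a \<Rightarrow> 'b) \<Rightarrow> real) \<Rightarrow> real set \<Rightarrow>
     (real \<Rightarrow> 'a \<Rightarrow> 'b) \<Rightarrow> (real \<Rightarrow> 'a \<Rightarrow> 'b) \<Rightarrow> bool" where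
  "has_weak_time_derivative X N J f g \<longleftrightarrow>
     f \<in> L1_loc_in X N J \<and> g \<in> L1_loc_in X N J \<and>
     (\<forall>\<phi>. test_function J \<phi> \<longrightarrow>
        (\<exists>v. has_Bochner_integral_in X N J (\<lambda>t x. deriv \<phi> t *\<^sub>R f t x) v \<and>
             has_Bochner_integral_in X N J (\<lambda>t x. - (\<phi> t *\<^sub>R g t x)) v))"

definition weak_time_derivative ::
    "('a \<Rightarrow> 'b::real_vector) set \<Rightarrow> (('a \<Rightarrow> 'b) \<Rightarrow> real) \<Rightarrow> real set \<Rightarrow>
     (real \<Rightarrow> 'a \<Rightarrow> 'b) \<Rightarrow> real \<Rightarrow> 'a \<Rightarrow> 'b" where
  "weak_time_derivative X N J f = (SOME g. has_weak_time_derivative X N J f g)"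

definition weighted_Lp ::
    "('a \<Rightarrow> 'b::real_vector) set \<Rightarrow> (('a \<Rightarrow> 'b) \<Rightarrow> real) \<Rightarrow> real \<Rightarrow> real \<Rightarrow> real \<Rightarrow>
     (real \<Rightarrow> 'a \<Rightarrow> 'b) set" where
  "weighted_Lp X N p \<mu> T =
     {f. strongly_measurable X N {0<..<T} f \<and>
         integrable (lebesgue_on {0<..<T}) (\<lambda>t. (t powr (1 - \<mu>) * N (f t)) powr p)}"

definition weighted_W1p ::
    "('a \<Rightarrow> 'b::real_vector) set \<Rightarrow> (('a \<Rightarrow> 'b) \<Rightarrow> real) \<Rightarrow> real \<Rightarrow> real \<Rightarrow> real \<Rightarrow>
     (real \<Rightarrow> 'a \<Rightarrow> 'b) set" where
  "weighted_W1p X N p \<mu> T =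
     {f \<in> weighted_Lp X N p \<mu> T.
        \<exists>g \<in> weighted_Lp X N p \<mu> T. has_weak_time_derivative X N {0<..<T} f g}"

definition K_functional ::
    "(real^3) set \<Rightarrow> (real^3 \<Rightarrow> 'b::euclidean_space) set \<Rightarrow> ((real^3 \<Rightarrow> 'b) \<Rightarrow> real) \<Rightarrow>
     (real^3 \<Rightarrow> 'b) set \<Rightarrow> ((real^3 \<Rightarrow> 'b) \<Rightarrow> real) \<Rightarrow> real \<Rightarrow> (real^3 \<Rightarrow> 'b) \<Rightarrow> real" where
  "K_functional \<Omega> Y0 N0 Y1 N1 s z =
     Inf {N0 a + s * N1 b | a b. a \<in> Y0 \<and> b \<in> Y1 \<and> (AE x in lebesgue_on \<Omega>. z x = a x + b x)}"

definition real_interpolation ::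
    "(real^3) set \<Rightarrow> (real^3 \<Rightarrow> 'b::euclidean_space) set \<Rightarrow> ((real^3 \<Rightarrow> 'b) \<Rightarrow> real) \<Rightarrow>
     (real^3 \<Rightarrow> 'b) set \<Rightarrow> ((real^3 \<Rightarrow> 'b) \<Rightarrow> real) \<Rightarrow> real \<Rightarrow> real \<Rightarrow> (real^3 \<Rightarrow> 'b) set" where
  "real_interpolation \<Omega> Y0 N0 Y1 N1 \<theta> q =
     {z. (\<exists>a\<in>Y0. \<exists>b\<in>Y1. AE x in lebesgue_on \<Omega>. z x = a x + b x) \<and>
         (\<integral>\<^sup>+s. ennreal ((s powr (- \<theta>) * K_functional \<Omega> Y0 N0 Y1 N1 s z) powr q / s)
            \<partial>lebesgue_on {0<..}) < \<infinity>}"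

text \<open>Values of \<open>z = (u, F, \<theta>, m)\<close>.\<close>

type_synonym state = "(real^3) \<times> (real^3^3) \<times> real \<times> (real^3)"

definition vel :: "(real^3 \<Rightarrow> state) \<Rightarrow> real^3 \<Rightarrow> real^3" where
  "vel z x = fst (z x)"

definition dfm :: "(real^3 \<Rightarrow> state) \<Rightarrow> real^3 \<Rightarrow> real^3^3" where
  "dfm z x = fst (snd (z x))"

definition tmp :: "(real^3 \<Rightarrow> state) \<Rightarrow> real^3 \<Rightarrow> real" where
  "tmp z x = fst (snd (snd (z x)))"

definition mag :: "(real^3 \<Rightarrow> state) \<Rightarrow> real^3 \<Rightarrow> real^3" where
  "mag z x = snd (snd (snd (z x)))"

definition X0 :: "real \<Rightarrow> (real^3) set \<Rightarrow> (real^3 \<Rightarrow> state) set" where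
  "X0 p \<Omega> = {z. vel z \<in> Lp_sigma p \<Omega> \<and> dfm z \<in> Lp p \<Omega> \<and> tmp z \<in> Lp p \<Omega> \<and>
                 mag z \<in> Sobolev 1 p \<Omega>}"

definition X0_norm :: "real \<Rightarrow> (real^3) set \<Rightarrow> (real^3 \<Rightarrow> state) \<Rightarrow> real" where
  "X0_norm p \<Omega> z = Lp_norm p \<Omega> (vel z) + Lp_norm p \<Omega> (dfm z) + Lp_norm p \<Omega> (tmp z) +
                    Sobolev_norm 1 p \<Omega> (mag z)"

definition X1 :: "real \<Rightarrow> (real^3) set \<Rightarrow> (real^3 \<Rightarrow> state) set" where
  "X1 p \<Omega> = {z. vel z \<in> Sobolev 2 p \<Omega> \<inter> Lp_sigma p \<Omega> \<and> zero_on_boundary \<Omega> (vel z) \<and>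
                 dfm z \<in> Sobolev 2 p \<Omega> \<and> zero_on_boundary \<Omega> (dfm z) \<and>
                 tmp z \<in> Sobolev 2 p \<Omega> \<and>
                 mag z \<in> Sobolev 3 p \<Omega> \<and>
                 zero_normal_component_on_boundary \<Omega> (weak_grad \<Omega> (mag z))}"

definition X1_norm :: "real \<Rightarrow> (real^3) set \<Rightarrow> (real^3 \<Rightarrow> state) \<Rightarrow> real" where
  "X1_norm p \<Omega> z = Sobolev_norm 2 p \<Omega> (vel z) + Sobolev_norm 2 p \<Omega> (dfm z) +
                    Sobolev_norm 2 p \<Omega> (tmp z) + Sobolev_norm 3 p \<Omega> (mag z)"

definition X_gamma :: "real \<Rightarrow> real \<Rightarrow> (real^3) set \<Rightarrow> (real^3 \<Rightarrow> state) set" where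
  "X_gamma p \<mu> \<Omega> =
     real_interpolation \<Omega> (X0 p \<Omega>) (X0_norm p \<Omega>) (X1 p \<Omega>) (X1_norm p \<Omega>) (\<mu> - 1 / p) p"

definition E1 :: "real \<Rightarrow> real \<Rightarrow> (real^3) set \<Rightarrow> real \<Rightarrow> (real \<Rightarrow> real^3 \<Rightarrow> state) set" where
  "E1 p \<mu> \<Omega> T = weighted_W1p (X0 p \<Omega>) (X0_norm p \<Omega>) p \<mu> T \<inter>
                   weighted_Lp (X1 p \<Omega>) (X1_norm p \<Omega>) p \<mu> T"

definition heat_flux ::
    "(real^3) set \<Rightarrow> (state \<Rightarrow> real^3^3) \<Rightarrow> (real^3 \<Rightarrow> state) \<Rightarrow> real^3 \<Rightarrow> real^3" where
  "heat_flux \<Omega> K z x = - (K (z x) *v weak_grad \<Omega> (tmp z) x)"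

text \<open>Since \<open>X_gamma\<close> embeds into the functions that are continuous up to the boundary, the
  pointwise conditions are those on the continuous representative, which is the one taken here.\<close>

definition state_manifold ::
    "real \<Rightarrow> real \<Rightarrow> (real^3) set \<Rightarrow> (state \<Rightarrow> real^3^3) \<Rightarrow> (real^3 \<Rightarrow> state) set" where
  "state_manifold p \<mu> \<Omega> K =
     {z \<in> X_gamma p \<mu> \<Omega>. continuous_on (closure \<Omega>) z \<and>
        (\<forall>x\<in>closure \<Omega>. tmp z x > 0 \<and> norm (mag z x) = 1) \<and>
        zero_normal_component_on_boundary \<Omega> (\<lambda>x. K (z x) *v weak_grad \<Omega> (tmp z) x)}"

definition tension :: "(real^3) set \<Rightarrow> (real^3 \<Rightarrow> real^3) \<Rightarrow> real^3 \<Rightarrow> real^3" where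
  "tension \<Omega> m x = weak_laplacian \<Omega> m x + (norm (weak_grad \<Omega> m x))\<^sup>2 *\<^sub>R m x"

text \<open>The equations at a fixed time; \<open>z'\<close> stands for the time derivative of \<open>z\<close> and \<open>\<pi>\<close> for the
  pressure.\<close>

definition MVE_equations ::
    "(real^3) set \<Rightarrow> (real \<Rightarrow> real) \<Rightarrow> (real \<Rightarrow> real) \<Rightarrow> (real \<Rightarrow> real) \<Rightarrow> (real \<Rightarrow> real) \<Rightarrow>
     (state \<Rightarrow> real^3^3) \<Rightarrow> (real^3 \<Rightarrow> state) \<Rightarrow> (real^3 \<Rightarrow> state) \<Rightarrow> (real^3 \<Rightarrow> real) \<Rightarrow> bool" where
  "MVE_equations \<Omega> \<mu>vis \<kappa> \<alpha> \<beta> K z' z \<pi> \<longleftrightarrow>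
     (let u = vel z; F = dfm z; \<theta> = tmp z; m = mag z in
      AE x in lebesgue_on \<Omega>.
        vel z' x + advection \<Omega> u u x - weak_div \<Omega> (\<lambda>y. \<mu>vis (\<theta> y) *\<^sub>R weak_grad \<Omega> u y) x
            + weak_grad \<Omega> \<pi> x
          = - weak_div \<Omega> (\<lambda>y. (\<chi> i j. weak_partial \<Omega> i m y \<bullet> weak_partial \<Omega> j m y)) x
            + weak_div \<Omega> (\<lambda>y. F y ** transpose (F y)) x \<and>
        weak_div \<Omega> u x = 0 \<and>
        dfm z' x + advection \<Omega> u F x - weak_div \<Omega> (\<lambda>y. \<kappa> (\<theta> y) *\<^sub>R weak_grad \<Omega> F y) x
          = transpose (weak_grad \<Omega> u x) ** F x \<and>
        tmp z' x + advection \<Omega> u \<theta> x + weak_div \<Omega> (heat_flux \<Omega> K z) x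
          = \<mu>vis (\<theta> x) * (norm (weak_grad \<Omega> u x))\<^sup>2 + \<kappa> (\<theta> x) * (norm (weak_grad \<Omega> F x))\<^sup>2
            + \<alpha> (\<theta> x) * (norm (tension \<Omega> m x))\<^sup>2 \<and>
        mag z' x + advection \<Omega> u m x
          = - (\<alpha> (\<theta> x) *\<^sub>R cross3 (m x) (cross3 (m x) (weak_laplacian \<Omega> m x)))
            - \<beta> (\<theta> x) *\<^sub>R cross3 (m x) (weak_laplacian \<Omega> m x) \<and>
        norm (m x) = 1)"

definition MVE_boundary_conditions ::
    "(real^3) set \<Rightarrow> (state \<Rightarrow> real^3^3) \<Rightarrow> (real^3 \<Rightarrow> state) \<Rightarrow> bool" where
  "MVE_boundary_conditions \<Omega> K z \<longleftrightarrow>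
     zero_on_boundary \<Omega> (vel z) \<and> zero_on_boundary \<Omega> (dfm z) \<and>
     zero_normal_component_on_boundary \<Omega> (heat_flux \<Omega> K z) \<and>
     zero_normal_component_on_boundary \<Omega> (weak_grad \<Omega> (mag z))"

text \<open>Elements of \<open>E1\<close> are continuous in time with values in \<open>X_gamma\<close>, hence in \<open>X0\<close> and in the
  continuous functions on the closure of \<open>\<Omega>\<close>. The second and third conjuncts select this
  representative, so that \<open>z t\<close> and \<open>z t x\<close> have a meaning for every \<open>t\<close> and every \<open>x\<close> in the
  closure. The interval of existence is \<open>[0, T\<^sub>+)\<close> with \<open>T\<^sub>+\<close> possibly infinite.\<close>

definition MVE_solution ::
    "real \<Rightarrow> real \<Rightarrow> (real^3) set \<Rightarrow> (real \<Rightarrow> real) \<Rightarrow> (real \<Rightarrow> real) \<Rightarrow> (real \<Rightarrow> real) \<Rightarrow>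
     (real \<Rightarrow> real) \<Rightarrow> (state \<Rightarrow> real^3^3) \<Rightarrow> (real^3 \<Rightarrow> state) \<Rightarrow> ereal \<Rightarrow>
     (real \<Rightarrow> real^3 \<Rightarrow> state) \<Rightarrow> (real \<Rightarrow> real^3 \<Rightarrow> real) \<Rightarrow> bool" where
  "MVE_solution p \<mu> \<Omega> \<mu>vis \<kappa> \<alpha> \<beta> K z0 Tp z \<pi> \<longleftrightarrow>
     0 < Tp \<and>
     (\<forall>t\<ge>0. ereal t < Tp \<longrightarrow> z t \<in> X0 p \<Omega> \<and> continuous_on (closure \<Omega>) (z t)) \<and>
     (\<forall>t\<ge>0. ereal t < Tp \<longrightarrow>
        ((\<lambda>s. X0_norm p \<Omega> (\<lambda>x. z s x - z t x)) \<longlongrightarrow> 0) (at t within {s. 0 \<le> s \<and> ereal s < Tp})) \<and>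
     (\<forall>x\<in>closure \<Omega>. z 0 x = z0 x) \<and>
     (\<forall>T>0. ereal T < Tp \<longrightarrow>
        z \<in> E1 p \<mu> \<Omega> T \<and>
        \<pi> \<in> weighted_Lp (homogeneous_H1 p \<Omega>) (homogeneous_H1_norm p \<Omega>) p \<mu> T \<and>
        (AE t in lebesgue_on {0<..<T}.
           MVE_equations \<Omega> \<mu>vis \<kappa> \<alpha> \<beta> K
             (weak_time_derivative (X0 p \<Omega>) (X0_norm p \<Omega>) {0<..<T} z t) (z t) (\<pi> t) \<and>
           MVE_boundary_conditions \<Omega> K (z t)))"

definition maximal_MVE_solution ::
    "real \<Rightarrow> real \<Rightarrow> (real^3) set \<Rightarrow> (real \<Rightarrow> real) \<Rightarrow> (real \<Rightarrow> real) \<Rightarrow> (real \<Rightarrow> real) \<Rightarrow>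
     (real \<Rightarrow> real) \<Rightarrow> (state \<Rightarrow> real^3^3) \<Rightarrow> (real^3 \<Rightarrow> state) \<Rightarrow> ereal \<Rightarrow>
     (real \<Rightarrow> real^3 \<Rightarrow> state) \<Rightarrow> (real \<Rightarrow> real^3 \<Rightarrow> real) \<Rightarrow> bool" where
  "maximal_MVE_solution p \<mu> \<Omega> \<mu>vis \<kappa> \<alpha> \<beta> K z0 Tp z \<pi> \<longleftrightarrow>
     MVE_solution p \<mu> \<Omega> \<mu>vis \<kappa> \<alpha> \<beta> K z0 Tp z \<pi> \<and>
     \<not> (\<exists>S w \<rho>. Tp < S \<and> MVE_solution p \<mu> \<Omega> \<mu>vis \<kappa> \<alpha> \<beta> K z0 S w \<rho> \<and>
          (\<forall>t\<ge>0. ereal t < Tp \<longrightarrow> (\<forall>x\<in>closure \<Omega>. w t x = z t x)))"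

definition energy_density :: "(real^3) set \<Rightarrow> (real^3 \<Rightarrow> state) \<Rightarrow> real^3 \<Rightarrow> real" where
  "energy_density \<Omega> z x =
     (norm (vel z x))\<^sup>2 / 2 + (norm (dfm z x))\<^sup>2 / 2 + (norm (weak_grad \<Omega> (mag z) x))\<^sup>2 / 2 + tmp z x"

definition total_energy :: "(real^3) set \<Rightarrow> (real^3 \<Rightarrow> state) \<Rightarrow> real" where
  "total_energy \<Omega> z = (\<integral>x. energy_density \<Omega> z x \<partial>lebesgue_on \<Omega>)"

definition entropy_density :: "(real^3 \<Rightarrow> state) \<Rightarrow> real^3 \<Rightarrow> real" where
  "entropy_density z x = 1 + ln (tmp z x)"

definition total_entropy :: "(real^3) set \<Rightarrow> (real^3 \<Rightarrow> state) \<Rightarrow> real" where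
  "total_entropy \<Omega> z = (\<integral>x. entropy_density z x \<partial>lebesgue_on \<Omega>)"

definition entropy_production_rate ::
    "(real^3) set \<Rightarrow> (real \<Rightarrow> real) \<Rightarrow> (real \<Rightarrow> real) \<Rightarrow> (real \<Rightarrow> real) \<Rightarrow>
     (state \<Rightarrow> real^3^3) \<Rightarrow> (real^3 \<Rightarrow> state) \<Rightarrow> real^3 \<Rightarrow> real" where
  "entropy_production_rate \<Omega> \<mu>vis \<kappa> \<alpha> K z x =
     (1 / tmp z x) *
       (\<mu>vis (tmp z x) * (norm (weak_grad \<Omega> (vel z) x))\<^sup>2
        + \<kappa> (tmp z x) * (norm (weak_grad \<Omega> (dfm z) x))\<^sup>2
        + \<alpha> (tmp z x) * (norm (tension \<Omega> (mag z) x))\<^sup>2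
        - (heat_flux \<Omega> K z x \<bullet> weak_grad \<Omega> (tmp z) x) / tmp z x)"

end

theory Submission
  imports Defs
begin

text \<open>For almost every time, testing the equations with \<open>(u, F, 1, -\<Delta>m)\<close> and integrating by parts
  gives the energy balance; testing the temperature equation with \<open>1 / \<theta>\<close> gives the entropy inequality.
  Boundary terms are removed by cutoffs, so that traces are not needed. The energy is quadratic and the
  entropy is concave, hence their increments are bounded below by a linear functional of the increment of \<open>z\<close>,
  which is the time integral of that functional applied to the derivative. No chain rule for functions with
  values in a Banach space is used: over short time steps the errors are small multiples of the integral
  of the norm of the derivative, and they sum to an arbitrarily small quantity.\<close>

section \<open>Smooth functions\<close>

text \<open>Three cancellations produce the energy balance. The divergence of the magnetic stress
  consists of \<open>Lap m . d_l m\<close>, which cancels the advection of \<open>m\<close> tested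
  with the Laplacian, and of a gradient, which a solenoidal \<open>u\<close> does not see. The
  elastic stress cancels the stretching of \<open>F\<close>. The dissipation reappears as the heat
  source. The test function \<open>- Lap m\<close> enters as a pairing of gradients: the time
  derivative of \<open>m\<close> lies in a first order Sobolev space, and the Neumann condition
  moves one derivative back. The obstacle is that the spaces are sets of representatives with a
  seminorm and that weak derivatives are chosen by \<open>SOME\<close>. Linear identities therefore
  hold almost everywhere only, and it is bounded linear functionals that pass through the Bochner
  integral; the quadratic energy and the logarithmic entropy have to be compared with such
  functionals. All pairings are taken in L2: on a bounded domain with \<open>2 \<le> p\<close> the
  norm of \<open>X0\<close> controls the L2 norm of \<open>(u, F, \<theta>, grad m)\<close>, and
  continuity in time is used in that norm.\<close>

lemma Ck_on_SucI:
  assumes "\<And>x. x \<in> S \<Longrightarrow> (f has_derivative f' x) (at x)" "\<And>v. Ck_on k (\<lambda>x. f' x v) S"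
  shows "Ck_on (Suc k) f S"
  using assms by auto

lemma Ck_on_SucE:
  assumes "Ck_on (Suc k) f S"
  obtains f' where "\<And>x. x \<in> S \<Longrightarrow> (f has_derivative f' x) (at x)" "\<And>v. Ck_on k (\<lambda>x. f' x v) S"
  using assms by auto

lemma Ck_on_Suc_lower: "Ck_on (Suc k) f S \<Longrightarrow> Ck_on k f S"
proof (induction k arbitrary: f)
  case 0
  then obtain f' where "\<forall>x\<in>S. (f has_derivative f' x) (at x)"
    by auto
  then show ?case
    by (auto intro!: continuous_at_imp_continuous_on intro: has_derivative_continuous)
next
  case (Suc k)
  from Suc.prems obtain f' where f': "\<And>x. x \<in> S \<Longrightarrow> (f has_derivative f' x) (at x)"
    "\<And>v. Ck_on (Suc k) (\<lambda>x. f' x v) S"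
    by (rule Ck_on_SucE) blast
  show ?case
    by (rule Ck_on_SucI[where f'=f']) (fact f'(1), rule Suc.IH, fact f'(2))
qed

lemma Ck_on_le: "Ck_on k f S \<Longrightarrow> j \<le> k \<Longrightarrow> Ck_on j f S"
proof (induction k)
  case (Suc k)
  then show ?case
    by (cases "j = Suc k") (use Ck_on_Suc_lower[OF Suc.prems(1)] in auto)
qed simp

lemma Ck_on_const: "Ck_on k (\<lambda>x. c) S"
proof (induction k arbitrary: c)
  case (Suc k)
  show ?case
    by (rule Ck_on_SucI[where f'="\<lambda>x v. 0"]) (auto intro: Suc)
qed auto

lemma Ck_on_linear: "bounded_linear g \<Longrightarrow> Ck_on k g S"
proof (cases k)
  case (Suc j)
  assume "bounded_linear g"
  then show ?thesis
    unfolding Suc by (intro Ck_on_SucI[where f'="\<lambda>x. g"] bounded_linear_imp_has_derivative Ck_on_const)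
qed (simp add: linear_continuous_on)

lemma Ck_on_add: "Ck_on k f S \<Longrightarrow> Ck_on k g S \<Longrightarrow> Ck_on k (\<lambda>x. f x + g x) S"
proof (induction k arbitrary: f g)
  case (Suc k)
  obtain f' where f': "\<And>x. x \<in> S \<Longrightarrow> (f has_derivative f' x) (at x)" "\<And>v. Ck_on k (\<lambda>x. f' x v) S"
    using Suc.prems(1) by (rule Ck_on_SucE) blast
  obtain g' where g': "\<And>x. x \<in> S \<Longrightarrow> (g has_derivative g' x) (at x)" "\<And>v. Ck_on k (\<lambda>x. g' x v) S"
    using Suc.prems(2) by (rule Ck_on_SucE) blast
  show ?case
    by (rule Ck_on_SucI[where f'="\<lambda>x v. f' x v + g' x v"])
      (intro has_derivative_add f' g' Suc.IH; assumption)+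
qed (auto intro: continuous_on_add)

lemma Ck_on_bilinear:
  assumes "bounded_bilinear bb"
  shows "Ck_on k f S \<Longrightarrow> Ck_on k g S \<Longrightarrow> Ck_on k (\<lambda>x. bb (f x) (g x)) S"
proof (induction k arbitrary: f g)
  case 0
  then show ?case
    using bounded_bilinear.continuous_on[OF assms] by auto
next
  case (Suc k)
  obtain f' where f': "\<And>x. x \<in> S \<Longrightarrow> (f has_derivative f' x) (at x)" "\<And>v. Ck_on k (\<lambda>x. f' x v) S"
    using Suc.prems(1) by (rule Ck_on_SucE) blast
  obtain g' where g': "\<And>x. x \<in> S \<Longrightarrow> (g has_derivative g' x) (at x)" "\<And>v. Ck_on k (\<lambda>x. g' x v) S"
    using Suc.prems(2) by (rule Ck_on_SucE) blast
  show ?case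
    by (rule Ck_on_SucI[where f'="\<lambda>x v. bb (f x) (g' x v) + bb (f' x v) (g x)"])
      (intro bounded_bilinear.FDERIV[OF assms] f' g' Suc.IH Ck_on_add Ck_on_Suc_lower[OF Suc.prems(1)]
        Ck_on_Suc_lower[OF Suc.prems(2)]; assumption)+
qed

lemmas Ck_on_mult = Ck_on_bilinear[OF bounded_bilinear_mult]
lemmas Ck_on_scaleR = Ck_on_bilinear[OF bounded_bilinear_scaleR]

lemma Ck_on_minus: "Ck_on k f S \<Longrightarrow> Ck_on k (\<lambda>x. - f x) S"
  using Ck_on_scaleR[OF Ck_on_const[of k "-1"], of f] by simp

lemma Ck_on_diff: "Ck_on k f S \<Longrightarrow> Ck_on k g S \<Longrightarrow> Ck_on k (\<lambda>x. f x - g x) S"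
  using Ck_on_add[OF _ Ck_on_minus, of k f S g] by simp

text \<open>For a real inner function the derivative of \<open>h\<close> at \<open>y\<close> is
  multiplication by the number \<open>h' y 1\<close>. The derivative of the composite is thus a
  product of two functions of class k, and the induction closes with
  \<open>Ck_on_mult\<close>.\<close>

lemma Ck_on_compose_real:
  fixes h :: "real \<Rightarrow> real" and g :: "'a::euclidean_space \<Rightarrow> real"
  shows "Ck_on k h UNIV \<Longrightarrow> Ck_on k g S \<Longrightarrow> Ck_on k (\<lambda>x. h (g x)) S"
proof (induction k arbitrary: h)
  case 0
  then show ?case
    by (auto intro: continuous_on_compose2)
next
  case (Suc k)
  obtain h' where h': "\<And>x. (h has_derivative h' x) (at x)" "\<And>v. Ck_on k (\<lambda>x. h' x v) UNIV"
    using Suc.prems(1) by (rule Ck_on_SucE) auto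
  obtain g' where g': "\<And>x. x \<in> S \<Longrightarrow> (g has_derivative g' x) (at x)" "\<And>v. Ck_on k (\<lambda>x. g' x v) S"
    using Suc.prems(2) by (rule Ck_on_SucE) blast
  have lin: "h' y r = r * h' y 1" for y r
    using linear_scale[OF has_derivative_linear[OF h'(1)], of y r 1] by simp
  show ?case
  proof (rule Ck_on_SucI[where f'="\<lambda>x v. h' (g x) (g' x v)"])
    show "((\<lambda>x. h (g x)) has_derivative (\<lambda>v. h' (g x) (g' x v))) (at x)" if "x \<in> S" for x
      using has_derivative_compose[OF g'(1)[OF that] h'(1)] by simp
    have eq: "(\<lambda>x. h' (g x) (g' x v)) = (\<lambda>x. g' x v * h' (g x) 1)" for v
      by (rule ext) (rule lin)
    show "Ck_on k (\<lambda>x. h' (g x) (g' x v)) S" for v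
      unfolding eq by (rule Ck_on_mult[OF g'(2) Suc.IH[OF h'(2) Ck_on_Suc_lower[OF Suc.prems(2)]]])
  qed
qed

lemma Ck_on_inverse:
  fixes g :: "'a::euclidean_space \<Rightarrow> real"
  shows "Ck_on k g S \<Longrightarrow> (\<And>x. x \<in> S \<Longrightarrow> g x \<noteq> 0) \<Longrightarrow> Ck_on k (\<lambda>x. inverse (g x)) S"
proof (induction k)
  case 0
  then show ?case
    by (auto intro: continuous_on_inverse)
next
  case (Suc k)
  obtain g' where g': "\<And>x. x \<in> S \<Longrightarrow> (g has_derivative g' x) (at x)" "\<And>v. Ck_on k (\<lambda>x. g' x v) S"
    using Suc.prems(1) by (rule Ck_on_SucE) blast
  have IH: "Ck_on k (\<lambda>x. inverse (g x)) S"
    using Suc Ck_on_Suc_lower by blast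
  show ?case
  proof (rule Ck_on_SucI)
    show "((\<lambda>x. inverse (g x)) has_derivative (\<lambda>v. - (inverse (g x) * g' x v * inverse (g x)))) (at x)"
      if "x \<in> S" for x
      by (rule Deriv.has_derivative_inverse[OF Suc.prems(2)[OF that] g'(1)[OF that]])
    show "Ck_on k (\<lambda>x. - (inverse (g x) * g' x v * inverse (g x))) S" for v
      by (intro Ck_on_minus Ck_on_mult IH g')
  qed
qed

section \<open>Functions with derivatives of every order\<close>

definition smooth :: "('a::euclidean_space \<Rightarrow> 'b::real_normed_vector) \<Rightarrow> bool" where
  "smooth f \<longleftrightarrow> (\<forall>k. Ck_on k f UNIV)"

text \<open>The derivative inside \<open>Ck_on\<close> is existentially bound and could differ for
  each \<open>k\<close>. Uniqueness of the Frechet derivative identifies all these witnesses with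
  \<open>frechet_derivative\<close>.\<close>

lemma smooth_derivative:
  assumes "smooth f"
  shows "(f has_derivative frechet_derivative f (at x)) (at x)"
    and "smooth (\<lambda>x. frechet_derivative f (at x) v)"
proof -
  have D: "(f has_derivative frechet_derivative f (at x)) (at x)" for x
    using assms[unfolded smooth_def, rule_format, of "Suc 0"] by (auto simp: frechet_derivative_works[symmetric] differentiable_def)
  then show "(f has_derivative frechet_derivative f (at x)) (at x)" .
  show "smooth (\<lambda>x. frechet_derivative f (at x) v)"
    unfolding smooth_def
  proof
    fix k
    obtain f' where f': "\<And>x. (f has_derivative f' x) (at x)" "\<And>v. Ck_on k (\<lambda>x. f' x v) UNIV"
      using assms[unfolded smooth_def, rule_format, of "Suc k"] by (rule Ck_on_SucE) auto
    have "f' = (\<lambda>x. frechet_derivative f (at x))"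
      using f'(1) frechet_derivative_at by blast
    then show "Ck_on k (\<lambda>x. frechet_derivative f (at x) v) UNIV"
      using f'(2) by simp
  qed
qed

text \<open>Smoothness as a greatest fixed point: a class closed under directional derivatives is
  smooth. It serves families that reproduce themselves under differentiation, such as translates,
  \<open>flat_exp\<close> and convolutions.\<close>

lemma smooth_coinduct:
  assumes "P f"
    and step: "\<And>f. P f \<Longrightarrow> \<exists>f'. (\<forall>x. (f has_derivative f' x) (at x)) \<and> (\<forall>v. P (\<lambda>x. f' x v))"
  shows "smooth f"
proof -
  have "Ck_on k f UNIV" for k
    using \<open>P f\<close>
  proof (induction k arbitrary: f)
    case 0
    from step[OF 0] obtain f' where "\<forall>x. (f has_derivative f' x) (at x)"
      by blast
    then show ?case
      by (auto intro!: continuous_at_imp_continuous_on intro: has_derivative_continuous)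
  next
    case (Suc k)
    from step[OF Suc.prems] obtain f' where "\<forall>x. (f has_derivative f' x) (at x)" "\<forall>v. P (\<lambda>x. f' x v)"
      by blast
    with Suc.IH show ?case
      by (intro Ck_on_SucI[where f'=f']) auto
  qed
  then show ?thesis
    by (simp add: smooth_def)
qed

lemma smooth_continuous_on: "smooth f \<Longrightarrow> continuous_on S f"
  using continuous_on_subset[of UNIV f S] by (auto simp: smooth_def dest!: spec[where x=0])

lemma smooth_const [intro]: "smooth (\<lambda>x. c)"
  and smooth_add [intro]: "smooth f \<Longrightarrow> smooth g \<Longrightarrow> smooth (\<lambda>x. f x + g x)"
  and smooth_minus [intro]: "smooth f \<Longrightarrow> smooth (\<lambda>x. - f x)"
  and smooth_diff [intro]: "smooth f \<Longrightarrow> smooth g \<Longrightarrow> smooth (\<lambda>x. f x - g x)"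
  by (auto simp: smooth_def Ck_on_const Ck_on_add Ck_on_minus Ck_on_diff)

lemma smooth_mult [intro]:
  fixes f g :: "'a::euclidean_space \<Rightarrow> real"
  shows "smooth f \<Longrightarrow> smooth g \<Longrightarrow> smooth (\<lambda>x. f x * g x)"
  by (auto simp: smooth_def Ck_on_mult)

lemma smooth_linear: "bounded_linear g \<Longrightarrow> smooth g"
  by (simp add: smooth_def Ck_on_linear)

lemma smooth_compose_real:
  fixes h :: "real \<Rightarrow> real" and g :: "'a::euclidean_space \<Rightarrow> real"
  shows "smooth h \<Longrightarrow> smooth g \<Longrightarrow> smooth (\<lambda>x. h (g x))"
  by (simp add: smooth_def Ck_on_compose_real)

lemma smooth_inverse:
  fixes g :: "'a::euclidean_space \<Rightarrow> real"
  shows "smooth g \<Longrightarrow> (\<And>x. g x \<noteq> 0) \<Longrightarrow> smooth (\<lambda>x. inverse (g x))"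
  by (auto simp: smooth_def intro: Ck_on_inverse)

lemma smooth_prod:
  fixes f :: "'i \<Rightarrow> 'a::euclidean_space \<Rightarrow> real"
  shows "(\<And>i. i \<in> I \<Longrightarrow> smooth (f i)) \<Longrightarrow> smooth (\<lambda>x. \<Prod>i\<in>I. f i x)"
  by (induction I rule: infinite_finite_induct) auto

lemma smooth_translate:
  assumes "smooth f"
  shows "smooth (\<lambda>x. f (x + a))"
proof (rule smooth_coinduct[where P="\<lambda>g. \<exists>f. smooth f \<and> g = (\<lambda>x. f (x + a))"])
  fix g :: "'a \<Rightarrow> 'b" assume "\<exists>f. smooth f \<and> g = (\<lambda>x. f (x + a))"
  then obtain f where f: "smooth f" "g = (\<lambda>x. f (x + a))" by blast
  have "(g has_derivative frechet_derivative f (at (x + a))) (at x)" for x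
    unfolding f(2) by (rule has_derivative_compose[of "\<lambda>x. x + a" "\<lambda>x. x" x UNIV f, OF _ smooth_derivative(1)[OF f(1)]])
      (auto intro!: derivative_eq_intros)
  then show "\<exists>f'. (\<forall>x. (g has_derivative f' x) (at x)) \<and>
      (\<forall>v. \<exists>f. smooth f \<and> (\<lambda>x. f' x v) = (\<lambda>x. f (x + a)))"
    using smooth_derivative(2)[OF f(1)]
    by (intro exI[of _ "\<lambda>x. frechet_derivative f (at (x + a))"]) auto
qed (use assms in auto)

section \<open>The smooth step built from a flat exponential\<close>

definition flat_exp :: "real poly \<Rightarrow> real \<Rightarrow> real" where
  "flat_exp P x = (if x > 0 then poly P (1 / x) * exp (- (1 / x)) else 0)"

lemma poly_exp_tendsto_0: "((\<lambda>t. poly P t * exp (- t)) \<longlongrightarrow> (0::real)) at_top"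
proof -
  have "((\<lambda>t. \<Sum>i\<le>degree P. coeff P i * (t ^ i / exp t)) \<longlongrightarrow> (0::real)) at_top"
    by (intro tendsto_null_sum tendsto_mult_right_zero tendsto_power_div_exp_0)
  then show ?thesis
    by (simp add: poly_altdef sum_distrib_right exp_minus divide_inverse mult.assoc)
qed

text \<open>With \<open>t = 1 / x\<close> one has \<open>d/dx = - t^2 d/dt\<close>, so
  \<open>P(t) exp(-t)\<close> has the derivative \<open>t^2 (P - P')(t) exp(-t)\<close>. The family
  is closed under differentiation, and at the origin the exponential beats every power of
  \<open>t\<close>.\<close>

lemma flat_exp_has_derivative:
  "(flat_exp P has_real_derivative flat_exp ([:0, 0, 1:] * (P - pderiv P)) x) (at x)"
proof -
  consider "x < 0" | "x = 0" | "x > 0" by linarith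
  then show ?thesis
  proof cases
    case 1
    have "((\<lambda>x. 0) has_real_derivative flat_exp ([:0, 0, 1:] * (P - pderiv P)) x) (at x)"
      using 1 by (simp add: flat_exp_def)
    then show ?thesis
      by (rule has_field_derivative_transform_within_open[where S="{..<0}"])
        (use 1 in \<open>auto simp: flat_exp_def\<close>)
  next
    case 2
    \<comment> \<open>\<open>pCons 0 P\<close> is the polynomial \<open>P\<close> times its
      variable: it absorbs the factor \<open>1 / h\<close> of the difference quotient at 0.\<close>
    have "((\<lambda>h. poly (pCons 0 P) (inverse h) * exp (- inverse h)) \<longlongrightarrow> 0) (at_right 0)"
      by (rule filterlim_compose[OF poly_exp_tendsto_0 filterlim_inverse_at_top_right])
    then have "((\<lambda>h. flat_exp P h / h) \<longlongrightarrow> 0) (at_right 0)"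
      by (rule Lim_transform_eventually)
        (auto simp: eventually_at flat_exp_def divide_inverse intro!: exI[of _ 1])
    moreover have "((\<lambda>h. flat_exp P h / h) \<longlongrightarrow> 0) (at_left 0)"
      by (rule Lim_transform_eventually[OF tendsto_const])
        (auto simp: eventually_at flat_exp_def intro!: exI[of _ 1])
    ultimately have "((\<lambda>h. flat_exp P h / h) \<longlongrightarrow> 0) (at 0)"
      by (simp add: filterlim_at_split)
    then show ?thesis
      using 2 by (simp add: DERIV_def) (simp add: flat_exp_def)
  next
    case 3
    have D: "((\<lambda>x. 1 / x) has_real_derivative - (1 / x\<^sup>2)) (at x)"
      using 3 by (auto intro!: derivative_eq_intros simp: power2_eq_square)
    have "((\<lambda>x. poly P (1 / x) * exp (- (1 / x))) has_real_derivative
        poly (pderiv P) (1 / x) * - (1 / x\<^sup>2) * exp (- (1 / x)) +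
        exp (- (1 / x)) * (- (- (1 / x\<^sup>2))) * poly P (1 / x)) (at x)"
      by (intro DERIV_mult DERIV_chain2[OF poly_DERIV D] DERIV_chain2[OF DERIV_exp] DERIV_minus D)
    also have "poly (pderiv P) (1 / x) * - (1 / x\<^sup>2) * exp (- (1 / x)) +
        exp (- (1 / x)) * (- (- (1 / x\<^sup>2))) * poly P (1 / x) = flat_exp ([:0, 0, 1:] * (P - pderiv P)) x"
      using 3 by (simp add: flat_exp_def power2_eq_square algebra_simps)
    finally have "((\<lambda>x. poly P (1 / x) * exp (- (1 / x))) has_real_derivative
        flat_exp ([:0, 0, 1:] * (P - pderiv P)) x) (at x)" .
    then show ?thesis
      by (rule has_field_derivative_transform_within_open[where S="{0<..}"])
        (use 3 in \<open>auto simp: flat_exp_def\<close>)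
  qed
qed

lemma smooth_flat_exp: "smooth (flat_exp P)"
proof (rule smooth_coinduct[where P="\<lambda>f. \<exists>P. f = flat_exp P"])
  fix f :: "real \<Rightarrow> real" assume "\<exists>P. f = flat_exp P"
  then obtain P where f: "f = flat_exp P" by blast
  have "(\<lambda>x. flat_exp ([:0, 0, 1:] * (P - pderiv P)) x * v) = flat_exp (smult v ([:0, 0, 1:] * (P - pderiv P)))" for v
    by (auto simp: flat_exp_def)
  then show "\<exists>f'. (\<forall>x. (f has_derivative f' x) (at x)) \<and> (\<forall>v. \<exists>P. (\<lambda>x. f' x v) = flat_exp P)"
    using flat_exp_has_derivative[of P]
    by (intro exI[of _ "\<lambda>x v. flat_exp ([:0, 0, 1:] * (P - pderiv P)) x * v"])
      (auto simp: f has_field_derivative_def)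
qed auto

definition bump_below :: "real \<Rightarrow> real" where "bump_below = flat_exp 1"

lemma bump_below: "smooth bump_below" "x \<le> 0 \<Longrightarrow> bump_below x = 0" "x > 0 \<Longrightarrow> bump_below x > 0"
    "0 \<le> bump_below x"
  by (auto simp: bump_below_def smooth_flat_exp) (auto simp: flat_exp_def)

text \<open>The denominator never vanishes, because \<open>x\<close> and \<open>1 - x\<close> cannot
  both be nonpositive.\<close>

definition smooth_step :: "real \<Rightarrow> real" where
  "smooth_step x = bump_below x * inverse (bump_below x + bump_below (1 - x))"

lemma smooth_step_eq_0: "x \<le> 0 \<Longrightarrow> smooth_step x = 0"
  and smooth_step_eq_1: "x \<ge> 1 \<Longrightarrow> smooth_step x = 1"
  and smooth_step_nonneg: "0 \<le> smooth_step x"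
  and smooth_step_le_1: "smooth_step x \<le> 1"
  and smooth_step_smooth: "smooth smooth_step"
proof -
  have pos: "bump_below x + bump_below (1 - x) > 0" for x
    using bump_below(3)[of x] bump_below(3)[of "1 - x"] bump_below(4)[of x] bump_below(4)[of "1 - x"]
    by (cases "x > 0") linarith+
  show "x \<le> 0 \<Longrightarrow> smooth_step x = 0"
    by (simp add: smooth_step_def bump_below)
  show "x \<ge> 1 \<Longrightarrow> smooth_step x = 1"
    using bump_below(2)[of "1 - x"] bump_below(3)[of x] by (simp add: smooth_step_def)
  show "0 \<le> smooth_step x"
    using pos[of x] bump_below(4)[of x] by (simp add: smooth_step_def)
  show "smooth_step x \<le> 1"
    using pos[of x] bump_below(4)[of "1 - x"] by (simp add: smooth_step_def field_simps)
  have "smooth (\<lambda>x. bump_below (1 - x))"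
    by (rule smooth_compose_real[OF bump_below(1)]) (intro smooth_diff smooth_const smooth_linear bounded_linear_ident)
  then show "smooth smooth_step"
    unfolding smooth_step_def[abs_def]
    using pos by (intro smooth_mult smooth_inverse smooth_add bump_below(1)) (auto simp: less_le)
qed

text \<open>What the cutoff arguments use about the derivative of the step, as a real function
  \<open>s'\<close>. The uniform bound \<open>M\<close> is what later survives the rescaling of the
  cutoffs.\<close>

lemma smooth_step_derivative:
  obtains s' M where "\<And>x. (smooth_step has_real_derivative s' x) (at x)" "continuous_on UNIV s'"
    "\<And>x. \<bar>s' x\<bar> \<le> M" "\<And>x. x \<le> 0 \<Longrightarrow> s' x = 0" "\<And>x. 1 \<le> x \<Longrightarrow> s' x = 0"
proof -
  define s' where "s' x = frechet_derivative smooth_step (at x) 1" for x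
  have lin: "frechet_derivative smooth_step (at x) v = s' x * v" for x v
    using linear_scale[OF has_derivative_linear[OF smooth_derivative(1)[OF smooth_step_smooth]], of x v 1]
    by (simp add: s'_def)
  have D: "(smooth_step has_real_derivative s' x) (at x)" for x
    using smooth_derivative(1)[OF smooth_step_smooth, of x]
    by (simp add: has_field_derivative_def lin[abs_def])
  have cont: "continuous_on S s'" for S
    unfolding s'_def[abs_def] by (rule smooth_continuous_on[OF smooth_derivative(2)[OF smooth_step_smooth]])
  have outer: "s' x = 0" if "x < 0 \<or> 1 < x" for x
  proof -
    have "((\<lambda>x. smooth_step x) has_real_derivative 0) (at x)"
    proof (cases "x < 0")
      case True
      show ?thesis
        by (rule has_field_derivative_transform_within_open[where S="{..<0}" and f="\<lambda>x. 0"])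
          (use True in \<open>auto simp: smooth_step_eq_0\<close>)
    next
      case False
      show ?thesis
        by (rule has_field_derivative_transform_within_open[where S="{1<..}" and f="\<lambda>x. 1"])
          (use False that in \<open>auto simp: smooth_step_eq_1\<close>)
    qed
    with D show ?thesis by (metis DERIV_unique)
  qed
  \<comment> \<open>On the open half-lines the step is locally constant; continuity of
    \<open>s'\<close> carries its zeros to the end points 0 and 1.\<close>
  have closed: "closed {x. s' x = 0}"
    using closed_Collect_eq[OF cont continuous_on_const] by simp
  have "closure {..<0} \<subseteq> {x. s' x = 0}" "closure {1<..} \<subseteq> {x. s' x = 0}"
    by (rule closure_minimal[OF _ closed]; use outer in auto)+
  then have z0: "s' 0 = 0" and z1: "s' 1 = 0" by auto
  have "bounded (s' ` {0..1})"
    by (intro compact_imp_bounded compact_continuous_image cont) auto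
  then obtain M where M: "\<And>x. x \<in> {0..1} \<Longrightarrow> \<bar>s' x\<bar> \<le> M"
    unfolding bounded_real by blast
  have "0 \<le> M" using M[of 0] by simp
  show ?thesis
  proof (rule that)
    show "\<bar>s' x\<bar> \<le> M" for x
      using M[of x] outer[of x] \<open>0 \<le> M\<close> by (cases "x \<in> {0..1}") auto
    show "x \<le> 0 \<Longrightarrow> s' x = 0" "1 \<le> x \<Longrightarrow> s' x = 0" for x
      using z0 z1 outer[of x] by (cases "x = 0 \<or> x = 1"; force)+
  qed (use D cont in auto)
qed

section \<open>Functions of bounded support\<close>

definition vanishes_outside :: "real \<Rightarrow> ('a::real_normed_vector \<Rightarrow> 'b::zero) \<Rightarrow> bool" where
  "vanishes_outside R f \<longleftrightarrow> (\<forall>x. R < norm x \<longrightarrow> f x = 0)"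

lemma vanishes_outside_derivative:
  fixes f :: "'a::euclidean_space \<Rightarrow> 'b::real_normed_vector"
  assumes "vanishes_outside R f" "\<And>x. (f has_derivative f' x) (at x)"
  shows "vanishes_outside R (\<lambda>x. f' x v)"
  unfolding vanishes_outside_def
proof safe
  fix x :: 'a assume "R < norm x"
  have "((\<lambda>x. 0) has_derivative f' x) (at x)"
    by (rule has_derivative_transform_within_open[OF assms(2), where s="- cball 0 R"])
      (use assms(1) \<open>R < norm x\<close> in \<open>auto simp: vanishes_outside_def dist_norm\<close>)
  then have "f' x = (\<lambda>v. 0)"
    by (rule has_derivative_unique) simp
  then show "f' x v = 0" by simp
qed

lemma integrable_vanishes_outside:
  fixes f :: "'a::euclidean_space \<Rightarrow> 'b::euclidean_space"
  assumes "continuous_on UNIV f" "vanishes_outside R f"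
  shows "integrable lborel f"
proof -
  have "integrable lborel (\<lambda>x. indicator (cball 0 R) x *\<^sub>R f x)"
    using continuous_on_subset[OF assms(1)]
    by (intro borel_integrable_compact) auto
  also have "(\<lambda>x. indicator (cball 0 R) x *\<^sub>R f x) = f"
    using assms(2) by (auto simp: vanishes_outside_def indicator_def fun_eq_iff not_le[symmetric])
  finally show ?thesis .
qed

lemma bounded_vanishes_outside:
  fixes f :: "'a::euclidean_space \<Rightarrow> 'b::real_normed_vector"
  assumes "continuous_on UNIV f" "vanishes_outside R f"
  obtains M where "0 < M" "\<And>x. norm (f x) \<le> M"
proof -
  have "bounded (f ` cball 0 R)"
    using continuous_on_subset[OF assms(1)] by (intro compact_imp_bounded compact_continuous_image) auto
  then obtain M where M: "0 < M" "\<And>x. x \<in> cball 0 R \<Longrightarrow> norm (f x) \<le> M"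
    unfolding bounded_pos by blast
  show ?thesis
  proof (rule that[OF M(1)])
    show "norm (f x) \<le> M" for x
      using M(1) M(2)[of x] assms(2) by (cases "norm x \<le> R") (auto simp: vanishes_outside_def)
  qed
qed

lemma uniformly_continuous_vanishes_outside:
  fixes f :: "'a::euclidean_space \<Rightarrow> 'b::real_normed_vector"
  assumes "continuous_on UNIV f" "vanishes_outside R f" "0 < e"
  obtains d where "0 < d" "\<And>x y. dist x y < d \<Longrightarrow> dist (f x) (f y) < e"
proof -
  \<comment> \<open>The margin 1: two points at distance below 1 either both lie in this larger
    ball, or both have norm above \<open>R\<close> and give the value 0.\<close>
  have "uniformly_continuous_on (cball 0 (R + 1)) f"
    using continuous_on_subset[OF assms(1)] by (intro compact_uniformly_continuous) auto
  then obtain d where d: "0 < d"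
    "\<And>x y. x \<in> cball 0 (R + 1) \<Longrightarrow> y \<in> cball 0 (R + 1) \<Longrightarrow> dist x y < d \<Longrightarrow> dist (f x) (f y) < e"
    unfolding uniformly_continuous_on_def using assms(3) by metis
  have "dist (f x) (f y) < e" if "dist x y < min d 1" for x y
  proof (cases "x \<in> cball 0 (R + 1) \<and> y \<in> cball 0 (R + 1)")
    case False
    have "norm x \<le> norm y + dist x y" "norm y \<le> norm x + dist x y"
      using norm_triangle_ineq3[of x y] by (auto simp: dist_norm)
    with False that have "R < norm x" "R < norm y"
      by auto
    then show ?thesis
      using assms(2,3) by (auto simp: vanishes_outside_def)
  qed (use d(2) that in auto)
  with d(1) show ?thesis
    by (intro that[of "min d 1"]) auto
qed

lemma integrable_lborel_translate:
  fixes f :: "'a::euclidean_space \<Rightarrow> 'b::euclidean_space"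
  assumes "integrable lborel f"
  shows "integrable lborel (\<lambda>x. f (x + c))" "integral\<^sup>L lborel (\<lambda>x. f (x + c)) = integral\<^sup>L lborel f"
proof -
  have D: "distr lborel borel (\<lambda>x. x + c) = (lborel :: 'a measure)"
    using lborel_distr_plus[of c] by (simp add: add.commute[of _ c])
  have f: "integrable (distr lborel borel (\<lambda>x. x + c)) f"
    unfolding D by fact
  have [measurable]: "f \<in> borel_measurable borel"
    using borel_measurable_integrable[OF assms] by simp
  show "integrable lborel (\<lambda>x. f (x + c))"
    using f by (subst (asm) integrable_distr_eq) auto
  have "integral\<^sup>L (distr lborel borel (\<lambda>x. x + c)) f = integral\<^sup>L lborel (\<lambda>x. f (x + c))"
    by (subst integral_distr) auto
  then show "integral\<^sup>L lborel (\<lambda>x. f (x + c)) = integral\<^sup>L lborel f"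
    unfolding D by simp
qed

text \<open>Translation invariance makes the integral of every difference quotient 0. The mean value
  theorem bounds the quotients by a constant on a fixed ball, so dominated convergence
  applies.\<close>

lemma integral_derivative_vanishes_outside:
  fixes f :: "'a::euclidean_space \<Rightarrow> real"
  assumes D: "\<And>x. (f has_derivative f' x) (at x)"
    and cont: "continuous_on UNIV (\<lambda>x. f' x v)"
    and van: "vanishes_outside R f"
  shows "integral\<^sup>L lborel (\<lambda>x. f' x v) = 0"
proof -
  have van': "vanishes_outside R (\<lambda>x. f' x v)"
    by (rule vanishes_outside_derivative[OF van D])
  obtain M where M: "0 < M" "\<And>x. norm (f' x v) \<le> M"
    by (rule bounded_vanishes_outside[OF cont van']) blast
  have contf: "continuous_on UNIV f"
    using D by (auto intro!: continuous_at_imp_continuous_on intro: has_derivative_continuous)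
  have intf: "integrable lborel f"
    by (rule integrable_vanishes_outside[OF contf van])
  \<comment> \<open>Step lengths of at most 1 enlarge the support by at most \<open>norm v\<close>,
    which gives one dominating indicator for all \<open>n\<close>.\<close>
  define h where "h n = 1 / real (Suc n)" for n
  have h: "0 < h n" "h n \<le> 1" for n by (auto simp: h_def field_simps)
  define q where "q n x = (f (x + h n *\<^sub>R v) - f x) / h n" for n x
  have zero: "integral\<^sup>L lborel (q n) = 0" for n
    unfolding q_def[abs_def] using integrable_lborel_translate[OF intf, of "h n *\<^sub>R v"] intf
    by simp
  have vd: "((\<lambda>t. f (x + t *\<^sub>R v)) has_real_derivative f' (x + t *\<^sub>R v) v) (at t)" for x t
  proof -
    have "((\<lambda>t. f (x + t *\<^sub>R v)) has_derivative (\<lambda>s. f' (x + t *\<^sub>R v) (s *\<^sub>R v))) (at t)"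
      by (rule has_derivative_compose[of "\<lambda>t. x + t *\<^sub>R v" "\<lambda>s. s *\<^sub>R v" t UNIV f, OF _ D])
        (auto intro!: derivative_eq_intros)
    moreover have "f' (x + t *\<^sub>R v) (s *\<^sub>R v) = f' (x + t *\<^sub>R v) v * s" for s
      using linear_scale[OF has_derivative_linear[OF D], of "x + t *\<^sub>R v" s v] by simp
    ultimately show ?thesis
      by (simp add: has_field_derivative_def)
  qed
  have bound: "norm (q n x) \<le> M * indicator (cball 0 (R + norm v)) x" for n x
  proof -
    obtain s where "f (x + h n *\<^sub>R v) - f (x + 0 *\<^sub>R v) = (h n - 0) * f' (x + s *\<^sub>R v) v"
      using MVT2[of 0 "h n" "\<lambda>t. f (x + t *\<^sub>R v)" "\<lambda>t. f' (x + t *\<^sub>R v) v"] h[of n] vd by blast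
    then have "q n x = f' (x + s *\<^sub>R v) v"
      using h(1)[of n] by (simp add: q_def)
    then have *: "norm (q n x) \<le> M" using M(2) by simp
    show ?thesis
    proof (cases "norm x \<le> R + norm v")
      case False
      have "norm x \<le> norm (x + h n *\<^sub>R v) + norm (h n *\<^sub>R v)"
        using norm_triangle_ineq4[of "x + h n *\<^sub>R v" "h n *\<^sub>R v"] by simp
      moreover have "norm (h n *\<^sub>R v) \<le> norm v"
        using h[of n] by (simp add: mult_left_le_one_le)
      ultimately have "f x = 0" "f (x + h n *\<^sub>R v) = 0"
        using False van norm_ge_zero[of v] unfolding vanishes_outside_def by (smt (verit))+
      then show ?thesis using M(1) by (simp add: q_def)
    qed (use * in simp)
  qed
  have lim: "(\<lambda>n. q n x) \<longlonglongrightarrow> f' x v" for x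
  proof -
    have "((\<lambda>s. (f (x + (0 + s) *\<^sub>R v) - f (x + 0 *\<^sub>R v)) / s) \<longlongrightarrow> f' (x + 0 *\<^sub>R v) v) (at 0)"
      using vd[of x 0] by (simp add: DERIV_def)
    moreover have "filterlim h (at 0) sequentially"
      using h(1) LIMSEQ_inverse_real_of_nat
      by (auto simp: filterlim_at h_def[abs_def] inverse_eq_divide less_imp_neq)
    ultimately show ?thesis
      unfolding q_def by (auto dest: filterlim_compose)
  qed
  have "(\<lambda>n. integral\<^sup>L lborel (q n)) \<longlonglongrightarrow> integral\<^sup>L lborel (\<lambda>x. f' x v)"
  proof (rule integral_dominated_convergence)
    show "integrable lborel (\<lambda>x. M * indicator (cball (0::'a) (R + norm v)) x :: real)"
      using emeasure_compact_finite[of "cball (0::'a) (R + norm v)"]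
      by (intro integrable_mult_right) (auto simp: integrable_indicator_iff)
    show "(\<lambda>x. f' x v) \<in> borel_measurable lborel"
      using borel_measurable_continuous_onI[OF cont] by simp
    show "q n \<in> borel_measurable lborel" for n
      using borel_measurable_continuous_onI[OF contf] unfolding q_def[abs_def] by measurable
  qed (use bound lim in auto)
  then show ?thesis
    by (simp add: zero LIMSEQ_const_iff)
qed

text \<open>A first order Taylor bound that is uniform in \<open>x\<close>: the mean value
  inequality is applied to \<open>f\<close> minus its linear part at \<open>x\<close>, whose
  derivative is small near \<open>x\<close> by uniform continuity. It justifies differentiating
  under convolution integrals and the exchange of weak derivatives.\<close>

lemma smooth_uniform_derivative:
  fixes f :: "'a::euclidean_space \<Rightarrow> real"
  assumes "smooth f" "vanishes_outside R f" "0 < e"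
  obtains d where "0 < d"
    "\<And>x h. norm h < d \<Longrightarrow> \<bar>f (x + h) - f x - frechet_derivative f (at x) h\<bar> \<le> e * norm h"
proof -
  let ?D = "\<lambda>x. frechet_derivative f (at x)"
  \<comment> \<open>Each of the \<open>DIM('a)\<close> basis directions contributes at most
    \<open>norm h * e'\<close>.\<close>
  define e' where "e' = e / DIM('a)"
  have e': "0 < e'" using assms(3) by (simp add: e'_def)
  have "\<exists>d>0. \<forall>x y. dist x y < d \<longrightarrow> dist (?D x b) (?D y b) < e'" for b
    using uniformly_continuous_vanishes_outside[OF smooth_continuous_on[OF smooth_derivative(2)[OF assms(1)]]
      vanishes_outside_derivative[OF assms(2) smooth_derivative(1)[OF assms(1)]] e', of b]
    by metis
  then obtain d where d: "\<And>b. 0 < d b" "\<And>b x y. dist x y < d b \<Longrightarrow> dist (?D x b) (?D y b) < e'"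
    by metis
  define d0 where "d0 = Min (d ` Basis)"
  have d0: "0 < d0" "\<And>b. b \<in> Basis \<Longrightarrow> d0 \<le> d b"
    using d(1) by (auto simp: d0_def)
  have lin: "linear (?D x)" for x
    using smooth_derivative(1)[OF assms(1)] has_derivative_linear by blast
  have diff: "\<bar>?D y h - ?D x h\<bar> \<le> e * norm h" if "dist y x < d0" for x y h
  proof -
    have "?D z h = (\<Sum>b\<in>Basis. (h \<bullet> b) * ?D z b)" for z
      using linear_sum[OF lin[of z], of "\<lambda>b. (h \<bullet> b) *\<^sub>R b" Basis] linear_scale[OF lin[of z]]
      by (simp add: euclidean_representation)
    then have "\<bar>?D y h - ?D x h\<bar> = \<bar>\<Sum>b\<in>Basis. (h \<bullet> b) * (?D y b - ?D x b)\<bar>"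
      by (simp add: sum_subtractf[symmetric] right_diff_distrib)
    also have "\<dots> \<le> (\<Sum>b\<in>(Basis::'a set). norm h * e')"
    proof (rule order_trans[OF sum_abs sum_mono])
      fix b :: 'a assume b: "b \<in> Basis"
      have "\<bar>?D y b - ?D x b\<bar> \<le> e'"
        using d(2)[of y x b] d0(2)[OF b] that by (simp add: dist_real_def)
      then show "\<bar>h \<bullet> b * (?D y b - ?D x b)\<bar> \<le> norm h * e'"
        unfolding abs_mult using Basis_le_norm[OF b, of h] by (intro mult_mono) auto
    qed
    also have "\<dots> = e * norm h" by (simp add: e'_def)
    finally show ?thesis .
  qed
  show ?thesis
  proof (rule that[OF d0(1)])
    fix x h :: 'a assume h: "norm h < d0"
    define g where "g y = f y - ?D x y" for y
    have "norm (g (x + h) - g x) \<le> e * norm ((x + h) - x)"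
    proof (rule differentiable_bound[of "ball x d0" g "\<lambda>y v. ?D y v - ?D x v"])
      show "(g has_derivative (\<lambda>v. ?D y v - ?D x v)) (at y within ball x d0)" for y
        unfolding g_def[abs_def]
        by (intro has_derivative_diff has_derivative_at_withinI[OF smooth_derivative(1)[OF assms(1)]]
            linear_imp_has_derivative lin)
      show "onorm (\<lambda>v. ?D y v - ?D x v) \<le> e" if "y \<in> ball x d0" for y
        using diff[of y x] that by (intro onorm_le) (auto simp: dist_commute)
    qed (use h d0 in \<open>auto simp: dist_norm\<close>)
    also have "g (x + h) - g x = f (x + h) - f x - ?D x h"
      using linear_add[OF lin[of x], of x h] by (simp add: g_def)
    finally show "\<bar>f (x + h) - f x - ?D x h\<bar> \<le> e * norm h" by simp
  qed
qed

section \<open>Mollification\<close>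

text \<open>The kernel is evaluated at \<open>z - x\<close>, not at \<open>x - z\<close>: it is then
  a translate of \<open>\<eta>\<close> centred at \<open>x\<close>, ready to be used as a test
  function, at the price of a minus sign in the derivative.\<close>

definition conv :: "('a::euclidean_space \<Rightarrow> real) \<Rightarrow> ('a \<Rightarrow> 'b::euclidean_space) \<Rightarrow> 'a \<Rightarrow> 'b" where
  "conv \<eta> f x = (\<integral>z. \<eta> (z - x) *\<^sub>R f z \<partial>lborel)"

lemma conv_integrable:
  fixes f :: "'a::euclidean_space \<Rightarrow> 'b::euclidean_space"
  assumes "continuous_on UNIV \<eta>" "vanishes_outside R \<eta>" "integrable lborel f"
  shows "integrable lborel (\<lambda>z. \<eta> (z - x) *\<^sub>R f z)"
proof -
  obtain M where M: "0 < M" "\<And>x. norm (\<eta> x) \<le> M"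
    by (rule bounded_vanishes_outside[OF assms(1,2)]) blast
  have [measurable]: "\<eta> \<in> borel_measurable borel"
    by (rule borel_measurable_continuous_onI[OF assms(1)])
  have [measurable]: "f \<in> borel_measurable borel"
    using borel_measurable_integrable[OF assms(3)] by simp
  show ?thesis
  proof (rule Bochner_Integration.integrable_bound)
    show "integrable lborel (\<lambda>z. M * norm (f z))"
      using assms(3) by auto
    show "AE z in lborel. norm (\<eta> (z - x) *\<^sub>R f z) \<le> norm (M * norm (f z))"
      using M by (auto intro!: mult_right_mono)
  qed simp
qed

text \<open>The uniform Taylor remainder of the kernel is integrated against \<open>f\<close>; the
  derivative in \<open>x\<close> falls on \<open>\<eta>\<close> with reversed sign.\<close>

lemma conv_has_derivative:
  fixes f :: "'a::euclidean_space \<Rightarrow> 'b::euclidean_space"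
  assumes \<eta>: "smooth \<eta>" "vanishes_outside R \<eta>" and f: "integrable lborel f"
  shows "(conv \<eta> f has_derivative (\<lambda>v. conv (\<lambda>y. - frechet_derivative \<eta> (at y) v) f x)) (at x)"
proof -
  let ?D = "\<lambda>x. frechet_derivative \<eta> (at x)"
  have lin: "linear (?D x)" for x
    using smooth_derivative(1)[OF \<eta>(1)] has_derivative_linear by blast
  have intD: "integrable lborel (\<lambda>z. ?D (z - x) v *\<^sub>R f z)" for v
    by (rule conv_integrable[OF smooth_continuous_on[OF smooth_derivative(2)[OF \<eta>(1)]]
          vanishes_outside_derivative[OF \<eta>(2) smooth_derivative(1)[OF \<eta>(1)]] f])
  have int: "integrable lborel (\<lambda>z. \<eta> (z - x) *\<^sub>R f z)" for x
    by (rule conv_integrable[OF smooth_continuous_on[OF \<eta>(1)] \<eta>(2) f])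
  have "linear (\<lambda>v. conv (\<lambda>y. - ?D y v) f x)"
    unfolding conv_def using intD linear_add[OF lin] linear_scale[OF lin]
    by (intro linearI) (simp_all add: scaleR_add_left algebra_simps flip: scaleR_scaleR)
  then have bl: "bounded_linear (\<lambda>v. conv (\<lambda>y. - ?D y v) f x)"
    by (simp add: linear_conv_bounded_linear)
  show ?thesis
    unfolding has_derivative_at_alt
  proof (intro conjI bl allI impI)
    fix e :: real assume e: "0 < e"
    define I where "I = (\<integral>z. norm (f z) \<partial>lborel)"
    have I: "0 \<le> I" by (simp add: I_def)
    \<comment> \<open>\<open>I + 1\<close> in the denominator, since \<open>I\<close> may be
      0.\<close>
    obtain d where d: "0 < d" "\<And>x h. norm h < d \<Longrightarrow> \<bar>\<eta> (x + h) - \<eta> x - ?D x h\<bar> \<le> e / (I + 1) * norm h"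
      using smooth_uniform_derivative[OF \<eta>, of "e / (I + 1)"] e I by (auto simp: field_simps)
    have "norm (conv \<eta> f y - conv \<eta> f x - conv (\<lambda>z. - ?D z (y - x)) f x) \<le> e * norm (y - x)"
      if y: "norm (y - x) < d" for y
    proof -
      have "conv \<eta> f y - conv \<eta> f x - conv (\<lambda>z. - ?D z (y - x)) f x =
          (\<integral>z. (\<eta> (z - y) - \<eta> (z - x) + ?D (z - x) (y - x)) *\<^sub>R f z \<partial>lborel)"
        using int[of y] int[of x] intD[of "y - x"]
        unfolding conv_def by (simp add: scaleR_add_left scaleR_diff_left)
      also have "norm \<dots> \<le> (\<integral>z. e / (I + 1) * norm (y - x) * norm (f z) \<partial>lborel)"
      proof (rule Bochner_Integration.integral_norm_bound_integral)
        show "integrable lborel (\<lambda>z. (\<eta> (z - y) - \<eta> (z - x) + ?D (z - x) (y - x)) *\<^sub>R f z)"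
          using int[of y] int[of x] intD[of "y - x"] by (simp add: scaleR_add_left scaleR_diff_left)
        show "norm ((\<eta> (z - y) - \<eta> (z - x) + ?D (z - x) (y - x)) *\<^sub>R f z)
            \<le> e / (I + 1) * norm (y - x) * norm (f z)" for z
        proof -
          have "?D (z - x) (x - y) = - ?D (z - x) (y - x)"
            using linear_scale[OF lin, of _ "-1" "y - x"] by simp
          then have "\<bar>\<eta> (z - y) - \<eta> (z - x) + ?D (z - x) (y - x)\<bar> \<le> e / (I + 1) * norm (y - x)"
            using d(2)[of "x - y" "z - x"] y by (simp add: norm_minus_commute)
          then have "\<bar>\<eta> (z - y) - \<eta> (z - x) + ?D (z - x) (y - x)\<bar> * norm (f z) \<le>
              e / (I + 1) * norm (y - x) * norm (f z)"
            by (rule mult_right_mono) simp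
          then show ?thesis by simp
        qed
      qed (use f in auto)
      also have "\<dots> = e * norm (y - x) * (I / (I + 1))"
        using f by (simp add: I_def)
      also have "\<dots> \<le> e * norm (y - x)"
        using I e by (intro mult_left_le) (auto simp: field_simps)
      finally show ?thesis .
    qed
    with d(1) show "\<exists>d>0. \<forall>y. norm (y - x) < d \<longrightarrow>
        norm (conv \<eta> f y - conv \<eta> f x - conv (\<lambda>z. - ?D z (y - x)) f x) \<le> e * norm (y - x)"
      by blast
  qed
qed

text \<open>A directional derivative of a convolution is a convolution with another smooth kernel of
  the same support, so coinduction runs over the kernels with \<open>f\<close> fixed.\<close>

lemma conv_smooth:
  fixes f :: "'a::euclidean_space \<Rightarrow> 'b::euclidean_space"
  assumes \<eta>: "smooth \<eta>" "vanishes_outside R \<eta>" and f: "integrable lborel f"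
  shows "smooth (conv \<eta> f)"
proof (rule smooth_coinduct[where P="\<lambda>h. \<exists>\<eta>. smooth \<eta> \<and> vanishes_outside R \<eta> \<and> h = conv \<eta> f"])
  fix h :: "'a \<Rightarrow> 'b" assume "\<exists>\<eta>. smooth \<eta> \<and> vanishes_outside R \<eta> \<and> h = conv \<eta> f"
  then obtain \<eta> where \<eta>: "smooth \<eta>" "vanishes_outside R \<eta>" and h: "h = conv \<eta> f"
    by blast
  have "\<exists>\<theta>. smooth \<theta> \<and> vanishes_outside R \<theta> \<and>
      (\<lambda>x. conv (\<lambda>y. - frechet_derivative \<eta> (at y) v) f x) = conv \<theta> f" for v
    using vanishes_outside_derivative[OF \<eta>(2) smooth_derivative(1)[OF \<eta>(1)], of v]
    by (intro exI[of _ "\<lambda>y. - frechet_derivative \<eta> (at y) v"])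
      (auto intro: smooth_derivative(2)[OF \<eta>(1)] simp: vanishes_outside_def)
  then show "\<exists>f'. (\<forall>x. (h has_derivative f' x) (at x)) \<and>
      (\<forall>v. \<exists>\<eta>. smooth \<eta> \<and> vanishes_outside R \<eta> \<and> (\<lambda>x. f' x v) = conv \<eta> f)"
    using conv_has_derivative[OF \<eta> f] unfolding h
    by (intro exI[of _ "\<lambda>x v. conv (\<lambda>y. - frechet_derivative \<eta> (at y) v) f x"]) blast
qed (use \<eta> in blast)

section \<open>Continuity of translations in L1\<close>

definition L1_translation_continuous :: "('a::euclidean_space \<Rightarrow> 'b::euclidean_space) \<Rightarrow> bool" where
  "L1_translation_continuous f \<longleftrightarrow>
     (\<forall>h. h \<longlonglongrightarrow> 0 \<longrightarrow> (\<lambda>n. \<integral>x. norm (f (x + h n) - f x) \<partial>lborel) \<longlonglongrightarrow> 0)"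

text \<open>Translation invariance expresses the L1 distance through the integral of the product of
  the two indicators. That product converges pointwise: inside \<open>U\<close> by openness, outside
  because it is 0.\<close>

lemma L1_translation_continuous_open:
  fixes U :: "'a::euclidean_space set" and c :: "'b::euclidean_space"
  assumes "open U" "emeasure lborel U < \<infinity>"
  shows "L1_translation_continuous (\<lambda>x. indicator U x *\<^sub>R c)"
  unfolding L1_translation_continuous_def
proof safe
  fix h :: "nat \<Rightarrow> 'a" assume h: "h \<longlonglongrightarrow> 0"
  let ?I = "indicator U :: 'a \<Rightarrow> real"
  have int: "integrable lborel ?I"
    using assms by (simp add: integrable_indicator_iff)
  have [measurable]: "U \<in> sets borel" using assms(1) by simp
  have int': "integrable lborel (\<lambda>x. ?I (x + a))" and eq: "(\<integral>x. ?I (x + a) \<partial>lborel) = integral\<^sup>L lborel ?I" for a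
    using integrable_lborel_translate[OF int] by auto
  have intp: "integrable lborel (\<lambda>x. ?I x * ?I (x + a))" for a
    by (rule Bochner_Integration.integrable_bound[OF int]) (auto simp: indicator_def)
  have "(\<lambda>n. \<integral>x. ?I x * ?I (x + h n) \<partial>lborel) \<longlonglongrightarrow> (\<integral>x. ?I x \<partial>lborel)"
  proof (rule integral_dominated_convergence[where w="?I"])
    show "AE x in lborel. (\<lambda>n. ?I x * ?I (x + h n)) \<longlonglongrightarrow> ?I x"
    proof (intro AE_I2)
      fix x :: 'a
      show "(\<lambda>n. ?I x * ?I (x + h n)) \<longlonglongrightarrow> ?I x"
      proof (cases "x \<in> U")
        case True
        have "(\<lambda>n. x + h n) \<longlonglongrightarrow> x"
          using tendsto_add[OF tendsto_const h, of x] by simp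
        then have "\<forall>\<^sub>F n in sequentially. x + h n \<in> U"
          using assms(1) True by (rule topological_tendstoD)
        then have "\<forall>\<^sub>F n in sequentially. ?I x = ?I x * ?I (x + h n)"
          by eventually_elim (use True in auto)
        then show ?thesis
          by (rule Lim_transform_eventually[OF tendsto_const])
      qed simp
    qed
  qed (use int in \<open>auto simp: indicator_def\<close>)
  then have "(\<lambda>n. (2 * integral\<^sup>L lborel ?I - 2 * (\<integral>x. ?I x * ?I (x + h n) \<partial>lborel)) * norm c)
      \<longlonglongrightarrow> (2 * integral\<^sup>L lborel ?I - 2 * integral\<^sup>L lborel ?I) * norm c"
    by (intro tendsto_intros)
  moreover have "(\<integral>x. norm (?I (x + a) *\<^sub>R c - ?I x *\<^sub>R c) \<partial>lborel) =
      (2 * integral\<^sup>L lborel ?I - 2 * (\<integral>x. ?I x * ?I (x + a) \<partial>lborel)) * norm c" for a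
  proof -
    have "norm (?I (x + a) *\<^sub>R c - ?I x *\<^sub>R c) = (?I (x + a) + ?I x - 2 * (?I x * ?I (x + a))) * norm c" for x
      by (auto simp: indicator_def)
    then show ?thesis
      using int int' intp by (simp add: eq)
  qed
  ultimately show "(\<lambda>n. \<integral>x. norm (?I (x + h n) *\<^sub>R c - ?I x *\<^sub>R c) \<partial>lborel) \<longlonglongrightarrow> 0"
    by simp
qed

text \<open>Three-term estimate through \<open>g\<close>; both outer terms equal the L1 distance of
  \<open>f\<close> and \<open>g\<close>, one of them after a translation. They use up half of
  \<open>e\<close>.\<close>

lemma L1_translation_continuous_approx:
  fixes f :: "'a::euclidean_space \<Rightarrow> 'b::euclidean_space"
  assumes f: "integrable lborel f"
    and approx: "\<And>e. 0 < e \<Longrightarrow> \<exists>g. integrable lborel g \<and> L1_translation_continuous g \<and>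
      (\<integral>x. norm (g x - f x) \<partial>lborel) \<le> e"
  shows "L1_translation_continuous f"
  unfolding L1_translation_continuous_def
proof safe
  fix h :: "nat \<Rightarrow> 'a" assume h: "h \<longlonglongrightarrow> 0"
  show "(\<lambda>n. \<integral>x. norm (f (x + h n) - f x) \<partial>lborel) \<longlonglongrightarrow> 0"
  proof (rule tendstoI)
    fix e :: real assume e: "0 < e"
    obtain g where g: "integrable lborel g" "L1_translation_continuous g"
      "(\<integral>x. norm (g x - f x) \<partial>lborel) \<le> e / 4"
      using approx[of "e / 4"] e by auto
    have "\<forall>\<^sub>F n in sequentially. (\<integral>x. norm (g (x + h n) - g x) \<partial>lborel) < e / 2"
      using order_tendstoD(2)[OF g(2)[unfolded L1_translation_continuous_def, rule_format, OF h], of "e / 2"] e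
      by simp
    then show "\<forall>\<^sub>F n in sequentially. dist (\<integral>x. norm (f (x + h n) - f x) \<partial>lborel) 0 < e"
    proof eventually_elim
      fix n assume n: "(\<integral>x. norm (g (x + h n) - g x) \<partial>lborel) < e / 2"
      have gf: "integrable lborel (\<lambda>x. norm (g x - f x))" using g(1) f by auto
      note tr = integrable_lborel_translate[OF gf, of "h n"]
      note trg = integrable_lborel_translate(1)[OF g(1), of "h n"]
      note trf = integrable_lborel_translate(1)[OF f, of "h n"]
      have "(\<integral>x. norm (f (x + h n) - f x) \<partial>lborel) \<le>
          (\<integral>x. norm (g (x + h n) - f (x + h n)) + norm (g (x + h n) - g x) + norm (g x - f x) \<partial>lborel)"
      proof (rule integral_mono)
        show "norm (f (x + h n) - f x) \<le>
            norm (g (x + h n) - f (x + h n)) + norm (g (x + h n) - g x) + norm (g x - f x)" for x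
          by norm
      qed (use trg trf f g(1) tr gf in auto)
      also have "\<dots> = (\<integral>x. norm (g x - f x) \<partial>lborel) + (\<integral>x. norm (g (x + h n) - g x) \<partial>lborel) +
          (\<integral>x. norm (g x - f x) \<partial>lborel)"
        using tr trg g(1) gf by simp
      also have "\<dots> < e" using n g(3) by linarith
      finally show "dist (\<integral>x. norm (f (x + h n) - f x) \<partial>lborel) 0 < e" by simp
    qed
  qed
qed

lemma L1_translation_continuous:
  fixes f :: "'a::euclidean_space \<Rightarrow> 'b::euclidean_space"
  assumes "integrable lborel f"
  shows "L1_translation_continuous f"
  using assms
proof (induction rule: integrable_induct)
  case (base A c)
  have A: "A \<in> sets borel" "emeasure lborel A < \<infinity>" using base by auto
  show ?case
  proof (rule L1_translation_continuous_approx)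
    show "integrable lborel (\<lambda>x. indicator A x *\<^sub>R c)"
      using A by (intro integrable_scaleR_left) (auto simp: integrable_indicator_iff)
    fix e :: real assume e: "0 < e"
    \<comment> \<open>The summand 1 covers \<open>c = 0\<close>.\<close>
    define e' where "e' = e / (norm c + 1)"
    have e': "0 < e'" using e by (simp add: e'_def add_nonneg_pos)
    \<comment> \<open>Outer regularity reduces measurable sets to open sets, for which translations
      are already understood.\<close>
    obtain U where U: "open U" "A \<subseteq> U" "emeasure lborel (U - A) \<le> e'"
      by (rule outer_regular_lborel_le[OF A(1) e'])
    have UA: "emeasure lborel (U - A) < \<infinity>"
      using U(3) by (simp add: order_le_less_trans)
    have [measurable]: "U \<in> sets borel" "A \<in> sets borel" using U(1) A(1) by auto
    have "emeasure lborel U \<le> emeasure lborel A + emeasure lborel (U - A)"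
      using emeasure_subadditive[of A lborel "U - A"] U(2) by (simp add: Un_absorb1)
    also have "\<dots> < \<infinity>" using A(2) UA by (simp add: ennreal_add_eq_top less_top)
    finally have Ufin: "emeasure lborel U < \<infinity>" .
    have "(\<integral>x. norm (indicator U x *\<^sub>R c - indicator A x *\<^sub>R c) \<partial>lborel) =
        (\<integral>x. indicator (U - A) x * norm c \<partial>lborel)"
      using U(2) by (intro Bochner_Integration.integral_cong) (auto simp: indicator_def)
    also have "\<dots> = measure lborel (U - A) * norm c"
      by simp
    also have "measure lborel (U - A) \<le> e'"
      using U(3) e' by (simp add: measure_def enn2real_leI)
    also have "e' * norm c \<le> e"
    proof -
      have "e * (norm c / (norm c + 1)) \<le> e"
        using e by (intro mult_left_le) (auto simp: divide_le_eq_1 add_nonneg_pos)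
      then show ?thesis by (simp add: e'_def)
    qed
    finally have "(\<integral>x. norm (indicator U x *\<^sub>R c - indicator A x *\<^sub>R c) \<partial>lborel) \<le> e"
      by (simp add: mult_right_mono)
    moreover have "integrable lborel (\<lambda>x. indicator U x *\<^sub>R c)"
      using Ufin by (intro integrable_scaleR_left) (auto simp: integrable_indicator_iff)
    ultimately show "\<exists>g. integrable lborel g \<and> L1_translation_continuous g \<and>
        (\<integral>x. norm (g x - indicator A x *\<^sub>R c) \<partial>lborel) \<le> e"
      using L1_translation_continuous_open[OF U(1) Ufin, of c] by blast
  qed
next
  case (add f g)
  show ?case
    unfolding L1_translation_continuous_def
  proof safe
    fix h :: "nat \<Rightarrow> 'a" assume h: "h \<longlonglongrightarrow> 0"
    note tr = integrable_lborel_translate(1)[OF add.hyps(1)] integrable_lborel_translate(1)[OF add.hyps(2)]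
    have lim: "(\<lambda>n. (\<integral>x. norm (f (x + h n) - f x) \<partial>lborel) + (\<integral>x. norm (g (x + h n) - g x) \<partial>lborel)) \<longlonglongrightarrow> 0"
      using add.IH h unfolding L1_translation_continuous_def by (auto intro!: tendsto_add_zero)
    show "(\<lambda>n. \<integral>x. norm (f (x + h n) + g (x + h n) - (f x + g x)) \<partial>lborel) \<longlonglongrightarrow> 0"
    proof (rule tendsto_sandwich[OF _ _ tendsto_const lim])
      have "(\<integral>x. norm (f (x + h n) + g (x + h n) - (f x + g x)) \<partial>lborel) \<le>
          (\<integral>x. norm (f (x + h n) - f x) + norm (g (x + h n) - g x) \<partial>lborel)" for n
      proof (rule integral_mono)
        show "norm (f (x + h n) + g (x + h n) - (f x + g x)) \<le> norm (f (x + h n) - f x) + norm (g (x + h n) - g x)" for x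
          by norm
      qed (use tr add.hyps in auto)
      then show "\<forall>\<^sub>F n in sequentially. (\<integral>x. norm (f (x + h n) + g (x + h n) - (f x + g x)) \<partial>lborel)
          \<le> (\<integral>x. norm (f (x + h n) - f x) \<partial>lborel) + (\<integral>x. norm (g (x + h n) - g x) \<partial>lborel)"
        using tr add.hyps by (intro always_eventually allI) simp
    qed simp
  qed
next
  case (lim f s)
  show ?case
  proof (rule L1_translation_continuous_approx[OF lim.hyps(4)])
    fix e :: real assume e: "0 < e"
    have "(\<lambda>i. \<integral>x. norm (s i x - f x) \<partial>lborel) \<longlonglongrightarrow> (\<integral>x. 0 \<partial>(lborel :: 'a measure))"
    \<comment> \<open>The factor 3: the simple functions of the induction rule satisfy
      \<open>norm (s i x) \<le> 2 * norm (f x)\<close>, and \<open>f\<close> itself adds one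
      more.\<close>
    proof (rule integral_dominated_convergence[where w="\<lambda>x. 3 * norm (f x)"])
      show "AE x in lborel. (\<lambda>i. norm (s i x - f x)) \<longlonglongrightarrow> 0"
        using lim.hyps(2) by (auto intro!: tendsto_norm_zero LIM_zero)
      show "AE x in lborel. norm (norm (s i x - f x)) \<le> 3 * norm (f x)" for i
      proof (intro AE_I2)
        fix x :: 'a
        show "norm (norm (s i x - f x)) \<le> 3 * norm (f x)"
          using lim.hyps(3)[of x i] norm_triangle_ineq4[of "s i x" "f x"] by simp
      qed
    qed (use lim.hyps(1,4) borel_measurable_integrable in auto)
    then have "\<forall>\<^sub>F i in sequentially. (\<integral>x. norm (s i x - f x) \<partial>lborel) < e"
      using e by (auto dest: order_tendstoD(2))
    then obtain i where "(\<integral>x. norm (s i x - f x) \<partial>lborel) < e"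
      by (auto simp: eventually_sequentially)
    then show "\<exists>g. integrable lborel g \<and> L1_translation_continuous g \<and>
        (\<integral>x. norm (g x - f x) \<partial>lborel) \<le> e"
      using lim.hyps(1) lim.IH by (intro exI[of _ "s i"]) auto
  qed
qed

section \<open>Mollifiers and L1 convergence\<close>

definition mollifier :: "real \<Rightarrow> ('a::euclidean_space \<Rightarrow> real) \<Rightarrow> bool" where
  "mollifier e \<eta> \<longleftrightarrow> smooth \<eta> \<and> (\<forall>x. 0 \<le> \<eta> x) \<and> vanishes_outside e \<eta> \<and> integral\<^sup>L lborel \<eta> = 1"

lemma mollifier_exists:
  assumes "0 < e"
  shows "\<exists>\<eta> :: 'a::euclidean_space \<Rightarrow> real. mollifier e \<eta>"
proof -
  \<comment> \<open>The product of bumps lives in the cube of half side \<open>d\<close>; the bound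
    of the norm by the sum of the coordinates puts this cube into the ball of radius
    \<open>e\<close>.\<close>
  define d where "d = e / DIM('a)"
  have d: "0 < d" using assms by (simp add: d_def)
  define b :: "'a \<Rightarrow> real" where "b x = (\<Prod>i\<in>Basis. bump_below (d + x \<bullet> i) * bump_below (d - x \<bullet> i))" for x
  have smooth: "smooth b"
    unfolding b_def[abs_def]
    by (intro smooth_prod smooth_mult smooth_compose_real[OF bump_below(1)] smooth_add smooth_diff smooth_const
        smooth_linear bounded_linear_inner_left)
  have nonneg: "0 \<le> b x" for x
    by (auto simp: b_def intro!: prod_nonneg mult_nonneg_nonneg bump_below(4))
  have van: "vanishes_outside e b"
    unfolding vanishes_outside_def
  proof safe
    fix x :: 'a assume "e < norm x"
    also have "norm x \<le> (\<Sum>i\<in>Basis. \<bar>x \<bullet> i\<bar>)" by (rule norm_le_l1)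
    finally have "\<exists>i\<in>Basis. d < \<bar>x \<bullet> i\<bar>"
      using sum_bounded_above[of Basis "\<lambda>i. \<bar>x \<bullet> i\<bar>" d] by (force simp: d_def not_le[symmetric])
    then show "b x = 0"
      by (force simp: b_def bump_below(2) abs_if split: if_splits)
  qed
  have int: "integrable lborel b"
    by (rule integrable_vanishes_outside[OF smooth_continuous_on[OF smooth] van])
  \<comment> \<open>If the integral were 0, the open set where \<open>b\<close> does not vanish
    would be negligible, yet it contains the origin.\<close>
  have "integral\<^sup>L lborel b \<noteq> 0"
  proof
    assume "integral\<^sup>L lborel b = 0"
    then have "AE x in lborel. b x = 0"
      using integral_nonneg_eq_0_iff_AE[OF int] nonneg by simp
    then have "{x. b x \<noteq> 0} \<in> null_sets lborel"
      using borel_measurable_continuous_onI[OF smooth_continuous_on[OF smooth]]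
      by (subst AE_iff_null_sets) auto
    then have "negligible {x. b x \<noteq> 0}"
      by (auto simp: negligible_iff_null_sets null_sets_completionI)
    moreover have "open {x. b x \<noteq> 0}"
      using open_Collect_neq[OF smooth_continuous_on[OF smooth] continuous_on_const] .
    moreover have "b 0 \<noteq> 0"
      using bump_below(3)[OF d] by (simp add: b_def)
    ultimately show False
      using open_not_negligible by blast
  qed
  moreover have "0 \<le> integral\<^sup>L lborel b" using nonneg by simp
  ultimately have pos: "0 < integral\<^sup>L lborel b" by simp
  have "mollifier e (\<lambda>x. inverse (integral\<^sup>L lborel b) * b x)"
    using pos nonneg van unfolding mollifier_def vanishes_outside_def
    by (auto intro: smooth smooth_mult smooth_const)
  then show ?thesis
    by (intro exI[of _ "\<lambda>x. inverse (integral\<^sup>L lborel b) * b x"])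
qed

lemma conv_alt:
  fixes f :: "'a::euclidean_space \<Rightarrow> 'b::euclidean_space"
  assumes "continuous_on UNIV \<eta>" "vanishes_outside R \<eta>" "integrable lborel f"
  shows "conv \<eta> f x = (\<integral>z. \<eta> z *\<^sub>R f (x + z) \<partial>lborel)"
    and "integrable lborel (\<lambda>z. \<eta> z *\<^sub>R f (x + z))"
  using integrable_lborel_translate[OF conv_integrable[OF assms, of x], of x]
  by (auto simp: conv_def add.commute)

text \<open>\<open>conv \<eta> f - f\<close> is the average of the translation differences of
  \<open>f\<close> with weight \<open>\<eta>\<close>; Tonelli exchanges this average with the L1
  norm. Nonnegative integrals make measurability enough for the exchange, and integrability results
  from the bound.\<close>

lemma conv_L1_le:
  fixes f :: "'a::euclidean_space \<Rightarrow> 'b::euclidean_space"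
  assumes f: "integrable lborel f" and "mollifier d \<eta>" and e: "0 \<le> e"
    and d': "\<And>h. norm h \<le> d \<Longrightarrow> (\<integral>\<^sup>+x. norm (f (x + h) - f x) \<partial>lborel) \<le> e"
  shows "integrable lborel (\<lambda>x. conv \<eta> f x - f x)"
    and "(\<integral>x. norm (conv \<eta> f x - f x) \<partial>lborel) \<le> e"
proof -
  have [measurable]: "f \<in> borel_measurable borel"
    using borel_measurable_integrable[OF f] by simp
  have \<eta>: "smooth \<eta>" "\<And>x. 0 \<le> \<eta> x" "vanishes_outside d \<eta>" "integral\<^sup>L lborel \<eta> = 1"
    using assms(2) by (auto simp: mollifier_def)
  note cont = smooth_continuous_on[OF \<eta>(1), of UNIV]
  have [measurable]: "\<eta> \<in> borel_measurable borel"
    by (rule borel_measurable_continuous_onI[OF cont])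
  have [measurable]: "conv \<eta> f \<in> borel_measurable borel"
    by (rule borel_measurable_continuous_onI[OF smooth_continuous_on[OF conv_smooth[OF \<eta>(1,3) f]]])
  have int: "integrable lborel \<eta>"
    by (rule integrable_vanishes_outside[OF cont \<eta>(3)])
  have nn\<eta>: "(\<integral>\<^sup>+z. \<eta> z \<partial>lborel) = 1"
    using nn_integral_eq_integral[OF int] \<eta>(2,4) by simp
  have pt: "ennreal (norm (conv \<eta> f x - f x)) \<le> (\<integral>\<^sup>+z. ennreal (\<eta> z) * ennreal (norm (f (x + z) - f x)) \<partial>lborel)" for x
  proof -
    have i1: "integrable lborel (\<lambda>z. \<eta> z *\<^sub>R f (x + z))" "integrable lborel (\<lambda>z. \<eta> z *\<^sub>R f x)"
      using conv_alt(2)[OF cont \<eta>(3) f] int by auto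
    then have i2: "integrable lborel (\<lambda>z. \<eta> z *\<^sub>R (f (x + z) - f x))"
      by (simp add: scaleR_diff_right)
    have "conv \<eta> f x - f x = (\<integral>z. \<eta> z *\<^sub>R (f (x + z) - f x) \<partial>lborel)"
      using i1 \<eta>(4) int by (simp add: conv_alt(1)[OF cont \<eta>(3) f] scaleR_diff_right)
    then have "ennreal (norm (conv \<eta> f x - f x)) \<le> (\<integral>\<^sup>+z. norm (\<eta> z *\<^sub>R (f (x + z) - f x)) \<partial>lborel)"
      using integral_norm_bound_ennreal[OF i2] by simp
    then show ?thesis
      using \<eta>(2) by (simp add: ennreal_mult)
  qed
  have le: "(\<integral>\<^sup>+x. norm (conv \<eta> f x - f x) \<partial>lborel) \<le> e"
  proof -
    have "(\<integral>\<^sup>+x. norm (conv \<eta> f x - f x) \<partial>lborel) \<le>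
        (\<integral>\<^sup>+x. (\<integral>\<^sup>+z. ennreal (\<eta> z) * ennreal (norm (f (x + z) - f x)) \<partial>lborel) \<partial>lborel)"
      by (intro nn_integral_mono pt)
    also have "\<dots> = (\<integral>\<^sup>+z. (\<integral>\<^sup>+x. ennreal (\<eta> z) * ennreal (norm (f (x + z) - f x)) \<partial>lborel) \<partial>lborel)"
      by (rule lborel_pair.Fubini'[symmetric]) measurable
    also have "\<dots> = (\<integral>\<^sup>+z. ennreal (\<eta> z) * (\<integral>\<^sup>+x. ennreal (norm (f (x + z) - f x)) \<partial>lborel) \<partial>lborel)"
      by (intro nn_integral_cong nn_integral_cmult) measurable
    also have "\<dots> \<le> (\<integral>\<^sup>+z. ennreal (\<eta> z) * e \<partial>lborel)"
    proof (rule nn_integral_mono)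
      fix z :: 'a
      show "ennreal (\<eta> z) * (\<integral>\<^sup>+x. ennreal (norm (f (x + z) - f x)) \<partial>lborel) \<le> ennreal (\<eta> z) * e"
        using d'[of z] \<eta>(3)
        by (cases "norm z \<le> d") (auto intro!: mult_left_mono simp: vanishes_outside_def)
    qed
    also have "\<dots> = e"
      using nn\<eta> by (simp add: nn_integral_multc)
    finally show ?thesis .
  qed
  have int: "integrable lborel (\<lambda>x. conv \<eta> f x - f x)"
    using le by (intro integrableI_bounded) (auto simp: order_le_less_trans)
  have "ennreal (\<integral>x. norm (conv \<eta> f x - f x) \<partial>lborel) \<le> e"
    using le nn_integral_eq_integral[OF integrable_norm[OF int]] by simp
  then show "(\<integral>x. norm (conv \<eta> f x - f x) \<partial>lborel) \<le> e"
    using e by simp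
  show "integrable lborel (\<lambda>x. conv \<eta> f x - f x)" by (rule int)
qed

lemma conv_L1_approx:
  fixes f :: "'a::euclidean_space \<Rightarrow> 'b::euclidean_space"
  assumes f: "integrable lborel f" and e: "0 < e"
  obtains d where "0 < d"
    "\<And>\<eta>. mollifier d \<eta> \<Longrightarrow> integrable lborel (\<lambda>x. conv \<eta> f x - f x) \<and>
       (\<integral>x. norm (conv \<eta> f x - f x) \<partial>lborel) \<le> e"
proof -
  have [measurable]: "f \<in> borel_measurable borel"
    using borel_measurable_integrable[OF f] by simp
  have "((\<lambda>h. \<integral>x. norm (f (x + h) - f x) \<partial>lborel) \<longlongrightarrow> 0) (at 0)"
    using L1_translation_continuous[OF f]
    unfolding tendsto_at_iff_sequentially L1_translation_continuous_def comp_def by auto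
  then have "\<forall>\<^sub>F h in at 0. (\<integral>x. norm (f (x + h) - f x) \<partial>lborel) < e"
    using e by (rule order_tendstoD)
  then obtain d where d: "0 < d" "\<And>h. h \<noteq> 0 \<Longrightarrow> dist h 0 < d \<Longrightarrow> (\<integral>x. norm (f (x + h) - f x) \<partial>lborel) < e"
    unfolding eventually_at by blast
  have d': "(\<integral>\<^sup>+x. norm (f (x + h) - f x) \<partial>lborel) \<le> e" if "norm h < d" for h
  proof -
    have "(\<integral>\<^sup>+x. norm (f (x + h) - f x) \<partial>lborel) = ennreal (\<integral>x. norm (f (x + h) - f x) \<partial>lborel)"
      using integrable_lborel_translate(1)[OF f, of h] f by (intro nn_integral_eq_integral) auto
    then show ?thesis
      using d(2)[of h] that e by (cases "h = 0") (auto intro!: ennreal_leI)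
  qed
  show ?thesis
  \<comment> \<open>The translation bound holds for \<open>norm h < d\<close>, whereas a mollifier
    may be positive up to and including its radius; halving restores the strict inequality.\<close>
  proof (rule that[of "d / 2"])
    show "0 < d / 2" using d(1) by simp
    fix \<eta> :: "'a \<Rightarrow> real" assume m: "mollifier (d / 2) \<eta>"
    show "integrable lborel (\<lambda>x. conv \<eta> f x - f x) \<and> (\<integral>x. norm (conv \<eta> f x - f x) \<partial>lborel) \<le> e"
      using conv_L1_le[OF f m, of e] d' d(1) e by auto
  qed
qed

lemma conv_diff_integrable_lborel:
  fixes f :: "'a::euclidean_space \<Rightarrow> 'b::euclidean_space"
  assumes f: "integrable lborel f" and "mollifier d \<eta>"
  shows "integrable lborel (\<lambda>x. conv \<eta> f x - f x)"
proof (rule conv_L1_le(1)[OF assms])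
  fix h :: 'a
  note int = integrable_norm[OF f] integrable_norm[OF integrable_lborel_translate(1)[OF f, of h]]
  have "(\<integral>\<^sup>+x. norm (f (x + h) - f x) \<partial>lborel) \<le> (\<integral>\<^sup>+x. ennreal (norm (f (x + h)) + norm (f x)) \<partial>lborel)"
    by (intro nn_integral_mono ennreal_leI norm_triangle_ineq4)
  also have "\<dots> = ennreal (\<integral>x. norm (f (x + h)) + norm (f x) \<partial>lborel)"
    using int by (intro nn_integral_eq_integral) auto
  also have "(\<integral>x. norm (f (x + h)) + norm (f x) \<partial>lborel) = 2 * (\<integral>x. norm (f x) \<partial>lborel)"
    using int integrable_lborel_translate(2)[OF int(1), of h] by simp
  finally show "(\<integral>\<^sup>+x. norm (f (x + h) - f x) \<partial>lborel) \<le> ennreal (2 * (\<integral>x. norm (f x) \<partial>lborel))" .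
qed simp

text \<open>A mollifier is a probability density. The bound keeps mollified functions inside the
  ball on which an outer function is differentiable.\<close>

lemma conv_norm_le:
  fixes f :: "'a::euclidean_space \<Rightarrow> 'b::euclidean_space"
  assumes "mollifier d \<eta>" "integrable lborel f" "AE x in lborel. norm (f x) \<le> B"
  shows "norm (conv \<eta> f x) \<le> B"
proof -
  have \<eta>: "smooth \<eta>" "\<And>x. 0 \<le> \<eta> x" "vanishes_outside d \<eta>" "integral\<^sup>L lborel \<eta> = 1"
    using assms(1) by (auto simp: mollifier_def)
  note cont = smooth_continuous_on[OF \<eta>(1), of UNIV]
  have int: "integrable lborel \<eta>"
    by (rule integrable_vanishes_outside[OF cont \<eta>(3)])
  have "integrable lborel (\<lambda>z. \<eta> (z - x))"
    using integrable_lborel_translate(1)[OF int, of "- x"] by simp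
  moreover have "integral\<^sup>L lborel (\<lambda>z. \<eta> (z - x)) = 1"
    using integrable_lborel_translate(2)[OF int, of "- x"] \<eta>(4) by simp
  moreover have "norm (conv \<eta> f x) \<le> (\<integral>z. norm (\<eta> (z - x) *\<^sub>R f z) \<partial>lborel)"
    unfolding conv_def by (rule integral_norm_bound)
  moreover have "(\<integral>z. norm (\<eta> (z - x) *\<^sub>R f z) \<partial>lborel) \<le> (\<integral>z. \<eta> (z - x) * B \<partial>lborel)"
  proof (rule integral_mono_AE)
    show "integrable lborel (\<lambda>z. norm (\<eta> (z - x) *\<^sub>R f z))"
      by (rule integrable_norm[OF conv_integrable[OF cont \<eta>(3) assms(2)]])
    show "AE z in lborel. norm (\<eta> (z - x) *\<^sub>R f z) \<le> \<eta> (z - x) * B"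
      using assms(3) \<eta>(2) by (auto elim!: eventually_mono intro: mult_left_mono)
  qed (use calculation(1) in auto)
  ultimately show ?thesis by simp
qed

section \<open>Test functions and local integrability\<close>

lemma test_functionD:
  fixes \<phi> :: "'a::euclidean_space \<Rightarrow> real"
  assumes "test_function S \<phi>"
  obtains C where "smooth \<phi>" "compact C" "C \<subseteq> S" "\<And>x. x \<notin> C \<Longrightarrow> \<phi> x = 0"
    "\<And>x v. x \<notin> C \<Longrightarrow> frechet_derivative \<phi> (at x) v = 0"
proof -
  have sm: "smooth \<phi>" using assms by (auto simp: test_function_def smooth_def)
  obtain C where C: "compact C" "C \<subseteq> S" "\<And>x. x \<notin> C \<Longrightarrow> \<phi> x = 0"
    using assms by (auto simp: test_function_def)
  have "frechet_derivative \<phi> (at x) v = 0" if "x \<notin> C" for x v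
  proof -
    have "((\<lambda>x. 0) has_derivative frechet_derivative \<phi> (at x)) (at x)"
      by (rule has_derivative_transform_within_open[OF smooth_derivative(1)[OF sm], where s="- C"])
        (use that C in \<open>auto simp: compact_imp_closed open_Compl\<close>)
    then have "frechet_derivative \<phi> (at x) = (\<lambda>v. 0)"
      by (rule has_derivative_unique) simp
    then show ?thesis by simp
  qed
  with sm C that show ?thesis by blast
qed

lemma test_functionI:
  assumes "smooth \<phi>" "compact C" "C \<subseteq> S" "\<And>x. x \<notin> C \<Longrightarrow> \<phi> x = 0"
  shows "test_function S \<phi>"
  using assms by (auto simp: test_function_def smooth_def)

lemma test_function_bounded:
  fixes \<phi> :: "'a::euclidean_space \<Rightarrow> real"
  assumes "test_function S \<phi>"
  obtains M where "0 < M" "\<And>x. \<bar>\<phi> x\<bar> \<le> M" "\<And>x. \<bar>frechet_derivative \<phi> (at x) v\<bar> \<le> M"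
proof -
  obtain C where C: "smooth \<phi>" "compact C" "C \<subseteq> S" "\<And>x. x \<notin> C \<Longrightarrow> \<phi> x = 0"
    using test_functionD[OF assms] by metis
  obtain R where "C \<subseteq> cball 0 R"
    using compact_imp_bounded[OF C(2)] by (auto simp: bounded_iff subset_iff)
  then have van: "vanishes_outside R \<phi>"
    using C(4) by (force simp: vanishes_outside_def)
  obtain M1 where "0 < M1" "\<And>x. norm (\<phi> x) \<le> M1"
    by (rule bounded_vanishes_outside[OF smooth_continuous_on[OF C(1)] van]) blast
  moreover obtain M2 where "0 < M2" "\<And>x. norm (frechet_derivative \<phi> (at x) v) \<le> M2"
    by (rule bounded_vanishes_outside[OF smooth_continuous_on[OF smooth_derivative(2)[OF C(1)]]
          vanishes_outside_derivative[OF van smooth_derivative(1)[OF C(1)]]]) blast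
  ultimately show ?thesis
    by (intro that[of "max M1 M2"]) (auto simp: le_max_iff_disj)
qed

lemma compact_sets_lebesgue: "compact C \<Longrightarrow> C \<in> sets lebesgue"
  and open_sets_lebesgue: "open C \<Longrightarrow> C \<in> sets lebesgue"
  by (simp_all add: borel_compact)

lemma lebesgue_on_integral_subset:
  fixes f :: "'a::euclidean_space \<Rightarrow> 'b::euclidean_space"
  assumes "C \<in> sets lebesgue" "S \<in> sets lebesgue" "C \<subseteq> S" "\<And>x. x \<in> S \<Longrightarrow> x \<notin> C \<Longrightarrow> f x = 0"
  shows "integral\<^sup>L (lebesgue_on S) f = integral\<^sup>L (lebesgue_on C) f"
    and "integrable (lebesgue_on S) f \<longleftrightarrow> integrable (lebesgue_on C) f"
proof -
  have "(\<lambda>x. indicator S x *\<^sub>R f x) = (\<lambda>x. indicator C x *\<^sub>R f x)"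
    using assms(3,4) by (auto simp: indicator_def fun_eq_iff)
  then show "integral\<^sup>L (lebesgue_on S) f = integral\<^sup>L (lebesgue_on C) f"
    and "integrable (lebesgue_on S) f \<longleftrightarrow> integrable (lebesgue_on C) f"
    using assms(1,2) by (auto simp: integral_restrict_space integrable_restrict_space)
qed

lemma integrable_lebesgue_on_subset:
  fixes f :: "'a::euclidean_space \<Rightarrow> 'b::euclidean_space"
  assumes "integrable (lebesgue_on S) f" "C \<subseteq> S" "C \<in> sets lebesgue" "S \<in> sets lebesgue"
  shows "integrable (lebesgue_on C) f"
proof -
  have "integrable lebesgue (\<lambda>x. indicator C x *\<^sub>R (indicator S x *\<^sub>R f x))"
    using assms(1,4) by (intro integrable_mult_indicator[OF assms(3)]) (simp add: integrable_restrict_space)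
  also have "(\<lambda>x. indicator C x *\<^sub>R (indicator S x *\<^sub>R f x)) = (\<lambda>x. indicator C x *\<^sub>R f x)"
    using assms(2) by (auto simp: indicator_def fun_eq_iff)
  finally show ?thesis using assms(3) by (simp add: integrable_restrict_space)
qed

lemma locally_integrableD:
  "locally_integrable_on f \<Omega> \<Longrightarrow> compact C \<Longrightarrow> C \<subseteq> \<Omega> \<Longrightarrow> integrable (lebesgue_on C) f"
  by (auto simp: locally_integrable_on_def)

lemma locally_integrable_integrable:
  assumes "integrable (lebesgue_on \<Omega>) f" "open \<Omega>"
  shows "locally_integrable_on f \<Omega>"
  using assms by (auto simp: locally_integrable_on_def compact_sets_lebesgue intro: integrable_lebesgue_on_subset)

lemma compact_exhaustion:
  assumes "open (\<Omega> :: 'a::euclidean_space set)"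
  shows "\<exists>C. (\<forall>n::nat. compact (C n)) \<and> (\<forall>n. C n \<subseteq> \<Omega>) \<and> (\<forall>n. C n \<subseteq> C (Suc n)) \<and> \<Union>(range C) = \<Omega>"
proof (rule open_Union_compact_subsets[OF assms])
  fix C assume "\<And>n::nat. compact (C n)" "\<And>n. C n \<subseteq> \<Omega>" "\<And>n. C n \<subseteq> interior (C (Suc n))" "\<Union>(range C) = \<Omega>"
  then show ?thesis
    using interior_subset by (intro exI[of _ C]) blast
qed

lemma locally_integrable_AE_on_compact:
  assumes \<Omega>: "open (\<Omega> :: 'a::euclidean_space set)"
    and "\<And>C. compact C \<Longrightarrow> C \<subseteq> \<Omega> \<Longrightarrow> AE x in lebesgue_on C. P x"
  shows "AE x in lebesgue_on \<Omega>. P x"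
proof -
  obtain C where C: "\<And>n. compact (C n)" "\<And>n. C n \<subseteq> \<Omega>" "\<And>n. C n \<subseteq> C (Suc n)" "\<Union>(range C) = \<Omega>"
    using compact_exhaustion[OF \<Omega>] by blast
  have "AE x in lebesgue. x \<in> C n \<longrightarrow> P x" for n
    using assms(2)[OF C(1,2)[of n]] C(1)[of n] by (simp add: AE_restrict_space_iff compact_sets_lebesgue)
  then have "AE x in lebesgue. \<forall>n. x \<in> C n \<longrightarrow> P x"
    by (subst AE_all_countable) blast
  moreover have "x \<in> \<Omega> \<longrightarrow> P x" if "\<forall>n. x \<in> C n \<longrightarrow> P x" for x
    using that C(4) by blast
  ultimately have "AE x in lebesgue. x \<in> \<Omega> \<longrightarrow> P x"
    by (rule eventually_mono)
  then show ?thesis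
    using \<Omega> by (simp add: AE_restrict_space_iff open_sets_lebesgue)
qed

lemma AE_lebesgue_on_subset:
  assumes "AE x in lebesgue_on S. P x" "C \<subseteq> S" "C \<in> sets lebesgue" "S \<in> sets lebesgue"
  shows "AE x in lebesgue_on C. P x"
  using assms by (auto simp: AE_restrict_space_iff elim!: eventually_mono)

lemma locally_integrable_measurable:
  fixes f :: "real^3 \<Rightarrow> 'b::euclidean_space"
  assumes "open \<Omega>" "locally_integrable_on f \<Omega>"
  shows "f \<in> borel_measurable (lebesgue_on \<Omega>)"
proof -
  obtain C where C: "\<And>n. compact (C n)" "\<And>n. C n \<subseteq> \<Omega>" "\<And>n. C n \<subseteq> C (Suc n)" "\<Union>(range C) = \<Omega>"
    using compact_exhaustion[OF assms(1)] by blast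
  have mono: "C m \<subseteq> C n" if "m \<le> n" for m n
    by (rule lift_Suc_mono_le[of C, OF C(3) that])
  have m: "(\<lambda>x. indicator (C n) x *\<^sub>R f x) \<in> borel_measurable lebesgue" for n
    using locally_integrableD[OF assms(2) C(1,2)[of n]] C(1)[of n]
    by (intro borel_measurable_integrable) (simp add: integrable_restrict_space compact_sets_lebesgue)
  have "(\<lambda>x. indicator \<Omega> x *\<^sub>R f x) \<in> borel_measurable lebesgue"
  proof (rule borel_measurable_LIMSEQ_metric[OF m])
    fix x
    show "(\<lambda>n. indicator (C n) x *\<^sub>R f x) \<longlonglongrightarrow> indicator \<Omega> x *\<^sub>R f x"
    proof (cases "x \<in> \<Omega>")
      case True
      then obtain N where "x \<in> C N" using C(4) by auto
      then have "\<forall>\<^sub>F n in sequentially. indicator \<Omega> x *\<^sub>R f x = indicator (C n) x *\<^sub>R f x"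
        using mono True by (intro eventually_sequentiallyI[of N]) (auto simp: indicator_def)
      then show ?thesis by (rule Lim_transform_eventually[OF tendsto_const])
    next
      case False
      then have "x \<notin> C n" for n using C(2) by auto
      with False show ?thesis by simp
    qed
  qed
  then show ?thesis
    using assms(1) by (subst borel_measurable_restrict_space_iff) (auto simp: open_sets_lebesgue)
qed

section \<open>Borel representatives and mollification inside a domain\<close>

lemma lebesgue_borel_representative:
  fixes f :: "'a::euclidean_space \<Rightarrow> 'b::euclidean_space"
  assumes "f \<in> borel_measurable lebesgue"
  shows "\<exists>h\<in>borel_measurable borel. AE x in lebesgue. f x = h x"
proof -
  have "\<exists>g\<in>borel_measurable lborel. AE x in lborel. f x \<bullet> b = g x" for b
    using assms by (intro completion_ex_borel_measurable_real) auto
  then obtain g where g: "\<And>b. g b \<in> borel_measurable lborel" "\<And>b. AE x in lborel. f x \<bullet> b = g b x"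
    by metis
  have [measurable]: "g b \<in> borel_measurable borel" for b using g(1) by simp
  have "AE x in lborel. \<forall>b\<in>Basis. f x \<bullet> b = g b x"
    using g(2) by (intro AE_finite_allI) auto
  then have "AE x in lborel. f x = (\<Sum>b\<in>Basis. g b x *\<^sub>R b)"
    by eventually_elim (metis (no_types, lifting) euclidean_representation sum.cong)
  then show ?thesis
    by (intro bexI[of _ "\<lambda>x. \<Sum>b\<in>Basis. g b x *\<^sub>R b"] AE_completion) auto
qed

text \<open>A bridge between measures: functions on a domain are Lebesgue measurable, while Fubini
  and translation invariance are applied to Borel functions on the whole space.\<close>

definition borel_extension :: "'a::euclidean_space set \<Rightarrow> ('a \<Rightarrow> 'b::euclidean_space) \<Rightarrow> ('a \<Rightarrow> 'b) \<Rightarrow> bool" where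
  "borel_extension D f h \<longleftrightarrow> integrable lborel h \<and> (AE x in lebesgue. h x = indicator D x *\<^sub>R f x)"

lemma borel_extension_exists:
  fixes f :: "'a::euclidean_space \<Rightarrow> 'b::euclidean_space"
  assumes "integrable (lebesgue_on D) f" "D \<in> sets lebesgue"
  obtains h where "borel_extension D f h"
proof -
  have int: "integrable lebesgue (\<lambda>x. indicator D x *\<^sub>R f x)"
    using assms by (simp add: integrable_restrict_space)
  obtain h where h: "h \<in> borel_measurable borel" "AE x in lebesgue. indicator D x *\<^sub>R f x = h x"
    using lebesgue_borel_representative[OF borel_measurable_integrable[OF int]] by blast
  have h': "h \<in> borel_measurable lebesgue"
    using measurable_completion[of h lborel borel] h(1) by simp
  have "integrable lebesgue h"
    by (rule integrable_cong_AE_imp[OF int h' h(2)])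
  then have "integrable lborel h"
    using h(1) by (simp add: integrable_completion)
  moreover have "AE x in lebesgue. h x = indicator D x *\<^sub>R f x"
    using h(2) by eventually_elim simp
  ultimately show ?thesis
    using that by (simp add: borel_extension_def)
qed

text \<open>The kernel centred at \<open>x\<close> vanishes off \<open>D\<close>, so the convolution
  does not see how \<open>f\<close> was extended.\<close>

lemma conv_borel_extension:
  fixes f :: "'a::euclidean_space \<Rightarrow> 'b::euclidean_space"
  assumes h: "borel_extension D f h" and D: "D \<in> sets lebesgue" "D \<subseteq> S" "S \<in> sets lebesgue"
    and \<eta>: "continuous_on UNIV \<eta>" "\<And>z. z \<notin> D \<Longrightarrow> \<eta> (z - x) = 0"
  shows "conv \<eta> h x = (\<integral>z. \<eta> (z - x) *\<^sub>R f z \<partial>lebesgue_on S)"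
proof -
  have m: "h \<in> borel_measurable borel" "\<eta> \<in> borel_measurable borel"
    using h borel_measurable_integrable borel_measurable_continuous_onI[OF \<eta>(1)]
    by (auto simp: borel_extension_def)
  have m': "(\<lambda>z. \<eta> (z - x) *\<^sub>R h z) \<in> borel_measurable lborel"
    using m by measurable
  have AE: "AE z in lebesgue. \<eta> (z - x) *\<^sub>R h z = indicator D z *\<^sub>R (\<eta> (z - x) *\<^sub>R f z)"
    using h unfolding borel_extension_def by (auto elim!: eventually_mono)
  have ml: "(\<lambda>z. \<eta> (z - x) *\<^sub>R h z) \<in> borel_measurable lebesgue"
    by (rule measurable_completion[OF m'])
  have "conv \<eta> h x = (\<integral>z. \<eta> (z - x) *\<^sub>R h z \<partial>lebesgue)"
    unfolding conv_def by (rule integral_completion[OF m', symmetric])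
  also have "\<dots> = (\<integral>z. indicator D z *\<^sub>R (\<eta> (z - x) *\<^sub>R f z) \<partial>lebesgue)"
    by (rule integral_cong_AE[OF ml borel_measurable_AE[OF ml AE] AE])
  also have "\<dots> = (\<integral>z. \<eta> (z - x) *\<^sub>R f z \<partial>lebesgue_on D)"
    using D(1) by (simp add: integral_restrict_space)
  also have "\<dots> = (\<integral>z. \<eta> (z - x) *\<^sub>R f z \<partial>lebesgue_on S)"
    using D \<eta>(2) by (intro lebesgue_on_integral_subset(1)[symmetric]) auto
  finally show ?thesis .
qed

lemma mollifier_mono: "mollifier d \<eta> \<Longrightarrow> d \<le> e \<Longrightarrow> mollifier e \<eta>"
  by (auto simp: mollifier_def vanishes_outside_def)

lemma mollifier_sequence:
  assumes "0 < r"
  shows "\<exists>\<eta> :: nat \<Rightarrow> 'a::euclidean_space \<Rightarrow> real. \<forall>n. mollifier (r / Suc n) (\<eta> n)"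
  using mollifier_exists[of "r / Suc n" for n] assms by (intro choice) auto

lemma conv_sequence:
  fixes f :: "'a::euclidean_space \<Rightarrow> 'b::euclidean_space"
  assumes \<eta>: "\<And>n. mollifier (r / Suc n) (\<eta> n)" and f: "integrable lborel f" and "0 < r"
  shows "(\<lambda>n. \<integral>x. norm (conv (\<eta> n) f x - f x) \<partial>lborel) \<longlonglongrightarrow> 0"
proof (rule tendstoI)
  fix e :: real assume e: "0 < e"
  obtain d where d: "0 < d" "\<And>\<eta>. mollifier d \<eta> \<Longrightarrow> integrable lborel (\<lambda>x. conv \<eta> f x - f x) \<and>
      (\<integral>x. norm (conv \<eta> f x - f x) \<partial>lborel) \<le> e / 2"
    by (rule conv_L1_approx[OF f, of "e / 2"]) (use e in auto)
  have "(\<lambda>n. r / Suc n) \<longlonglongrightarrow> 0"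
    using tendsto_mult_right_zero[OF LIMSEQ_inverse_real_of_nat, of r] by (simp add: divide_inverse)
  then have "\<forall>\<^sub>F n in sequentially. r / Suc n < d"
    using d(1) by (rule order_tendstoD)
  then show "\<forall>\<^sub>F n in sequentially. dist (\<integral>x. norm (conv (\<eta> n) f x - f x) \<partial>lborel) 0 < e"
  proof eventually_elim
    fix n assume "r / Suc n < d"
    then have "(\<integral>x. norm (conv (\<eta> n) f x - f x) \<partial>lborel) \<le> e / 2"
      using d(2)[OF mollifier_mono[OF \<eta>]] by (meson less_imp_le)
    then show "dist (\<integral>x. norm (conv (\<eta> n) f x - f x) \<partial>lborel) 0 < e"
      using e by simp
  qed
qed

lemma conv_diff_integrable:
  fixes f :: "'a::euclidean_space \<Rightarrow> 'b::euclidean_space"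
  assumes "mollifier d \<eta>" "integrable lborel f" "C \<in> sets lebesgue"
  shows "integrable (lebesgue_on C) (\<lambda>x. conv \<eta> f x - f x)"
proof -
  note int = conv_diff_integrable_lborel[OF assms(2,1)]
  have "integrable lebesgue (\<lambda>x. conv \<eta> f x - f x)"
    using int integrable_completion[OF borel_measurable_integrable[OF int]] by simp
  then show ?thesis
    using assms(3) by (simp add: integrable_restrict_space integrable_mult_indicator)
qed

text \<open>Room for mollification: \<open>D\<close> is the Minkowski sum of \<open>C\<close> and a
  small closed ball, so kernels of radius \<open>r\<close> centred in \<open>C\<close> stay inside a
  compact part of the domain.\<close>

lemma compact_neighbourhood:
  fixes C :: "'a::euclidean_space set"
  assumes "compact C" "open \<Omega>" "C \<subseteq> \<Omega>"
  obtains r D where "0 < r" "compact D" "D \<subseteq> \<Omega>" "C \<subseteq> D" "\<And>x y. x \<in> C \<Longrightarrow> norm (y - x) \<le> r \<Longrightarrow> y \<in> D"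
proof -
  obtain r where r: "0 < r" "(\<Union>x\<in>C. cball x r) \<subseteq> \<Omega>"
    by (rule compact_subset_open_imp_cball_epsilon_subset[OF assms])
  define D where "D = {x + y | x y. x \<in> C \<and> y \<in> cball 0 r}"
  have sub: "y \<in> D" if "x \<in> C" "norm (y - x) \<le> r" for x y
    unfolding D_def using that by (intro CollectI exI[of _ x] exI[of _ "y - x"]) auto
  have "compact D"
    unfolding D_def by (rule compact_sums[OF assms(1) compact_cball])
  moreover have "D \<subseteq> \<Omega>"
    using r(2) by (force simp: D_def dist_norm)
  moreover have "C \<subseteq> D" using sub[of x x for x] r(1) by auto
  ultimately show ?thesis by (rule that[OF r(1) _ _ _ sub])
qed

lemma borel_extension_mollified:
  fixes f :: "'a::euclidean_space \<Rightarrow> 'b::euclidean_space"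
  assumes h: "borel_extension D f h" and \<eta>: "\<And>n. mollifier (r / Suc n) (\<eta> n)" "0 < r"
    and C: "compact C" "C \<subseteq> D"
  shows "integrable (lebesgue_on C) (\<lambda>x. conv (\<eta> n) h x - f x)"
    and "(\<lambda>n. \<integral>x. norm (conv (\<eta> n) h x - f x) \<partial>lebesgue_on C) \<longlonglongrightarrow> 0"
proof -
  have hi: "integrable lborel h" using h by (simp add: borel_extension_def)
  have Cs: "C \<in> sets lebesgue"
    using C(1) by (rule compact_sets_lebesgue)
  have AE: "AE x in lebesgue_on C. conv (\<eta> n) h x - h x = conv (\<eta> n) h x - f x" for n
    using h C Cs unfolding borel_extension_def AE_restrict_space_iff[of C lebesgue]
    by (auto simp: AE_restrict_space_iff elim!: eventually_mono)
  have int: "integrable (lebesgue_on C) (\<lambda>x. conv (\<eta> n) h x - h x)" for n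
    by (rule conv_diff_integrable[OF \<eta>(1) hi Cs])
  have m: "(\<lambda>x. conv (\<eta> n) h x - f x) \<in> borel_measurable (lebesgue_on C)" for n
  proof -
    have AE': "AE x in lebesgue. indicator C x *\<^sub>R (conv (\<eta> n) h x - h x) = indicator C x *\<^sub>R (conv (\<eta> n) h x - f x)"
      using AE[of n] Cs by (auto simp: AE_restrict_space_iff indicator_def elim!: eventually_mono)
    show ?thesis
      using borel_measurable_AE[OF _ AE'] borel_measurable_integrable[OF int[of n]] Cs
      by (simp add: borel_measurable_restrict_space_iff)
  qed
  show "integrable (lebesgue_on C) (\<lambda>x. conv (\<eta> n) h x - f x)" for n
    by (rule integrable_cong_AE_imp[OF int m AE])
  have le: "(\<integral>x. norm (conv (\<eta> n) h x - f x) \<partial>lebesgue_on C) \<le> (\<integral>x. norm (conv (\<eta> n) h x - h x) \<partial>lborel)" for n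
  proof -
    have sm: "smooth (\<eta> n)" "vanishes_outside (r / Suc n) (\<eta> n)" using \<eta>(1)[of n] by (auto simp: mollifier_def)
    have mb: "(\<lambda>x. norm (conv (\<eta> n) h x - h x)) \<in> borel_measurable lborel"
      using borel_measurable_continuous_onI[OF smooth_continuous_on[OF conv_smooth[OF sm hi]]]
        borel_measurable_integrable[OF hi] by simp
    have il: "integrable lborel (\<lambda>x. norm (conv (\<eta> n) h x - h x))"
      by (rule integrable_norm[OF conv_diff_integrable_lborel[OF hi \<eta>(1)]])
    have "(\<integral>x. norm (conv (\<eta> n) h x - f x) \<partial>lebesgue_on C) = (\<integral>x. norm (conv (\<eta> n) h x - h x) \<partial>lebesgue_on C)"
      using AE[of n] m int by (intro integral_cong_AE) (auto elim!: eventually_mono intro: borel_measurable_integrable)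
    also have "\<dots> = (\<integral>x. indicator C x *\<^sub>R norm (conv (\<eta> n) h x - h x) \<partial>lebesgue)"
      using Cs by (simp add: integral_restrict_space)
    also have "\<dots> \<le> (\<integral>x. norm (conv (\<eta> n) h x - h x) \<partial>lebesgue)"
      using il mb Cs
      by (intro integral_mono integrable_mult_indicator) (auto simp: integrable_completion indicator_def)
    also have "\<dots> = (\<integral>x. norm (conv (\<eta> n) h x - h x) \<partial>lborel)"
      by (rule integral_completion[OF mb])
    finally show ?thesis .
  qed
  show "(\<lambda>n. \<integral>x. norm (conv (\<eta> n) h x - f x) \<partial>lebesgue_on C) \<longlonglongrightarrow> 0"
    by (rule tendsto_sandwich[OF _ _ tendsto_const conv_sequence[OF \<eta>(1) hi \<eta>(2)]]) (use le in auto)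
qed

lemma mollifier_test_function:
  assumes "mollifier r \<eta>" "x \<in> C" "compact D" "D \<subseteq> \<Omega>" "\<And>x y. x \<in> C \<Longrightarrow> norm (y - x) \<le> r \<Longrightarrow> y \<in> D"
  shows "test_function \<Omega> (\<lambda>z. \<eta> (z - x))" "z \<notin> D \<Longrightarrow> \<eta> (z - x) = 0"
proof -
  show z: "\<eta> (z - x) = 0" if "z \<notin> D" for z
    using assms(1,2) assms(5)[of x z] that by (auto simp: mollifier_def vanishes_outside_def not_le[symmetric])
  show "test_function \<Omega> (\<lambda>z. \<eta> (z - x))"
    using smooth_translate[of \<eta> "- x"] assms(1,3,4) z by (intro test_functionI[of _ D]) (auto simp: mollifier_def)
qed

lemma frechet_derivative_translate:
  assumes "smooth \<eta>"
  shows "frechet_derivative (\<lambda>z. \<eta> (z - x)) (at z) = frechet_derivative \<eta> (at (z - x))"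
proof -
  have "((\<lambda>z. \<eta> (z - x)) has_derivative frechet_derivative \<eta> (at (z - x))) (at z)"
    by (rule has_derivative_compose[of "\<lambda>z. z - x" "\<lambda>x. x" z UNIV \<eta>, OF _ smooth_derivative(1)[OF assms]])
      (auto intro!: derivative_eq_intros)
  then show ?thesis by (rule frechet_derivative_at[symmetric])
qed

text \<open>Fundamental lemma of the calculus of variations. At points of \<open>C\<close> a
  mollification of \<open>f\<close> is the pairing with a test function, hence 0, while the
  mollifications converge to \<open>f\<close> in L1 on \<open>C\<close>.\<close>

lemma locally_integrable_eq_0:
  fixes f :: "real^3 \<Rightarrow> 'b::euclidean_space"
  assumes \<Omega>: "open \<Omega>" and f: "locally_integrable_on f \<Omega>"
    and zero: "\<And>\<phi>. test_function \<Omega> \<phi> \<Longrightarrow> (\<integral>x. \<phi> x *\<^sub>R f x \<partial>lebesgue_on \<Omega>) = 0"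
  shows "AE x in lebesgue_on \<Omega>. f x = 0"
proof (rule locally_integrable_AE_on_compact[OF \<Omega>])
  fix C assume C: "compact C" "C \<subseteq> \<Omega>"
  obtain r D where D: "0 < r" "compact D" "D \<subseteq> \<Omega>" "C \<subseteq> D" "\<And>x y. x \<in> C \<Longrightarrow> norm (y - x) \<le> r \<Longrightarrow> y \<in> D"
    by (rule compact_neighbourhood[OF C(1) \<Omega> C(2)]) blast
  have Ds: "D \<in> sets lebesgue" "\<Omega> \<in> sets lebesgue" using D(2) \<Omega> by (auto simp: compact_sets_lebesgue open_sets_lebesgue)
  obtain h where h: "borel_extension D f h"
    using borel_extension_exists[OF locally_integrableD[OF f D(2,3)] Ds(1)] by blast
  obtain \<eta> :: "nat \<Rightarrow> real^3 \<Rightarrow> real" where \<eta>: "\<And>n. mollifier (r / Suc n) (\<eta> n)"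
    using mollifier_sequence[OF D(1)] by blast
  have \<eta>r: "mollifier r (\<eta> n)" for n
    by (rule mollifier_mono[OF \<eta>[of n]]) (use D(1) in \<open>simp add: field_simps\<close>)
  have "conv (\<eta> n) h x = 0" if "x \<in> C" for n x
    using conv_borel_extension[OF h Ds(1) D(3) Ds(2), of "\<eta> n" x] mollifier_test_function[OF \<eta>r that D(2,3,5)]
      zero \<eta>r[of n] by (auto simp: mollifier_def intro: smooth_continuous_on)
  then have "(\<integral>x. norm (conv (\<eta> n) h x - f x) \<partial>lebesgue_on C) = (\<integral>x. norm (f x) \<partial>lebesgue_on C)" for n
    by (intro Bochner_Integration.integral_cong) auto
  then have "(\<integral>x. norm (f x) \<partial>lebesgue_on C) = 0"
    using borel_extension_mollified(2)[OF h \<eta> D(1) C(1) D(4)] by (simp add: LIMSEQ_const_iff)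
  then show "AE x in lebesgue_on C. f x = 0"
    using integral_nonneg_eq_0_iff_AE[OF integrable_norm[OF locally_integrableD[OF f C]]] by simp
qed

text \<open>Local smooth approximation of a function together with its weak derivative. The last two
  properties, convergence almost everywhere and preservation of sup bounds, are what the chain rule
  needs in addition.\<close>

lemma weak_partial_approx:
  fixes f g :: "real^3 \<Rightarrow> 'b::euclidean_space"
  assumes \<Omega>: "open \<Omega>" and w: "has_weak_partial \<Omega> i f g" and C: "compact C" "C \<subseteq> \<Omega>"
  obtains F :: "nat \<Rightarrow> real^3 \<Rightarrow> 'b" where "\<And>n. smooth (F n)"
    "\<And>n. integrable (lebesgue_on C) (\<lambda>x. F n x - f x)"
    "(\<lambda>n. \<integral>x. norm (F n x - f x) \<partial>lebesgue_on C) \<longlonglongrightarrow> 0"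
    "\<And>n. integrable (lebesgue_on C) (\<lambda>x. frechet_derivative (F n) (at x) (axis i 1) - g x)"
    "(\<lambda>n. \<integral>x. norm (frechet_derivative (F n) (at x) (axis i 1) - g x) \<partial>lebesgue_on C) \<longlonglongrightarrow> 0"
    "AE x in lebesgue_on C. (\<lambda>n. F n x) \<longlonglongrightarrow> f x"
    "\<And>n x B. 0 \<le> B \<Longrightarrow> (\<And>x. x \<in> \<Omega> \<Longrightarrow> norm (f x) \<le> B) \<Longrightarrow> norm (F n x) \<le> B"
proof -
  let ?M = "lebesgue_on \<Omega>"
  obtain r D where D: "0 < r" "compact D" "D \<subseteq> \<Omega>" "C \<subseteq> D" "\<And>x y. x \<in> C \<Longrightarrow> norm (y - x) \<le> r \<Longrightarrow> y \<in> D"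
    by (rule compact_neighbourhood[OF C(1) \<Omega> C(2)]) blast
  have Ds: "D \<in> sets lebesgue" "\<Omega> \<in> sets lebesgue" using D(2) \<Omega> by (auto simp: compact_sets_lebesgue open_sets_lebesgue)
  have loc: "locally_integrable_on f \<Omega>" "locally_integrable_on g \<Omega>"
    and ibp: "\<And>\<phi>. test_function \<Omega> \<phi> \<Longrightarrow>
        (\<integral>x. frechet_derivative \<phi> (at x) (axis i 1) *\<^sub>R f x \<partial>?M) =
        - (\<integral>x. \<phi> x *\<^sub>R g x \<partial>?M)"
    using w by (auto simp: has_weak_partial_def)
  obtain h where h: "borel_extension D f h"
    using borel_extension_exists[OF locally_integrableD[OF loc(1) D(2,3)] Ds(1)] by blast
  obtain k where k: "borel_extension D g k"
    using borel_extension_exists[OF locally_integrableD[OF loc(2) D(2,3)] Ds(1)] by blast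
  obtain \<eta> :: "nat \<Rightarrow> real^3 \<Rightarrow> real" where \<eta>: "\<And>n. mollifier (r / Suc n) (\<eta> n)"
    using mollifier_sequence[OF D(1)] by blast
  have \<eta>r: "mollifier r (\<eta> n)" for n
    by (rule mollifier_mono[OF \<eta>[of n]]) (use D(1) in \<open>simp add: field_simps\<close>)
  have sm: "smooth (\<eta> n)" "vanishes_outside r (\<eta> n)" for n using \<eta>r[of n] by (auto simp: mollifier_def)
  have hi: "integrable lborel h" using h by (simp add: borel_extension_def)
  define F where "F n = conv (\<eta> n) h" for n
  have smF: "smooth (F n)" for n
    unfolding F_def by (rule conv_smooth[OF sm hi])
  \<comment> \<open>Mollification commutes with the weak derivative: the minus sign from
    differentiating the kernel and the one in the weak identity cancel.\<close>
  have DF: "frechet_derivative (F n) (at x) (axis i 1) = conv (\<eta> n) k x" if x: "x \<in> C" for n x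
  proof -
    note tf = mollifier_test_function[OF \<eta>r[of n] x D(2,3,5)]
    have out: "frechet_derivative (\<eta> n) (at (z - x)) v = 0" if "z \<notin> D" for z v
    proof -
      have "((\<lambda>x. 0) has_derivative frechet_derivative (\<lambda>z. \<eta> n (z - x)) (at z)) (at z)"
        by (rule has_derivative_transform_within_open[where s="- D", OF smooth_derivative(1)])
          (use tf that D(2) in \<open>auto simp: compact_imp_closed open_Compl test_function_def smooth_def\<close>)
      then have "frechet_derivative (\<lambda>z. \<eta> n (z - x)) (at z) = (\<lambda>v. 0)"
        by (rule has_derivative_unique) simp
      then show ?thesis by (simp add: frechet_derivative_translate[OF sm(1)])
    qed
    have "frechet_derivative (F n) (at x) = (\<lambda>v. conv (\<lambda>y. - frechet_derivative (\<eta> n) (at y) v) h x)"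
      unfolding F_def by (rule frechet_derivative_at[OF conv_has_derivative[OF sm hi], symmetric])
    then have "frechet_derivative (F n) (at x) (axis i 1) =
        conv (\<lambda>y. - frechet_derivative (\<eta> n) (at y) (axis i 1)) h x"
      by simp
    also have "\<dots> = (\<integral>z. - frechet_derivative (\<eta> n) (at (z - x)) (axis i 1) *\<^sub>R f z \<partial>?M)"
      by (rule conv_borel_extension[OF h Ds(1) D(3) Ds(2)])
        (use out in \<open>auto intro!: smooth_continuous_on smooth_derivative(2)[OF sm(1)] smooth_minus\<close>)
    also have "\<dots> = (\<integral>z. \<eta> n (z - x) *\<^sub>R g z \<partial>?M)"
      using ibp[OF tf(1)] by (simp add: frechet_derivative_translate[OF sm(1)])
    also have "\<dots> = conv (\<eta> n) k x"
      by (rule conv_borel_extension[OF k Ds(1) D(3) Ds(2), symmetric])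
        (use tf(2) in \<open>auto intro!: smooth_continuous_on sm\<close>)
    finally show ?thesis .
  qed
  note Fh = borel_extension_mollified[OF h \<eta> D(1) C(1) D(4), folded F_def]
  note Fk = borel_extension_mollified[OF k \<eta> D(1) C(1) D(4)]
  have Dint: "integrable (lebesgue_on C) (\<lambda>x. frechet_derivative (F n) (at x) (axis i 1) - g x)" for n
    by (rule Bochner_Integration.integrable_cong[THEN iffD2, OF refl _ Fk(1)[of n]]) (simp add: DF)
  have Deq: "(\<integral>x. norm (frechet_derivative (F n) (at x) (axis i 1) - g x) \<partial>lebesgue_on C) =
      (\<integral>x. norm (conv (\<eta> n) k x - g x) \<partial>lebesgue_on C)" for n
    by (intro Bochner_Integration.integral_cong) (auto simp: DF)
  have bound: "norm (F n x) \<le> B" if "0 \<le> B" "\<And>x. x \<in> \<Omega> \<Longrightarrow> norm (f x) \<le> B" for n x B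
  proof -
    have "AE x in lebesgue. norm (h x) \<le> B"
      using h that D(3) unfolding borel_extension_def
      by (auto elim!: eventually_mono simp: indicator_def)
    then have "AE x in lborel. norm (h x) \<le> B"
      using borel_measurable_integrable[OF hi] by (subst (asm) AE_completion_iff) auto
    then show ?thesis
      unfolding F_def by (rule conv_norm_le[OF \<eta>r hi])
  qed
  \<comment> \<open>L1 convergence gives convergence almost everywhere along a subsequence only; the
    L1 limits are inherited by it.\<close>
  obtain q :: "nat \<Rightarrow> nat" where q: "strict_mono q" "AE x in lebesgue_on C. (\<lambda>n. F (q n) x - f x) \<longlonglongrightarrow> 0"
    using tendsto_L1_AE_subseq[OF Fh(1) Fh(2)] by blast
  show ?thesis
  proof (rule that[of "\<lambda>n. F (q n)"])
    show "(\<lambda>n. \<integral>x. norm (F (q n) x - f x) \<partial>lebesgue_on C) \<longlonglongrightarrow> 0"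
      using LIMSEQ_subseq_LIMSEQ[OF Fh(2) q(1)] by (simp add: comp_def)
    show "(\<lambda>n. \<integral>x. norm (frechet_derivative (F (q n)) (at x) (axis i 1) - g x) \<partial>lebesgue_on C) \<longlonglongrightarrow> 0"
      using LIMSEQ_subseq_LIMSEQ[OF Fk(2) q(1)] by (simp add: comp_def Deq)
    show "AE x in lebesgue_on C. (\<lambda>n. F (q n) x) \<longlonglongrightarrow> f x"
      using q(2) by (auto elim!: eventually_mono simp: LIM_zero_iff)
  qed (use smF Fh(1) Dint bound in auto)
qed

section \<open>Weak partial derivatives\<close>

text \<open>Holds because Lebesgue measure is complete.\<close>

lemma lebesgue_on_measurable_AE:
  fixes f g :: "'a::euclidean_space \<Rightarrow> 'b::euclidean_space"
  assumes "S \<in> sets lebesgue" "AE x in lebesgue_on S. f x = g x" "f \<in> borel_measurable (lebesgue_on S)"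
  shows "g \<in> borel_measurable (lebesgue_on S)"
proof -
  have AE': "AE x in lebesgue. indicator S x *\<^sub>R f x = indicator S x *\<^sub>R g x"
    using assms(1,2) by (auto simp: AE_restrict_space_iff indicator_def elim!: eventually_mono)
  show ?thesis
    using borel_measurable_AE[OF _ AE'] assms(1,3) by (simp add: borel_measurable_restrict_space_iff)
qed

lemma lebesgue_on_integral_cong_AE:
  fixes f g :: "'a::euclidean_space \<Rightarrow> 'b::euclidean_space"
  assumes S: "S \<in> sets lebesgue" and AE: "AE x in lebesgue_on S. f x = g x"
  shows "integral\<^sup>L (lebesgue_on S) f = integral\<^sup>L (lebesgue_on S) g"
    and "integrable (lebesgue_on S) f \<longleftrightarrow> integrable (lebesgue_on S) g"
proof -
  have AE': "AE x in lebesgue_on S. g x = f x" using AE by eventually_elim simp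
  show int: "integrable (lebesgue_on S) f \<longleftrightarrow> integrable (lebesgue_on S) g"
    using integrable_cong_AE_imp[OF _ _ AE] integrable_cong_AE_imp[OF _ _ AE']
      lebesgue_on_measurable_AE[OF S AE] lebesgue_on_measurable_AE[OF S AE']
    by (meson borel_measurable_integrable)
  show "integral\<^sup>L (lebesgue_on S) f = integral\<^sup>L (lebesgue_on S) g"
  proof (cases "integrable (lebesgue_on S) f")
    case True
    then show ?thesis
      using int by (intro integral_cong_AE AE) (auto intro: borel_measurable_integrable)
  next
    case False
    then show ?thesis using int by (simp add: not_integrable_integral_eq)
  qed
qed

lemma continuous_measurable_lebesgue_on:
  fixes a :: "'a::euclidean_space \<Rightarrow> 'b::euclidean_space"
  assumes "continuous_on UNIV a"
  shows "a \<in> borel_measurable (lebesgue_on S)"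
  using measurable_completion[of a lborel borel] borel_measurable_continuous_onI[OF assms]
  by (intro measurable_restrict_space1) simp

lemma integrable_bounded_mult:
  fixes f :: "'a \<Rightarrow> 'b::euclidean_space" and a :: "'a \<Rightarrow> real"
  assumes f: "integrable M f" and a: "a \<in> borel_measurable M" "AE x in M. \<bar>a x\<bar> \<le> B"
  shows "integrable M (\<lambda>x. a x *\<^sub>R f x)"
proof (rule Bochner_Integration.integrable_bound)
  show "integrable M (\<lambda>x. B * norm (f x))" using f by auto
  show "AE x in M. norm (a x *\<^sub>R f x) \<le> norm (B * norm (f x))"
    using a(2) by eventually_elim (auto simp: abs_mult intro!: mult_right_mono)
qed (use a f in \<open>auto intro: borel_measurable_integrable\<close>)

lemma test_function_integrable:
  fixes f :: "real^3 \<Rightarrow> 'b::euclidean_space"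
  assumes \<phi>: "test_function \<Omega> \<phi>" and f: "locally_integrable_on f \<Omega>" and \<Omega>: "open \<Omega>"
  shows "integrable (lebesgue_on \<Omega>) (\<lambda>x. \<phi> x *\<^sub>R f x)"
    and "integrable (lebesgue_on \<Omega>) (\<lambda>x. frechet_derivative \<phi> (at x) v *\<^sub>R f x)"
proof -
  obtain C where C: "smooth \<phi>" "compact C" "C \<subseteq> \<Omega>" "\<And>x. x \<notin> C \<Longrightarrow> \<phi> x = 0"
    "\<And>x v. x \<notin> C \<Longrightarrow> frechet_derivative \<phi> (at x) v = 0"
    by (rule test_functionD[OF \<phi>]) blast
  obtain M where M: "0 < M" "\<And>x. \<bar>\<phi> x\<bar> \<le> M" "\<And>x. \<bar>frechet_derivative \<phi> (at x) v\<bar> \<le> M"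
    by (rule test_function_bounded[OF \<phi>]) blast
  note s = compact_sets_lebesgue[OF C(2)] open_sets_lebesgue[OF \<Omega>]
  note fC = locally_integrableD[OF f C(2,3)]
  show "integrable (lebesgue_on \<Omega>) (\<lambda>x. \<phi> x *\<^sub>R f x)"
    using M(2) C(4)
    by (subst lebesgue_on_integral_subset(2)[OF s C(3)])
      (auto intro!: integrable_bounded_mult[OF fC] continuous_measurable_lebesgue_on smooth_continuous_on C(1))
  show "integrable (lebesgue_on \<Omega>) (\<lambda>x. frechet_derivative \<phi> (at x) v *\<^sub>R f x)"
    using M(3) C(5)
    by (subst lebesgue_on_integral_subset(2)[OF s C(3)])
      (auto intro!: integrable_bounded_mult[OF fC] continuous_measurable_lebesgue_on smooth_continuous_on
        smooth_derivative(2) C(1))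
qed

lemma locally_integrable_cong_AE:
  fixes f g :: "real^3 \<Rightarrow> 'b::euclidean_space"
  assumes "open \<Omega>" "AE x in lebesgue_on \<Omega>. f x = g x" "locally_integrable_on f \<Omega>"
  shows "locally_integrable_on g \<Omega>"
  unfolding locally_integrable_on_def
proof safe
  fix C assume C: "compact C" "C \<subseteq> \<Omega>"
  note s = compact_sets_lebesgue[OF C(1)] open_sets_lebesgue[OF assms(1)]
  show "integrable (lebesgue_on C) g"
    using lebesgue_on_integral_cong_AE(2)[OF s(1) AE_lebesgue_on_subset[OF assms(2) C(2) s]]
      locally_integrableD[OF assms(3) C] by simp
qed

lemma has_weak_partial_cong_AE:
  fixes f g :: "real^3 \<Rightarrow> 'b::euclidean_space"
  assumes \<Omega>: "open \<Omega>" and w: "has_weak_partial \<Omega> i f g"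
    and f': "AE x in lebesgue_on \<Omega>. f x = f' x" and g': "AE x in lebesgue_on \<Omega>. g x = g' x"
  shows "has_weak_partial \<Omega> i f' g'"
proof -
  let ?M = "lebesgue_on \<Omega>"
  have "(\<integral>x. a x *\<^sub>R f x \<partial>?M) = (\<integral>x. a x *\<^sub>R f' x \<partial>?M)" for a
    by (rule lebesgue_on_integral_cong_AE(1)[OF open_sets_lebesgue[OF \<Omega>]]) (use f' in \<open>auto elim!: eventually_mono\<close>)
  moreover have "(\<integral>x. a x *\<^sub>R g x \<partial>?M) = (\<integral>x. a x *\<^sub>R g' x \<partial>?M)" for a
    by (rule lebesgue_on_integral_cong_AE(1)[OF open_sets_lebesgue[OF \<Omega>]]) (use g' in \<open>auto elim!: eventually_mono\<close>)
  ultimately show ?thesis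
    using w locally_integrable_cong_AE[OF \<Omega> f'] locally_integrable_cong_AE[OF \<Omega> g']
    by (simp add: has_weak_partial_def)
qed

section \<open>Linear operations, uniqueness and limits\<close>

lemma locally_integrable_linear:
  fixes f :: "real^3 \<Rightarrow> 'b::euclidean_space" and L :: "'b \<Rightarrow> 'c::euclidean_space"
  assumes "bounded_linear L" "locally_integrable_on f \<Omega>"
  shows "locally_integrable_on (\<lambda>x. L (f x)) \<Omega>"
  using assms by (auto simp: locally_integrable_on_def intro: integrable_bounded_linear)

lemma locally_integrable_add:
  "locally_integrable_on f \<Omega> \<Longrightarrow> locally_integrable_on g \<Omega> \<Longrightarrow> locally_integrable_on (\<lambda>x. f x + g x) \<Omega>"
  by (auto simp: locally_integrable_on_def)

lemma locally_integrable_bound: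
  fixes f :: "real^3 \<Rightarrow> 'b::euclidean_space" and g :: "real^3 \<Rightarrow> 'c::euclidean_space"
  assumes "open \<Omega>" "locally_integrable_on f \<Omega>" "g \<in> borel_measurable (lebesgue_on \<Omega>)"
    "\<And>x. x \<in> \<Omega> \<Longrightarrow> norm (g x) \<le> norm (f x)"
  shows "locally_integrable_on g \<Omega>"
  unfolding locally_integrable_on_def
proof safe
  fix C assume C: "compact C" "C \<subseteq> \<Omega>"
  have "g \<in> borel_measurable (lebesgue_on C)"
    by (rule measurable_restrict_mono[OF assms(3) C(2)])
  then show "integrable (lebesgue_on C) g"
    using C(2) assms(4) by (intro Bochner_Integration.integrable_bound[OF locally_integrableD[OF assms(2) C]] AE_I2) auto
qed

lemma locally_integrable_continuous:
  fixes f :: "real^3 \<Rightarrow> 'b::euclidean_space"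
  assumes "continuous_on \<Omega> f"
  shows "locally_integrable_on f \<Omega>"
  unfolding locally_integrable_on_def
proof safe
  fix C assume C: "compact C" "C \<subseteq> \<Omega>"
  have int: "integrable lborel (\<lambda>x. indicator C x *\<^sub>R f x)"
    by (rule borel_integrable_compact[OF C(1) continuous_on_subset[OF assms C(2)]])
  then show "integrable (lebesgue_on C) f"
    using C(1) integrable_completion[OF borel_measurable_integrable[OF int]]
    by (simp add: integrable_restrict_space compact_sets_lebesgue)
qed

lemma has_weak_partialD:
  assumes "has_weak_partial \<Omega> i f g"
  shows "locally_integrable_on f \<Omega>" "locally_integrable_on g \<Omega>"
    "\<And>\<phi>. test_function \<Omega> \<phi> \<Longrightarrow> (\<integral>x. frechet_derivative \<phi> (at x) (axis i 1) *\<^sub>R f x \<partial>lebesgue_on \<Omega>) =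
        - (\<integral>x. \<phi> x *\<^sub>R g x \<partial>lebesgue_on \<Omega>)"
  using assms by (auto simp: has_weak_partial_def)

lemma has_weak_partial_linear:
  fixes f g :: "real^3 \<Rightarrow> 'b::euclidean_space" and L :: "'b \<Rightarrow> 'c::euclidean_space"
  assumes \<Omega>: "open \<Omega>" and w: "has_weak_partial \<Omega> i f g" and L: "bounded_linear L"
  shows "has_weak_partial \<Omega> i (\<lambda>x. L (f x)) (\<lambda>x. L (g x))"
  unfolding has_weak_partial_def
proof (intro conjI allI impI locally_integrable_linear[OF L] has_weak_partialD[OF w])
  let ?M = "lebesgue_on \<Omega>"
  fix \<phi> assume \<phi>: "test_function \<Omega> \<phi>"
  interpret L: bounded_linear L by fact
  note int = test_function_integrable[OF \<phi> has_weak_partialD(1)[OF w] \<Omega>]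
    test_function_integrable[OF \<phi> has_weak_partialD(2)[OF w] \<Omega>]
  have "(\<integral>x. frechet_derivative \<phi> (at x) (axis i 1) *\<^sub>R L (f x) \<partial>?M) =
      L (\<integral>x. frechet_derivative \<phi> (at x) (axis i 1) *\<^sub>R f x \<partial>?M)"
    using int by (subst integral_bounded_linear[OF L, symmetric]) (auto simp: L.scaleR)
  also have "\<dots> = - L (\<integral>x. \<phi> x *\<^sub>R g x \<partial>?M)"
    using has_weak_partialD(3)[OF w \<phi>] by (simp add: L.neg)
  also have "L (\<integral>x. \<phi> x *\<^sub>R g x \<partial>?M) = (\<integral>x. \<phi> x *\<^sub>R L (g x) \<partial>?M)"
    using int by (subst integral_bounded_linear[OF L, symmetric]) (auto simp: L.scaleR)
  finally show "(\<integral>x. frechet_derivative \<phi> (at x) (axis i 1) *\<^sub>R L (f x) \<partial>?M) =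
      - (\<integral>x. \<phi> x *\<^sub>R L (g x) \<partial>?M)" .
qed

lemma has_weak_partial_add:
  fixes f g :: "real^3 \<Rightarrow> 'b::euclidean_space"
  assumes \<Omega>: "open \<Omega>" and w: "has_weak_partial \<Omega> i f f'" "has_weak_partial \<Omega> i g g'"
  shows "has_weak_partial \<Omega> i (\<lambda>x. f x + g x) (\<lambda>x. f' x + g' x)"
  unfolding has_weak_partial_def
proof (intro conjI allI impI locally_integrable_add has_weak_partialD[OF w(1)] has_weak_partialD[OF w(2)])
  fix \<phi> assume \<phi>: "test_function \<Omega> \<phi>"
  note int = test_function_integrable[OF \<phi> has_weak_partialD(1)[OF w(1)] \<Omega>]
    test_function_integrable[OF \<phi> has_weak_partialD(2)[OF w(1)] \<Omega>]
    test_function_integrable[OF \<phi> has_weak_partialD(1)[OF w(2)] \<Omega>]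
    test_function_integrable[OF \<phi> has_weak_partialD(2)[OF w(2)] \<Omega>]
  show "(\<integral>x. frechet_derivative \<phi> (at x) (axis i 1) *\<^sub>R (f x + g x) \<partial>lebesgue_on \<Omega>) =
      - (\<integral>x. \<phi> x *\<^sub>R (f' x + g' x) \<partial>lebesgue_on \<Omega>)"
    using int has_weak_partialD(3)[OF w(1) \<phi>] has_weak_partialD(3)[OF w(2) \<phi>]
    by (simp add: scaleR_add_right)
qed

lemma has_weak_partial_diff:
  fixes f g :: "real^3 \<Rightarrow> 'b::euclidean_space"
  assumes \<Omega>: "open \<Omega>" and w: "has_weak_partial \<Omega> i f f'" "has_weak_partial \<Omega> i g g'"
  shows "has_weak_partial \<Omega> i (\<lambda>x. f x - g x) (\<lambda>x. f' x - g' x)"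
  using has_weak_partial_add[OF \<Omega> w(1) has_weak_partial_linear[OF \<Omega> w(2) bounded_linear_minus[OF bounded_linear_ident]]]
  by simp

lemma has_weak_partial_zero: "has_weak_partial \<Omega> i (\<lambda>x. 0) (\<lambda>x. 0)"
  by (simp add: has_weak_partial_def locally_integrable_on_def)

lemma has_weak_partial_sum:
  fixes f :: "'i \<Rightarrow> real^3 \<Rightarrow> 'b::euclidean_space"
  assumes \<Omega>: "open \<Omega>" and "\<And>k. k \<in> I \<Longrightarrow> has_weak_partial \<Omega> i (f k) (f' k)"
  shows "has_weak_partial \<Omega> i (\<lambda>x. \<Sum>k\<in>I. f k x) (\<lambda>x. \<Sum>k\<in>I. f' k x)"
  using assms(2)
  by (induction I rule: infinite_finite_induct) (auto intro: has_weak_partial_zero has_weak_partial_add[OF \<Omega>])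

lemma has_weak_partial_componentwise:
  fixes f g :: "real^3 \<Rightarrow> 'b::euclidean_space"
  assumes \<Omega>: "open \<Omega>" and "\<And>b. b \<in> Basis \<Longrightarrow> has_weak_partial \<Omega> i (\<lambda>x. f x \<bullet> b) (\<lambda>x. g x \<bullet> b)"
  shows "has_weak_partial \<Omega> i f g"
proof -
  have "has_weak_partial \<Omega> i (\<lambda>x. \<Sum>b\<in>Basis. (f x \<bullet> b) *\<^sub>R b) (\<lambda>x. \<Sum>b\<in>Basis. (g x \<bullet> b) *\<^sub>R b)"
    by (intro has_weak_partial_sum[OF \<Omega>] has_weak_partial_linear[OF \<Omega> assms(2)] bounded_linear_scaleR_left)
  then show ?thesis by (simp add: euclidean_representation)
qed

lemma has_weak_partial_unique:
  fixes f :: "real^3 \<Rightarrow> 'b::euclidean_space"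
  assumes \<Omega>: "open \<Omega>" and w: "has_weak_partial \<Omega> i f g" "has_weak_partial \<Omega> i f h"
  shows "AE x in lebesgue_on \<Omega>. g x = h x"
proof -
  have d: "has_weak_partial \<Omega> i (\<lambda>x. f x - f x) (\<lambda>x. g x - h x)"
    by (rule has_weak_partial_diff[OF \<Omega> w])
  have "AE x in lebesgue_on \<Omega>. g x - h x = 0"
    by (rule locally_integrable_eq_0[OF \<Omega> has_weak_partialD(2)[OF d]])
      (use has_weak_partialD(3)[OF d] in simp)
  then show ?thesis by simp
qed

lemma weak_partial_eq:
  fixes f :: "real^3 \<Rightarrow> 'b::euclidean_space"
  assumes \<Omega>: "open \<Omega>" and w: "has_weak_partial \<Omega> i f g"
  shows "has_weak_partial \<Omega> i f (weak_partial \<Omega> i f)"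
    and "AE x in lebesgue_on \<Omega>. weak_partial \<Omega> i f x = g x"
proof -
  show "has_weak_partial \<Omega> i f (weak_partial \<Omega> i f)"
    unfolding weak_partial_def by (rule someI[of "has_weak_partial \<Omega> i f", OF w])
  then show "AE x in lebesgue_on \<Omega>. weak_partial \<Omega> i f x = g x"
    by (rule has_weak_partial_unique[OF \<Omega> _ w])
qed

text \<open>The product with a test function has bounded support, so its directional derivative
  integrates to 0 over the whole space; that integrand vanishes outside the domain.\<close>

lemma classical_weak_partial:
  fixes f :: "real^3 \<Rightarrow> real"
  assumes \<Omega>: "open \<Omega>" and f: "\<And>x. (f has_derivative f' x) (at x)"
    and cont: "continuous_on UNIV (\<lambda>x. f' x (axis i 1))"
  shows "has_weak_partial \<Omega> i f (\<lambda>x. f' x (axis i 1))"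
proof -
  let ?M = "lebesgue_on \<Omega>"
  have contf: "continuous_on UNIV f"
    using f by (auto intro!: continuous_at_imp_continuous_on intro: has_derivative_continuous)
  have loc: "locally_integrable_on f \<Omega>" "locally_integrable_on (\<lambda>x. f' x (axis i 1)) \<Omega>"
    by (intro locally_integrable_continuous continuous_on_subset[OF contf] continuous_on_subset[OF cont]; simp)+
  show ?thesis
    unfolding has_weak_partial_def
  proof (intro conjI allI impI loc)
    fix \<phi> assume \<phi>: "test_function \<Omega> \<phi>"
    obtain C where C: "smooth \<phi>" "compact C" "C \<subseteq> \<Omega>" "\<And>x. x \<notin> C \<Longrightarrow> \<phi> x = 0"
      "\<And>x v. x \<notin> C \<Longrightarrow> frechet_derivative \<phi> (at x) v = 0"
      by (rule test_functionD[OF \<phi>]) blast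
    obtain R where R: "C \<subseteq> cball 0 R"
      using compact_imp_bounded[OF C(2)] by (auto simp: bounded_iff subset_iff)
    let ?e = "axis i 1 :: real^3"
    let ?g = "\<lambda>x. \<phi> x * f' x ?e + frechet_derivative \<phi> (at x) ?e * f x"
    have D: "((\<lambda>x. \<phi> x * f x) has_derivative (\<lambda>v. \<phi> x * f' x v + frechet_derivative \<phi> (at x) v * f x)) (at x)" for x
      by (rule has_derivative_mult[OF smooth_derivative(1)[OF C(1)] f])
    have cg: "continuous_on UNIV ?g"
      by (intro continuous_intros cont contf smooth_continuous_on[OF smooth_derivative(2)[OF C(1)]]
          smooth_continuous_on[OF C(1)])
    have "integral\<^sup>L lborel ?g = 0"
      by (rule integral_derivative_vanishes_outside[OF D cg, of R])
        (use R C(4) in \<open>force simp: vanishes_outside_def\<close>)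
    then have "integral\<^sup>L (lebesgue_on UNIV) ?g = 0"
      using borel_measurable_continuous_onI[OF cg] by (simp add: lebesgue_on_UNIV_eq integral_completion)
    moreover have "?g x = 0" if "x \<notin> \<Omega>" for x
    proof -
      have "x \<notin> C" using that C(3) by auto
      then show ?thesis using C(4,5) by simp
    qed
    then have "integral\<^sup>L (lebesgue_on UNIV) ?g = integral\<^sup>L ?M ?g"
      using \<Omega> by (intro lebesgue_on_integral_subset(1)) (auto simp: open_sets_lebesgue)
    ultimately have "integral\<^sup>L ?M ?g = 0" by simp
    then show "(\<integral>x. frechet_derivative \<phi> (at x) ?e *\<^sub>R f x \<partial>?M) = - (\<integral>x. \<phi> x *\<^sub>R f' x ?e \<partial>?M)"
      using test_function_integrable[OF \<phi> loc(1) \<Omega>] test_function_integrable[OF \<phi> loc(2) \<Omega>] by simp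
  qed
qed

lemma has_weak_partial_const:
  fixes c :: "'b::euclidean_space"
  assumes "open \<Omega>"
  shows "has_weak_partial \<Omega> i (\<lambda>x. c) (\<lambda>x. 0)"
proof -
  have "has_weak_partial \<Omega> i (\<lambda>x. 1::real) (\<lambda>x. (\<lambda>v. 0) (axis i 1))"
    by (rule classical_weak_partial[OF assms]) auto
  from has_weak_partial_linear[OF assms this bounded_linear_scaleR_left[of c]] show ?thesis by simp
qed

text \<open>Limit passage in the defining identity. It carries the two truncation arguments below:
  the product rule, and the vanishing of a weak derivative on the zero set of its function.\<close>

lemma has_weak_partial_dominated:
  fixes f :: "nat \<Rightarrow> real^3 \<Rightarrow> 'b::euclidean_space"
  assumes \<Omega>: "open \<Omega>" and w: "\<And>n. has_weak_partial \<Omega> i (f n) (f' n)"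
    and lim: "\<And>x. x \<in> \<Omega> \<Longrightarrow> (\<lambda>n. f n x) \<longlonglongrightarrow> g x" "\<And>x. x \<in> \<Omega> \<Longrightarrow> (\<lambda>n. f' n x) \<longlonglongrightarrow> g' x"
    and dom: "locally_integrable_on k \<Omega>" "locally_integrable_on k' \<Omega>"
      "\<And>n x. x \<in> \<Omega> \<Longrightarrow> norm (f n x) \<le> k x" "\<And>n x. x \<in> \<Omega> \<Longrightarrow> norm (f' n x) \<le> k' x"
  shows "has_weak_partial \<Omega> i g g'"
proof -
  let ?M = "lebesgue_on \<Omega>"
  have m: "h \<in> borel_measurable ?M" "locally_integrable_on h \<Omega>"
    if h: "\<And>n. locally_integrable_on (q n) \<Omega>" "\<And>x. x \<in> \<Omega> \<Longrightarrow> (\<lambda>n. q n x) \<longlonglongrightarrow> h x"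
      "locally_integrable_on k \<Omega>" "\<And>n x. x \<in> \<Omega> \<Longrightarrow> norm (q n x) \<le> k x" for h k and q :: "nat \<Rightarrow> real^3 \<Rightarrow> 'b"
  proof -
    show m: "h \<in> borel_measurable ?M"
      by (rule borel_measurable_LIMSEQ_metric[OF locally_integrable_measurable[OF \<Omega> h(1)]]) (use h(2) in simp)
    have "norm (h x) \<le> k x" if "x \<in> \<Omega>" for x
      using h(2)[OF that] h(4)[OF that]
      by (intro LIMSEQ_le_const2[OF tendsto_norm]) auto
    then show "locally_integrable_on h \<Omega>"
      using abs_ge_self by (intro locally_integrable_bound[OF \<Omega> h(3) m]) (auto intro: order_trans)
  qed
  note g = m[OF has_weak_partialD(1)[OF w] lim(1) dom(1,3)]
  note g' = m[OF has_weak_partialD(2)[OF w] lim(2) dom(2,4)]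
  show ?thesis
    unfolding has_weak_partial_def
  proof (intro conjI allI impI g(2) g'(2))
    fix \<phi> assume \<phi>: "test_function \<Omega> \<phi>"
    let ?d = "\<lambda>x. frechet_derivative \<phi> (at x) (axis i 1)"
    note sm = test_functionD[OF \<phi>]
    have meas: "\<phi> \<in> borel_measurable ?M" "?d \<in> borel_measurable ?M"
      using sm by (metis continuous_measurable_lebesgue_on smooth_continuous_on smooth_derivative(2))+
    have l1: "(\<lambda>n. \<integral>x. ?d x *\<^sub>R f n x \<partial>?M) \<longlonglongrightarrow> (\<integral>x. ?d x *\<^sub>R g x \<partial>?M)"
    proof (rule integral_dominated_convergence)
      show "integrable ?M (\<lambda>x. norm (?d x *\<^sub>R k x))"
        by (rule integrable_norm[OF test_function_integrable(2)[OF \<phi> dom(1) \<Omega>]])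
      show "AE x in ?M. norm (?d x *\<^sub>R f n x) \<le> norm (?d x *\<^sub>R k x)" for n
        using dom(3)[of _ n] by (intro AE_I2) (auto simp: abs_mult intro!: mult_left_mono intro: order_trans[OF _ abs_ge_self])
    qed (use lim(1) meas(2) g(1) borel_measurable_integrable[OF test_function_integrable(2)[OF \<phi> has_weak_partialD(1)[OF w] \<Omega>]]
        in \<open>auto intro!: AE_I2 tendsto_intros\<close>)
    have l2: "(\<lambda>n. \<integral>x. \<phi> x *\<^sub>R f' n x \<partial>?M) \<longlonglongrightarrow> (\<integral>x. \<phi> x *\<^sub>R g' x \<partial>?M)"
    proof (rule integral_dominated_convergence)
      show "integrable ?M (\<lambda>x. norm (\<phi> x *\<^sub>R k' x))"
        by (rule integrable_norm[OF test_function_integrable(1)[OF \<phi> dom(2) \<Omega>]])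
      show "AE x in ?M. norm (\<phi> x *\<^sub>R f' n x) \<le> norm (\<phi> x *\<^sub>R k' x)" for n
        using dom(4)[of _ n] by (intro AE_I2) (auto simp: abs_mult intro!: mult_left_mono intro: order_trans[OF _ abs_ge_self])
    qed (use lim(2) meas(1) g'(1) borel_measurable_integrable[OF test_function_integrable(1)[OF \<phi> has_weak_partialD(2)[OF w] \<Omega>]]
        in \<open>auto intro!: AE_I2 tendsto_intros\<close>)
    show "(\<integral>x. ?d x *\<^sub>R g x \<partial>?M) = - (\<integral>x. \<phi> x *\<^sub>R g' x \<partial>?M)"
      using LIMSEQ_unique[OF l1] tendsto_minus[OF l2] has_weak_partialD(3)[OF w \<phi>] by simp
  qed
qed

section \<open>Chain rule and product rule\<close>

lemma lipschitz_from_derivative: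
  fixes G :: "'b::euclidean_space \<Rightarrow> real"
  assumes "convex S" "\<And>y. y \<in> S \<Longrightarrow> (G has_derivative G' y) (at y)" "0 \<le> L"
    "\<And>y v. y \<in> S \<Longrightarrow> \<bar>G' y v\<bar> \<le> L * norm v" "y \<in> S" "z \<in> S"
  shows "\<bar>G y - G z\<bar> \<le> L * norm (y - z)"
proof -
  have "norm (G y - G z) \<le> L * norm (y - z)"
  proof (rule differentiable_bound[OF assms(1) _ _ assms(5,6)])
    show "(G has_derivative G' x) (at x within S)" if "x \<in> S" for x
      by (rule has_derivative_at_withinI[OF assms(2)[OF that]])
    show "onorm (G' x) \<le> L" if "x \<in> S" for x
      by (rule onorm_bound) (use assms(3,4) that in auto)
  qed
  then show ?thesis by simp
qed

lemma measurable_continuous_compose: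
  fixes f :: "'a \<Rightarrow> 'b::euclidean_space" and h :: "'b \<Rightarrow> 'c::euclidean_space"
  assumes "closed S" "continuous_on S h" "f \<in> borel_measurable M" "\<And>x. x \<in> space M \<Longrightarrow> f x \<in> S"
  shows "(\<lambda>x. h (f x)) \<in> borel_measurable M"
proof -
  have "(\<lambda>y. indicator S y *\<^sub>R h y) \<in> borel_measurable borel"
    using assms(1,2) by (intro borel_measurable_continuous_on_indicator) auto
  then have "(\<lambda>x. indicator S (f x) *\<^sub>R h (f x)) \<in> borel_measurable M"
    by (rule measurable_compose[OF assms(3)])
  then show ?thesis
    using assms(4) by (subst measurable_cong[where g="\<lambda>x. indicator S (f x) *\<^sub>R h (f x)"]) auto
qed

lemma has_weak_partial_chain:
  fixes f g :: "real^3 \<Rightarrow> 'b::euclidean_space" and G :: "'b \<Rightarrow> real"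
  assumes \<Omega>: "open \<Omega>" and w: "has_weak_partial \<Omega> i f g"
    and S: "S = UNIV \<or> S = cball 0 B \<and> 0 \<le> B" "\<And>x. x \<in> \<Omega> \<Longrightarrow> f x \<in> S"
    and G: "\<And>y. y \<in> S \<Longrightarrow> (G has_derivative G' y) (at y)" "\<And>v. continuous_on S (\<lambda>y. G' y v)"
    and L: "0 \<le> L" "\<And>y v. y \<in> S \<Longrightarrow> \<bar>G' y v\<bar> \<le> L * norm v"
  shows "has_weak_partial \<Omega> i (\<lambda>x. G (f x)) (\<lambda>x. G' (f x) (g x))"
proof -
  have convS: "convex S" and closedS: "closed S" using S(1) by auto
  have lip: "\<bar>G y - G z\<bar> \<le> L * norm (y - z)" if "y \<in> S" "z \<in> S" for y z
    by (rule lipschitz_from_derivative[OF convS G(1) L that])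
  have lin: "linear (G' y)" if "y \<in> S" for y
    using G(1)[OF that] has_derivative_linear by blast
  have contG: "continuous_on S G"
    using G(1) by (auto intro!: continuous_at_imp_continuous_on intro: has_derivative_continuous)
  have rep: "G' y v = (\<Sum>b\<in>Basis. (v \<bullet> b) * G' y b)" if "y \<in> S" for y v
    using linear_sum[OF lin[OF that], of "\<lambda>b. (v \<bullet> b) *\<^sub>R b" Basis] linear_scale[OF lin[OF that]]
    by (simp add: euclidean_representation)
  note locf = has_weak_partialD(1)[OF w] and locg = has_weak_partialD(2)[OF w]
  note mf = locally_integrable_measurable[OF \<Omega> locf] and mg = locally_integrable_measurable[OF \<Omega> locg]
  have mGf: "(\<lambda>x. G (f x)) \<in> borel_measurable (lebesgue_on \<Omega>)"
    by (rule measurable_continuous_compose[OF closedS contG mf]) (use S(2) in simp)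
  have mG'b: "(\<lambda>x. G' (f x) b) \<in> borel_measurable (lebesgue_on \<Omega>)" for b
    by (rule measurable_continuous_compose[OF closedS G(2) mf]) (use S(2) in simp)
  have mG': "(\<lambda>x. G' (f x) (g x)) \<in> borel_measurable (lebesgue_on \<Omega>)"
  proof -
    have "(\<lambda>x. \<Sum>b\<in>Basis. (g x \<bullet> b) * G' (f x) b) \<in> borel_measurable (lebesgue_on \<Omega>)"
      using mG'b mg by measurable
    then show ?thesis
      using S(2) rep by (subst measurable_cong[where g="\<lambda>x. \<Sum>b\<in>Basis. (g x \<bullet> b) * G' (f x) b"]) auto
  qed
  have "0 \<in> S" using S(1) by auto
  have loc1: "locally_integrable_on (\<lambda>x. G (f x)) \<Omega>"
  proof (rule locally_integrable_bound[OF \<Omega> _ mGf])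
    show "locally_integrable_on (\<lambda>x. \<bar>G 0\<bar> + L * norm (f x)) \<Omega>"
      using locf by (auto simp: locally_integrable_on_def integrable_restrict_space[symmetric]
          intro!: Bochner_Integration.integrable_add locally_integrableD[OF locally_integrable_continuous[OF continuous_on_const]])
    show "norm (G (f x)) \<le> norm (\<bar>G 0\<bar> + L * norm (f x))" if "x \<in> \<Omega>" for x
      using lip[OF S(2)[OF that] \<open>0 \<in> S\<close>] L(1) by auto
  qed
  have loc2: "locally_integrable_on (\<lambda>x. G' (f x) (g x)) \<Omega>"
  proof (rule locally_integrable_bound[OF \<Omega> _ mG'])
    show "locally_integrable_on (\<lambda>x. L *\<^sub>R g x) \<Omega>"
      by (rule locally_integrable_linear[OF bounded_linear_scaleR_right locg])
    show "norm (G' (f x) (g x)) \<le> norm (L *\<^sub>R g x)" if "x \<in> \<Omega>" for x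
      using L(2)[OF S(2)[OF that], of "g x"] L(1) by simp
  qed
  show ?thesis
    unfolding has_weak_partial_def
  proof (intro conjI allI impI loc1 loc2)
    fix \<phi> assume \<phi>: "test_function \<Omega> \<phi>"
    obtain C where C: "smooth \<phi>" "compact C" "C \<subseteq> \<Omega>" "\<And>x. x \<notin> C \<Longrightarrow> \<phi> x = 0"
      "\<And>x v. x \<notin> C \<Longrightarrow> frechet_derivative \<phi> (at x) v = 0"
      by (rule test_functionD[OF \<phi>]) blast
    define e where "e = (axis i 1 :: real^3)"
    define d where "d x = frechet_derivative \<phi> (at x) e" for x
    obtain M where M: "0 < M" "\<And>x. \<bar>\<phi> x\<bar> \<le> M" "\<And>x. \<bar>d x\<bar> \<le> M"
      unfolding d_def by (rule test_function_bounded[OF \<phi>]) blast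
    obtain F :: "nat \<Rightarrow> real^3 \<Rightarrow> 'b" where F: "\<And>n. smooth (F n)"
      "\<And>n. integrable (lebesgue_on C) (\<lambda>x. F n x - f x)"
      "(\<lambda>n. \<integral>x. norm (F n x - f x) \<partial>lebesgue_on C) \<longlonglongrightarrow> 0"
      "\<And>n. integrable (lebesgue_on C) (\<lambda>x. frechet_derivative (F n) (at x) e - g x)"
      "(\<lambda>n. \<integral>x. norm (frechet_derivative (F n) (at x) e - g x) \<partial>lebesgue_on C) \<longlonglongrightarrow> 0"
      "AE x in lebesgue_on C. (\<lambda>n. F n x) \<longlonglongrightarrow> f x"
      "\<And>n x B. 0 \<le> B \<Longrightarrow> (\<And>x. x \<in> \<Omega> \<Longrightarrow> norm (f x) \<le> B) \<Longrightarrow> norm (F n x) \<le> B"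
      unfolding e_def by (rule weak_partial_approx[OF \<Omega> w C(2,3)]) blast
    \<comment> \<open>For a ball this is the sup bound of the mollified functions.\<close>
    have FS: "F n x \<in> S" for n x
      using S F(7)[of B n x] by (auto simp: subset_iff)
    let ?M = "lebesgue_on C"
    let ?D = "\<lambda>n x. frechet_derivative (F n) (at x) e"
    let ?I = "\<lambda>n v. \<integral>x. \<phi> x * G' (F n x) (v x) \<partial>?M"
    note s = compact_sets_lebesgue[OF C(2)] open_sets_lebesgue[OF \<Omega>]
    have toC: "(\<integral>x. a x * h x \<partial>lebesgue_on \<Omega>) = (\<integral>x. a x * h x \<partial>?M)"
      if "a = d \<or> a = \<phi>" for a and h :: "real^3 \<Rightarrow> real"
      using that C(4,5) by (intro lebesgue_on_integral_subset(1)[OF s C(3)]) (auto simp: d_def)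
    have DGF: "((\<lambda>x. G (F n x)) has_derivative (\<lambda>v. G' (F n x) (frechet_derivative (F n) (at x) v))) (at x)" for n x
      by (rule has_derivative_compose[OF smooth_derivative(1)[OF F(1)] G(1)[OF FS]])
    have contF: "continuous_on UNIV (F n)" for n by (rule smooth_continuous_on[OF F(1)])
    have contG'F: "continuous_on UNIV (\<lambda>x. G' (F n x) b)" for n b
      by (rule continuous_on_compose2[OF G(2) contF]) (use FS in auto)
    have contGF: "continuous_on UNIV (\<lambda>x. G' (F n x) (?D n x))" for n
    proof -
      have eq: "(\<lambda>x. G' (F n x) (?D n x)) = (\<lambda>x. \<Sum>b\<in>Basis. (?D n x \<bullet> b) * G' (F n x) b)"
        by (rule ext) (rule rep[OF FS])
      show ?thesis
        unfolding eq by (intro continuous_intros contG'F smooth_continuous_on[OF smooth_derivative(2)[OF F(1)]])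
    qed
    have wF: "has_weak_partial \<Omega> i (\<lambda>x. G (F n x)) (\<lambda>x. G' (F n x) (?D n x))" for n
      unfolding e_def by (rule classical_weak_partial[OF \<Omega> DGF contGF[unfolded e_def]])
    have ibp: "(\<integral>x. d x * G (F n x) \<partial>?M) = - ?I n (?D n)" for n
      using has_weak_partialD(3)[OF wF \<phi>, of n] toC[of d "\<lambda>x. G (F n x)"] toC[of \<phi> "\<lambda>x. G' (F n x) (?D n x)"]
      by (simp add: d_def e_def)
    have md: "d \<in> borel_measurable ?M" "\<phi> \<in> borel_measurable ?M"
      unfolding d_def
      by (intro continuous_measurable_lebesgue_on smooth_continuous_on smooth_derivative(2) C(1))+
    note iGf = locally_integrableD[OF loc1 C(2,3)] and iG' = locally_integrableD[OF loc2 C(2,3)]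
      and ig = locally_integrableD[OF locg C(2,3)]
    have mGF: "(\<lambda>x. G (F n x)) \<in> borel_measurable ?M" for n
      by (intro continuous_measurable_lebesgue_on continuous_on_compose2[OF contG contF]) (use FS in auto)
    have mG'F: "(\<lambda>x. G' (F n x) b) \<in> borel_measurable ?M" for n b
      by (intro continuous_measurable_lebesgue_on contG'F)
    have mD: "(\<lambda>x. ?D n x) \<in> borel_measurable ?M" for n
      by (intro continuous_measurable_lebesgue_on smooth_continuous_on smooth_derivative(2) F(1))
    have mG'v: "(\<lambda>x. G' (F n x) (v x)) \<in> borel_measurable ?M" if "v \<in> borel_measurable ?M" for n v
    proof -
      have eq: "(\<lambda>x. G' (F n x) (v x)) = (\<lambda>x. \<Sum>b\<in>Basis. (v x \<bullet> b) * G' (F n x) b)"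
        by (rule ext) (rule rep[OF FS])
      show ?thesis
        unfolding eq using mG'F that by measurable
    qed
    have l1: "(\<lambda>n. \<integral>x. d x * G (F n x) \<partial>?M) \<longlonglongrightarrow> (\<integral>x. d x * G (f x) \<partial>?M)"
    proof (rule LIM_zero_cancel, rule tendsto_rabs_zero_cancel, rule tendsto_sandwich[OF _ _ tendsto_const])
      show "(\<lambda>n. M * L * (\<integral>x. norm (F n x - f x) \<partial>?M)) \<longlonglongrightarrow> 0"
        by (intro tendsto_mult_right_zero F(3))
      have "\<bar>(\<integral>x. d x * G (F n x) \<partial>?M) - (\<integral>x. d x * G (f x) \<partial>?M)\<bar> \<le> M * L * (\<integral>x. norm (F n x - f x) \<partial>?M)" for n
      proof -
        have bd: "\<bar>G (F n x) - G (f x)\<bar> \<le> L * norm (F n x - f x)" if "x \<in> C" for x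
          using lip[OF FS S(2)] that C(3) by auto
        have iL: "integrable ?M (\<lambda>x. L * norm (F n x - f x))" using F(2) by auto
        have i0: "integrable ?M (\<lambda>x. G (F n x) - G (f x))"
          using bd L(1) mGF borel_measurable_integrable[OF iGf]
          by (intro Bochner_Integration.integrable_bound[OF iL] AE_I2) auto
        have i1: "integrable ?M (\<lambda>x. G (F n x))"
          using Bochner_Integration.integrable_add[OF i0 iGf] by simp
        have i2: "integrable ?M (\<lambda>x. d x * G (F n x))" "integrable ?M (\<lambda>x. d x * G (f x))"
          using integrable_bounded_mult[OF i1 md(1)] integrable_bounded_mult[OF iGf md(1)] M(3) by auto
        have "(\<integral>x. d x * G (F n x) \<partial>?M) - (\<integral>x. d x * G (f x) \<partial>?M) = (\<integral>x. d x * (G (F n x) - G (f x)) \<partial>?M)"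
          using i2 by (simp add: right_diff_distrib)
        also have "\<bar>\<dots>\<bar> \<le> (\<integral>x. M * (L * norm (F n x - f x)) \<partial>?M)"
        proof (rule integral_abs_bound_integral)
          show "integrable ?M (\<lambda>x. d x * (G (F n x) - G (f x)))"
            using i2 by (simp add: right_diff_distrib)
          show "\<bar>d x * (G (F n x) - G (f x))\<bar> \<le> M * (L * norm (F n x - f x))" if "x \<in> space ?M" for x
            using that M(1,3) bd[of x] by (auto simp: abs_mult intro!: mult_mono)
        qed (use iL in auto)
        finally show ?thesis by (simp add: mult.assoc)
      qed
      then show "\<forall>\<^sub>F n in sequentially. \<bar>(\<integral>x. d x * G (F n x) \<partial>?M) - (\<integral>x. d x * G (f x) \<partial>?M)\<bar>
          \<le> M * L * (\<integral>x. norm (F n x - f x) \<partial>?M)" by simp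
    qed simp
    have ab: "integrable ?M (\<lambda>x. \<phi> x * G' (F n x) (v x))" "\<bar>\<phi> x * G' (F n x) (v x)\<bar> \<le> M * L * norm (v x)"
      if v: "integrable ?M v" for v n x
    proof -
      show b: "\<bar>\<phi> x * G' (F n x) (v x)\<bar> \<le> M * L * norm (v x)" for x
        unfolding abs_mult mult.assoc using M(1,2) L(1) L(2)[OF FS] by (intro mult_mono) auto
      have "integrable ?M (\<lambda>x. M * L * norm (v x))" using v by auto
      then show "integrable ?M (\<lambda>x. \<phi> x * G' (F n x) (v x))"
      proof (rule Bochner_Integration.integrable_bound)
        show "(\<lambda>x. \<phi> x * G' (F n x) (v x)) \<in> borel_measurable ?M"
          using mG'v[OF borel_measurable_integrable[OF v]] md(2) by (rule borel_measurable_times[rotated])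
        show "AE x in ?M. norm (\<phi> x * G' (F n x) (v x)) \<le> norm (M * L * norm (v x))"
          unfolding real_norm_def by (intro AE_I2 order_trans[OF b abs_ge_self])
      qed
    qed
    \<comment> \<open>The derivative is split as \<open>g\<close> plus an error. Here the direction
      \<open>g\<close> is fixed and only the base point moves: convergence almost everywhere and
      continuity of \<open>G'\<close> suffice, with \<open>norm (g x)\<close> dominating.\<close>
    have l2: "(\<lambda>n. ?I n g) \<longlonglongrightarrow> (\<integral>x. \<phi> x * G' (f x) (g x) \<partial>?M)"
    proof (rule integral_dominated_convergence)
      show "integrable ?M (\<lambda>x. M * L * norm (g x))" using ig by auto
      show "AE x in ?M. norm (\<phi> x * G' (F n x) (g x)) \<le> M * L * norm (g x)" for n
        using ab(2)[OF ig] by auto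
      show "AE x in ?M. (\<lambda>n. \<phi> x * G' (F n x) (g x)) \<longlonglongrightarrow> \<phi> x * G' (f x) (g x)"
        using F(6) AE_space
      proof eventually_elim
        fix x assume x: "(\<lambda>n. F n x) \<longlonglongrightarrow> f x" "x \<in> space ?M"
        have "f x \<in> S" using x(2) C(3) S(2) by auto
        then show "(\<lambda>n. \<phi> x * G' (F n x) (g x)) \<longlonglongrightarrow> \<phi> x * G' (f x) (g x)"
          using FS by (intro tendsto_mult tendsto_const continuous_on_tendsto_compose[OF G(2) x(1)]) auto
      qed
    qed (use ab(1)[OF ig] borel_measurable_integrable[OF iG'] md(2) in \<open>auto intro: borel_measurable_integrable\<close>)
    \<comment> \<open>Here the direction is the error of the derivative: it tends to 0 in L1 and
      \<open>G'\<close> is bounded by \<open>L\<close>.\<close>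
    have l3: "(\<lambda>n. ?I n (\<lambda>x. ?D n x - g x)) \<longlonglongrightarrow> 0"
    proof (rule tendsto_rabs_zero_cancel, rule tendsto_sandwich[OF _ _ tendsto_const])
      show "(\<lambda>n. M * L * (\<integral>x. norm (?D n x - g x) \<partial>?M)) \<longlonglongrightarrow> 0"
        by (intro tendsto_mult_right_zero F(5))
      have "\<bar>?I n (\<lambda>x. ?D n x - g x)\<bar> \<le> (\<integral>x. M * L * norm (?D n x - g x) \<partial>?M)" for n
        using ab[OF F(4)] F(4) by (intro integral_abs_bound_integral) auto
      then show "\<forall>\<^sub>F n in sequentially. \<bar>?I n (\<lambda>x. ?D n x - g x)\<bar>
          \<le> M * L * (\<integral>x. norm (?D n x - g x) \<partial>?M)" by simp
    qed simp
    have split: "?I n (?D n) =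
        ?I n (\<lambda>x. ?D n x - g x) + ?I n g" for n
    proof -
      have "\<phi> x * G' (F n x) (?D n x) = \<phi> x * G' (F n x) (?D n x - g x) + \<phi> x * G' (F n x) (g x)" for x
      proof -
        have "G' (F n x) (?D n x - g x) = G' (F n x) (?D n x) - G' (F n x) (g x)"
          by (rule linear_diff[OF lin[OF FS]])
        then show ?thesis by (simp only:) (simp add: right_diff_distrib)
      qed
      then have "?I n (?D n) =
          (\<integral>x. \<phi> x * G' (F n x) (?D n x - g x) + \<phi> x * G' (F n x) (g x) \<partial>?M)"
        by (intro Bochner_Integration.integral_cong refl)
      also have "\<dots> = ?I n (\<lambda>x. ?D n x - g x) + ?I n g"
        by (rule Bochner_Integration.integral_add[OF ab(1)[OF F(4)] ab(1)[OF ig]])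
      finally show ?thesis .
    qed
    have "(\<lambda>n. \<integral>x. d x * G (F n x) \<partial>?M) \<longlonglongrightarrow> - (0 + (\<integral>x. \<phi> x * G' (f x) (g x) \<partial>?M))"
      unfolding ibp split by (intro tendsto_minus tendsto_add l2 l3)
    then have "(\<integral>x. d x * G (f x) \<partial>?M) = - (\<integral>x. \<phi> x * G' (f x) (g x) \<partial>?M)"
      using LIMSEQ_unique[OF l1] by simp
    then show "(\<integral>x. frechet_derivative \<phi> (at x) (axis i 1) *\<^sub>R G (f x) \<partial>lebesgue_on \<Omega>) =
        - (\<integral>x. \<phi> x *\<^sub>R G' (f x) (g x) \<partial>lebesgue_on \<Omega>)"
      using toC[of d "\<lambda>x. G (f x)"] toC[of \<phi> "\<lambda>x. G' (f x) (g x)"] by (simp add: d_def e_def)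
  qed
qed

lemma locally_integrable_norm:
  "locally_integrable_on f \<Omega> \<Longrightarrow> locally_integrable_on (\<lambda>x. norm (f x)) \<Omega>"
  by (auto simp: locally_integrable_on_def)

text \<open>Recentred at \<open>c\<close>, because \<open>has_weak_partial_chain\<close> works with
  balls around 0; the Lipschitz constant comes from compactness of the ball, one bound per basis
  direction.\<close>

lemma has_weak_partial_chain_bounded:
  fixes f g :: "real^3 \<Rightarrow> 'b::euclidean_space" and G :: "'b \<Rightarrow> 'c::euclidean_space"
  assumes \<Omega>: "open \<Omega>" and w: "has_weak_partial \<Omega> i f g"
    and B: "0 \<le> B" "\<And>x. x \<in> \<Omega> \<Longrightarrow> norm (f x - c) \<le> B"
    and G: "\<And>y. norm (y - c) \<le> B \<Longrightarrow> (G has_derivative G' y) (at y)" "\<And>v. continuous_on (cball c B) (\<lambda>y. G' y v)"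
  shows "has_weak_partial \<Omega> i (\<lambda>x. G (f x)) (\<lambda>x. G' (f x) (g x))"
proof (rule has_weak_partial_componentwise[OF \<Omega>])
  fix b :: 'c assume b: "b \<in> Basis"
  let ?S = "cball 0 B :: 'b set"
  have D: "((\<lambda>y. G (y + c) \<bullet> b) has_derivative (\<lambda>v. G' (y + c) v \<bullet> b)) (at y)" if "y \<in> ?S" for y
  proof -
    have "((\<lambda>y. G (y + c)) has_derivative G' (y + c)) (at y)"
      by (rule has_derivative_compose[of "\<lambda>y. y + c" "\<lambda>v. v" y UNIV G, OF _ G(1)])
        (use that in \<open>auto intro!: derivative_eq_intros\<close>)
    then show ?thesis by (rule has_derivative_inner_left)
  qed
  have cont: "continuous_on ?S (\<lambda>y. G' (y + c) v \<bullet> b)" for v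
    by (intro continuous_intros continuous_on_compose2[OF G(2)[of v], of _ "\<lambda>y. y + c"])
      (auto simp: dist_norm norm_minus_commute)
  have "\<exists>K. \<forall>y\<in>?S. \<bar>G' (y + c) a \<bullet> b\<bar> \<le> K" for a
    using compact_imp_bounded[OF compact_continuous_image[OF cont compact_cball]]
    by (auto simp: bounded_real)
  then obtain K where K: "\<And>a y. y \<in> ?S \<Longrightarrow> \<bar>G' (y + c) a \<bullet> b\<bar> \<le> K a"
    by metis
  have "0 \<in> ?S" using B(1) by simp
  then have K0: "0 \<le> K a" for a using K[of 0 a] by linarith
  define L where "L = (\<Sum>a\<in>Basis. K a)"
  have "has_weak_partial \<Omega> i (\<lambda>x. (\<lambda>y. G (y + c) \<bullet> b) (f x - c)) (\<lambda>x. (\<lambda>y v. G' (y + c) v \<bullet> b) (f x - c) (g x))"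
  proof (rule has_weak_partial_chain[OF \<Omega>, where S="?S" and B=B and L=L and f="\<lambda>x. f x - c" and g=g and
        G="\<lambda>y. G (y + c) \<bullet> b" and G'="\<lambda>y v. G' (y + c) v \<bullet> b"])
    show "has_weak_partial \<Omega> i (\<lambda>x. f x - c) g"
      using has_weak_partial_diff[OF \<Omega> w has_weak_partial_const[OF \<Omega>, of i c]] by simp
    show "0 \<le> L" using K0 by (simp add: L_def sum_nonneg)
    show "\<bar>G' (y + c) v \<bullet> b\<bar> \<le> L * norm v" if y: "y \<in> ?S" for y v
    proof -
      have lin: "linear (\<lambda>v. G' (y + c) v \<bullet> b)"
        using has_derivative_linear[OF D[OF y]] .
      have "G' (y + c) v \<bullet> b = (\<Sum>a\<in>Basis. (v \<bullet> a) * (G' (y + c) a \<bullet> b))"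
        using linear_sum[OF lin, of "\<lambda>a. (v \<bullet> a) *\<^sub>R a" Basis] linear_scale[OF lin]
        by (simp add: euclidean_representation)
      also have "\<bar>\<dots>\<bar> \<le> (\<Sum>a\<in>Basis. norm v * K a)"
        using K[OF y] Basis_le_norm by (intro order_trans[OF sum_abs sum_mono]) (auto simp: abs_mult intro!: mult_mono)
      finally show ?thesis by (simp add: L_def sum_distrib_left mult.commute)
    qed
  qed (use B D cont in auto)
  then show "has_weak_partial \<Omega> i (\<lambda>x. G (f x) \<bullet> b) (\<lambda>x. G' (f x) (g x) \<bullet> b)" by simp
qed

text \<open>\<open>N sin (a / N)\<close> is a smooth truncation: bounded by \<open>N\<close> and by
  the modulus of \<open>a\<close>, converging to \<open>a\<close>, with derivative
  \<open>cos (a / N)\<close> of modulus at most 1 converging to 1.\<close>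

lemma sine_truncation_tendsto: "(\<lambda>n. real (Suc n) * sin (a / real (Suc n))) \<longlonglongrightarrow> a"
proof (cases "a = 0")
  case False
  have "((\<lambda>h. (sin (0 + h) - sin 0) / h) \<longlongrightarrow> cos 0) (at (0::real))"
    using DERIV_sin[of "0::real"] by (simp only: DERIV_def)
  moreover have "filterlim (\<lambda>n. a / real (Suc n)) (at 0) sequentially"
    using False tendsto_mult_right_zero[OF LIMSEQ_inverse_real_of_nat, of a]
    by (auto simp: filterlim_at divide_inverse)
  ultimately have "(\<lambda>n. sin (a / real (Suc n)) / (a / real (Suc n))) \<longlonglongrightarrow> 1"
    by (auto dest: filterlim_compose)
  moreover have "a * (sin (a / real (Suc n)) / (a / real (Suc n))) = real (Suc n) * sin (a / real (Suc n))" for n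
    using False by (simp del: of_nat_Suc)
  ultimately show ?thesis
    using tendsto_mult_left[of "\<lambda>n. sin (a / real (Suc n)) / (a / real (Suc n))" 1 sequentially a] by simp
qed simp

lemma cosine_truncation_tendsto: "(\<lambda>n. cos (a / real (Suc n))) \<longlonglongrightarrow> 1"
proof -
  have "(\<lambda>n. a / real (Suc n)) \<longlonglongrightarrow> 0"
    using tendsto_mult_right_zero[OF LIMSEQ_inverse_real_of_nat, of a] by (simp add: divide_inverse)
  then have "(\<lambda>n. cos (a / real (Suc n))) \<longlonglongrightarrow> cos 0"
    by (rule tendsto_cos)
  then show ?thesis by simp
qed

lemma sine_truncation_le: "\<bar>real (Suc n) * sin (a / real (Suc n))\<bar> \<le> \<bar>a\<bar>"
proof -
  have "\<bar>real (Suc n) * sin (a / real (Suc n))\<bar> \<le> real (Suc n) * \<bar>a / real (Suc n)\<bar>"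
    unfolding abs_mult by (intro mult_mono abs_sin_x_le_abs_x) auto
  then show ?thesis by (simp add: abs_divide del: of_nat_Suc)
qed

text \<open>Both factors are truncated by \<open>N sin (\<cdot> / N)\<close>, which makes the product a function of bounded derivative.\<close>

lemma has_weak_partial_mult:
  fixes f g :: "real^3 \<Rightarrow> real"
  assumes \<Omega>: "open \<Omega>" and w: "has_weak_partial \<Omega> i f f'" "has_weak_partial \<Omega> i g g'"
    and loc: "locally_integrable_on (\<lambda>x. f x * g x) \<Omega>" "locally_integrable_on (\<lambda>x. f' x * g x) \<Omega>"
      "locally_integrable_on (\<lambda>x. f x * g' x) \<Omega>"
  shows "has_weak_partial \<Omega> i (\<lambda>x. f x * g x) (\<lambda>x. f x * g' x + f' x * g x)"
proof (rule has_weak_partial_dominated[OF \<Omega>, where k="\<lambda>x. norm (f x * g x)" and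
      k'="\<lambda>x. norm (f x * g' x) + norm (f' x * g x)"])
  define T where "T n a = real (Suc n) * sin (a / real (Suc n))" for n a
  have T: "\<bar>T n a\<bar> \<le> \<bar>a\<bar>" "\<bar>T n a\<bar> \<le> Suc n" "(\<lambda>n. T n a) \<longlonglongrightarrow> a" "continuous_on S (T n)" for n a S
    using sine_truncation_le sine_truncation_tendsto
    by (auto simp: T_def[abs_def] abs_mult mult_left_le simp del: of_nat_Suc intro!: continuous_intros)
  have DT: "(T n has_derivative (\<lambda>v. v * cos (a / real (Suc n)))) (at a)" for n a
    unfolding T_def[abs_def]
    by (auto intro!: derivative_eq_intros simp: field_simps simp del: of_nat_Suc)
  \<comment> \<open>The truncated product is one function of the pair \<open>(f, g)\<close> with
    bounded derivative, so the vector-valued chain rule gives the product rule for it.\<close>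
  define G where "G n p = T n (fst p) * T n (snd p)" for n and p :: "real \<times> real"
  define G' where "G' n p v = T n (fst p) * (snd v * cos (snd p / real (Suc n))) +
      (fst v * cos (fst p / real (Suc n))) * T n (snd p)" for n and p v :: "real \<times> real"
  have DG: "(G n has_derivative G' n p) (at p)" for n p
    unfolding G_def[abs_def] G'_def[abs_def]
    by (intro has_derivative_mult has_derivative_compose[OF has_derivative_fst[OF has_derivative_ident] DT]
        has_derivative_compose[OF has_derivative_snd[OF has_derivative_ident] DT])
  have pair: "has_weak_partial \<Omega> i (\<lambda>x. (f x, g x)) (\<lambda>x. (f' x, g' x))"
  proof -
    have "has_weak_partial \<Omega> i (\<lambda>x. (f x, 0) + (0, g x)) (\<lambda>x. (f' x, 0) + (0, g' x))"
      using has_weak_partial_linear[OF \<Omega> w(1), of "\<lambda>r. (r, 0)"] has_weak_partial_linear[OF \<Omega> w(2), of "\<lambda>r. (0, r)"]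
        bounded_linear_Pair[OF bounded_linear_ident bounded_linear_zero]
        bounded_linear_Pair[OF bounded_linear_zero bounded_linear_ident]
      by (intro has_weak_partial_add[OF \<Omega>]) auto
    then show ?thesis by simp
  qed
  show "has_weak_partial \<Omega> i (\<lambda>x. G n (f x, g x)) (\<lambda>x. G' n (f x, g x) (f' x, g' x))" for n
  proof (rule has_weak_partial_chain[OF \<Omega> pair, where S=UNIV and L="2 * real (Suc n)" and B=0])
    show "continuous_on UNIV (\<lambda>y. G' n y v)" for v
      unfolding G'_def by (intro continuous_intros continuous_on_compose2[OF T(4)[of UNIV]]) auto
    show "\<bar>G' n y v\<bar> \<le> 2 * real (Suc n) * norm v" for y v
    proof -
      have "\<bar>fst v\<bar> \<le> norm v" "\<bar>snd v\<bar> \<le> norm v"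
        using norm_fst_le[of "fst v" "snd v"] norm_snd_le[of "snd v" "fst v"] by auto
      then have "\<bar>snd v * cos (snd y / real (Suc n))\<bar> \<le> norm v * 1" "\<bar>fst v * cos (fst y / real (Suc n))\<bar> \<le> norm v * 1"
        unfolding abs_mult by (intro mult_mono; simp)+
      then have "\<bar>T n (fst y) * (snd v * cos (snd y / real (Suc n)))\<bar> \<le> Suc n * norm v"
        "\<bar>(fst v * cos (fst y / real (Suc n))) * T n (snd y)\<bar> \<le> norm v * Suc n"
        unfolding abs_mult[of "T n (fst y)"] abs_mult[of _ "T n (snd y)"] using T(2) by (intro mult_mono; simp)+
      then have "\<bar>G' n y v\<bar> \<le> Suc n * norm v + norm v * Suc n"
        unfolding G'_def by (rule order_trans[OF abs_triangle_ineq add_mono])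
      then show ?thesis by (simp add: mult.commute del: of_nat_Suc)
    qed
  qed (use DG in auto)
  show "(\<lambda>n. G n (f x, g x)) \<longlonglongrightarrow> f x * g x" for x
    unfolding G_def using T(3) by (auto intro!: tendsto_intros)
  show "(\<lambda>n. G' n (f x, g x) (f' x, g' x)) \<longlonglongrightarrow> f x * g' x + f' x * g x" for x
  proof -
    have "(\<lambda>n. G' n (f x, g x) (f' x, g' x)) \<longlonglongrightarrow> f x * (g' x * 1) + (f' x * 1) * g x"
      unfolding G'_def fst_conv snd_conv by (intro tendsto_intros T(3) cosine_truncation_tendsto)
    then show ?thesis by simp
  qed
  show "norm (G n (f x, g x)) \<le> norm (f x * g x)" for n x
    using T(1) by (auto simp: G_def abs_mult intro!: mult_mono)
  show "norm (G' n (f x, g x) (f' x, g' x)) \<le> norm (f x * g' x) + norm (f' x * g x)" for n x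
  proof -
    have "\<bar>g' x * cos (g x / real (Suc n))\<bar> \<le> \<bar>g' x\<bar>" "\<bar>f' x * cos (f x / real (Suc n))\<bar> \<le> \<bar>f' x\<bar>"
      unfolding abs_mult by (intro mult_left_le; simp)+
    then have "\<bar>T n (f x) * (g' x * cos (g x / real (Suc n)))\<bar> \<le> \<bar>f x\<bar> * \<bar>g' x\<bar>"
      "\<bar>(f' x * cos (f x / real (Suc n))) * T n (g x)\<bar> \<le> \<bar>f' x\<bar> * \<bar>g x\<bar>"
      unfolding abs_mult[of "T n (f x)"] abs_mult[of _ "T n (g x)"] using T(1) by (intro mult_mono; simp)+
    then show ?thesis
      unfolding G'_def by (auto simp: abs_mult intro: order_trans[OF abs_triangle_ineq])
  qed
qed (intro locally_integrable_add locally_integrable_norm loc)+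

text \<open>Expansion over both bases reduces the claim to products of real coordinates, each of
  which is dominated by the product of the norms.\<close>

lemma has_weak_partial_bilinear:
  fixes f :: "real^3 \<Rightarrow> 'b::euclidean_space" and g :: "real^3 \<Rightarrow> 'c::euclidean_space"
    and bb :: "'b \<Rightarrow> 'c \<Rightarrow> 'd::euclidean_space"
  assumes \<Omega>: "open \<Omega>" and bb: "bounded_bilinear bb"
    and w: "has_weak_partial \<Omega> i f f'" "has_weak_partial \<Omega> i g g'"
    and loc: "locally_integrable_on (\<lambda>x. norm (f x) * norm (g x)) \<Omega>"
      "locally_integrable_on (\<lambda>x. norm (f' x) * norm (g x)) \<Omega>"
      "locally_integrable_on (\<lambda>x. norm (f x) * norm (g' x)) \<Omega>"
  shows "has_weak_partial \<Omega> i (\<lambda>x. bb (f x) (g x)) (\<lambda>x. bb (f x) (g' x) + bb (f' x) (g x))"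
proof -
  let ?M = "lebesgue_on \<Omega>"
  interpret bounded_bilinear bb by fact
  have m: "f \<in> borel_measurable ?M" "f' \<in> borel_measurable ?M"
    "g \<in> borel_measurable ?M" "g' \<in> borel_measurable ?M"
    by (intro locally_integrable_measurable[OF \<Omega>] has_weak_partialD[OF w(1)] has_weak_partialD[OF w(2)])+
  have comp: "locally_integrable_on (\<lambda>x. (h x \<bullet> b) * (k x \<bullet> c)) \<Omega>"
    if "locally_integrable_on (\<lambda>x. norm (h x) * norm (k x)) \<Omega>" "b \<in> Basis" "c \<in> Basis"
      "h \<in> borel_measurable ?M" "k \<in> borel_measurable ?M"
    for h :: "real^3 \<Rightarrow> 'b" and k :: "real^3 \<Rightarrow> 'c" and b c
  proof (rule locally_integrable_bound[OF \<Omega> that(1)])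
    show "norm ((h x \<bullet> b) * (k x \<bullet> c)) \<le> norm (norm (h x) * norm (k x))" for x
      using Basis_le_norm[OF that(2), of "h x"] Basis_le_norm[OF that(3), of "k x"]
      by (auto simp: abs_mult intro!: mult_mono)
  qed (use that in measurable)
  have expand: "bb y z = (\<Sum>b\<in>Basis. \<Sum>c\<in>Basis. ((y \<bullet> b) * (z \<bullet> c)) *\<^sub>R bb b c)" for y z
  proof -
    have l: "bb y z = (\<Sum>b\<in>Basis. (y \<bullet> b) *\<^sub>R bb b z)"
      using sum_left[of "\<lambda>b. (y \<bullet> b) *\<^sub>R b" Basis z] by (simp add: scaleR_left euclidean_representation)
    have r: "bb b z = (\<Sum>c\<in>Basis. (z \<bullet> c) *\<^sub>R bb b c)" for b z
      using sum_right[of b "\<lambda>c. (z \<bullet> c) *\<^sub>R c" Basis] by (simp add: scaleR_right euclidean_representation)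
    show ?thesis
      unfolding l by (rule sum.cong[OF refl], subst r) (simp add: scaleR_sum_right)
  qed
  have "has_weak_partial \<Omega> i (\<lambda>x. \<Sum>b\<in>Basis. \<Sum>c\<in>Basis. ((f x \<bullet> b) * (g x \<bullet> c)) *\<^sub>R bb b c)
      (\<lambda>x. \<Sum>b\<in>Basis. \<Sum>c\<in>Basis. ((f x \<bullet> b) * (g' x \<bullet> c) + (f' x \<bullet> b) * (g x \<bullet> c)) *\<^sub>R bb b c)"
    by (intro has_weak_partial_sum[OF \<Omega>] has_weak_partial_linear[OF \<Omega> has_weak_partial_mult[OF \<Omega>]]
        has_weak_partial_linear[OF \<Omega> w(1)] has_weak_partial_linear[OF \<Omega> w(2)] comp loc m
        bounded_linear_scaleR_left bounded_linear_inner_left)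
  moreover have "(\<lambda>x. bb (f x) (g x)) = (\<lambda>x. \<Sum>b\<in>Basis. \<Sum>c\<in>Basis. ((f x \<bullet> b) * (g x \<bullet> c)) *\<^sub>R bb b c)"
    by (rule ext) (rule expand)
  moreover have "(\<lambda>x. bb (f x) (g' x) + bb (f' x) (g x)) =
      (\<lambda>x. \<Sum>b\<in>Basis. \<Sum>c\<in>Basis. ((f x \<bullet> b) * (g' x \<bullet> c) + (f' x \<bullet> b) * (g x \<bullet> c)) *\<^sub>R bb b c)"
    by (rule ext, subst expand[of "f x" "g' x" for x], subst expand[of "f' x" "g x" for x])
      (simp only: scaleR_add_left sum.distrib)
  ultimately show ?thesis by simp
qed

section \<open>Cutoffs and compactly supported functions\<close>

lemma test_function_cutoff:
  fixes C :: "'a::euclidean_space set"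
  assumes "compact C" "open \<Omega>" "C \<subseteq> \<Omega>"
  obtains \<phi> where "test_function \<Omega> \<phi>" "\<And>x. x \<in> C \<Longrightarrow> \<phi> x = 1"
    "\<And>x v. x \<in> C \<Longrightarrow> frechet_derivative \<phi> (at x) v = 0"
proof -
  obtain r1 D1 where D1: "0 < r1" "compact D1" "D1 \<subseteq> \<Omega>" "C \<subseteq> D1" "\<And>x y. x \<in> C \<Longrightarrow> norm (y - x) \<le> r1 \<Longrightarrow> y \<in> D1"
    by (rule compact_neighbourhood[OF assms]) blast
  obtain r2 D2 where D2: "0 < r2" "compact D2" "D2 \<subseteq> \<Omega>" "D1 \<subseteq> D2" "\<And>x y. x \<in> D1 \<Longrightarrow> norm (y - x) \<le> r2 \<Longrightarrow> y \<in> D2"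
    by (rule compact_neighbourhood[OF D1(2) assms(2) D1(3)]) blast
  \<comment> \<open>The indicator of \<open>D1\<close> is mollified. The bound \<open>r1 / 2\<close>
    makes the result equal to 1 on a whole neighbourhood of \<open>C\<close>, so its derivative
    vanishes on \<open>C\<close>; the bound \<open>r2\<close> keeps its support in
    \<open>D2\<close>.\<close>
  define d where "d = min (r1 / 2) r2"
  have d: "0 < d" "d \<le> r1 / 2" "d \<le> r2" using D1(1) D2(1) by (auto simp: d_def)
  obtain \<eta> :: "'a \<Rightarrow> real" where \<eta>: "mollifier d \<eta>"
    using mollifier_exists[OF d(1)] by blast
  have sm: "smooth \<eta>" "vanishes_outside d \<eta>" "integral\<^sup>L lborel \<eta> = 1"
    using \<eta> by (auto simp: mollifier_def)
  have int: "integrable lborel (indicator D1 :: 'a \<Rightarrow> real)"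
    using D1(2) emeasure_compact_finite[OF D1(2)] by (simp add: integrable_indicator_iff borel_compact)
  define \<phi> where "\<phi> = conv \<eta> (indicator D1 :: 'a \<Rightarrow> real)"
  have smphi: "smooth \<phi>" unfolding \<phi>_def by (rule conv_smooth[OF sm(1,2) int])
  have eq: "\<phi> x = (\<integral>z. \<eta> z *\<^sub>R (indicator D1 (x + z) :: real) \<partial>lborel)" for x
    unfolding \<phi>_def by (rule conv_alt(1)[OF smooth_continuous_on[OF sm(1)] sm(2) int])
  have one: "\<phi> x = 1" if "c \<in> C" "norm (x - c) \<le> r1 / 2" for x c
  proof -
    have "\<eta> z *\<^sub>R (indicator D1 (x + z) :: real) = \<eta> z" for z
    proof (cases "norm z \<le> d")
      case True
      have "norm (x + z - c) \<le> norm (x - c) + norm z" by norm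
      then have "x + z \<in> D1" using True that d by (intro D1(5)[OF that(1)]) auto
      then show ?thesis by simp
    qed (use sm(2) in \<open>auto simp: vanishes_outside_def\<close>)
    then have "(\<lambda>z. \<eta> z *\<^sub>R (indicator D1 (x + z) :: real)) = \<eta>" by (rule ext)
    then show ?thesis by (simp only: eq sm(3))
  qed
  have zero: "\<phi> x = 0" if "x \<notin> D2" for x
  proof -
    have "\<eta> z *\<^sub>R (indicator D1 (x + z) :: real) = 0" for z
    proof (cases "norm z \<le> d")
      case True
      then have "x + z \<notin> D1" using D2(5)[of "x + z" x] that d by auto
      then show ?thesis by simp
    qed (use sm(2) in \<open>auto simp: vanishes_outside_def\<close>)
    then have "(\<lambda>z. \<eta> z *\<^sub>R (indicator D1 (x + z) :: real)) = (\<lambda>z. 0)" by (rule ext)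
    then show ?thesis by (simp only: eq integral_zero)
  qed
  show ?thesis
  proof (rule that)
    show "test_function \<Omega> \<phi>" by (rule test_functionI[OF smphi D2(2,3) zero])
    show "\<phi> x = 1" if "x \<in> C" for x using one[OF that, of x] D1(1) by simp
    show "frechet_derivative \<phi> (at x) v = 0" if x: "x \<in> C" for x v
    proof -
      have "((\<lambda>x. 1) has_derivative frechet_derivative \<phi> (at x)) (at x)"
        by (rule has_derivative_transform_within_open[OF smooth_derivative(1)[OF smphi], where s="ball x (r1 / 2)"])
          (use D1(1) one[OF x] in \<open>auto simp: dist_norm norm_minus_commute\<close>)
      then have "frechet_derivative \<phi> (at x) = (\<lambda>v. 0)"
        by (rule has_derivative_unique) simp
      then show ?thesis by simp
    qed
  qed
qed

text \<open>Tested with a cutoff that is 1 on \<open>C\<close>: there its derivative vanishes, and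
  off \<open>C\<close> both functions do.\<close>

lemma integral_weak_partial_compact_support:
  fixes h k :: "real^3 \<Rightarrow> 'b::euclidean_space"
  assumes \<Omega>: "open \<Omega>" and w: "has_weak_partial \<Omega> i h k" and C: "compact C" "C \<subseteq> \<Omega>"
    and out: "\<And>x. x \<in> \<Omega> \<Longrightarrow> x \<notin> C \<Longrightarrow> h x = 0" "\<And>x. x \<in> \<Omega> \<Longrightarrow> x \<notin> C \<Longrightarrow> k x = 0"
  shows "integral\<^sup>L (lebesgue_on \<Omega>) k = 0"
proof -
  let ?M = "lebesgue_on \<Omega>"
  obtain \<phi> where \<phi>: "test_function \<Omega> \<phi>" "\<And>x. x \<in> C \<Longrightarrow> \<phi> x = 1"
    "\<And>x v. x \<in> C \<Longrightarrow> frechet_derivative \<phi> (at x) v = 0"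
    by (rule test_function_cutoff[OF C(1) \<Omega> C(2)]) blast
  have "(\<integral>x. \<phi> x *\<^sub>R k x \<partial>?M) = integral\<^sup>L ?M k"
  proof (rule Bochner_Integration.integral_cong)
    show "\<phi> x *\<^sub>R k x = k x" if "x \<in> space ?M" for x
      using that \<phi>(2)[of x] out(2)[of x] by (cases "x \<in> C") auto
  qed simp
  moreover have "(\<integral>x. frechet_derivative \<phi> (at x) (axis i 1) *\<^sub>R h x \<partial>?M) = 0"
  proof (rule integral_eq_zero_AE[OF AE_I2])
    show "frechet_derivative \<phi> (at x) (axis i 1) *\<^sub>R h x = 0" if "x \<in> space ?M" for x
      using that \<phi>(3)[of x] out(1)[of x] by (cases "x \<in> C") auto
  qed
  ultimately show ?thesis using has_weak_partialD(3)[OF w \<phi>(1)] by simp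
qed

text \<open>The cutoffs along the boundary are composed with a defining function of class C1 and are
  not smooth, so the weak identity is needed for test functions of this class.\<close>

lemma C1_test:
  fixes f g :: "real^3 \<Rightarrow> real"
  assumes \<Omega>: "open \<Omega>" and w: "has_weak_partial \<Omega> i f g"
    and \<rho>: "\<And>x. (\<rho> has_derivative \<rho>' x) (at x)" "continuous_on UNIV (\<lambda>x. \<rho>' x (axis i 1))"
    and C: "compact C" "C \<subseteq> \<Omega>" "\<And>x. x \<notin> C \<Longrightarrow> \<rho> x = 0"
  shows "integrable (lebesgue_on \<Omega>) (\<lambda>x. \<rho> x * g x + \<rho>' x (axis i 1) * f x)"
    and "(\<integral>x. \<rho> x * g x + \<rho>' x (axis i 1) * f x \<partial>lebesgue_on \<Omega>) = 0"
proof -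
  have cont: "continuous_on UNIV \<rho>"
    using \<rho>(1) by (auto intro!: continuous_at_imp_continuous_on intro: has_derivative_continuous)
  have out: "\<rho>' x v = 0" if "x \<notin> C" for x v
  proof -
    have "((\<lambda>x. 0) has_derivative \<rho>' x) (at x)"
      by (rule has_derivative_transform_within_open[OF \<rho>(1), where s="- C"])
        (use that C in \<open>auto simp: compact_imp_closed open_Compl\<close>)
    then have "\<rho>' x = (\<lambda>v. 0)" by (rule has_derivative_unique) simp
    then show ?thesis by simp
  qed
  have mult: "integrable (lebesgue_on K) (\<lambda>x. a x * h x)"
    if "continuous_on UNIV a" "integrable (lebesgue_on K) h" "compact K" for a h :: "real^3 \<Rightarrow> real" and K
  proof -
    have "bounded (a ` K)"
      by (intro compact_imp_bounded compact_continuous_image continuous_on_subset[OF that(1)] that(3)) simp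
    then obtain B where "\<forall>y\<in>K. \<bar>a y\<bar> \<le> B" unfolding bounded_real by blast
    then have "AE x in lebesgue_on K. \<bar>a x\<bar> \<le> B" by (intro AE_I2) auto
    from integrable_bounded_mult[OF that(2) continuous_measurable_lebesgue_on[OF that(1)] this] show ?thesis by simp
  qed
  have loc: "locally_integrable_on (\<lambda>x. a x * h x) \<Omega>"
    if "continuous_on UNIV a" "locally_integrable_on h \<Omega>" for a h :: "real^3 \<Rightarrow> real"
    using mult[OF that(1)] that(2) by (auto simp: locally_integrable_on_def)
  have wp: "has_weak_partial \<Omega> i (\<lambda>x. \<rho> x * f x) (\<lambda>x. \<rho> x * g x + \<rho>' x (axis i 1) * f x)"
    by (intro has_weak_partial_mult[OF \<Omega> classical_weak_partial[OF \<Omega> \<rho>] w] loc cont \<rho>(2) has_weak_partialD[OF w])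
  show "(\<integral>x. \<rho> x * g x + \<rho>' x (axis i 1) * f x \<partial>lebesgue_on \<Omega>) = 0"
    by (rule integral_weak_partial_compact_support[OF \<Omega> wp C(1,2)]) (auto simp: C(3) out)
  show "integrable (lebesgue_on \<Omega>) (\<lambda>x. \<rho> x * g x + \<rho>' x (axis i 1) * f x)"
    using locally_integrableD[OF has_weak_partialD(2)[OF wp] C(1,2)]
    by (subst lebesgue_on_integral_subset(2)[OF compact_sets_lebesgue[OF C(1)] open_sets_lebesgue[OF \<Omega>] C(2)])
      (auto simp: C(3) out)
qed

text \<open>The second-order difference quotient of the test function replaces a classical mixed derivative.\<close>

lemma has_weak_partial_commute:
  fixes f :: "real^3 \<Rightarrow> 'b::euclidean_space"
  assumes \<Omega>: "open \<Omega>" and wi: "has_weak_partial \<Omega> i f fi" and wj: "has_weak_partial \<Omega> j f fj"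
    and wij: "has_weak_partial \<Omega> j fi fij"
  shows "has_weak_partial \<Omega> i fj fij"
  unfolding has_weak_partial_def
proof (intro conjI allI impI has_weak_partialD(2)[OF wj] has_weak_partialD(2)[OF wij])
  let ?M = "lebesgue_on \<Omega>"
  fix \<phi> assume \<phi>: "test_function \<Omega> \<phi>"
  let ?ei = "axis i 1 :: real^3" and ?ej = "axis j 1 :: real^3"
  obtain C where C: "smooth \<phi>" "compact C" "C \<subseteq> \<Omega>" "\<And>x. x \<notin> C \<Longrightarrow> \<phi> x = 0"
    "\<And>x v. x \<notin> C \<Longrightarrow> frechet_derivative \<phi> (at x) v = 0"
    by (rule test_functionD[OF \<phi>]) blast
  obtain r D where D: "0 < r" "compact D" "D \<subseteq> \<Omega>" "C \<subseteq> D" "\<And>x y. x \<in> C \<Longrightarrow> norm (y - x) \<le> r \<Longrightarrow> y \<in> D"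
    by (rule compact_neighbourhood[OF C(2) \<Omega> C(3)]) blast
  note s = compact_sets_lebesgue[OF D(2)] open_sets_lebesgue[OF \<Omega>]
  note lf = has_weak_partialD(1)[OF wi] and lfj = has_weak_partialD(2)[OF wj]
  define dj where "dj x = frechet_derivative \<phi> (at x) ?ej" for x
  have smj: "smooth dj" unfolding dj_def by (rule smooth_derivative(2)[OF C(1)])
  have djC: "dj x = 0" if "x \<notin> C" for x unfolding dj_def by (rule C(5)[OF that])
  have tj: "test_function \<Omega> dj" by (rule test_functionI[OF smj C(2,3) djC])
  have vanC: "\<exists>R. vanishes_outside R h" if "\<And>x. x \<notin> C \<Longrightarrow> h x = 0" for h :: "real^3 \<Rightarrow> real"
  proof -
    obtain R where "C \<subseteq> cball 0 R"
      using compact_imp_bounded[OF C(2)] by (auto simp: bounded_iff subset_iff)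
    then have "vanishes_outside R h" using that unfolding vanishes_outside_def by force
    then show ?thesis by blast
  qed
  obtain R1 R2 where R: "vanishes_outside R1 \<phi>" "vanishes_outside R2 dj"
    using vanC[of \<phi>] vanC[of dj] C(4) djC by blast
  \<comment> \<open>The defect in the identity that results from testing \<open>wj\<close> with the
    derivative of \<open>\<phi>\<close> in direction \<open>i\<close>, except that the two
    derivatives on \<open>\<phi>\<close> appear in the other order. The aim is
    \<open>A = 0\<close>.\<close>
  define A where "A = (\<integral>x. frechet_derivative dj (at x) ?ei *\<^sub>R f x + frechet_derivative \<phi> (at x) ?ei *\<^sub>R fj x \<partial>?M)"
  have iA: "integrable ?M (\<lambda>x. frechet_derivative dj (at x) ?ei *\<^sub>R f x)"
    "integrable ?M (\<lambda>x. frechet_derivative \<phi> (at x) ?ei *\<^sub>R fj x)"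
    by (rule test_function_integrable(2)[OF tj lf \<Omega>], rule test_function_integrable(2)[OF \<phi> lfj \<Omega>])
  note iD = locally_integrableD[OF lf D(2,3)] locally_integrableD[OF lfj D(2,3)]
  define I where "I = (\<integral>x. norm (f x) + norm (fj x) \<partial>lebesgue_on D)"
  have bound: "norm A \<le> e * I" if e: "0 < e" for e
  proof -
    obtain d1 where d1: "0 < d1"
      "\<And>x h. norm h < d1 \<Longrightarrow> \<bar>\<phi> (x + h) - \<phi> x - frechet_derivative \<phi> (at x) h\<bar> \<le> e * norm h"
      by (rule smooth_uniform_derivative[OF C(1) R(1) e]) blast
    obtain d2 where d2: "0 < d2"
      "\<And>x h. norm h < d2 \<Longrightarrow> \<bar>dj (x + h) - dj x - frechet_derivative dj (at x) h\<bar> \<le> e * norm h"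
      by (rule smooth_uniform_derivative[OF smj R(2) e]) blast
    \<comment> \<open>Below \<open>r\<close> the shifted support stays in \<open>D\<close>; below
      \<open>d1\<close> and \<open>d2\<close> each of the two difference quotients is within
      \<open>e\<close> of its derivative.\<close>
    define t where "t = min r (min d1 d2) / 2"
    have t: "0 < t" "t < r" "t < d1" "t < d2" using D(1) d1(1) d2(1) by (auto simp: t_def)
    \<comment> \<open>The difference quotient in direction \<open>i\<close> is a test function whose
      derivative in direction \<open>j\<close> is the difference quotient of \<open>dj\<close>.
      Testing \<open>wj\<close> with \<open>q\<close> turns \<open>A\<close> into an integral of
      quotient errors.\<close>
    define q where "q x = (\<phi> (x + t *\<^sub>R ?ei) - \<phi> x) / t" for x
    have smq: "smooth q"
    proof -
      have "smooth (\<lambda>x. (1 / t) * (\<phi> (x + t *\<^sub>R ?ei) - \<phi> x))"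
        by (intro smooth_mult smooth_const smooth_diff smooth_translate C(1))
      then show ?thesis by (simp add: q_def[abs_def])
    qed
    have shift: "x \<notin> C \<and> x + t *\<^sub>R ?ei \<notin> C" if "x \<notin> D" for x
      using D(4) D(5)[of "x + t *\<^sub>R ?ei" x] that t by auto
    have tq: "test_function \<Omega> q"
      by (rule test_functionI[OF smq D(2,3)]) (use shift C(4) in \<open>auto simp: q_def\<close>)
    have Dq: "frechet_derivative q (at x) ?ej = (dj (x + t *\<^sub>R ?ei) - dj x) / t" for x
    proof -
      have "((\<lambda>x. \<phi> (x + t *\<^sub>R ?ei)) has_derivative frechet_derivative \<phi> (at (x + t *\<^sub>R ?ei))) (at x)"
        by (rule has_derivative_compose[of "\<lambda>x. x + t *\<^sub>R ?ei" "\<lambda>v. v" x UNIV \<phi>, OF _ smooth_derivative(1)[OF C(1)]])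
          (auto intro!: derivative_eq_intros)
      then have "(q has_derivative (\<lambda>v. (frechet_derivative \<phi> (at (x + t *\<^sub>R ?ei)) v - frechet_derivative \<phi> (at x) v) / t)) (at x)"
        unfolding q_def[abs_def] divide_inverse
        by (intro has_derivative_mult_left has_derivative_diff smooth_derivative(1)[OF C(1)])
      from frechet_derivative_at[OF this] show ?thesis by (simp add: dj_def fun_eq_iff)
    qed
    have iq: "integrable ?M (\<lambda>x. frechet_derivative q (at x) ?ej *\<^sub>R f x)"
      "integrable ?M (\<lambda>x. q x *\<^sub>R fj x)"
      by (rule test_function_integrable(2)[OF tq lf \<Omega>], rule test_function_integrable(1)[OF tq lfj \<Omega>])
    let ?u = "\<lambda>x. (frechet_derivative dj (at x) ?ei - frechet_derivative q (at x) ?ej) *\<^sub>R f x +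
        (frechet_derivative \<phi> (at x) ?ei - q x) *\<^sub>R fj x"
    have iu: "integrable ?M ?u"
      using iA iq by (simp add: scaleR_diff_left)
    have "A = (\<integral>x. ?u x \<partial>?M)"
      using iA iq has_weak_partialD(3)[OF wj tq] by (simp add: A_def scaleR_diff_left)
    also have "\<dots> = (\<integral>x. ?u x \<partial>lebesgue_on D)"
    proof (rule lebesgue_on_integral_subset(1)[OF s D(3)])
      fix x assume "x \<notin> D"
      then have x: "x \<notin> C" "x + t *\<^sub>R ?ei \<notin> C" using shift by auto
      moreover have "frechet_derivative dj (at x) ?ei = 0"
      proof -
        have "((\<lambda>x. 0) has_derivative frechet_derivative dj (at x)) (at x)"
          by (rule has_derivative_transform_within_open[OF smooth_derivative(1)[OF smj], where s="- C"])
            (use x C(2) djC in \<open>auto simp: compact_imp_closed open_Compl\<close>)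
        then have "frechet_derivative dj (at x) = (\<lambda>v. 0)" by (rule has_derivative_unique) simp
        then show ?thesis by simp
      qed
      ultimately show "?u x = 0" using C(4,5) djC by (simp add: Dq) (simp add: q_def)
    qed
    also have "norm \<dots> \<le> (\<integral>x. e * (norm (f x) + norm (fj x)) \<partial>lebesgue_on D)"
    proof (rule Bochner_Integration.integral_norm_bound_integral)
      show "integrable (lebesgue_on D) ?u" by (rule integrable_lebesgue_on_subset[OF iu D(3) s])
      show "integrable (lebesgue_on D) (\<lambda>x. e * (norm (f x) + norm (fj x)))" using iD by auto
      fix x
      have lin: "frechet_derivative h (at x) (t *\<^sub>R v) = t * frechet_derivative h (at x) v" if "smooth h" for h :: "real^3 \<Rightarrow> real" and v
        using linear_scale[OF has_derivative_linear[OF smooth_derivative(1)[OF that]], of x t v] by simp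
      have key: "\<bar>frechet_derivative h (at x) v - (h (x + t *\<^sub>R v) - h x) / t\<bar> \<le> e"
        if "smooth h" "\<bar>h (x + t *\<^sub>R v) - h x - frechet_derivative h (at x) (t *\<^sub>R v)\<bar> \<le> e * norm (t *\<^sub>R v)" "norm v = 1"
        for h :: "real^3 \<Rightarrow> real" and v
      proof -
        have "t * (frechet_derivative h (at x) v - (h (x + t *\<^sub>R v) - h x) / t) =
            - (h (x + t *\<^sub>R v) - h x - frechet_derivative h (at x) (t *\<^sub>R v))"
          using t(1) by (simp add: lin[OF that(1)] field_simps)
        then have "\<bar>t\<bar> * \<bar>frechet_derivative h (at x) v - (h (x + t *\<^sub>R v) - h x) / t\<bar> =
            \<bar>h (x + t *\<^sub>R v) - h x - frechet_derivative h (at x) (t *\<^sub>R v)\<bar>"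
          by (simp only: abs_mult[symmetric] abs_minus_cancel)
        then have "t * \<bar>frechet_derivative h (at x) v - (h (x + t *\<^sub>R v) - h x) / t\<bar> =
            \<bar>h (x + t *\<^sub>R v) - h x - frechet_derivative h (at x) (t *\<^sub>R v)\<bar>"
          using t(1) by simp
        also have "\<dots> \<le> t * e" using that(2,3) t(1) by (simp add: mult.commute)
        finally show ?thesis using t(1) by simp
      qed
      have "\<bar>frechet_derivative \<phi> (at x) ?ei - q x\<bar> \<le> e" unfolding q_def
        by (rule key[OF C(1) d1(2)]) (use t in auto)
      moreover have "\<bar>frechet_derivative dj (at x) ?ei - frechet_derivative q (at x) ?ej\<bar> \<le> e" unfolding Dq
        by (rule key[OF smj d2(2)]) (use t in auto)
      ultimately show "norm (?u x) \<le> e * (norm (f x) + norm (fj x))"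
        by (intro order_trans[OF norm_triangle_ineq]) (auto simp: distrib_left intro!: add_mono mult_right_mono)
    qed
    also have "\<dots> = e * I" using iD by (simp add: I_def)
    finally show ?thesis .
  qed
  have "0 \<le> I" by (simp add: I_def)
  have "norm A \<le> 0"
  proof (rule field_le_epsilon)
    fix e :: real assume "0 < e"
    then have "norm A \<le> e / (I + 1) * I" using \<open>0 \<le> I\<close> by (intro bound) auto
    also have "\<dots> \<le> e" using \<open>0 < e\<close> \<open>0 \<le> I\<close> by (simp add: field_simps)
    finally show "norm A \<le> 0 + e" by simp
  qed
  have "(\<integral>x. frechet_derivative \<phi> (at x) ?ei *\<^sub>R fj x \<partial>?M) =
      - (\<integral>x. frechet_derivative dj (at x) ?ei *\<^sub>R f x \<partial>?M)"
  proof -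
    have "(\<integral>x. frechet_derivative dj (at x) ?ei *\<^sub>R f x \<partial>?M) +
        (\<integral>x. frechet_derivative \<phi> (at x) ?ei *\<^sub>R fj x \<partial>?M) = A"
      unfolding A_def by (rule Bochner_Integration.integral_add[OF iA, symmetric])
    then show ?thesis
      using \<open>norm A \<le> 0\<close> by (simp only: eq_neg_iff_add_eq_0 add.commute norm_le_zero_iff)
  qed
  also have "\<dots> = (\<integral>x. dj x *\<^sub>R fi x \<partial>?M)"
    using has_weak_partialD(3)[OF wi tj] by simp
  also have "\<dots> = - (\<integral>x. \<phi> x *\<^sub>R fij x \<partial>?M)"
    using has_weak_partialD(3)[OF wij \<phi>] by (simp add: dj_def)
  finally show "(\<integral>x. frechet_derivative \<phi> (at x) ?ei *\<^sub>R fj x \<partial>?M) = - (\<integral>x. \<phi> x *\<^sub>R fij x \<partial>?M)" .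
qed

section \<open>Integration by parts with a factor that vanishes on the boundary\<close>

text \<open>The values of \<open>V\<close> are truncated rather than the domain:
  \<open>G n (V x)\<close> is 0 wherever \<open>V\<close> is small, in particular near the boundary,
  so it has compact support whatever the shape of the boundary.\<close>

lemma zero_boundary_integration_by_parts:
  fixes V A :: "real^3 \<Rightarrow> real"
  assumes \<Omega>: "open \<Omega>" "bounded \<Omega>" and V: "continuous_on (closure \<Omega>) V" "\<And>x. x \<in> frontier \<Omega> \<Longrightarrow> V x = 0"
    and w: "has_weak_partial \<Omega> i V V'" "has_weak_partial \<Omega> i A A'"
    and int: "integrable (lebesgue_on \<Omega>) (\<lambda>x. V x * A' x)" "integrable (lebesgue_on \<Omega>) (\<lambda>x. V' x * A x)"
  shows "(\<integral>x. V x * A' x + V' x * A x \<partial>lebesgue_on \<Omega>) = 0"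
proof -
  let ?M = "lebesgue_on \<Omega>"
  obtain s' M where s': "\<And>x. (smooth_step has_real_derivative s' x) (at x)" "continuous_on UNIV s'"
    "\<And>x. \<bar>s' x\<bar> \<le> M" "\<And>x. x \<le> 0 \<Longrightarrow> s' x = 0" "\<And>x. 1 \<le> x \<Longrightarrow> s' x = 0"
    by (rule smooth_step_derivative) blast
  have M: "0 \<le> M" using s'(3)[of 0] by linarith
  \<comment> \<open>The argument is at most 0 for \<open>\<bar>y\<bar> \<le> 1 / (n + 1)\<close> and
    reaches 1 at a fixed multiple of that size. The slope of the step is thus multiplied by values
    of \<open>y\<close> of matching order, which keeps \<open>g n\<close> bounded uniformly in
    \<open>n\<close>.\<close>
  define arg where "arg n y = (real (Suc n))\<^sup>2 * y\<^sup>2 - 1" for n and y :: real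
  define G where "G n y = y * smooth_step (arg n y)" for n y
  define g where "g n y = smooth_step (arg n y) + y * (s' (arg n y) * ((real (Suc n))\<^sup>2 * (2 * y)))" for n y
  have dG: "(G n has_real_derivative g n y) (at y)" for n y
  proof -
    have "((arg n) has_real_derivative (real (Suc n))\<^sup>2 * (2 * y)) (at y)"
      unfolding arg_def[abs_def] by (auto intro!: derivative_eq_intros simp del: of_nat_Suc)
    from DERIV_mult[OF DERIV_ident DERIV_chain2[OF s'(1) this]] show ?thesis
      unfolding G_def[abs_def] g_def by (simp add: add.commute mult.commute)
  qed
  have cg: "continuous_on S (g n)" for n S
  proof -
    have "continuous_on S (arg n)" unfolding arg_def[abs_def] by (intro continuous_intros)
    then show ?thesis
      unfolding g_def[abs_def]
      by (intro continuous_intros continuous_on_compose2[OF s'(2)]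
          continuous_on_compose2[OF smooth_continuous_on[OF smooth_step_smooth, of UNIV]]) auto
  qed
  have G_le: "\<bar>G n y\<bar> \<le> \<bar>y\<bar>" for n y
    unfolding G_def abs_mult using smooth_step_nonneg smooth_step_le_1 by (intro mult_left_le) (auto simp: abs_le_iff intro: order_trans[of _ 0])
  \<comment> \<open>Where \<open>s'\<close> does not vanish, \<open>arg\<close> lies between 0 and
    1, so the factor \<open>2 * (arg n y + 1)\<close> is at most 4.\<close>
  have g_le: "\<bar>g n y\<bar> \<le> 1 + 4 * M" for n y
  proof -
    have "\<bar>y * (s' (arg n y) * ((real (Suc n))\<^sup>2 * (2 * y)))\<bar> = \<bar>s' (arg n y)\<bar> * (2 * (arg n y + 1))"
      unfolding arg_def by (simp add: abs_mult power2_eq_square algebra_simps del: of_nat_Suc)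
    also have "\<dots> \<le> M * 4"
    proof (cases "arg n y \<le> 0 \<or> 1 \<le> arg n y")
      case False
      then show ?thesis using s'(3)[of "arg n y"] by (intro mult_mono) auto
    qed (use s' M in auto)
    finally show ?thesis
      unfolding g_def using smooth_step_le_1[of "arg n y"] smooth_step_nonneg[of "arg n y"] by linarith
  qed
  have G_lim: "(\<lambda>n. G n y) \<longlonglongrightarrow> y" and g_lim: "(\<lambda>n. g n y) \<longlonglongrightarrow> (if y = 0 then 0 else 1)" for y
  proof -
    have ev: "\<forall>\<^sub>F n in sequentially. 1 \<le> arg n y" if "y \<noteq> 0"
    proof -
      obtain N :: nat where N: "2 / y\<^sup>2 < real N" using reals_Archimedean2 by blast
      show ?thesis
      proof (rule eventually_sequentiallyI[of N])
        fix n assume "N \<le> n"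
        then have "2 / y\<^sup>2 \<le> real (Suc n)" using N by linarith
        also have "\<dots> \<le> (real (Suc n))\<^sup>2" by (simp add: power2_eq_square del: of_nat_Suc)
        finally show "1 \<le> arg n y" using that by (simp add: arg_def divide_le_eq del: of_nat_Suc)
      qed
    qed
    show "(\<lambda>n. G n y) \<longlonglongrightarrow> y"
    proof (cases "y = 0")
      case False
      have "\<forall>\<^sub>F n in sequentially. y = G n y"
        using ev[OF False] by eventually_elim (simp add: G_def smooth_step_eq_1)
      then show ?thesis by (rule Lim_transform_eventually[OF tendsto_const])
    qed (simp add: G_def)
    show "(\<lambda>n. g n y) \<longlonglongrightarrow> (if y = 0 then 0 else 1)"
    proof (cases "y = 0")
      case False
      have "\<forall>\<^sub>F n in sequentially. (if y = 0 then 0 else 1) = g n y"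
        using ev[OF False] by eventually_elim (simp add: g_def smooth_step_eq_1 s'(5) False)
      then show ?thesis by (rule Lim_transform_eventually[OF tendsto_const])
    qed (simp add: g_def arg_def smooth_step_eq_0)
  qed
  have wG: "has_weak_partial \<Omega> i (\<lambda>x. G n (V x)) (\<lambda>x. g n (V x) * V' x)" for n
  proof -
    have "has_weak_partial \<Omega> i (\<lambda>x. G n (V x)) (\<lambda>x. (\<lambda>y v. g n y * v) (V x) (V' x))"
    proof (rule has_weak_partial_chain[OF \<Omega>(1) w(1), where S=UNIV and L="1 + 4 * M" and B=0])
      show "\<bar>g n y * v\<bar> \<le> (1 + 4 * M) * norm v" for y v
        unfolding abs_mult real_norm_def by (intro mult_right_mono g_le) simp
    qed (use dG cg M in \<open>auto simp: has_field_derivative_def intro!: continuous_intros\<close>)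
    then show ?thesis by simp
  qed
  \<comment> \<open>A weak derivative vanishes almost everywhere on the zero set:
    \<open>G n (V x)\<close> tends to \<open>V x\<close>, while its derivative tends to
    \<open>V' x\<close> off the zero set and to 0 on it.\<close>
  have V'0: "AE x in ?M. V' x = (if V x = 0 then 0 else V' x)"
  proof (rule has_weak_partial_unique[OF \<Omega>(1) w(1)])
    show "has_weak_partial \<Omega> i V (\<lambda>x. if V x = 0 then 0 else V' x)"
    proof (rule has_weak_partial_dominated[OF \<Omega>(1) wG, where k="\<lambda>x. norm (V x)" and k'="\<lambda>x. norm ((1 + 4 * M) *\<^sub>R V' x)"])
      show "locally_integrable_on (\<lambda>x. norm (V x)) \<Omega>" "locally_integrable_on (\<lambda>x. norm ((1 + 4 * M) *\<^sub>R V' x)) \<Omega>"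
        by (intro locally_integrable_norm has_weak_partialD[OF w(1)]
            locally_integrable_linear[OF bounded_linear_scaleR_right has_weak_partialD(2)[OF w(1)]])+
      show "(\<lambda>n. g n (V x) * V' x) \<longlonglongrightarrow> (if V x = 0 then 0 else V' x)" for x
        using tendsto_mult_right[OF g_lim[of "V x"], of "V' x"] by (simp split: if_splits)
      show "norm (g n (V x) * V' x) \<le> norm ((1 + 4 * M) *\<^sub>R V' x)" for n x
        using mult_right_mono[OF g_le[of n "V x"], of "\<bar>V' x\<bar>"] M by (simp add: abs_mult)
    qed (use G_lim G_le in auto)
  qed
  note mV = locally_integrable_measurable[OF \<Omega>(1) has_weak_partialD(1)[OF w(1)]]
    and mV' = locally_integrable_measurable[OF \<Omega>(1) has_weak_partialD(2)[OF w(1)]]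
    and mA = locally_integrable_measurable[OF \<Omega>(1) has_weak_partialD(1)[OF w(2)]]
    and mA' = locally_integrable_measurable[OF \<Omega>(1) has_weak_partialD(2)[OF w(2)]]
  note [measurable] = mV mV' mA mA'
  have mG: "(\<lambda>x. G n (V x)) \<in> borel_measurable ?M" "(\<lambda>x. g n (V x)) \<in> borel_measurable ?M" for n
  proof -
    have "continuous_on UNIV (G n)"
      using dG by (auto intro!: continuous_at_imp_continuous_on DERIV_isCont)
    then show "(\<lambda>x. G n (V x)) \<in> borel_measurable ?M" "(\<lambda>x. g n (V x)) \<in> borel_measurable ?M"
      using cg by (auto intro!: measurable_compose[OF mV] borel_measurable_continuous_onI)
  qed
  have zero: "(\<integral>x. G n (V x) * A' x + g n (V x) * V' x * A x \<partial>?M) = 0" for n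
  proof -
    \<comment> \<open>Closed in the closure of the domain and disjoint from the frontier, where
      \<open>V\<close> is 0; hence a compact subset of the open domain.\<close>
    define C where "C = {x \<in> closure \<Omega>. 1 / real (Suc n) \<le> \<bar>V x\<bar>}"
    have "closed C"
      unfolding C_def by (intro continuous_on_closed_Collect_le continuous_intros V(1) closed_closure)
    then have C: "compact C"
      using \<Omega>(2) by (auto simp: compact_eq_bounded_closed C_def intro: bounded_subset[OF bounded_closure])
    have "C \<inter> frontier \<Omega> = {}" using V(2) by (auto simp: C_def simp del: of_nat_Suc)
    then have C\<Omega>: "C \<subseteq> \<Omega>" using \<Omega>(1) by (auto simp: C_def frontier_def interior_open)
    have out: "G n (V x) = 0" "g n (V x) = 0" if "x \<in> \<Omega>" "x \<notin> C" for x
    proof -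
      have "\<bar>V x\<bar> < 1 / real (Suc n)" using that closure_subset[of \<Omega>] by (auto simp: C_def)
      then have "\<bar>real (Suc n) * V x\<bar> \<le> 1" by (simp add: abs_mult field_simps del: of_nat_Suc)
      then have "arg n (V x) \<le> 0"
        unfolding arg_def power_mult_distrib[symmetric] by (simp add: abs_square_le_1)
      then show "G n (V x) = 0" "g n (V x) = 0"
        by (simp_all add: G_def g_def smooth_step_eq_0 s'(4))
    qed
    have loc: "locally_integrable_on (\<lambda>x. V x * A x) \<Omega>"
      unfolding locally_integrable_on_def
    proof safe
      fix K assume K: "compact K" "K \<subseteq> \<Omega>"
      have "bounded (V ` closure \<Omega>)"
        using \<Omega>(2) by (intro compact_imp_bounded compact_continuous_image V(1)) (simp add: compact_closure)
      then obtain B where B: "\<forall>x\<in>closure \<Omega>. \<bar>V x\<bar> \<le> B" unfolding bounded_real by blast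
      show "integrable (lebesgue_on K) (\<lambda>x. V x * A x)"
      proof -
        have "AE x in lebesgue_on K. \<bar>V x\<bar> \<le> B"
          using B K(2) closure_subset[of \<Omega>] by (intro AE_I2) auto
        from integrable_bounded_mult[OF locally_integrableD[OF has_weak_partialD(1)[OF w(2)] K]
            measurable_restrict_mono[OF mV K(2)] this] show ?thesis by simp
      qed
    qed
    have "has_weak_partial \<Omega> i (\<lambda>x. G n (V x) * A x) (\<lambda>x. G n (V x) * A' x + (g n (V x) * V' x) * A x)"
    proof (rule has_weak_partial_mult[OF \<Omega>(1) wG w(2)])
      show "locally_integrable_on (\<lambda>x. G n (V x) * A x) \<Omega>"
        using mG by (intro locally_integrable_bound[OF \<Omega>(1) loc]) (auto simp: abs_mult intro!: mult_right_mono G_le)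
      show "locally_integrable_on (\<lambda>x. G n (V x) * A' x) \<Omega>"
        using mG by (intro locally_integrable_bound[OF \<Omega>(1) locally_integrable_integrable[OF int(1) \<Omega>(1)]])
          (auto simp: abs_mult intro!: mult_right_mono G_le)
      show "locally_integrable_on (\<lambda>x. g n (V x) * V' x * A x) \<Omega>"
      proof (rule locally_integrable_bound[OF \<Omega>(1)])
        show "locally_integrable_on (\<lambda>x. (1 + 4 * M) *\<^sub>R (V' x * A x)) \<Omega>"
          by (rule locally_integrable_linear[OF bounded_linear_scaleR_right locally_integrable_integrable[OF int(2) \<Omega>(1)]])
        show "norm (g n (V x) * V' x * A x) \<le> norm ((1 + 4 * M) *\<^sub>R (V' x * A x))" for x
          using mult_right_mono[OF g_le[of n "V x"], of "\<bar>V' x * A x\<bar>"] M by (simp add: abs_mult mult.assoc)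
      qed (use mG in measurable)
    qed
    from integral_weak_partial_compact_support[OF \<Omega>(1) this C C\<Omega>] out show ?thesis by simp
  qed
  have "(\<lambda>n. \<integral>x. G n (V x) * A' x + g n (V x) * V' x * A x \<partial>?M) \<longlonglongrightarrow>
      (\<integral>x. V x * A' x + (if V x = 0 then 0 else 1) * V' x * A x \<partial>?M)"
  proof (rule integral_dominated_convergence)
    show "integrable ?M (\<lambda>x. norm (V x * A' x) + (1 + 4 * M) * norm (V' x * A x))"
      using int by auto
    show "AE x in ?M. (\<lambda>n. G n (V x) * A' x + g n (V x) * V' x * A x) \<longlonglongrightarrow>
        V x * A' x + (if V x = 0 then 0 else 1) * V' x * A x"
      by (intro AE_I2 tendsto_add tendsto_mult G_lim g_lim tendsto_const)
    show "AE x in ?M. norm (G n (V x) * A' x + g n (V x) * V' x * A x) \<le>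
        norm (V x * A' x) + (1 + 4 * M) * norm (V' x * A x)" for n
    proof (intro AE_I2 order_trans[OF norm_triangle_ineq] add_mono)
      show "norm (G n (V x) * A' x) \<le> norm (V x * A' x)" for x
        by (auto simp: abs_mult intro!: mult_right_mono G_le)
      show "norm (g n (V x) * V' x * A x) \<le> (1 + 4 * M) * norm (V' x * A x)" for x
        using mult_right_mono[OF g_le[of n "V x"], of "\<bar>V' x * A x\<bar>"] by (simp add: abs_mult mult.assoc)
    qed
  qed (use mG in measurable)
  then have "(\<integral>x. V x * A' x + (if V x = 0 then 0 else 1) * V' x * A x \<partial>?M) = 0"
    unfolding zero by (simp add: LIMSEQ_const_iff)
  moreover have "(\<integral>x. V x * A' x + V' x * A x \<partial>?M) =
      (\<integral>x. V x * A' x + (if V x = 0 then 0 else 1) * V' x * A x \<partial>?M)"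
    by (rule lebesgue_on_integral_cong_AE(1)[OF open_sets_lebesgue[OF \<Omega>(1)]])
      (use V'0 in \<open>eventually_elim, auto\<close>)
  ultimately show ?thesis by simp
qed

section \<open>The divergence theorem for fields tangential to the boundary\<close>

text \<open>Chords of \<open>S\<close> in direction \<open>e\<close> are shorter than
  \<open>\<tau>\<close>, so translates by multiples of \<open>\<tau>\<close> are pairwise disjoint.
  About \<open>1 / \<tau>\<close> of them fit into one fixed ball, which forces the measure to be of
  order \<open>\<tau>\<close>.\<close>

lemma measure_le_disjoint_translates:
  fixes S :: "'a::euclidean_space set"
  assumes S: "S \<in> lmeasurable" and e: "norm e = 1" and \<tau>: "0 < \<tau>" "\<tau> \<le> 1" and sub: "S \<subseteq> ball x \<rho>"
    and sep: "\<And>y h. y \<in> S \<Longrightarrow> y + h *\<^sub>R e \<in> S \<Longrightarrow> 0 \<le> h \<Longrightarrow> h < \<tau>"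
  shows "measure lebesgue S \<le> 2 * measure lebesgue (ball x (\<rho> + 1)) * \<tau>"
proof -
  define N where "N = nat \<lfloor>1 / \<tau>\<rfloor>"
  have fl: "1 \<le> \<lfloor>1 / \<tau>\<rfloor>" using \<tau> by (simp add: le_floor_iff)
  \<comment> \<open>The first bound keeps all translates within distance 1 of \<open>S\<close>; the
    second says that rounding \<open>1 / \<tau>\<close> down loses at most a factor 2, as
    \<open>N\<close> is at least 1.\<close>
  have N: "real N * \<tau> \<le> 1" "1 \<le> 2 * real N * \<tau>"
  proof -
    have "real N = of_int \<lfloor>1 / \<tau>\<rfloor>" unfolding N_def by (rule of_nat_nat) (use fl in linarith)
    then have "real N \<le> 1 / \<tau>" "1 / \<tau> < real N + 1" "1 \<le> real N" using fl by linarith+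
    then have "real N * \<tau> \<le> 1" "1 < (real N + 1) * \<tau>" "1 * \<tau> \<le> real N * \<tau>"
      using \<tau>(1) mult_right_mono[of 1 "real N" \<tau>] by (simp_all add: pos_le_divide_eq pos_divide_less_eq)
    moreover have "(real N + 1) * \<tau> = real N * \<tau> + \<tau>" by (simp add: distrib_right)
    ultimately show "real N * \<tau> \<le> 1" "1 \<le> 2 * real N * \<tau>"
      by linarith+
  qed
  define T where "T j = (\<lambda>y. (real j * \<tau>) *\<^sub>R e + y) ` S" for j :: nat
  have T: "T j \<in> lmeasurable" "measure lebesgue (T j) = measure lebesgue S" for j
    unfolding T_def using S by (auto intro: measurable_translation measure_translation)
  have disj: "disjoint_family_on T {..<N}"
  proof -
    have "T j \<inter> T k = {}" if "j < k" for j k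
    proof (rule ccontr)
      assume "T j \<inter> T k \<noteq> {}"
      then obtain y z where yz: "y \<in> S" "z \<in> S" "(real j * \<tau>) *\<^sub>R e + y = (real k * \<tau>) *\<^sub>R e + z"
        by (auto simp: T_def)
      have "z + ((real k - real j) * \<tau>) *\<^sub>R e = y"
        using yz(3) by (simp add: algebra_simps scaleR_diff_left)
      then have "(real k - real j) * \<tau> < \<tau>"
        using sep[of z "(real k - real j) * \<tau>"] yz that \<tau>(1) by simp
      moreover have "1 \<le> real k - real j" using that by linarith
      ultimately show False using \<tau>(1) mult_right_mono[of 1 "real k - real j" \<tau>] by simp
    qed
    then show ?thesis
      unfolding disjoint_family_on_def by (metis inf_commute linorder_neqE_nat)
  qed
  have subT: "(\<Union>j\<in>{..<N}. T j) \<subseteq> ball x (\<rho> + 1)"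
  proof safe
    fix j z assume "j < N" "z \<in> T j"
    then obtain y where y: "y \<in> S" "z = (real j * \<tau>) *\<^sub>R e + y" by (auto simp: T_def)
    have "real j * \<tau> \<le> real N * \<tau>" using \<open>j < N\<close> \<tau>(1) by (intro mult_right_mono) auto
    then have "real j * \<tau> \<le> 1" by (rule order_trans[OF _ N(1)])
    moreover have "\<bar>real j * \<tau>\<bar> = real j * \<tau>" using \<tau>(1) by (intro abs_of_nonneg mult_nonneg_nonneg) auto
    ultimately have "norm ((real j * \<tau>) *\<^sub>R e) \<le> 1" by (simp only: norm_scaleR e mult_1_right)
    moreover have "dist x z \<le> dist x y + norm ((real j * \<tau>) *\<^sub>R e)" using dist_triangle[of x z y] by (simp add: y(2) dist_norm)
    moreover have "dist x y < \<rho>" using y(1) sub by auto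
    ultimately show "z \<in> ball x (\<rho> + 1)" by simp
  qed
  have "real N * measure lebesgue S = (\<Sum>j<N. measure lebesgue (T j))" by (simp add: T)
  also have "\<dots> = measure lebesgue (\<Union>j\<in>{..<N}. T j)"
  proof (rule measure_finite_Union[OF _ _ disj, symmetric])
    show "T ` {..<N} \<subseteq> sets lebesgue" using fmeasurableD[OF T(1)] by blast
    show "emeasure lebesgue (T j) \<noteq> \<infinity>" for j using fmeasurableD2[OF T(1)] by simp
  qed simp
  also have "\<dots> \<le> measure lebesgue (ball x (\<rho> + 1))"
    using T(1) by (intro measure_mono_fmeasurable subT) (auto simp: fmeasurableD)
  finally have *: "real N * measure lebesgue S \<le> measure lebesgue (ball x (\<rho> + 1))" .
  have "measure lebesgue S \<le> (2 * real N * \<tau>) * measure lebesgue S"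
    using N(2) mult_right_mono[of 1 "2 * real N * \<tau>" "measure lebesgue S"] by simp
  also have "\<dots> = 2 * \<tau> * (real N * measure lebesgue S)" by simp
  also have "\<dots> \<le> 2 * \<tau> * measure lebesgue (ball x (\<rho> + 1))"
    using * \<tau>(1) by (intro mult_left_mono) auto
  finally show ?thesis by (simp add: mult.commute mult.left_commute)
qed

section \<open>Local defining functions and the outward normal\<close>

lemma local_defining_functionD:
  fixes \<psi> :: "'a::euclidean_space \<Rightarrow> real"
  assumes "local_defining_function (Suc 0) \<Omega> x U \<psi>"
  shows "open U" "x \<in> U" "\<And>y. y \<in> U \<Longrightarrow> (\<psi> has_derivative frechet_derivative \<psi> (at y)) (at y)"
    "\<And>v. continuous_on U (\<lambda>y. frechet_derivative \<psi> (at y) v)"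
    "\<And>y. y \<in> U \<Longrightarrow> frechet_derivative \<psi> (at y) \<noteq> (\<lambda>_. 0)"
    "\<And>y. y \<in> U \<Longrightarrow> y \<in> \<Omega> \<longleftrightarrow> \<psi> y < 0" "\<And>y. y \<in> U \<Longrightarrow> y \<in> frontier \<Omega> \<longleftrightarrow> \<psi> y = 0"
proof -
  note * = assms[unfolded local_defining_function_def]
  from * have "Ck_on (Suc 0) \<psi> U" by blast
  then obtain f' where f': "\<And>y. y \<in> U \<Longrightarrow> (\<psi> has_derivative f' y) (at y)" "\<And>v. continuous_on U (\<lambda>y. f' y v)"
    by auto
  have eq: "frechet_derivative \<psi> (at y) = f' y" if "y \<in> U" for y
    using frechet_derivative_at[OF f'(1)[OF that]] by simp
  show "(\<psi> has_derivative frechet_derivative \<psi> (at y)) (at y)" if "y \<in> U" for y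
    using f'(1)[OF that] eq[OF that] by simp
  show "continuous_on U (\<lambda>y. frechet_derivative \<psi> (at y) v)" for v
    using f'(2)[of v] by (simp add: eq cong: continuous_on_cong)
qed (use assms[unfolded local_defining_function_def] in auto)

lemma local_defining_function_shift:
  "local_defining_function k \<Omega> x U \<psi> \<Longrightarrow> y \<in> U \<Longrightarrow> local_defining_function k \<Omega> y U \<psi>"
  by (simp add: local_defining_function_def)

lemma local_defining_function_lower:
  "local_defining_function (Suc k) \<Omega> x U \<psi> \<Longrightarrow> local_defining_function (Suc 0) \<Omega> x U \<psi>"
  unfolding local_defining_function_def using Ck_on_le[of "Suc k" \<psi> U "Suc 0"] by (auto simp del: Ck_on.simps)

lemma has_derivative_direction_sign:
  fixes \<psi> :: "'a::euclidean_space \<Rightarrow> real"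
  assumes "(\<psi> has_derivative D) (at x)" "\<psi> x = 0" "0 < D v"
  shows "\<forall>\<^sub>F t in at_right 0. 0 < \<psi> (x + t *\<^sub>R v)"
proof -
  have "((\<lambda>t. \<psi> (x + t *\<^sub>R v)) has_derivative (\<lambda>s. D (s *\<^sub>R v))) (at 0)"
    by (rule has_derivative_compose[of "\<lambda>t. x + t *\<^sub>R v" "\<lambda>s. s *\<^sub>R v" 0 UNIV \<psi>])
      (use assms(1) in \<open>auto intro!: derivative_eq_intros\<close>)
  moreover have "D (s *\<^sub>R v) = D v * s" for s
    using linear_scale[OF has_derivative_linear[OF assms(1)], of s v] by simp
  ultimately have "((\<lambda>t. \<psi> (x + t *\<^sub>R v)) has_real_derivative D v) (at 0)"
    by (simp add: has_field_derivative_def)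
  from DERIV_pos_inc_right[OF this assms(3)] obtain d where "0 < d" "\<forall>h>0. h < d \<longrightarrow> \<psi> (x + 0 *\<^sub>R v) < \<psi> (x + (0 + h) *\<^sub>R v)"
    by auto
  then show ?thesis
    using assms(2) unfolding eventually_at_right_field by (intro exI[of _ d]) auto
qed

text \<open>The description in \<open>outward_normal\<close> must be shown unique. If two defining
  functions had different unit gradients \<open>m\<close> and \<open>n\<close>, then along
  \<open>m - n\<close> one of them would increase and the other decrease from 0, so nearby points
  would lie both outside and inside the domain.\<close>

lemma outward_normal_defining_function:
  fixes \<Omega> :: "'a::euclidean_space set"
  assumes "local_defining_function (Suc 0) \<Omega> x U \<psi>" "x \<in> frontier \<Omega>"
  obtains c where "0 < c" "\<And>v. frechet_derivative \<psi> (at x) v = c * (outward_normal \<Omega> x \<bullet> v)"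
proof -
  note L = local_defining_functionD[OF assms(1)]
  define P where "P n \<longleftrightarrow> norm n = 1 \<and> (\<exists>U \<psi> c. local_defining_function 1 \<Omega> x U \<psi> \<and> c > 0 \<and>
      (\<psi> has_derivative (\<lambda>h. c * (n \<bullet> h))) (at x))" for n
  have grad: "\<exists>n. norm n = 1 \<and> (\<exists>c>0. D = (\<lambda>h. c * (n \<bullet> h)))"
    if D: "linear D" "D \<noteq> (\<lambda>_. 0)" for D :: "'a \<Rightarrow> real"
  proof -
    define g where "g = (\<Sum>b\<in>Basis. D b *\<^sub>R b)"
    have Dg: "D h = g \<bullet> h" for h
    proof -
      have "D h = (\<Sum>b\<in>Basis. (h \<bullet> b) * D b)"
        using linear_sum[OF D(1), of "\<lambda>b. (h \<bullet> b) *\<^sub>R b" Basis] linear_scale[OF D(1)]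
        by (simp add: euclidean_representation)
      then show ?thesis by (simp add: g_def inner_sum_left inner_commute[of h] mult.commute)
    qed
    then have "g \<noteq> 0" using D(2) by (auto simp: fun_eq_iff)
    then show ?thesis
      by (intro exI[of _ "g /\<^sub>R norm g"] conjI exI[of _ "norm g"]) (auto simp: Dg fun_eq_iff)
  qed
  obtain n c where nc: "norm n = 1" "0 < c" "frechet_derivative \<psi> (at x) = (\<lambda>h. c * (n \<bullet> h))"
    using grad[OF has_derivative_linear[OF L(3)[OF L(2)]] L(5)[OF L(2)]] by blast
  have Pn: "P n"
    unfolding P_def using nc assms(1) L(3)[OF L(2)] by auto
  have uniq: "m = n" if Pm: "P m" for m
  proof (rule ccontr)
    assume "m \<noteq> n"
    obtain V \<phi> d where m: "norm m = 1" "local_defining_function (Suc 0) \<Omega> x V \<phi>" "0 < d"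
      "(\<phi> has_derivative (\<lambda>h. d * (m \<bullet> h))) (at x)"
      using Pm unfolding P_def One_nat_def by blast
    note M = local_defining_functionD[OF m(2)]
    define v where "v = m - n"
    have "m \<bullet> n < 1"
    proof -
      have "0 < (m - n) \<bullet> (m - n)" using \<open>m \<noteq> n\<close> by simp
      then show ?thesis
        using nc(1) m(1) by (simp add: inner_diff_left inner_diff_right inner_commute norm_eq_sqrt_inner)
    qed
    then have v: "0 < m \<bullet> v" "n \<bullet> v < 0"
      using nc(1) m(1) by (auto simp: v_def inner_diff_right norm_eq_sqrt_inner inner_commute)
    have 1: "\<forall>\<^sub>F t in at_right 0. 0 < \<phi> (x + t *\<^sub>R v)"
      by (rule has_derivative_direction_sign[OF m(4)]) (use M(2,7) assms(2) m(3) v in auto)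
    have 2: "\<forall>\<^sub>F t in at_right 0. 0 < - \<psi> (x + t *\<^sub>R v)"
      by (rule has_derivative_direction_sign[OF has_derivative_minus[OF L(3)[OF L(2)]]])
        (use L(2,7) assms(2) nc v in \<open>auto simp: mult_pos_neg\<close>)
    have "((\<lambda>t. x + t *\<^sub>R v) \<longlongrightarrow> x + 0 *\<^sub>R v) (at_right 0)" by (intro tendsto_intros)
    then have 3: "\<forall>\<^sub>F t in at_right 0. x + t *\<^sub>R v \<in> U \<inter> V"
      using L(1,2) M(1,2) by (intro topological_tendstoD) auto
    from 1 2 3 have "\<forall>\<^sub>F t in at_right (0::real). False"
      by eventually_elim (use L(6) M(6) in force)
    then show False by simp
  qed
  have "outward_normal \<Omega> x = n"
    unfolding outward_normal_def P_def[symmetric] using Pn uniq by (rule the_equality)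
  with nc show ?thesis using that[of c] by simp
qed

text \<open>Near \<open>x\<close> the function \<open>\<psi>\<close> grows in a fixed direction
  \<open>e\<close> with slope at least \<open>c\<close>, half the slope at \<open>x\<close>. A chord
  of the strip in that direction is therefore shorter than \<open>2 * \<delta> / c\<close>, and the
  translation argument bounds the measure.\<close>

lemma local_defining_function_strip:
  fixes \<Omega> :: "'a::euclidean_space set"
  assumes "local_defining_function (Suc 0) \<Omega> x U \<psi>"
  obtains \<rho> C d where "0 < \<rho>" "ball x \<rho> \<subseteq> U" "0 < d" "0 \<le> C"
    "\<And>\<delta>. 0 < \<delta> \<Longrightarrow> \<delta> \<le> d \<Longrightarrow> {y \<in> ball x \<rho>. - (2 * \<delta>) < \<psi> y \<and> \<psi> y < 0} \<in> lmeasurable \<and>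
       measure lebesgue {y \<in> ball x \<rho>. - (2 * \<delta>) < \<psi> y \<and> \<psi> y < 0} \<le> C * \<delta>"
proof -
  note L = local_defining_functionD[OF assms]
  let ?D = "\<lambda>y. frechet_derivative \<psi> (at y)"
  have lin: "linear (?D y)" if "y \<in> U" for y by (rule has_derivative_linear[OF L(3)[OF that]])
  have "\<exists>b\<in>Basis. ?D x b \<noteq> 0"
  proof (rule ccontr)
    assume "\<not> ?thesis"
    then have "?D x h = 0" for h
      using linear_sum[OF lin[OF L(2)], of "\<lambda>b. (h \<bullet> b) *\<^sub>R b" Basis] linear_scale[OF lin[OF L(2)]]
      by (simp add: euclidean_representation)
    with L(5)[OF L(2)] show False by auto
  qed
  then obtain b where b: "b \<in> Basis" "?D x b \<noteq> 0" by blast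
  \<comment> \<open>A coordinate direction in which the derivative does not vanish, with the sign
    that makes it positive.\<close>
  define e where "e = sgn (?D x b) *\<^sub>R b"
  have e: "norm e = 1" using b by (auto simp: e_def sgn_real_def)
  have "?D x e = \<bar>?D x b\<bar>" using linear_scale[OF lin[OF L(2)]] by (simp add: e_def abs_sgn mult.commute)
  then have De: "0 < ?D x e" using b by simp
  define c where "c = ?D x e / 2"
  have c: "0 < c" using De by (simp add: c_def)
  have "isCont (\<lambda>y. ?D y e) x"
    using L(1,2,4) continuous_on_eq_continuous_at by blast
  then have "((\<lambda>y. ?D y e) \<longlongrightarrow> ?D x e) (nhds x)"
    unfolding isCont_def by (rule tendsto_at_iff_tendsto_nhds[THEN iffD1])
  then have "\<forall>\<^sub>F y in nhds x. c < ?D y e"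
    using De by (intro order_tendstoD) (auto simp: c_def)
  moreover have "\<forall>\<^sub>F y in nhds x. y \<in> U" using L(1,2) by (rule eventually_nhds_in_open)
  ultimately have "\<forall>\<^sub>F y in nhds x. c < ?D y e \<and> y \<in> U" by (rule eventually_conj)
  then obtain \<rho> where \<rho>: "0 < \<rho>" "\<And>y. dist y x < \<rho> \<Longrightarrow> c < ?D y e \<and> y \<in> U"
    unfolding eventually_nhds_metric by blast
  have growth: "c * h \<le> \<psi> (y + h *\<^sub>R e) - \<psi> y"
    if y: "y \<in> ball x \<rho>" "y + h *\<^sub>R e \<in> ball x \<rho>" "0 \<le> h" for y h
  proof (cases "h = 0")
    case False
    have mem: "y + t *\<^sub>R e \<in> ball x \<rho>" if "0 \<le> t" "t \<le> h" for t
    proof -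
      have "y + t *\<^sub>R e = (1 - t / h) *\<^sub>R y + (t / h) *\<^sub>R (y + h *\<^sub>R e)"
        using False by (simp add: algebra_simps)
      then show ?thesis
        using convexD[OF convex_ball y(1,2), of "1 - t / h" "t / h"] that y(3) False by simp
    qed
    have der: "((\<lambda>t. \<psi> (y + t *\<^sub>R e)) has_real_derivative ?D (y + t *\<^sub>R e) e) (at t)" if "0 \<le> t" "t \<le> h" for t
    proof -
      have U: "y + t *\<^sub>R e \<in> U" using mem[OF that] \<rho>(2) by (auto simp: dist_commute)
      have "((\<lambda>t. \<psi> (y + t *\<^sub>R e)) has_derivative (\<lambda>s. ?D (y + t *\<^sub>R e) (s *\<^sub>R e))) (at t)"
        by (rule has_derivative_compose[of "\<lambda>t. y + t *\<^sub>R e" "\<lambda>s. s *\<^sub>R e" t UNIV \<psi>, OF _ L(3)[OF U]])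
          (auto intro!: derivative_eq_intros)
      then show ?thesis
        using linear_scale[OF lin[OF U]] by (simp add: has_field_derivative_def mult.commute[of _ "?D (y + t *\<^sub>R e) e"])
    qed
    obtain t where t: "0 < t" "t < h" "\<psi> (y + h *\<^sub>R e) - \<psi> (y + 0 *\<^sub>R e) = (h - 0) * ?D (y + t *\<^sub>R e) e"
      using MVT2[of 0 h "\<lambda>t. \<psi> (y + t *\<^sub>R e)" "\<lambda>t. ?D (y + t *\<^sub>R e) e"] y(3) False der by auto
    have "c \<le> ?D (y + t *\<^sub>R e) e" using \<rho>(2)[of "y + t *\<^sub>R e"] mem[of t] t by (auto simp: dist_commute)
    then show ?thesis using t y(3) by (simp add: mult.commute mult_left_mono)
  qed simp
  have contU: "continuous_on U \<psi>"
    using L(3) by (auto intro!: continuous_at_imp_continuous_on intro: has_derivative_continuous)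
  have ballU: "ball x \<rho> \<subseteq> U" using \<rho>(2) by (auto simp: dist_commute)
  show ?thesis
  proof (rule that[OF \<rho>(1) ballU])
    \<comment> \<open>The value of \<open>d\<close> is \<open>c / 2\<close>: it ensures
      \<open>2 * \<delta> / c \<le> 1\<close>, as \<open>measure_le_disjoint_translates\<close> asks
      of \<open>\<tau>\<close>.\<close>
    show "0 < c / 2" using c by simp
    show "0 \<le> 4 * measure lebesgue (ball x (\<rho> + 1)) / c" using c by simp
    fix \<delta> :: real assume \<delta>: "0 < \<delta>" "\<delta> \<le> c / 2"
    define S where "S = {y \<in> ball x \<rho>. - (2 * \<delta>) < \<psi> y \<and> \<psi> y < 0}"
    have "S = ball x \<rho> \<inter> (\<psi> -` {- (2 * \<delta>)<..<0})" by (auto simp: S_def)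
    then have "open S"
      using continuous_open_preimage[OF continuous_on_subset[OF contU ballU] open_ball, of "{- (2 * \<delta>)<..<0}"] by simp
    then have S: "S \<in> lmeasurable"
      by (intro bounded_set_imp_lmeasurable) (auto simp: S_def open_sets_lebesgue intro: bounded_subset[OF bounded_ball])
    have "measure lebesgue S \<le> 2 * measure lebesgue (ball x (\<rho> + 1)) * (2 * \<delta> / c)"
    proof (rule measure_le_disjoint_translates[OF S e])
      show "h < 2 * \<delta> / c" if "y \<in> S" "y + h *\<^sub>R e \<in> S" "0 \<le> h" for y h
        using growth[of y h] that c by (auto simp: S_def pos_less_divide_eq mult.commute)
    qed (use \<delta> c in \<open>auto simp: S_def field_simps\<close>)
    then show "{y \<in> ball x \<rho>. - (2 * \<delta>) < \<psi> y \<and> \<psi> y < 0} \<in> lmeasurable \<and>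
        measure lebesgue {y \<in> ball x \<rho>. - (2 * \<delta>) < \<psi> y \<and> \<psi> y < 0} \<le> 4 * measure lebesgue (ball x (\<rho> + 1)) / c * \<delta>"
      using S by (simp add: S_def mult_ac)
  qed
qed

section \<open>The divergence theorem near the boundary and globally\<close>

lemma integrable_continuous_mult:
  fixes a h :: "'a::euclidean_space \<Rightarrow> real"
  assumes "bounded S" "continuous_on (closure S) a" "integrable (lebesgue_on S) h" "S \<in> sets lebesgue"
  shows "integrable (lebesgue_on S) (\<lambda>x. a x * h x)"
proof -
  have "bounded (a ` closure S)"
    using assms(1,2) by (intro compact_imp_bounded compact_continuous_image) (simp_all add: compact_closure)
  then obtain B where B: "\<forall>y\<in>closure S. \<bar>a y\<bar> \<le> B" unfolding bounded_real by blast
  have "(\<lambda>x. indicator (closure S) x *\<^sub>R a x) \<in> borel_measurable lborel"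
    using borel_measurable_continuous_on_indicator[OF _ assms(2)] by simp
  from measurable_completion[OF this] have "a \<in> borel_measurable (lebesgue_on (closure S))"
    by (simp add: borel_measurable_restrict_space_iff)
  then have m: "a \<in> borel_measurable (lebesgue_on S)"
    by (rule measurable_restrict_mono[OF _ closure_subset])
  have "AE x in lebesgue_on S. \<bar>a x\<bar> \<le> B" using B closure_subset[of S] by (intro AE_I2) auto
  from integrable_bounded_mult[OF assms(3) m this] show ?thesis by simp
qed

text \<open>The cutoff \<open>S (- \<psi> / \<delta> - 1)\<close> vanishes near the boundary. Its gradient is of order \<open>1 / \<delta>\<close> on a strip
  of measure \<open>O(\<delta>)\<close>, where the normal component of \<open>G\<close> is small.\<close>

lemma divergence_near_boundary:
  fixes w :: "real^3 \<Rightarrow> real" and G D :: "3 \<Rightarrow> real^3 \<Rightarrow> real"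
  assumes \<Omega>: "open \<Omega>" "bounded \<Omega>"
    and ldf: "local_defining_function (Suc 0) \<Omega> x0 U \<psi>"
    and strip: "ball x0 \<rho> \<subseteq> U" "0 < d" "0 \<le> C"
      "\<And>\<delta>. 0 < \<delta> \<Longrightarrow> \<delta> \<le> d \<Longrightarrow> {y \<in> ball x0 \<rho>. - (2 * \<delta>) < \<psi> y \<and> \<psi> y < 0} \<in> lmeasurable \<and>
         measure lebesgue {y \<in> ball x0 \<rho>. - (2 * \<delta>) < \<psi> y \<and> \<psi> y < 0} \<le> C * \<delta>"
    and G: "\<And>i. continuous_on (closure \<Omega>) (G i)"
      "\<And>x. x \<in> frontier \<Omega> \<Longrightarrow> (\<Sum>i\<in>UNIV. outward_normal \<Omega> x $ i * G i x) = 0"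
    and w: "\<And>x. x \<in> \<Omega> \<Longrightarrow> \<bar>w x\<bar> \<le> B"
    and D: "\<And>i. has_weak_partial \<Omega> i (\<lambda>x. w x * G i x) (D i)" "\<And>i. integrable (lebesgue_on \<Omega>) (D i)"
      "\<And>i. integrable (lebesgue_on \<Omega>) (\<lambda>x. w x * G i x)"
    and \<zeta>: "test_function (ball x0 \<rho>) \<zeta>"
  shows "(\<integral>x. (\<Sum>i\<in>UNIV. \<zeta> x * D i x + frechet_derivative \<zeta> (at x) (axis i 1) * (w x * G i x)) \<partial>lebesgue_on \<Omega>) = 0"
proof -
  let ?M = "lebesgue_on \<Omega>"
  note L = local_defining_functionD[OF ldf]
  note \<Omega>s = open_sets_lebesgue[OF \<Omega>(1)]
  obtain K where K: "smooth \<zeta>" "compact K" "K \<subseteq> ball x0 \<rho>" "\<And>x. x \<notin> K \<Longrightarrow> \<zeta> x = 0"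
    "\<And>x v. x \<notin> K \<Longrightarrow> frechet_derivative \<zeta> (at x) v = 0"
    by (rule test_functionD[OF \<zeta>]) blast
  obtain M where M: "0 < M" "\<And>x. \<bar>\<zeta> x\<bar> \<le> M" by (rule test_function_bounded[OF \<zeta>]) blast
  obtain s' Ms where s': "\<And>x. (smooth_step has_real_derivative s' x) (at x)" "continuous_on UNIV s'"
    "\<And>x. \<bar>s' x\<bar> \<le> Ms" "\<And>x. x \<le> 0 \<Longrightarrow> s' x = 0" "\<And>x. 1 \<le> x \<Longrightarrow> s' x = 0"
    by (rule smooth_step_derivative) blast
  have Ms: "0 \<le> Ms" using s'(3)[of 0] by linarith
  have KU: "K \<subseteq> U" using K(3) strip(1) by auto
  let ?e = "\<lambda>i. axis i 1 :: real^3"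
  let ?d\<psi> = "\<lambda>x v. frechet_derivative \<psi> (at x) v" and ?d\<zeta> = "\<lambda>x v. frechet_derivative \<zeta> (at x) v"
  \<comment> \<open>On the frontier the gradient of \<open>\<psi>\<close> is a positive multiple of
    the normal, so \<open>r\<close> vanishes there by the flux condition.\<close>
  define r where "r x = (\<Sum>i\<in>UNIV. ?d\<psi> x (?e i) * G i x)" for x
  have cont\<psi>: "continuous_on U \<psi>"
    using L(3) by (auto intro!: continuous_at_imp_continuous_on intro: has_derivative_continuous)
  have cr: "continuous_on (K \<inter> closure \<Omega>) r"
    unfolding r_def[abs_def] using KU
    by (intro continuous_intros continuous_on_subset[OF G(1)] continuous_on_subset[OF L(4)]) auto
  have r0: "r x = 0" if x: "x \<in> K" "x \<in> frontier \<Omega>" for x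
  proof -
    obtain c where "0 < c" "\<And>v. ?d\<psi> x v = c * (outward_normal \<Omega> x \<bullet> v)"
      using outward_normal_defining_function[OF local_defining_function_shift[OF ldf] x(2)] x(1) KU by blast
    then show ?thesis
      using G(2)[OF x(2)] by (simp add: r_def inner_axis mult.assoc sum_distrib_left[symmetric])
  qed
  \<comment> \<open>The points of \<open>K\<close> with large \<open>r\<close> form a compact set
    inside the domain, on which \<open>\<psi>\<close> has a negative maximum; half its modulus
    serves as \<open>t\<close>.\<close>
  have small: "\<exists>t>0. \<forall>x\<in>K \<inter> \<Omega>. - (2 * t) < \<psi> x \<longrightarrow> \<bar>r x\<bar> \<le> \<epsilon>" if \<epsilon>: "0 < \<epsilon>" for \<epsilon>
  proof (cases "{x \<in> K \<inter> closure \<Omega>. \<epsilon> \<le> \<bar>r x\<bar>} = {}")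
    case True
    then have "\<forall>x\<in>K \<inter> \<Omega>. \<bar>r x\<bar> \<le> \<epsilon>" using closure_subset[of \<Omega>] by force
    then show ?thesis by (intro exI[of _ 1]) auto
  next
    case False
    define E where "E = {x \<in> K \<inter> closure \<Omega>. \<epsilon> \<le> \<bar>r x\<bar>}"
    have "closed E"
      unfolding E_def using K(2)
      by (intro continuous_on_closed_Collect_le continuous_intros cr) (auto simp: compact_imp_closed)
    then have E: "compact E" using K(2) by (auto simp: E_def compact_eq_bounded_closed intro: bounded_subset)
    have neg: "\<psi> x < 0" if x: "x \<in> E" for x
    proof -
      have "x \<notin> frontier \<Omega>" using x r0[of x] \<epsilon> by (auto simp: E_def)
      then have "x \<in> \<Omega>" using x \<Omega>(1) by (auto simp: E_def frontier_def interior_open)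
      then show ?thesis using x KU L(6)[of x] by (auto simp: E_def)
    qed
    obtain x where x: "x \<in> E" "\<And>y. y \<in> E \<Longrightarrow> \<psi> y \<le> \<psi> x"
      using continuous_attains_sup[OF E _ continuous_on_subset[OF cont\<psi>]] False KU by (auto simp: E_def)
    show ?thesis
    proof (intro exI[of _ "- \<psi> x / 2"] conjI ballI impI)
      show "0 < - \<psi> x / 2" using neg[OF x(1)] by simp
      fix y assume "y \<in> K \<inter> \<Omega>" "- (2 * (- \<psi> x / 2)) < \<psi> y"
      then show "\<bar>r y\<bar> \<le> \<epsilon>" using x(2)[of y] closure_subset[of \<Omega>] by (force simp: E_def)
    qed
  qed
  define \<delta> where "\<delta> n = d / real (Suc n)" for n
  have \<delta>: "0 < \<delta> n" "\<delta> n \<le> d" for n using strip(2) by (auto simp: \<delta>_def field_simps)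
  have \<delta>0: "\<delta> \<longlonglongrightarrow> 0"
    using tendsto_mult_right_zero[OF LIMSEQ_inverse_real_of_nat, of d] by (simp add: \<delta>_def[abs_def] divide_inverse)
  \<comment> \<open>The step rises while \<open>- \<psi>\<close> runs from \<open>\<delta> n\<close>
    to \<open>2 * \<delta> n\<close>. Extending it by 0 outside \<open>U\<close> does no harm, since
    \<open>\<zeta>\<close> vanishes off \<open>K\<close> and \<open>K \<subseteq> U\<close>.\<close>
  define arg where "arg n x = - \<psi> x / \<delta> n - 1" for n x
  define c where "c n x = (if x \<in> U then smooth_step (arg n x) else 0)" for n x
  define c' where "c' n x = (if x \<in> U then s' (arg n x) / \<delta> n else 0)" for n x
  define \<phi> where "\<phi> n x = \<zeta> x * c n x" for n x
  define \<phi>' where "\<phi>' n x v = ?d\<zeta> x v * c n x - \<zeta> x * (c' n x * ?d\<psi> x v)" for n x v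
  have carg: "continuous_on U (arg n)" for n
    unfolding arg_def[abs_def] by (intro continuous_intros cont\<psi>) (use \<delta>(1)[of n] in auto)
  \<comment> \<open>The open sets \<open>U\<close> and the complement of \<open>K\<close> cover the
    space.\<close>
  have glue: "continuous_on UNIV h" if "continuous_on U h" "\<And>x. x \<notin> K \<Longrightarrow> h x = 0" for h :: "real^3 \<Rightarrow> real"
  proof -
    have "continuous_on (U \<union> - K) h"
    proof (rule continuous_on_open_Un[OF L(1) _ that(1)])
      show "open (- K)" using K(2) by (simp add: compact_imp_closed open_Compl)
      show "continuous_on (- K) h"
        by (rule continuous_on_eq[OF continuous_on_const[of _ 0]]) (use that(2) in auto)
    qed
    moreover have "U \<union> - K = UNIV" using KU by auto
    ultimately show ?thesis by simp
  qed
  have d\<phi>: "(\<phi> n has_derivative \<phi>' n x) (at x)" for n x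
  proof (cases "x \<in> U")
    case True
    have "((\<lambda>x. smooth_step (arg n x)) has_derivative (\<lambda>v. - ?d\<psi> x v / \<delta> n * s' (arg n x))) (at x)"
    proof -
      have "((arg n) has_derivative (\<lambda>v. - ?d\<psi> x v / \<delta> n)) (at x)"
        unfolding arg_def[abs_def] divide_inverse
        using has_derivative_diff[OF has_derivative_mult_left[OF has_derivative_minus[OF L(3)[OF True]]] has_derivative_const] by simp
      from has_derivative_compose[OF this s'(1)[unfolded has_field_derivative_def]] show ?thesis
        by (simp add: mult.commute)
    qed
    from has_derivative_mult[OF smooth_derivative(1)[OF K(1)] this]
    have "((\<lambda>x. \<zeta> x * smooth_step (arg n x)) has_derivative \<phi>' n x) (at x)"
      using True by (simp add: \<phi>'_def[abs_def] c_def c'_def algebra_simps)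
    then show ?thesis
      by (rule has_derivative_transform_within_open[OF _ L(1) True]) (simp add: \<phi>_def c_def)
  next
    case False
    then have "x \<notin> K" using KU by auto
    have "((\<lambda>x. 0) has_derivative \<phi>' n x) (at x)"
      using \<open>x \<notin> K\<close> K(4,5) by (simp add: \<phi>'_def[abs_def])
    then show ?thesis
      by (rule has_derivative_transform_within_open[where s="- K"])
        (use K(2,4) \<open>x \<notin> K\<close> in \<open>auto simp: compact_imp_closed open_Compl \<phi>_def\<close>)
  qed
  have cs: "continuous_on U (\<lambda>x. smooth_step (arg n x))" "continuous_on U (\<lambda>x. s' (arg n x))" for n
    by (rule continuous_on_compose2[OF smooth_continuous_on[OF smooth_step_smooth, of UNIV] carg], simp)
      (rule continuous_on_compose2[OF s'(2) carg], simp)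
  have cU: "continuous_on U (c n)" "continuous_on U (c' n)" for n
  proof -
    have "continuous_on U (\<lambda>x. s' (arg n x) / \<delta> n)"
      by (intro continuous_intros cs) (use \<delta>(1)[of n] in auto)
    then show "continuous_on U (c n)" "continuous_on U (c' n)"
      using cs(1)[of n] by (simp_all add: c_def c'_def cong: continuous_on_cong)
  qed
  have c1: "continuous_on UNIV (\<lambda>x. ?d\<zeta> x v * c n x)" and c2: "continuous_on UNIV (\<lambda>x. \<zeta> x * (c' n x * ?d\<psi> x v))"
    and c3: "continuous_on UNIV (\<lambda>x. \<zeta> x * c n x)" and c4: "continuous_on UNIV (\<lambda>x. \<zeta> x * c' n x)" for n v
    by (rule glue; (intro continuous_intros smooth_continuous_on smooth_derivative(2) K(1) cU L(4))?; simp add: K(4,5))+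
  have mult: "integrable ?M (\<lambda>x. a x * h x)"
    if "continuous_on UNIV a" "integrable ?M h" for a h :: "real^3 \<Rightarrow> real"
    by (rule integrable_continuous_mult[OF \<Omega>(2) continuous_on_subset[OF that(1)] that(2) \<Omega>s]) simp
  have i1: "integrable ?M (\<lambda>x. \<zeta> x * c n x * D i x)"
    and i2: "integrable ?M (\<lambda>x. ?d\<zeta> x (?e i) * c n x * (w x * G i x))"
    and i3: "integrable ?M (\<lambda>x. \<zeta> x * (c' n x * ?d\<psi> x (?e i)) * (w x * G i x))" for n i
    by (rule mult[OF c3 D(2)], rule mult[OF c1 D(3)], rule mult[OF c2 D(3)])
  \<comment> \<open>\<open>I\<close> is the integrand of the claim with the cutoff inserted,
    \<open>J\<close> collects the derivative of the cutoff. Their integrals agree because the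
    truncated test function is admissible in \<open>C1_test\<close>.\<close>
  define I where "I n x = (\<Sum>i\<in>UNIV. \<zeta> x * c n x * D i x + ?d\<zeta> x (?e i) * c n x * (w x * G i x))" for n x
  define J where "J n x = \<zeta> x * c' n x * (w x * r x)" for n x
  have iI: "integrable ?M (I n)" for n unfolding I_def[abs_def] using i1 i2 by auto
  have Jeq: "J n x = (\<Sum>i\<in>UNIV. \<zeta> x * (c' n x * ?d\<psi> x (?e i)) * (w x * G i x))" for n x
    by (simp add: J_def r_def sum_distrib_left algebra_simps)
  have iJ: "integrable ?M (J n)" for n unfolding Jeq[abs_def] using i3 by auto
  have IJ: "integral\<^sup>L ?M (I n) = integral\<^sup>L ?M (J n)" for n
  proof -
    define H where "H = {x \<in> K. \<psi> x \<le> - \<delta> n}"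
    have "closed H" unfolding H_def
      using K(2) KU by (intro continuous_on_closed_Collect_le continuous_intros continuous_on_subset[OF cont\<psi>])
        (auto simp: compact_imp_closed)
    then have H: "compact H" using K(2) by (auto simp: H_def compact_eq_bounded_closed intro: bounded_subset)
    have H\<Omega>: "H \<subseteq> \<Omega>" using KU L(6) \<delta>(1)[of n] by (force simp: H_def)
    have out: "\<zeta> x * c n x = 0" if "x \<notin> H" for x
    proof (cases "x \<in> K")
      case True
      then have "- \<psi> x / \<delta> n \<le> 1" using that \<delta>(1)[of n] by (auto simp: H_def field_simps)
      then show ?thesis by (simp add: c_def arg_def smooth_step_eq_0)
    qed (simp add: K(4))
    have C1: "integrable ?M (\<lambda>x. \<phi> n x * D i x + \<phi>' n x (?e i) * (w x * G i x))"
      "(\<integral>x. \<phi> n x * D i x + \<phi>' n x (?e i) * (w x * G i x) \<partial>?M) = 0" for i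
    proof -
      have "continuous_on UNIV (\<lambda>x. \<phi>' n x (?e i))" unfolding \<phi>'_def by (intro continuous_on_diff c1 c2)
      note * = C1_test[OF \<Omega>(1) D(1) d\<phi> this H H\<Omega>]
      show "integrable ?M (\<lambda>x. \<phi> n x * D i x + \<phi>' n x (?e i) * (w x * G i x))"
        "(\<integral>x. \<phi> n x * D i x + \<phi>' n x (?e i) * (w x * G i x) \<partial>?M) = 0"
        using * out by (simp_all add: \<phi>_def)
    qed
    have "I n x - J n x = (\<Sum>i\<in>UNIV. \<phi> n x * D i x + \<phi>' n x (?e i) * (w x * G i x))" for x
      unfolding I_def Jeq sum_subtractf[symmetric] by (intro sum.cong) (auto simp: \<phi>_def \<phi>'_def algebra_simps)
    then have "(\<integral>x. I n x - J n x \<partial>?M) = 0"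
      using C1 by simp
    then show ?thesis using iI iJ by simp
  qed
  have "(\<lambda>n. integral\<^sup>L ?M (J n)) \<longlonglongrightarrow> 0"
  proof (rule tendstoI)
    fix \<epsilon> :: real assume \<epsilon>: "0 < \<epsilon>"
    \<comment> \<open>Chosen so that the final bound is \<open>\<epsilon>\<close> times
      \<open>(Q - 1) / Q\<close>, which is below \<open>\<epsilon>\<close>; the summand 1 also makes
      \<open>Q\<close> positive.\<close>
    define Q where "Q = M * Ms * \<bar>B\<bar> * C + 1"
    have Q: "0 < Q" using M(1) Ms strip(3) by (simp add: Q_def add_nonneg_pos)
    obtain t where t: "0 < t" "\<And>x. x \<in> K \<inter> \<Omega> \<Longrightarrow> - (2 * t) < \<psi> x \<Longrightarrow> \<bar>r x\<bar> \<le> \<epsilon> / Q"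
      using small[of "\<epsilon> / Q"] \<epsilon> Q by auto
    have "\<forall>\<^sub>F n in sequentially. \<delta> n < t" using \<delta>0 t(1) by (rule order_tendstoD)
    then show "\<forall>\<^sub>F n in sequentially. dist (integral\<^sup>L ?M (J n)) 0 < \<epsilon>"
    proof eventually_elim
      fix n assume n: "\<delta> n < t"
      define S where "S = {y \<in> ball x0 \<rho>. - (2 * \<delta> n) < \<psi> y \<and> \<psi> y < 0}"
      have S: "S \<in> lmeasurable" "measure lebesgue S \<le> C * \<delta> n" using strip(4)[OF \<delta>] by (auto simp: S_def)
      have S\<Omega>: "S \<subseteq> \<Omega>" using L(6) strip(1) by (auto simp: S_def)
      \<comment> \<open>The factor \<open>1 / \<delta> n\<close> of the cutoff gradient is
        compensated by the measure of the strip, and the smallness comes from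
        \<open>r\<close>.\<close>
      have bound: "\<bar>J n x\<bar> \<le> M * (Ms / \<delta> n) * (\<bar>B\<bar> * (\<epsilon> / Q)) * indicator S x" if x: "x \<in> \<Omega>" for x
      proof (cases "x \<in> K \<and> - (2 * \<delta> n) < \<psi> x")
        case True
        then have "x \<in> S" using K(3) KU L(6) x by (auto simp: S_def)
        have "\<bar>r x\<bar> \<le> \<epsilon> / Q" using t(2)[of x] True x n by auto
        moreover have "\<bar>c' n x\<bar> \<le> Ms / \<delta> n"
          using s'(3)[of "arg n x"] \<delta>(1)[of n] Ms by (auto simp: c'_def divide_right_mono)
        moreover have "\<bar>w x\<bar> \<le> \<bar>B\<bar>" using w[OF x] by linarith
        ultimately have "\<bar>J n x\<bar> \<le> M * (Ms / \<delta> n) * (\<bar>B\<bar> * (\<epsilon> / Q))"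
          unfolding J_def abs_mult using M Ms \<delta>(1)[of n] Q \<epsilon> by (intro mult_mono) auto
        then show ?thesis using \<open>x \<in> S\<close> by simp
      next
        case False
        then have "\<zeta> x * c' n x = 0"
        proof (cases "x \<in> K")
          case True
          with False have "1 \<le> arg n x" using \<delta>(1)[of n] by (auto simp: arg_def field_simps)
          then show ?thesis by (simp add: c'_def s'(5))
        qed (simp add: K(4))
        then have "J n x = 0" by (simp only: J_def mult_zero_left)
        then show ?thesis using M Ms \<delta>(1)[of n] Q \<epsilon> by (simp add: zero_le_mult_iff)
      qed
      have iS: "integrable ?M (\<lambda>x. M * (Ms / \<delta> n) * (\<bar>B\<bar> * (\<epsilon> / Q)) * indicator S x :: real)"
        and eS: "(\<integral>x. (indicator S x :: real) \<partial>?M) = measure lebesgue S"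
      proof -
        have [simp]: "indicator \<Omega> x * indicator S x = (indicator S x :: real)" for x
          using S\<Omega> by (auto simp: indicator_def)
        show "integrable ?M (\<lambda>x. M * (Ms / \<delta> n) * (\<bar>B\<bar> * (\<epsilon> / Q)) * indicator S x :: real)"
          using S(1) \<Omega>s
          by (intro integrable_mult_right, subst integrable_restrict_space) (auto simp: fmeasurable_def integrable_indicator_iff)
        show "(\<integral>x. (indicator S x :: real) \<partial>?M) = measure lebesgue S"
          using S(1) \<Omega>s by (subst integral_restrict_space) auto
      qed
      have "\<bar>integral\<^sup>L ?M (J n)\<bar> \<le> (\<integral>x. M * (Ms / \<delta> n) * (\<bar>B\<bar> * (\<epsilon> / Q)) * indicator S x \<partial>?M)"
        by (rule integral_abs_bound_integral[OF iJ iS]) (use bound in auto)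
      also have "\<dots> = M * (Ms / \<delta> n) * (\<bar>B\<bar> * (\<epsilon> / Q)) * measure lebesgue S"
        by (simp only: integral_mult_right_zero eS)
      also have "\<dots> \<le> M * (Ms / \<delta> n) * (\<bar>B\<bar> * (\<epsilon> / Q)) * (C * \<delta> n)"
        using M Ms \<delta>(1)[of n] Q \<epsilon> by (intro mult_left_mono S(2)) (auto simp: zero_le_mult_iff)
      also have "\<dots> = \<epsilon> * ((Q - 1) / Q)" using \<delta>(1)[of n] by (simp add: Q_def)
      also have "\<dots> < \<epsilon> * 1" using \<epsilon> Q by (intro mult_strict_left_mono) (auto simp: divide_less_eq)
      finally show "dist (integral\<^sup>L ?M (J n)) 0 < \<epsilon>" by simp
    qed
  qed
  moreover have "(\<lambda>n. integral\<^sup>L ?M (I n)) \<longlonglongrightarrow>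
      (\<integral>x. (\<Sum>i\<in>UNIV. \<zeta> x * D i x + ?d\<zeta> x (?e i) * (w x * G i x)) \<partial>?M)"
  proof (rule integral_dominated_convergence)
    have f1: "integrable ?M (\<lambda>x. \<zeta> x * D i x)" "integrable ?M (\<lambda>x. ?d\<zeta> x (?e i) * (w x * G i x))" for i
      by (rule mult[OF smooth_continuous_on[OF K(1)] D(2)],
          rule mult[OF smooth_continuous_on[OF smooth_derivative(2)[OF K(1)]] D(3)])
    show "integrable ?M (\<lambda>x. \<Sum>i\<in>UNIV. \<bar>\<zeta> x * D i x\<bar> + \<bar>?d\<zeta> x (?e i) * (w x * G i x)\<bar>)"
      using f1 by auto
    show "(\<lambda>x. \<Sum>i\<in>UNIV. \<zeta> x * D i x + ?d\<zeta> x (?e i) * (w x * G i x)) \<in> borel_measurable ?M"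
      using f1 by (intro borel_measurable_integrable) auto
    have c01: "0 \<le> c n x" "c n x \<le> 1" for n x
      using smooth_step_nonneg smooth_step_le_1 by (auto simp: c_def)
    show "AE x in ?M. norm (I n x) \<le> (\<Sum>i\<in>UNIV. \<bar>\<zeta> x * D i x\<bar> + \<bar>?d\<zeta> x (?e i) * (w x * G i x)\<bar>)" for n
    proof (rule AE_I2)
      fix x
      have *: "\<bar>a * c n x * b\<bar> \<le> \<bar>a * b\<bar>" for a b
        using c01[of n x] mult_left_le[of "c n x" "\<bar>a * b\<bar>"] by (simp add: abs_mult mult_ac)
      show "norm (I n x) \<le> (\<Sum>i\<in>UNIV. \<bar>\<zeta> x * D i x\<bar> + \<bar>?d\<zeta> x (?e i) * (w x * G i x)\<bar>)"
        unfolding I_def real_norm_def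
        by (intro order_trans[OF sum_abs sum_mono] order_trans[OF abs_triangle_ineq add_mono] *)
    qed
    show "AE x in ?M. (\<lambda>n. I n x) \<longlonglongrightarrow> (\<Sum>i\<in>UNIV. \<zeta> x * D i x + ?d\<zeta> x (?e i) * (w x * G i x))"
    proof (rule AE_I2)
      fix x assume "x \<in> space ?M"
      then have x: "x \<in> \<Omega>" by simp
      show "(\<lambda>n. I n x) \<longlonglongrightarrow> (\<Sum>i\<in>UNIV. \<zeta> x * D i x + ?d\<zeta> x (?e i) * (w x * G i x))"
      proof (cases "x \<in> K")
        case True
        then have neg: "\<psi> x < 0" and xU: "x \<in> U" using L(6) KU x by auto
        then have "\<forall>\<^sub>F n in sequentially. \<delta> n < - \<psi> x / 2" by (intro order_tendstoD[OF \<delta>0]) auto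
        then have "\<forall>\<^sub>F n in sequentially. (\<Sum>i\<in>UNIV. \<zeta> x * D i x + ?d\<zeta> x (?e i) * (w x * G i x)) = I n x"
        proof eventually_elim
          fix n assume "\<delta> n < - \<psi> x / 2"
          then have "1 \<le> arg n x" using \<delta>(1)[of n] by (simp add: arg_def field_simps)
          then show "(\<Sum>i\<in>UNIV. \<zeta> x * D i x + ?d\<zeta> x (?e i) * (w x * G i x)) = I n x"
            using xU by (simp add: I_def c_def smooth_step_eq_1)
        qed
        then show ?thesis by (rule Lim_transform_eventually[OF tendsto_const])
      qed (simp add: I_def K(4,5))
    qed
  qed (rule borel_measurable_integrable[OF iI])
  ultimately show ?thesis
    unfolding IJ by (rule LIMSEQ_unique[rotated])
qed

text \<open>Localisation: around every boundary point some cutoff reduces the claim to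
  \<open>divergence_near_boundary\<close>, and compactness of the frontier leaves finitely many of
  them. What remains is supported away from the boundary.\<close>

lemma divergence_bounded:
  fixes w :: "real^3 \<Rightarrow> real" and G D :: "3 \<Rightarrow> real^3 \<Rightarrow> real"
  assumes \<Omega>: "open \<Omega>" "bounded \<Omega>" "Ck_boundary (Suc k) \<Omega>"
    and G: "\<And>i. continuous_on (closure \<Omega>) (G i)"
      "\<And>x. x \<in> frontier \<Omega> \<Longrightarrow> (\<Sum>i\<in>UNIV. outward_normal \<Omega> x $ i * G i x) = 0"
    and w: "\<And>x. x \<in> \<Omega> \<Longrightarrow> \<bar>w x\<bar> \<le> B"
    and D: "\<And>i. has_weak_partial \<Omega> i (\<lambda>x. w x * G i x) (D i)" "\<And>i. integrable (lebesgue_on \<Omega>) (D i)"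
      "\<And>i. integrable (lebesgue_on \<Omega>) (\<lambda>x. w x * G i x)"
  shows "(\<integral>x. (\<Sum>i\<in>UNIV. D i x) \<partial>lebesgue_on \<Omega>) = 0"
proof -
  let ?M = "lebesgue_on \<Omega>"
  note \<Omega>s = open_sets_lebesgue[OF \<Omega>(1)]
  define f where "f \<zeta> i x = \<zeta> x * D i x + frechet_derivative \<zeta> (at x) (axis i 1) * (w x * G i x)" for \<zeta> i x
  \<comment> \<open>The integral of the divergence of \<open>\<zeta> w G\<close>, linear in
    \<open>\<zeta>\<close>; the claim is that it vanishes for the constant 1.\<close>
  define Q where "Q \<zeta> = (\<integral>x. (\<Sum>i\<in>UNIV. f \<zeta> i x) \<partial>?M)" for \<zeta> :: "real^3 \<Rightarrow> real"
  have mult: "integrable ?M (\<lambda>x. a x * h x)"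
    if "continuous_on UNIV a" "integrable ?M h" for a h :: "real^3 \<Rightarrow> real"
    by (rule integrable_continuous_mult[OF \<Omega>(2) continuous_on_subset[OF that(1)] that(2) \<Omega>s]) simp
  have int: "integrable ?M (\<lambda>x. f \<zeta> i x)" if "smooth \<zeta>" for \<zeta> i
    unfolding f_def by (intro Bochner_Integration.integrable_add mult smooth_continuous_on that smooth_derivative(2) D)
  have vanish: "Q \<zeta> = 0" if \<zeta>: "smooth \<zeta>" and N: "open N" "frontier \<Omega> \<subseteq> N" "\<And>x. x \<in> N \<Longrightarrow> \<zeta> x = 0" for \<zeta> N
  proof -
    define C where "C = closure \<Omega> - N"
    have "closed C" using N(1) by (simp add: C_def closed_Diff)
    then have C: "compact C" using \<Omega>(2) by (auto simp: C_def compact_eq_bounded_closed intro: bounded_subset[OF bounded_closure])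
    have C\<Omega>: "C \<subseteq> \<Omega>" using N(2) \<Omega>(1) by (auto simp: C_def frontier_def interior_open)
    have out: "\<zeta> x = 0" "frechet_derivative \<zeta> (at x) v = 0" if "x \<in> \<Omega>" "x \<notin> C" for x v
    proof -
      have xN: "x \<in> N" using that closure_subset[of \<Omega>] by (auto simp: C_def)
      have "((\<lambda>x. 0) has_derivative frechet_derivative \<zeta> (at x)) (at x)"
        by (rule has_derivative_transform_within_open[OF smooth_derivative(1)[OF \<zeta>] N(1) xN]) (use N(3) in auto)
      then have "frechet_derivative \<zeta> (at x) = (\<lambda>v. 0)" by (rule has_derivative_unique) simp
      then show "\<zeta> x = 0" "frechet_derivative \<zeta> (at x) v = 0" using N(3)[OF xN] by simp_all
    qed
    have loc: "locally_integrable_on (\<lambda>x. a x * h x) \<Omega>"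
      if "continuous_on UNIV a" "integrable ?M h" for a h :: "real^3 \<Rightarrow> real"
      by (rule locally_integrable_integrable[OF mult[OF that] \<Omega>(1)])
    have "(\<integral>x. f \<zeta> i x \<partial>?M) = 0" for i
    proof -
      have "has_weak_partial \<Omega> i (\<lambda>x. \<zeta> x * (w x * G i x)) (\<lambda>x. f \<zeta> i x)"
        unfolding f_def by (intro has_weak_partial_mult[OF \<Omega>(1) classical_weak_partial[OF \<Omega>(1) smooth_derivative(1)[OF \<zeta>]] D(1)] loc
            smooth_continuous_on \<zeta> smooth_derivative(2)[OF \<zeta>] D)
      from integral_weak_partial_compact_support[OF \<Omega>(1) this C C\<Omega>] out show ?thesis by (simp add: f_def)
    qed
    then show ?thesis unfolding Q_def using int[OF \<zeta>] by simp
  qed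
  have "\<exists>r b. 0 < r \<and> smooth b \<and> (\<forall>y. dist x y < r \<longrightarrow> b y = 1) \<and> (\<forall>\<zeta>. smooth \<zeta> \<longrightarrow> Q (\<lambda>y. \<zeta> y * b y) = 0)"
    if x: "x \<in> frontier \<Omega>" for x
  proof -
    obtain U \<psi> where "local_defining_function (Suc k) \<Omega> x U \<psi>" using \<Omega>(3) x by (auto simp: Ck_boundary_def)
    then have ldf: "local_defining_function (Suc 0) \<Omega> x U \<psi>" by (rule local_defining_function_lower)
    obtain \<rho> C d where \<rho>: "0 < \<rho>" and strip: "ball x \<rho> \<subseteq> U" "0 < d" "0 \<le> C"
      "\<And>\<delta>. 0 < \<delta> \<Longrightarrow> \<delta> \<le> d \<Longrightarrow> {y \<in> ball x \<rho>. - (2 * \<delta>) < \<psi> y \<and> \<psi> y < 0} \<in> lmeasurable \<and>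
       measure lebesgue {y \<in> ball x \<rho>. - (2 * \<delta>) < \<psi> y \<and> \<psi> y < 0} \<le> C * \<delta>"
      by (rule local_defining_function_strip[OF ldf]) blast
    obtain b where b: "test_function (ball x \<rho>) b" "\<And>y. y \<in> cball x (\<rho> / 2) \<Longrightarrow> b y = 1"
      by (rule test_function_cutoff[of "cball x (\<rho> / 2)" "ball x \<rho>"]) (use \<rho> in auto)
    obtain K where K: "smooth b" "compact K" "K \<subseteq> ball x \<rho>" "\<And>y. y \<notin> K \<Longrightarrow> b y = 0"
      by (rule test_functionD[OF b(1)]) blast
    have "Q (\<lambda>y. \<zeta> y * b y) = 0" if "smooth \<zeta>" for \<zeta>
    proof -
      have "test_function (ball x \<rho>) (\<lambda>y. \<zeta> y * b y)"
        by (rule test_functionI[OF smooth_mult[OF that K(1)] K(2,3)]) (simp add: K(4))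
      from divergence_near_boundary[OF \<Omega>(1,2) ldf strip G w D this] show ?thesis
        by (simp add: Q_def f_def)
    qed
    then show ?thesis using \<rho> b(2) K(1) by (intro exI[of _ "\<rho> / 2"] exI[of _ b]) auto
  qed
  then have "\<forall>x\<in>frontier \<Omega>. \<exists>p. 0 < fst p \<and> smooth (snd p) \<and> (\<forall>y. dist x y < fst p \<longrightarrow> snd p y = 1) \<and>
      (\<forall>\<zeta>. smooth \<zeta> \<longrightarrow> Q (\<lambda>y. \<zeta> y * snd p y) = 0)"
    by fastforce
  then obtain p where p: "\<forall>x\<in>frontier \<Omega>. 0 < fst (p x) \<and> smooth (snd (p x)) \<and> (\<forall>y. dist x y < fst (p x) \<longrightarrow> snd (p x) y = 1) \<and>
      (\<forall>\<zeta>. smooth \<zeta> \<longrightarrow> Q (\<lambda>y. \<zeta> y * snd (p x) y) = 0)"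
    by (rule bchoice[THEN exE])
  define r b where "r = fst \<circ> p" and "b = snd \<circ> p"
  have rb: "\<And>x. x \<in> frontier \<Omega> \<Longrightarrow> 0 < r x" "\<And>x. x \<in> frontier \<Omega> \<Longrightarrow> smooth (b x)"
    "\<And>x y. x \<in> frontier \<Omega> \<Longrightarrow> dist x y < r x \<Longrightarrow> b x y = 1"
    "\<And>x \<zeta>. x \<in> frontier \<Omega> \<Longrightarrow> smooth \<zeta> \<Longrightarrow> Q (\<lambda>y. \<zeta> y * b x y) = 0"
    using p by (simp_all add: r_def b_def)
  have "compact (frontier \<Omega>)" using \<Omega>(2) by (simp add: compact_frontier_bounded)
  then obtain I where I: "I \<subseteq> frontier \<Omega>" "finite I" "frontier \<Omega> \<subseteq> (\<Union>x\<in>I. ball x (r x))"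
    by (rule compactE_image[of _ "frontier \<Omega>" "\<lambda>x. ball x (r x)"]) (use rb(1) in force)+
  \<comment> \<open>A product of factors \<open>1 - b x\<close> in place of a partition of unity:
    each step splits off \<open>\<zeta>\<close> times \<open>b x\<close>, on which \<open>Q\<close>
    vanishes, and the full product is 0 on the balls covering the frontier.\<close>
  have split: "Q \<zeta> = Q (\<lambda>y. \<zeta> y * (\<Prod>x\<in>J. 1 - b x y))" if "finite J" "J \<subseteq> frontier \<Omega>" "smooth \<zeta>" for J \<zeta>
    using that
  proof (induction J arbitrary: \<zeta> rule: finite_induct)
    case (insert x J)
    have s1: "smooth (\<lambda>y. \<zeta> y * b x y)" "smooth (\<lambda>y. \<zeta> y * (1 - b x y))"
      using insert.prems by (auto intro!: smooth_mult smooth_diff smooth_const rb(2))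
    have "f \<zeta> i y = f (\<lambda>y. \<zeta> y * b x y) i y + f (\<lambda>y. \<zeta> y * (1 - b x y)) i y" for i y
    proof -
      have "frechet_derivative \<zeta> (at y) = (\<lambda>v. frechet_derivative (\<lambda>y. \<zeta> y * b x y) (at y) v +
          frechet_derivative (\<lambda>y. \<zeta> y * (1 - b x y)) (at y) v)"
        using has_derivative_add[OF smooth_derivative(1)[OF s1(1)] smooth_derivative(1)[OF s1(2)], of y]
        by (intro frechet_derivative_at[symmetric]) (simp add: algebra_simps)
      then show ?thesis unfolding f_def by (simp add: algebra_simps)
    qed
    then have "Q \<zeta> = Q (\<lambda>y. \<zeta> y * b x y) + Q (\<lambda>y. \<zeta> y * (1 - b x y))"
      unfolding Q_def using int[OF s1(1)] int[OF s1(2)] by (simp add: sum.distrib)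
    also have "Q (\<lambda>y. \<zeta> y * b x y) = 0" using insert.prems by (intro rb(4)) auto
    also have "Q (\<lambda>y. \<zeta> y * (1 - b x y)) = Q (\<lambda>y. \<zeta> y * (1 - b x y) * (\<Prod>x\<in>J. 1 - b x y))"
      using insert s1(2) by blast
    finally show ?case using insert.hyps by (simp add: mult.assoc)
  qed simp
  have "Q (\<lambda>y. 1) = Q (\<lambda>y. 1 * (\<Prod>x\<in>I. 1 - b x y))" by (rule split[OF I(2,1)]) auto
  also have "\<dots> = 0"
  proof (rule vanish)
    show "smooth (\<lambda>y. 1 * (\<Prod>x\<in>I. 1 - b x y))"
      using I(1) by (intro smooth_mult smooth_const smooth_prod smooth_diff rb(2)) auto
    show "open (\<Union>x\<in>I. ball x (r x))" by auto
    show "1 * (\<Prod>x\<in>I. 1 - b x y) = 0" if "y \<in> (\<Union>x\<in>I. ball x (r x))" for y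
      using that I(1,2) rb(3) by (auto intro!: prod_zero)
  qed (rule I(3))
  finally show ?thesis
    by (simp add: Q_def f_def frechet_derivative_const)
qed

text \<open>An unbounded \<open>w\<close> is reached through the sine truncations. They shrink every
  product in modulus, so the integrands without truncation dominate.\<close>

lemma divergence_theorem_zero_flux:
  fixes w :: "real^3 \<Rightarrow> real" and G D w' :: "3 \<Rightarrow> real^3 \<Rightarrow> real"
  assumes \<Omega>: "open \<Omega>" "bounded \<Omega>" "Ck_boundary (Suc k) \<Omega>"
    and G: "\<And>i. continuous_on (closure \<Omega>) (G i)"
      "\<And>x. x \<in> frontier \<Omega> \<Longrightarrow> (\<Sum>i\<in>UNIV. outward_normal \<Omega> x $ i * G i x) = 0"
    and D: "\<And>i. has_weak_partial \<Omega> i (G i) (D i)" "\<And>i. integrable (lebesgue_on \<Omega>) (D i)"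
    and w: "\<And>i. has_weak_partial \<Omega> i w (w' i)" "integrable (lebesgue_on \<Omega>) w" "\<And>i. integrable (lebesgue_on \<Omega>) (w' i)"
    and wD: "\<And>i. integrable (lebesgue_on \<Omega>) (\<lambda>x. w x * D i x)"
  shows "(\<integral>x. (\<Sum>i\<in>UNIV. w x * D i x + w' i x * G i x) \<partial>lebesgue_on \<Omega>) = 0"
proof -
  let ?M = "lebesgue_on \<Omega>"
  note \<Omega>s = open_sets_lebesgue[OF \<Omega>(1)]
  define T where "T n a = real (Suc n) * sin (a / real (Suc n))" for n a
  have T: "\<bar>T n a\<bar> \<le> \<bar>a\<bar>" "\<bar>T n a\<bar> \<le> Suc n" "(\<lambda>n. T n a) \<longlonglongrightarrow> a" for n a
    using sine_truncation_le sine_truncation_tendsto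
    by (auto simp: T_def[abs_def] abs_mult mult_left_le simp del: of_nat_Suc)
  have DT: "(T n has_derivative (\<lambda>v. v * cos (a / real (Suc n)))) (at a)" for n a
    unfolding T_def[abs_def] by (auto intro!: derivative_eq_intros simp: field_simps simp del: of_nat_Suc)
  have c1: "\<bar>cos (a / real (Suc n)) * b\<bar> \<le> \<bar>b\<bar>" for n and a b :: real
    using mult_right_mono[OF abs_cos_le_one, of "\<bar>b\<bar>" "a / real (Suc n)"] by (simp add: abs_mult del: of_nat_Suc)
  have cc: "continuous_on UNIV (\<lambda>a. v * cos (a / real (Suc n)))" for v :: real and n
    by (intro continuous_intros) auto
  have wT: "has_weak_partial \<Omega> i (\<lambda>x. T n (w x)) (\<lambda>x. w' i x * cos (w x / real (Suc n)))" for n i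
    using has_weak_partial_chain[OF \<Omega>(1) w(1), where S=UNIV and G="T n" and G'="\<lambda>a v. v * cos (a / real (Suc n))" and L=1 and B=0 and i=i]
      DT c1 cc by (auto simp: mult.commute simp del: of_nat_Suc)
  have wG: "integrable ?M (\<lambda>x. w' i x * G i x)" "integrable ?M (\<lambda>x. w x * G i x)" for i
    using integrable_continuous_mult[OF \<Omega>(2) G(1) w(3) \<Omega>s, of i i] integrable_continuous_mult[OF \<Omega>(2) G(1) w(2) \<Omega>s, of i]
    by (simp_all add: mult.commute)
  have [measurable]: "w \<in> borel_measurable ?M" "w' i \<in> borel_measurable ?M"
    "D i \<in> borel_measurable ?M" "G i \<in> borel_measurable ?M" for i
    using w(2,3) D by (auto intro: borel_measurable_integrable locally_integrable_measurable[OF \<Omega>(1)] has_weak_partialD)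
  have [measurable]: "(\<lambda>x. T n (w x)) \<in> borel_measurable ?M" for n
    unfolding T_def by measurable
  let ?D = "\<lambda>n i x. T n (w x) * D i x + (w' i x * cos (w x / real (Suc n))) * G i x"
  have i1: "integrable ?M (\<lambda>x. T n (w x) * D i x)" for n i
    by (rule Bochner_Integration.integrable_bound[OF wD[of i]]) (auto simp: abs_mult intro!: mult_right_mono T(1))
  have i2: "integrable ?M (\<lambda>x. w' i x * cos (w x / real (Suc n)) * G i x)" for n i
  proof (rule Bochner_Integration.integrable_bound[OF wG(1)[of i]])
    show "AE x in ?M. norm (w' i x * cos (w x / real (Suc n)) * G i x) \<le> norm (w' i x * G i x)"
    proof (rule AE_I2)
      fix x
      show "norm (w' i x * cos (w x / real (Suc n)) * G i x) \<le> norm (w' i x * G i x)"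
        using c1[of "w x" n "w' i x * G i x"] by (simp add: mult_ac del: of_nat_Suc)
    qed
  qed measurable
  have i3: "integrable ?M (\<lambda>x. T n (w x) * G i x)" for n i
    by (rule Bochner_Integration.integrable_bound[OF wG(2)[of i]]) (auto simp: abs_mult intro!: mult_right_mono T(1))
  have zero: "(\<integral>x. (\<Sum>i\<in>UNIV. ?D n i x) \<partial>?M) = 0" for n
  proof (rule divergence_bounded[OF \<Omega> G])
    show "\<bar>T n (w x)\<bar> \<le> Suc n" for x by (rule T(2))
    show "has_weak_partial \<Omega> i (\<lambda>x. T n (w x) * G i x) (?D n i)" for i
      by (intro has_weak_partial_mult[OF \<Omega>(1) wT D(1)] locally_integrable_integrable[OF _ \<Omega>(1)] i1 i2 i3)
  qed (use i1 i2 i3 in auto)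
  have "(\<lambda>n. \<integral>x. (\<Sum>i\<in>UNIV. ?D n i x) \<partial>?M) \<longlonglongrightarrow> (\<integral>x. (\<Sum>i\<in>UNIV. w x * D i x + w' i x * 1 * G i x) \<partial>?M)"
  proof (rule integral_dominated_convergence)
    show "integrable ?M (\<lambda>x. \<Sum>i\<in>UNIV. \<bar>w x * D i x\<bar> + \<bar>w' i x * G i x\<bar>)" using wD wG by auto
    show "AE x in ?M. (\<lambda>n. \<Sum>i\<in>UNIV. ?D n i x) \<longlonglongrightarrow> (\<Sum>i\<in>UNIV. w x * D i x + w' i x * 1 * G i x)"
      by (intro AE_I2 tendsto_sum tendsto_add tendsto_mult T(3) cosine_truncation_tendsto tendsto_const)
    show "AE x in ?M. norm (\<Sum>i\<in>UNIV. ?D n i x) \<le> (\<Sum>i\<in>UNIV. \<bar>w x * D i x\<bar> + \<bar>w' i x * G i x\<bar>)" for n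
      unfolding real_norm_def
    proof (intro AE_I2 order_trans[OF sum_abs sum_mono] order_trans[OF abs_triangle_ineq add_mono])
      show "\<bar>T n (w x) * D i x\<bar> \<le> \<bar>w x * D i x\<bar>" for x i by (auto simp: abs_mult intro!: mult_right_mono T(1))
      show "\<bar>w' i x * cos (w x / real (Suc n)) * G i x\<bar> \<le> \<bar>w' i x * G i x\<bar>" for x i
        using c1[of "w x" n "w' i x * G i x"] by (simp add: mult_ac del: of_nat_Suc)
    qed
  qed measurable
  then show ?thesis unfolding zero by (simp add: LIMSEQ_const_iff)
qed

section \<open>Functionals along weakly differentiable curves\<close>

text \<open>\<open>X\<close> is the carrier of the Bochner theory, \<open>Y\<close> a larger space
  in which linear combinations are formed. Simple integrals of functions with values in
  \<open>X\<close> are only claimed to lie in \<open>Y\<close>, so the linear structure has to be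
  verified for \<open>Y\<close>.\<close>

locale bounded_functional =
  fixes X Y :: "('a \<Rightarrow> 'b::real_vector) set" and N :: "('a \<Rightarrow> 'b) \<Rightarrow> real" and l :: "('a \<Rightarrow> 'b) \<Rightarrow> real" and K :: real
  assumes XY: "X \<subseteq> Y" and zero: "(\<lambda>x. 0) \<in> Y"
    and add: "\<And>y z. y \<in> Y \<Longrightarrow> z \<in> Y \<Longrightarrow> (\<lambda>x. y x + z x) \<in> Y \<and> l (\<lambda>x. y x + z x) = l y + l z"
    and scale: "\<And>c y. y \<in> Y \<Longrightarrow> (\<lambda>x. c *\<^sub>R y x) \<in> Y \<and> l (\<lambda>x. c *\<^sub>R y x) = c * l y"
    and bound: "\<And>y. y \<in> Y \<Longrightarrow> \<bar>l y\<bar> \<le> K * N y" and K: "0 < K"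
begin

lemma diff: "y \<in> Y \<Longrightarrow> z \<in> Y \<Longrightarrow> (\<lambda>x. y x - z x) \<in> Y \<and> l (\<lambda>x. y x - z x) = l y - l z"
  using add[of y "\<lambda>x. (-1) *\<^sub>R z x"] scale[of z "-1"] by simp

lemma sum_mem:
  assumes "finite A" "A \<subseteq> Y"
  shows "(\<lambda>x. \<Sum>a\<in>A. c a *\<^sub>R a x) \<in> Y \<and> l (\<lambda>x. \<Sum>a\<in>A. c a *\<^sub>R a x) = (\<Sum>a\<in>A. c a * l a)"
  using assms
proof (induction A)
  case empty
  show ?case using zero scale[OF zero, of 0] by simp
next
  case (insert a A)
  then show ?case using add[of "\<lambda>x. c a *\<^sub>R a x" "\<lambda>x. \<Sum>a\<in>A. c a *\<^sub>R a x"] scale[of a "c a"] by auto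
qed

lemma lipschitz: "y \<in> Y \<Longrightarrow> z \<in> Y \<Longrightarrow> \<bar>l y - l z\<bar> \<le> K * N (\<lambda>x. y x - z x)"
  using diff[of y z] bound[of "\<lambda>x. y x - z x"] by simp

lemma simple:
  assumes s: "simple_into J X s" and J: "J \<in> lmeasurable"
  shows "integrable (lebesgue_on J) (\<lambda>t. l (s t))" "(\<integral>t. l (s t) \<partial>lebesgue_on J) = l (simple_integral J s)"
proof -
  let ?J = "\<lambda>a. {t \<in> J. s t = a}"
  note * = s[unfolded simple_into_def]
  have Js: "J \<in> sets lebesgue" using J by (simp add: fmeasurableD)
  have set: "?J a \<in> lmeasurable" for a
    using * by (intro fmeasurableI2[OF J]) auto
  have eq: "l (s t) = (\<Sum>a\<in>s ` J. l a * indicator (?J a) t)" if "t \<in> J" for t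
  proof -
    have "(\<Sum>a\<in>s ` J. l a * indicator (?J a) t) = (\<Sum>a\<in>s ` J. if a = s t then l a else 0)"
      using that by (intro sum.cong) (auto simp: indicator_def)
    then show ?thesis using * that by (simp add: sum.delta)
  qed
  have i: "integrable (lebesgue_on J) (\<lambda>t. indicator (?J a) t :: real)"
    and m: "(\<integral>t. (indicator (?J a) t :: real) \<partial>lebesgue_on J) = measure lebesgue (?J a)" for a
  proof -
    have [simp]: "indicator J t * indicator (?J a) t = (indicator (?J a) t :: real)" for t
      by (auto simp: indicator_def)
    show "integrable (lebesgue_on J) (\<lambda>t. indicator (?J a) t :: real)"
      using set[of a] Js by (subst integrable_restrict_space) (auto simp: fmeasurable_def integrable_indicator_iff)
    show "(\<integral>t. (indicator (?J a) t :: real) \<partial>lebesgue_on J) = measure lebesgue (?J a)"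
      using set[of a] Js by (subst integral_restrict_space) auto
  qed
  have "integrable (lebesgue_on J) (\<lambda>t. \<Sum>a\<in>s ` J. l a * indicator (?J a) t)"
    using i by auto
  then show "integrable (lebesgue_on J) (\<lambda>t. l (s t))"
    by (rule Bochner_Integration.integrable_cong[THEN iffD1, rotated 2]) (use eq in auto)
  have "(\<integral>t. l (s t) \<partial>lebesgue_on J) = (\<integral>t. (\<Sum>a\<in>s ` J. l a * indicator (?J a) t) \<partial>lebesgue_on J)"
    by (rule Bochner_Integration.integral_cong) (use eq in auto)
  also have "\<dots> = (\<Sum>a\<in>s ` J. l a * measure lebesgue (?J a))"
  proof -
    have "(\<integral>t. (\<Sum>a\<in>s ` J. l a * indicator (?J a) t) \<partial>lebesgue_on J) =
        (\<Sum>a\<in>s ` J. \<integral>t. l a * indicator (?J a) t \<partial>lebesgue_on J)"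
      by (rule Bochner_Integration.integral_sum) (intro integrable_mult_right i)
    then show ?thesis by (simp only: integral_mult_right_zero m)
  qed
  also have "\<dots> = l (simple_integral J s)"
    unfolding simple_integral_def using sum_mem[of "s ` J" "\<lambda>a. measure lebesgue (?J a)"] * XY
    by (auto simp: mult.commute)
  finally show "(\<integral>t. l (s t) \<partial>lebesgue_on J) = l (simple_integral J s)" .
qed

lemma simple_integral_mem: "simple_into J X s \<Longrightarrow> simple_integral J s \<in> Y"
  unfolding simple_integral_def using sum_mem[of "s ` J" "\<lambda>a. measure lebesgue {t \<in> J. s t = a}"] XY
  by (auto simp: simple_into_def)

lemma measurable:
  assumes f: "strongly_measurable X N J f" and J: "(J :: real set) \<in> lmeasurable"
  shows "(\<lambda>t. l (f t)) \<in> borel_measurable (lebesgue_on J)" "AE t in lebesgue_on J. f t \<in> X"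
proof -
  have Js: "J \<in> sets lebesgue" using J by (simp add: fmeasurableD)
  obtain s where s: "\<And>n. simple_into J X (s n)"
    "AE t in lebesgue_on J. f t \<in> X \<and> (\<lambda>n. N (\<lambda>x. s n t x - f t x)) \<longlonglongrightarrow> 0"
    using f by (auto simp: strongly_measurable_def)
  show "AE t in lebesgue_on J. f t \<in> X" using s(2) by eventually_elim simp
  have m: "(\<lambda>t. lim (\<lambda>n. l (s n t))) \<in> borel_measurable (lebesgue_on J)"
    using simple(1)[OF s(1) J] by (intro borel_measurable_lim_metric borel_measurable_integrable)
  have "AE t in lebesgue_on J. lim (\<lambda>n. l (s n t)) = l (f t)"
    using s(2) AE_space
  proof eventually_elim
    case (elim t)
    then have tJ: "t \<in> J" by simp
    have sX: "s n t \<in> Y" for n using s(1)[of n] tJ XY by (auto simp: simple_into_def)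
    have "(\<lambda>n. l (s n t)) \<longlonglongrightarrow> l (f t)"
    proof (rule LIM_zero_cancel, rule tendsto_rabs_zero_cancel, rule tendsto_sandwich[OF _ _ tendsto_const])
      show "(\<lambda>n. K * N (\<lambda>x. s n t x - f t x)) \<longlonglongrightarrow> 0" using elim by (intro tendsto_mult_right_zero) auto
      show "\<forall>\<^sub>F n in sequentially. \<bar>l (s n t) - l (f t)\<bar> \<le> K * N (\<lambda>x. s n t x - f t x)"
        using lipschitz[OF sX] elim XY by (intro always_eventually) auto
    qed simp
    then show ?case by (rule limI)
  qed
  then show "(\<lambda>t. l (f t)) \<in> borel_measurable (lebesgue_on J)"
    by (rule lebesgue_on_measurable_AE[OF Js _ m])
qed

text \<open>The device that turns identities between Bochner integrals into scalar ones: along the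
  approximating simple functions both sides converge, the left one in L1 and the right one by
  continuity of \<open>l\<close>.\<close>

lemma has_Bochner_integral:
  assumes f: "has_Bochner_integral_in X N J f v" and J: "(J :: real set) \<in> lmeasurable"
  shows "(\<integral>t. l (f t) \<partial>lebesgue_on J) = l v"
proof -
  let ?E = "\<lambda>n s. \<integral>\<^sup>+t. ennreal (N (\<lambda>x. s n t x - f t x)) \<partial>lebesgue_on J"
  obtain s where s: "\<And>n. simple_into J X (s n)"
    "(\<lambda>n. ?E n s) \<longlonglongrightarrow> 0"
    "(\<lambda>n. N (\<lambda>x. simple_integral J (s n) x - v x)) \<longlonglongrightarrow> 0"
    and v: "v \<in> X" and sm: "strongly_measurable X N J f"
    using f by (auto simp: has_Bochner_integral_in_def)
  note mf = measurable[OF sm J]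
  note sl = simple[OF s(1) J]
  have le: "(\<integral>\<^sup>+t. norm (l (s n t) - l (f t)) \<partial>lebesgue_on J) \<le>
      ennreal K * ?E n s" for n
  proof -
    \<comment> \<open>The constant \<open>K\<close> is extracted from the integral of the scalar
      difference, whose measurability is known. The integrand with \<open>N\<close> is touched by
      monotonicity alone.\<close>
    have m: "(\<lambda>t. norm (l (s n t) - l (f t)) / K) \<in> borel_measurable (lebesgue_on J)"
      using mf(1) borel_measurable_integrable[OF sl(1)[of n]] by measurable
    have "(\<integral>\<^sup>+t. norm (l (s n t) - l (f t)) \<partial>lebesgue_on J) =
        (\<integral>\<^sup>+t. ennreal K * ennreal (norm (l (s n t) - l (f t)) / K) \<partial>lebesgue_on J)"
      using K by (intro nn_integral_cong) (simp add: ennreal_mult[symmetric])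
    also have "\<dots> = ennreal K * (\<integral>\<^sup>+t. ennreal (norm (l (s n t) - l (f t)) / K) \<partial>lebesgue_on J)"
      by (rule nn_integral_cmult[OF measurable_compose[OF m measurable_ennreal]])
    also have "\<dots> \<le> ennreal K * ?E n s"
    proof (intro mult_left_mono nn_integral_mono_AE)
      show "AE t in lebesgue_on J. ennreal (norm (l (s n t) - l (f t)) / K) \<le> ennreal (N (\<lambda>x. s n t x - f t x))"
        using mf(2) AE_space
      proof eventually_elim
        case (elim t)
        then have "s n t \<in> Y" "f t \<in> Y" using s(1)[of n] XY by (auto simp: simple_into_def)
        from lipschitz[OF this] show ?case using K by (intro ennreal_leI) (simp add: pos_divide_le_eq mult.commute)
      qed
    qed simp
    finally show ?thesis .
  qed
  have "(\<lambda>n. ennreal K * ?E n s) \<longlonglongrightarrow> ennreal K * 0"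
    by (rule ennreal_tendsto_cmult[OF _ s(2)]) simp
  then have "(\<lambda>n. ennreal K * ?E n s) \<longlonglongrightarrow> 0"
    by (simp only: mult_zero_right)
  then have lim: "(\<lambda>n. \<integral>\<^sup>+t. norm (l (s n t) - l (f t)) \<partial>lebesgue_on J) \<longlonglongrightarrow> 0"
  proof (rule tendsto_sandwich[OF _ _ tendsto_const, rotated 2])
    show "\<forall>\<^sub>F n in sequentially. (\<integral>\<^sup>+t. norm (l (s n t) - l (f t)) \<partial>lebesgue_on J) \<le>
        ennreal K * ?E n s"
      using le by (rule always_eventually[OF allI])
  qed simp_all
  then have "\<forall>\<^sub>F n in sequentially. (\<integral>\<^sup>+t. norm (l (s n t) - l (f t)) \<partial>lebesgue_on J) < 1"
    by (rule order_tendstoD) simp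
  \<comment> \<open>One simple approximation at finite L1 distance makes \<open>l (f t)\<close>
    integrable.\<close>
  then obtain n where "(\<integral>\<^sup>+t. norm (l (s n t) - l (f t)) \<partial>lebesgue_on J) < 1" by (auto simp: eventually_sequentially)
  then have "integrable (lebesgue_on J) (\<lambda>t. l (s n t) - l (f t))"
    using mf(1) borel_measurable_integrable[OF sl(1)[of n]]
    by (intro integrableI_bounded) (auto intro: order_less_trans)
  then have int: "integrable (lebesgue_on J) (\<lambda>t. l (f t))"
    using Bochner_Integration.integrable_diff[OF sl(1)[of n], of "\<lambda>t. l (s n t) - l (f t)"] by simp
  have l1: "(\<lambda>n. \<integral>t. l (s n t) \<partial>lebesgue_on J) \<longlonglongrightarrow> (\<integral>t. l (f t) \<partial>lebesgue_on J)"
    by (rule tendsto_L1_int[OF sl(1) int lim])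
  have "(\<lambda>n. l (simple_integral J (s n))) \<longlonglongrightarrow> l v"
  proof (rule LIM_zero_cancel, rule tendsto_rabs_zero_cancel, rule tendsto_sandwich[OF _ _ tendsto_const])
    show "(\<lambda>n. K * N (\<lambda>x. simple_integral J (s n) x - v x)) \<longlonglongrightarrow> 0"
      by (intro tendsto_mult_right_zero s(3))
    show "\<forall>\<^sub>F n in sequentially. \<bar>l (simple_integral J (s n)) - l v\<bar> \<le> K * N (\<lambda>x. simple_integral J (s n) x - v x)"
      using lipschitz[OF simple_integral_mem[OF s(1)]] v XY by (intro always_eventually) auto
  qed simp
  then show ?thesis using LIMSEQ_unique[OF l1] by (simp add: sl(2))
qed

end

section \<open>The fundamental theorem of calculus for weak derivatives in time\<close>

text \<open>\<open>s'\<close> lives on \<open>{0..1}\<close> and has integral 1, so its rescalings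
  concentrate at \<open>c\<close> from the right for \<open>\<sigma> = 1\<close> and from the left
  for \<open>\<sigma> = -1\<close>. After substitution only values of \<open>F\<close> on that side
  of \<open>c\<close> enter.\<close>

lemma approximate_identity_right:
  fixes F :: "real \<Rightarrow> real"
  assumes s': "\<And>x. (smooth_step has_real_derivative s' x) (at x)" "continuous_on UNIV s'"
    "\<And>x. x \<le> 0 \<Longrightarrow> s' x = 0" "\<And>x. 1 \<le> x \<Longrightarrow> s' x = 0" "\<And>x. \<bar>s' x\<bar> \<le> M"
    and F: "F \<in> borel_measurable borel" "\<And>x. \<bar>F x\<bar> \<le> B" and \<sigma>: "\<sigma> = 1 \<or> \<sigma> = -1"
    and lim: "\<And>r. 0 < r \<Longrightarrow> (\<lambda>n. F (c + \<sigma> * r / real (Suc n))) \<longlonglongrightarrow> L"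
  shows "(\<lambda>n. \<integral>x. real (Suc n) * s' (real (Suc n) * (\<sigma> * (x - c))) * F x \<partial>lborel) \<longlonglongrightarrow> L"
proof -
  have [measurable]: "s' \<in> borel_measurable borel" "F \<in> borel_measurable borel"
    using borel_measurable_continuous_onI[OF s'(2)] F(1) by auto
  have ind: "s' r = s' r * indicator {0..1::real} r" for r using s'(3,4)[of r] by (cases "r \<le> 0"; cases "1 \<le> r") (auto simp: indicator_def)
  have "isCont s' x" for x using s'(2) by (simp add: continuous_on_eq_continuous_at)
  from has_bochner_integral_FTC_Icc_real[OF _ s'(1) this, of 0 1]
  have hb: "has_bochner_integral lborel s' 1"
    by (simp add: ind[symmetric] smooth_step_eq_0 smooth_step_eq_1)
  have \<sigma>2: "\<sigma> * \<sigma> = 1" "\<bar>\<sigma>\<bar> = 1" using \<sigma> by auto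
  have subst: "(\<integral>x. real (Suc n) * s' (real (Suc n) * (\<sigma> * (x - c))) * F x \<partial>lborel) =
      (\<integral>r. s' r * F (c + \<sigma> * r / real (Suc n)) \<partial>lborel)" for n
  proof -
    have "(\<integral>x. real (Suc n) * s' (real (Suc n) * (\<sigma> * (x - c))) * F x \<partial>lborel) =
        \<bar>\<sigma> / real (Suc n)\<bar> *\<^sub>R (\<integral>r. real (Suc n) * s' (real (Suc n) * (\<sigma> * ((c + \<sigma> / real (Suc n) * r) - c))) *
          F (c + \<sigma> / real (Suc n) * r) \<partial>lborel)"
      by (rule lborel_integral_real_affine) (use \<sigma> in auto)
    also have "(\<lambda>r. real (Suc n) * s' (real (Suc n) * (\<sigma> * ((c + \<sigma> / real (Suc n) * r) - c))) * F (c + \<sigma> / real (Suc n) * r))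
        = (\<lambda>r. real (Suc n) * (s' r * F (c + \<sigma> * r / real (Suc n))))"
    proof
      fix r
      have "real (Suc n) * (\<sigma> * ((c + \<sigma> / real (Suc n) * r) - c)) = (\<sigma> * \<sigma>) * r" by (simp del: of_nat_Suc)
      then show "real (Suc n) * s' (real (Suc n) * (\<sigma> * ((c + \<sigma> / real (Suc n) * r) - c))) * F (c + \<sigma> / real (Suc n) * r)
          = real (Suc n) * (s' r * F (c + \<sigma> * r / real (Suc n)))" by (simp only: \<sigma>2(1)) simp
    qed
    finally show ?thesis using \<sigma>2(2) by (simp add: abs_divide del: of_nat_Suc)
  qed
  have "(\<lambda>n. \<integral>r. s' r * F (c + \<sigma> * r / real (Suc n)) \<partial>lborel) \<longlonglongrightarrow> (\<integral>r. s' r * L \<partial>lborel)"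
  proof (rule integral_dominated_convergence)
    have "0 \<le> M" using s'(5)[of 0] by linarith
    then show "AE r in lborel. norm (s' r * F (c + \<sigma> * r / real (Suc n))) \<le> M * B * indicator {0..1::real} r" for n
      using s'(5) F(2) by (intro AE_I2, subst ind) (auto simp: abs_mult indicator_def intro!: mult_mono)
    show "integrable lborel (\<lambda>r. M * B * indicator {0..1::real} r :: real)"
      by (intro integrable_mult_right) (auto simp: integrable_indicator_iff)
    show "AE r in lborel. (\<lambda>n. s' r * F (c + \<sigma> * r / real (Suc n))) \<longlonglongrightarrow> s' r * L"
    proof (rule AE_I2)
      fix r show "(\<lambda>n. s' r * F (c + \<sigma> * r / real (Suc n))) \<longlonglongrightarrow> s' r * L"
        using s'(3)[of r] lim[of r] by (cases "r \<le> 0") (auto intro!: tendsto_intros simp del: of_nat_Suc)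
    qed
  qed measurable
  also have "(\<integral>r. s' r * L \<partial>lborel) = L" using hb by (simp add: has_bochner_integral_iff)
  finally show ?thesis unfolding subst .
qed

text \<open>The test functions \<open>S (n (\<tau> - s)) S (n (t - \<tau>))\<close> approximate the indicator of \<open>(s, t)\<close>.\<close>

lemma weak_derivative_fundamental_theorem:
  fixes F G :: "real \<Rightarrow> real"
  assumes st: "0 < s" "s < t" "t < T" and F: "continuous_on {s..t} F"
    and G: "integrable (lebesgue_on {s..t}) G"
    and w: "\<And>\<phi>. test_function {0<..<T} \<phi> \<Longrightarrow>
      (\<integral>\<tau>. deriv \<phi> \<tau> * F \<tau> \<partial>lebesgue_on {0<..<T}) = - (\<integral>\<tau>. \<phi> \<tau> * G \<tau> \<partial>lebesgue_on {0<..<T})"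
  shows "F t - F s = (\<integral>\<tau>. G \<tau> \<partial>lebesgue_on {s..t})"
proof -
  obtain s' M where s': "\<And>x. (smooth_step has_real_derivative s' x) (at x)" "continuous_on UNIV s'"
    "\<And>x. \<bar>s' x\<bar> \<le> M" "\<And>x. x \<le> 0 \<Longrightarrow> s' x = 0" "\<And>x. 1 \<le> x \<Longrightarrow> s' x = 0"
    by (rule smooth_step_derivative) blast
  define m where "m n = real (Suc n)" for n
  have m: "0 < m n" for n by (simp add: m_def)
  define a where "a n \<tau> = smooth_step (m n * (\<tau> - s))" for n \<tau>
  define b where "b n \<tau> = smooth_step (m n * (t - \<tau>))" for n \<tau>
  define a' where "a' n \<tau> = m n * s' (m n * (\<tau> - s))" for n \<tau>
  define b' where "b' n \<tau> = m n * s' (m n * (t - \<tau>))" for n \<tau>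
  have sm: "smooth (\<lambda>\<tau>. a n \<tau> * b n \<tau>)" for n
    unfolding a_def b_def
    by (intro smooth_mult smooth_compose_real[OF smooth_step_smooth] smooth_diff smooth_const smooth_linear bounded_linear_ident)
  have der: "((\<lambda>\<tau>. a n \<tau> * b n \<tau>) has_real_derivative a' n \<tau> * b n \<tau> - b' n \<tau> * a n \<tau>) (at \<tau>)" for n \<tau>
  proof -
    have "((\<lambda>\<tau>. m n * (\<tau> - s)) has_real_derivative m n) (at \<tau>)" "((\<lambda>\<tau>. m n * (t - \<tau>)) has_real_derivative - m n) (at \<tau>)"
      by (auto intro!: derivative_eq_intros)
    from DERIV_mult[OF DERIV_chain2[OF s'(1) this(1)] DERIV_chain2[OF s'(1) this(2)]] show ?thesis
      by (simp add: a_def[abs_def] b_def[abs_def] a'_def b'_def mult_ac)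
  qed
  have a0: "a n \<tau> = 0" "a' n \<tau> = 0" if "\<tau> \<le> s" for n \<tau>
    using that m[of n] by (simp_all add: a_def a'_def mult_le_0_iff smooth_step_eq_0 s'(4))
  have b0: "b n \<tau> = 0" "b' n \<tau> = 0" if "t \<le> \<tau>" for n \<tau>
    using that m[of n] by (simp_all add: b_def b'_def mult_le_0_iff smooth_step_eq_0 s'(4))
  have tf: "test_function {0<..<T} (\<lambda>\<tau>. a n \<tau> * b n \<tau>)" for n
    by (rule test_functionI[OF sm, of "{s..t}"]) (use st a0 b0 in \<open>auto simp: not_le\<close>)
  \<comment> \<open>\<open>F\<close> is controlled on \<open>{s..t}\<close> only. Its extension by 0
    may jump at the ends, but the one-sided kernels look inwards.\<close>
  define F2 where "F2 \<tau> = indicator {s..t} \<tau> *\<^sub>R F \<tau>" for \<tau>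
  have F2m: "F2 \<in> borel_measurable borel"
    unfolding F2_def[abs_def] using F by (intro borel_measurable_continuous_on_indicator) auto
  obtain B where B: "\<And>x. \<bar>F2 x\<bar> \<le> B"
  proof -
    have "bounded (F ` {s..t})" by (intro compact_imp_bounded compact_continuous_image F) simp
    then obtain B where "\<forall>x\<in>{s..t}. \<bar>F x\<bar> \<le> B" unfolding bounded_real by blast
    then have "\<bar>F2 x\<bar> \<le> max B 0" for x by (auto simp: F2_def indicator_def le_max_iff_disj)
    then show ?thesis using that by blast
  qed
  have h0: "(\<lambda>n. r / real (Suc n)) \<longlonglongrightarrow> 0" for r :: real
    using tendsto_mult_right_zero[OF LIMSEQ_inverse_real_of_nat, of r] by (simp add: divide_inverse)
  have limF: "(\<lambda>n. F2 (c + \<sigma> * r / real (Suc n))) \<longlonglongrightarrow> F c"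
    if c: "c = s \<and> \<sigma> = 1 \<or> c = t \<and> \<sigma> = -1" and r: "0 < r" for c \<sigma> r
  proof -
    have lim: "(\<lambda>n. c + \<sigma> * r / real (Suc n)) \<longlonglongrightarrow> c" using tendsto_add[OF tendsto_const h0, of c "\<sigma> * r"] by simp
    have "\<forall>\<^sub>F n in sequentially. r / real (Suc n) < t - s" using h0 st(2) by (intro order_tendstoD) auto
    then have ev: "\<forall>\<^sub>F n in sequentially. c + \<sigma> * r / real (Suc n) \<in> {s..t}"
      by eventually_elim (use c r in auto)
    have "(\<lambda>n. F (c + \<sigma> * r / real (Suc n))) \<longlonglongrightarrow> F c"
      by (rule continuous_on_tendsto_compose[OF F lim _ ev]) (use c st in auto)
    then show ?thesis
      by (rule Lim_transform_eventually) (use ev in \<open>eventually_elim, simp add: F2_def\<close>)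
  qed
  have "(\<lambda>n. \<integral>x. real (Suc n) * s' (real (Suc n) * (1 * (x - s))) * F2 x \<partial>lborel) \<longlonglongrightarrow> F s"
    by (rule approximate_identity_right[OF s'(1,2,4,5,3) F2m B _ limF]) auto
  then have la: "(\<lambda>n. \<integral>x. a' n x * F2 x \<partial>lborel) \<longlonglongrightarrow> F s"
    by (simp add: a'_def m_def del: of_nat_Suc)
  have "(\<lambda>n. \<integral>x. real (Suc n) * s' (real (Suc n) * (-1 * (x - t))) * F2 x \<partial>lborel) \<longlonglongrightarrow> F t"
    by (rule approximate_identity_right[OF s'(1,2,4,5,3) F2m B _ limF]) auto
  then have lb: "(\<lambda>n. \<integral>x. b' n x * F2 x \<partial>lborel) \<longlonglongrightarrow> F t"
    by (simp add: b'_def m_def del: of_nat_Suc)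
  have [measurable]: "s' \<in> borel_measurable borel" "F2 \<in> borel_measurable borel"
    using borel_measurable_continuous_onI[OF s'(2)] F2m by auto
  have F2i: "integrable lborel F2"
    unfolding F2_def[abs_def] by (rule borel_integrable_compact[OF _ F]) simp
  have iab: "integrable lborel (\<lambda>x. a' n x * F2 x)" "integrable lborel (\<lambda>x. b' n x * F2 x)" for n
  proof -
    have "AE x in lborel. \<bar>a' n x\<bar> \<le> m n * M" "AE x in lborel. \<bar>b' n x\<bar> \<le> m n * M"
      using s'(3) m[of n] by (auto simp: a'_def b'_def abs_mult intro!: mult_left_mono)
    then show "integrable lborel (\<lambda>x. a' n x * F2 x)" "integrable lborel (\<lambda>x. b' n x * F2 x)"
      using integrable_bounded_mult[OF F2i, of "a' n" "m n * M"] integrable_bounded_mult[OF F2i, of "b' n" "m n * M"]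
      by (auto simp: a'_def[abs_def] b'_def[abs_def])
  qed
  let ?g = "\<lambda>n \<tau>. a n \<tau> * b n \<tau> * G \<tau>"
  \<comment> \<open>For such \<open>n\<close> the zones where the two steps rise are disjoint; then
    each step equals 1 where the other one has a nonzero derivative.\<close>
  have "\<forall>\<^sub>F n in sequentially. 2 / real (Suc n) < t - s" using h0 st(2) by (intro order_tendstoD) auto
  then have "\<forall>\<^sub>F n in sequentially. (\<integral>x. a' n x * F2 x \<partial>lborel) - (\<integral>x. b' n x * F2 x \<partial>lborel) =
      - (\<integral>\<tau>. ?g n \<tau> \<partial>lebesgue_on {s..t})"
  proof eventually_elim
    fix n assume n: "2 / real (Suc n) < t - s"
    then have n': "2 < m n * (t - s)" by (simp add: m_def pos_divide_less_eq mult.commute del: of_nat_Suc)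
    have one: "a' n \<tau> * b n \<tau> = a' n \<tau>" "b' n \<tau> * a n \<tau> = b' n \<tau>" for \<tau>
    proof -
      show "a' n \<tau> * b n \<tau> = a' n \<tau>"
      proof (cases "m n * (\<tau> - s) < 1")
        case True
        then have "1 \<le> m n * (t - \<tau>)" using n' by (simp add: right_diff_distrib)
        then show ?thesis by (simp add: b_def smooth_step_eq_1)
      qed (simp add: a'_def s'(5))
      show "b' n \<tau> * a n \<tau> = b' n \<tau>"
      proof (cases "m n * (t - \<tau>) < 1")
        case True
        then have "1 \<le> m n * (\<tau> - s)" using n' by (simp add: right_diff_distrib)
        then show ?thesis by (simp add: a_def smooth_step_eq_1)
      qed (simp add: b'_def s'(5))
    qed
    have d: "deriv (\<lambda>\<tau>. a n \<tau> * b n \<tau>) \<tau> = a' n \<tau> - b' n \<tau>" for \<tau>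
      using DERIV_imp_deriv[OF der[of n \<tau>]] by (simp add: one)
    have sets: "{s..t} \<in> sets lebesgue" "{0<..<T} \<in> sets lebesgue" "{s..t} \<subseteq> {0<..<T}" using st by auto
    have mm: "(\<lambda>x. a' n x * F2 x - b' n x * F2 x) \<in> borel_measurable lborel"
      using iab[of n] by auto
    have "(\<integral>x. a' n x * F2 x \<partial>lborel) - (\<integral>x. b' n x * F2 x \<partial>lborel) = (\<integral>x. a' n x * F2 x - b' n x * F2 x \<partial>lebesgue)"
      using iab[of n] by (subst integral_completion[OF mm]) simp
    also have "\<dots> = (\<integral>x. indicator {s..t} x *\<^sub>R (deriv (\<lambda>\<tau>. a n \<tau> * b n \<tau>) x * F x) \<partial>lebesgue)"
      by (rule Bochner_Integration.integral_cong) (auto simp: d F2_def algebra_simps)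
    also have "\<dots> = (\<integral>\<tau>. deriv (\<lambda>\<tau>. a n \<tau> * b n \<tau>) \<tau> * F \<tau> \<partial>lebesgue_on {s..t})"
      using sets(1) by (subst integral_restrict_space) auto
    also have "\<dots> = (\<integral>\<tau>. deriv (\<lambda>\<tau>. a n \<tau> * b n \<tau>) \<tau> * F \<tau> \<partial>lebesgue_on {0<..<T})"
    proof (rule lebesgue_on_integral_subset(1)[OF sets, symmetric])
      fix \<tau> :: real assume "\<tau> \<notin> {s..t}"
      then have "a' n \<tau> * b n \<tau> = 0" "b' n \<tau> * a n \<tau> = 0" using a0[of \<tau> n] b0[of \<tau> n] by auto
      then show "deriv (\<lambda>\<tau>. a n \<tau> * b n \<tau>) \<tau> * F \<tau> = 0" by (simp add: d one)
    qed
    also have "\<dots> = - (\<integral>\<tau>. ?g n \<tau> \<partial>lebesgue_on {0<..<T})" by (rule w[OF tf])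
    also have "(\<integral>\<tau>. ?g n \<tau> \<partial>lebesgue_on {0<..<T}) = (\<integral>\<tau>. ?g n \<tau> \<partial>lebesgue_on {s..t})"
      by (rule lebesgue_on_integral_subset(1)[OF sets]) (use a0 b0 in \<open>auto simp: not_le\<close>)
    finally show "(\<integral>x. a' n x * F2 x \<partial>lborel) - (\<integral>x. b' n x * F2 x \<partial>lborel) =
      - (\<integral>\<tau>. ?g n \<tau> \<partial>lebesgue_on {s..t})" .
  qed
  with tendsto_diff[OF la lb] have l1: "(\<lambda>n. - (\<integral>\<tau>. ?g n \<tau> \<partial>lebesgue_on {s..t})) \<longlonglongrightarrow> F s - F t"
    by (rule Lim_transform_eventually)
  have "(\<lambda>n. \<integral>\<tau>. ?g n \<tau> \<partial>lebesgue_on {s..t}) \<longlonglongrightarrow> (\<integral>\<tau>. G \<tau> \<partial>lebesgue_on {s..t})"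
  proof (rule integral_dominated_convergence)
    have cont: "continuous_on UNIV (\<lambda>\<tau>. a n \<tau> * b n \<tau>)" for n by (rule smooth_continuous_on[OF sm])
    show "integrable (lebesgue_on {s..t}) (\<lambda>\<tau>. norm (G \<tau>))" using G by simp
    show "G \<in> borel_measurable (lebesgue_on {s..t})" using G by (rule borel_measurable_integrable)
    show "(\<lambda>\<tau>. ?g n \<tau>) \<in> borel_measurable (lebesgue_on {s..t})" for n
      by (intro borel_measurable_times continuous_measurable_lebesgue_on cont borel_measurable_integrable[OF G])
    show "AE \<tau> in lebesgue_on {s..t}. norm (?g n \<tau>) \<le> norm (G \<tau>)" for n
    proof (rule AE_I2)
      fix \<tau>
      have "\<bar>a n \<tau> * b n \<tau>\<bar> \<le> 1"
        using smooth_step_nonneg smooth_step_le_1 by (auto simp: a_def b_def abs_mult intro!: mult_le_one)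
      then show "norm (?g n \<tau>) \<le> norm (G \<tau>)"
        unfolding norm_mult[of _ "G \<tau>"] by (intro mult_left_le_one_le) auto
    qed
    \<comment> \<open>At the two end points the test functions are 0 for every \<open>n\<close>;
      these points form a null set.\<close>
    have "AE \<tau> in lebesgue. \<tau> \<noteq> s" "AE \<tau> in lebesgue. \<tau> \<noteq> t" by (auto intro!: AE_completion AE_lborel_singleton)
    then have "AE \<tau> in lebesgue. \<tau> \<in> {s..t} \<longrightarrow> (\<lambda>n. ?g n \<tau>) \<longlonglongrightarrow> G \<tau>"
    proof eventually_elim
      case (elim \<tau>)
      show ?case
      proof
        assume "\<tau> \<in> {s..t}"
        then have p: "0 < \<tau> - s" "0 < t - \<tau>" using elim by auto
        have "\<forall>\<^sub>F n in sequentially. 1 / real (Suc n) < \<tau> - s" "\<forall>\<^sub>F n in sequentially. 1 / real (Suc n) < t - \<tau>"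
          by (rule order_tendstoD(2)[OF h0 p(1)], rule order_tendstoD(2)[OF h0 p(2)])
        then have "\<forall>\<^sub>F n in sequentially. G \<tau> = ?g n \<tau>"
        proof eventually_elim
          case (elim n)
          then have "1 \<le> m n * (\<tau> - s)" "1 \<le> m n * (t - \<tau>)"
            by (simp_all add: m_def pos_divide_less_eq mult.commute del: of_nat_Suc)
          then show ?case by (simp add: a_def b_def smooth_step_eq_1)
        qed
        then show "(\<lambda>n. ?g n \<tau>) \<longlonglongrightarrow> G \<tau>" by (rule Lim_transform_eventually[OF tendsto_const])
      qed
    qed
    then show "AE \<tau> in lebesgue_on {s..t}. (\<lambda>n. ?g n \<tau>) \<longlonglongrightarrow> G \<tau>"
      by (simp add: AE_restrict_space_iff)
  qed
  from LIMSEQ_unique[OF l1 tendsto_minus[OF this]] show ?thesis by simp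
qed

context bounded_functional
begin

text \<open>Applying \<open>l\<close> to the two Bochner integrals in the definition gives a scalar
  weak derivative; continuity of the curve in \<open>N\<close> makes the scalar function continuous,
  so the one-dimensional theorem applies.\<close>

lemma weak_time_derivative:
  assumes w: "has_weak_time_derivative X N {0<..<T} f g" and f: "\<And>t. 0 < t \<Longrightarrow> t < T \<Longrightarrow> f t \<in> X"
    and cont: "\<And>t. 0 < t \<Longrightarrow> t < T \<Longrightarrow> ((\<lambda>s. N (\<lambda>x. f s x - f t x)) \<longlongrightarrow> 0) (at t)"
    and st: "0 < s" "s \<le> t" "t < T"
  shows "integrable (lebesgue_on {s..t}) (\<lambda>\<tau>. l (g \<tau>))"
    and "l (f t) - l (f s) = (\<integral>\<tau>. l (g \<tau>) \<partial>lebesgue_on {s..t})"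
proof -
  have gl: "strongly_measurable X N {s..t} g" "integrable (lebesgue_on {s..t}) (\<lambda>t. N (g t))"
  proof -
    have "{s..t} \<subseteq> {0<..<T}" using st by auto
    then show "strongly_measurable X N {s..t} g" "integrable (lebesgue_on {s..t}) (\<lambda>t. N (g t))"
      using w unfolding has_weak_time_derivative_def L1_loc_in_def by blast+
  qed
  have J: "{s..t} \<in> lmeasurable" "{0<..<T} \<in> lmeasurable" by auto
  show int: "integrable (lebesgue_on {s..t}) (\<lambda>\<tau>. l (g \<tau>))"
  proof (rule Bochner_Integration.integrable_bound)
    show "integrable (lebesgue_on {s..t}) (\<lambda>\<tau>. K * N (g \<tau>))" using gl(2) by simp
    show "(\<lambda>\<tau>. l (g \<tau>)) \<in> borel_measurable (lebesgue_on {s..t})" by (rule measurable(1)[OF gl(1) J(1)])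
    show "AE \<tau> in lebesgue_on {s..t}. norm (l (g \<tau>)) \<le> norm (K * N (g \<tau>))"
      using measurable(2)[OF gl(1) J(1)] by eventually_elim (use bound XY in \<open>force intro: order_trans[OF _ abs_ge_self]\<close>)
  qed
  show "l (f t) - l (f s) = (\<integral>\<tau>. l (g \<tau>) \<partial>lebesgue_on {s..t})"
  proof (cases "s = t")
    case False
    show ?thesis
    proof (rule weak_derivative_fundamental_theorem[where T=T])
      show "continuous_on {s..t} (\<lambda>\<tau>. l (f \<tau>))"
      proof (rule continuous_at_imp_continuous_on, rule ballI)
        fix \<tau> assume "\<tau> \<in> {s..t}"
        then have \<tau>: "0 < \<tau>" "\<tau> < T" using st by auto
        have "((\<lambda>\<sigma>. l (f \<sigma>)) \<longlongrightarrow> l (f \<tau>)) (at \<tau>)"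
        proof (rule LIM_zero_cancel, rule tendsto_rabs_zero_cancel, rule tendsto_sandwich[OF _ _ tendsto_const])
          show "((\<lambda>\<sigma>. K * N (\<lambda>x. f \<sigma> x - f \<tau> x)) \<longlongrightarrow> 0) (at \<tau>)" by (intro tendsto_mult_right_zero cont \<tau>)
          have "\<forall>\<^sub>F \<sigma> in at \<tau>. \<sigma> \<in> {0<..<T}" using \<tau> by (intro eventually_at_in_open') auto
          then show "\<forall>\<^sub>F \<sigma> in at \<tau>. \<bar>l (f \<sigma>) - l (f \<tau>)\<bar> \<le> K * N (\<lambda>x. f \<sigma> x - f \<tau> x)"
            by eventually_elim (use f \<tau> XY in \<open>auto intro!: lipschitz\<close>)
        qed simp
        then show "isCont (\<lambda>\<tau>. l (f \<tau>)) \<tau>" by (simp add: isCont_def)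
      qed
      fix \<phi> :: "real \<Rightarrow> real" assume \<phi>: "test_function {0<..<T} \<phi>"
      then obtain v where v: "has_Bochner_integral_in X N {0<..<T} (\<lambda>t x. deriv \<phi> t *\<^sub>R f t x) v"
        "has_Bochner_integral_in X N {0<..<T} (\<lambda>t x. - (\<phi> t *\<^sub>R g t x)) v"
        using w by (auto simp: has_weak_time_derivative_def)
      have "(\<integral>\<tau>. deriv \<phi> \<tau> * l (f \<tau>) \<partial>lebesgue_on {0<..<T}) = (\<integral>\<tau>. l (\<lambda>x. deriv \<phi> \<tau> *\<^sub>R f \<tau> x) \<partial>lebesgue_on {0<..<T})"
        by (rule Bochner_Integration.integral_cong) (use scale[OF subsetD[OF XY f]] in auto)
      also have "\<dots> = (\<integral>\<tau>. l (\<lambda>x. - (\<phi> \<tau> *\<^sub>R g \<tau> x)) \<partial>lebesgue_on {0<..<T})"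
        using has_Bochner_integral[OF v(1) J(2)] has_Bochner_integral[OF v(2) J(2)] by simp
      also have "\<dots> = (\<integral>\<tau>. - (\<phi> \<tau> * l (g \<tau>)) \<partial>lebesgue_on {0<..<T})"
      proof (rule lebesgue_on_integral_cong_AE(1))
        have "AE \<tau> in lebesgue_on {0<..<T}. g \<tau> \<in> X"
        proof (rule locally_integrable_AE_on_compact)
          fix C :: "real set" assume C: "compact C" "C \<subseteq> {0<..<T}"
          show "AE \<tau> in lebesgue_on C. g \<tau> \<in> X"
          proof (cases "C = {}")
            case False
            \<comment> \<open>\<open>L1_loc_in\<close> speaks of compact intervals, so the compact
              set \<open>C\<close> is enclosed in one.\<close>
            have ab: "{Inf C..Sup C} \<subseteq> {0<..<T}" "C \<subseteq> {Inf C..Sup C}"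
            proof -
              have "Inf C \<in> C" "Sup C \<in> C" using closed_contains_Inf closed_contains_Sup False C(1)
                by (auto simp: compact_imp_closed compact_imp_bounded bounded_imp_bdd_below bounded_imp_bdd_above)
              then have "Inf C \<in> {0<..<T}" "Sup C \<in> {0<..<T}" using C(2) by blast+
              then show "{Inf C..Sup C} \<subseteq> {0<..<T}" by auto
              show "C \<subseteq> {Inf C..Sup C}"
                using C(1) by (auto intro!: cInf_lower cSup_upper simp: compact_imp_bounded bounded_imp_bdd_below bounded_imp_bdd_above)
            qed
            have "strongly_measurable X N {Inf C..Sup C} g"
              using w ab(1) by (auto simp: has_weak_time_derivative_def L1_loc_in_def)
            from AE_lebesgue_on_subset[OF measurable(2)[OF this] ab(2) compact_sets_lebesgue[OF C(1)]] show ?thesis by simp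
          qed (simp add: AE_restrict_space_iff)
        qed simp
        then show "AE \<tau> in lebesgue_on {0<..<T}. l (\<lambda>x. - (\<phi> \<tau> *\<^sub>R g \<tau> x)) = - (\<phi> \<tau> * l (g \<tau>))"
        proof eventually_elim
          case (elim \<tau>)
          then show ?case using scale[of "g \<tau>" "- \<phi> \<tau>"] XY by auto
        qed
      qed simp
      finally show "(\<integral>\<tau>. deriv \<phi> \<tau> * l (f \<tau>) \<partial>lebesgue_on {0<..<T}) = - (\<integral>\<tau>. \<phi> \<tau> * l (g \<tau>) \<partial>lebesgue_on {0<..<T})"
        by simp
    qed (use st False int in auto)
  next
    case True
    have "AE \<tau> in lebesgue. \<tau> \<noteq> t" by (rule AE_completion[OF AE_lborel_singleton])
    then have "AE \<tau> in lebesgue. \<tau> \<in> {s..t} \<longrightarrow> l (g \<tau>) = 0"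
      by eventually_elim (use True in auto)
    then have "AE \<tau> in lebesgue_on {s..t}. l (g \<tau>) = 0"
      by (subst AE_restrict_space_iff) auto
    then have "(\<integral>\<tau>. l (g \<tau>) \<partial>lebesgue_on {s..t}) = 0" by (rule integral_eq_zero_AE)
    then show ?thesis using True by simp
  qed
qed

end

section \<open>Integration by parts in Sobolev spaces\<close>

text \<open>The common class for all factors: on a bounded domain it contains \<open>Lp\<close> for
  \<open>2 \<le> p\<close>, products of two members are integrable, and it is stable under bounded
  factors.\<close>

definition sq_int :: "(real^3) set \<Rightarrow> (real^3 \<Rightarrow> 'b::euclidean_space) \<Rightarrow> bool" where
  "sq_int \<Omega> f \<longleftrightarrow> f \<in> borel_measurable (lebesgue_on \<Omega>) \<and> integrable (lebesgue_on \<Omega>) (\<lambda>x. (norm (f x))\<^sup>2)"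

lemma sq_intD: "sq_int \<Omega> f \<Longrightarrow> f \<in> borel_measurable (lebesgue_on \<Omega>)"
    "sq_int \<Omega> f \<Longrightarrow> integrable (lebesgue_on \<Omega>) (\<lambda>x. (norm (f x))\<^sup>2)"
  by (auto simp: sq_int_def)

lemma sq_int_bound:
  assumes "sq_int \<Omega> f" "g \<in> borel_measurable (lebesgue_on \<Omega>)" "AE x in lebesgue_on \<Omega>. norm (g x) \<le> C * norm (f x)"
  shows "sq_int \<Omega> g"
  unfolding sq_int_def
proof (intro conjI assms(2))
  let ?M = "lebesgue_on \<Omega>"
  show "integrable ?M (\<lambda>x. (norm (g x))\<^sup>2)"
  proof (rule Bochner_Integration.integrable_bound)
    show "integrable ?M (\<lambda>x. C\<^sup>2 * (norm (f x))\<^sup>2)" using sq_intD(2)[OF assms(1)] by simp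
    show "AE x in ?M. norm ((norm (g x))\<^sup>2) \<le> norm (C\<^sup>2 * (norm (f x))\<^sup>2)"
      using assms(3) by eventually_elim (simp add: power_mult_distrib[symmetric] abs_le_square_iff[symmetric])
  qed (use assms(2) in measurable)
qed

lemma sq_int_add:
  assumes "sq_int \<Omega> f" "sq_int \<Omega> g"
  shows "sq_int \<Omega> (\<lambda>x. f x + g x)"
  unfolding sq_int_def
proof
  let ?M = "lebesgue_on \<Omega>"
  note [measurable] = sq_intD(1)[OF assms(1)] sq_intD(1)[OF assms(2)]
  show "(\<lambda>x. f x + g x) \<in> borel_measurable ?M" by measurable
  show "integrable ?M (\<lambda>x. (norm (f x + g x))\<^sup>2)"
  proof (rule Bochner_Integration.integrable_bound)
    show "integrable ?M (\<lambda>x. 2 * (norm (f x))\<^sup>2 + 2 * (norm (g x))\<^sup>2)"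
      using sq_intD(2)[OF assms(1)] sq_intD(2)[OF assms(2)] by simp
    have "(norm (f x + g x))\<^sup>2 \<le> 2 * (norm (f x))\<^sup>2 + 2 * (norm (g x))\<^sup>2" for x
      using power_mono[OF norm_triangle_ineq[of "f x" "g x"], of 2] sum_squares_bound[of "norm (f x)" "norm (g x)"]
      by (simp add: power2_sum)
    then show "AE x in ?M. norm ((norm (f x + g x))\<^sup>2) \<le> norm (2 * (norm (f x))\<^sup>2 + 2 * (norm (g x))\<^sup>2)"
      by (intro AE_I2) simp
  qed measurable
qed

lemma sq_int_linear:
  assumes "sq_int \<Omega> f" "bounded_linear L"
  shows "sq_int \<Omega> (\<lambda>x. L (f x))"
proof -
  interpret bounded_linear L by fact
  obtain K where "\<And>x. norm (L x) \<le> norm x * K" using bounded by blast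
  then show ?thesis
    using sq_intD(1)[OF assms(1)] borel_measurable_continuous_onI[OF linear_continuous_on[OF assms(2)]]
    by (intro sq_int_bound[OF assms(1), of _ K]) (auto simp: mult.commute intro: measurable_compose)
qed

lemma sq_int_sum: "(\<And>i. i \<in> I \<Longrightarrow> sq_int \<Omega> (f i)) \<Longrightarrow> sq_int \<Omega> (\<lambda>x. \<Sum>i\<in>I. f i x)"
  by (induction I rule: infinite_finite_induct) (auto intro: sq_int_add simp: sq_int_def[of _ "\<lambda>x. 0"])

lemma sq_int_prod:
  assumes "sq_int \<Omega> f" "sq_int \<Omega> g"
  shows "integrable (lebesgue_on \<Omega>) (\<lambda>x. norm (f x) * norm (g x))"
proof (rule Bochner_Integration.integrable_bound)
  let ?M = "lebesgue_on \<Omega>"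
  show "integrable ?M (\<lambda>x. (norm (f x))\<^sup>2 + (norm (g x))\<^sup>2)"
    using sq_intD(2)[OF assms(1)] sq_intD(2)[OF assms(2)] by simp
  have "norm (f x) * norm (g x) \<le> (norm (f x))\<^sup>2 + (norm (g x))\<^sup>2" for x
    using sum_squares_bound[of "norm (f x)" "norm (g x)"] zero_le_power2[of "norm (f x)"] zero_le_power2[of "norm (g x)"]
      mult_nonneg_nonneg[OF norm_ge_zero norm_ge_zero, of "f x" "g x"] by linarith
  then show "AE x in ?M. norm (norm (f x) * norm (g x)) \<le> norm ((norm (f x))\<^sup>2 + (norm (g x))\<^sup>2)"
    by (intro AE_I2) simp
  show "(\<lambda>x. norm (f x) * norm (g x)) \<in> borel_measurable ?M"
    using sq_intD(1)[OF assms(1)] sq_intD(1)[OF assms(2)] by measurable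
qed

lemma sq_int_bilinear:
  fixes f :: "real^3 \<Rightarrow> 'b::euclidean_space" and g :: "real^3 \<Rightarrow> 'c::euclidean_space"
    and bb :: "'b \<Rightarrow> 'c \<Rightarrow> 'd::euclidean_space"
  assumes "sq_int \<Omega> f" "sq_int \<Omega> g" "bounded_bilinear bb"
  shows "integrable (lebesgue_on \<Omega>) (\<lambda>x. bb (f x) (g x))"
proof -
  let ?M = "lebesgue_on \<Omega>"
  interpret bounded_bilinear bb by fact
  obtain K where K: "\<And>a b. norm (bb a b) \<le> norm a * norm b * K" using bounded by blast
  show ?thesis
  proof (rule Bochner_Integration.integrable_bound)
    show "integrable ?M (\<lambda>x. K * (norm (f x) * norm (g x)))" using sq_int_prod[OF assms(1,2)] by simp
    show "(\<lambda>x. bb (f x) (g x)) \<in> borel_measurable ?M"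
      by (rule borel_measurable_continuous_Pair[OF sq_intD(1)[OF assms(1)] sq_intD(1)[OF assms(2)]])
        (intro continuous_on continuous_on_fst continuous_on_snd continuous_on_id)
    show "AE x in ?M. norm (bb (f x) (g x)) \<le> norm (K * (norm (f x) * norm (g x)))"
      using K by (intro AE_I2) (metis abs_ge_self mult.commute order_trans real_norm_def)
  qed
qed

lemmas sq_int_inner = sq_int_bilinear[OF _ _ bounded_bilinear_inner]
lemmas sq_int_mult = sq_int_bilinear[OF _ _ bounded_bilinear_mult]

definition sq_norm :: "(real^3) set \<Rightarrow> (real^3 \<Rightarrow> 'b::euclidean_space) \<Rightarrow> real" where
  "sq_norm \<Omega> f = sqrt (\<integral>x. (norm (f x))\<^sup>2 \<partial>lebesgue_on \<Omega>)"

lemma sq_norm_Cauchy_Schwarz: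
  assumes "sq_int \<Omega> f" "sq_int \<Omega> g"
  shows "\<bar>\<integral>x. f x \<bullet> g x \<partial>lebesgue_on \<Omega>\<bar> \<le> sq_norm \<Omega> f * sq_norm \<Omega> g"
proof -
  let ?M = "lebesgue_on \<Omega>"
  define A where "A = (\<integral>x. (norm (f x))\<^sup>2 \<partial>?M)"
  define B where "B = (\<integral>x. (norm (g x))\<^sup>2 \<partial>?M)"
  define c where "c = \<bar>\<integral>x. f x \<bullet> g x \<partial>?M\<bar>"
  note i = sq_intD(2)[OF assms(1)] sq_intD(2)[OF assms(2)]
  have AB: "0 \<le> A" "0 \<le> B" "0 \<le> c" by (auto simp: A_def B_def c_def)
  \<comment> \<open>The pointwise inequality of arithmetic and geometric mean with free weights; the
    weights are chosen afterwards.\<close>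
  have quad: "2 * s * t * c \<le> s\<^sup>2 * A + t\<^sup>2 * B" if "0 \<le> s" "0 \<le> t" for s t
  proof -
    have "2 * s * t * c = \<bar>\<integral>x. 2 * s * t * (f x \<bullet> g x) \<partial>?M\<bar>"
      using that by (simp add: c_def abs_mult)
    also have "\<dots> \<le> (\<integral>x. s\<^sup>2 * (norm (f x))\<^sup>2 + t\<^sup>2 * (norm (g x))\<^sup>2 \<partial>?M)"
    proof (rule integral_abs_bound_integral)
      fix x
      have "\<bar>2 * s * t * (f x \<bullet> g x)\<bar> \<le> 2 * (s * norm (f x)) * (t * norm (g x))"
        using mult_left_mono[OF Cauchy_Schwarz_ineq2[of "f x" "g x"], of "2 * s * t"] that
        by (simp add: abs_mult mult_ac)
      also have "\<dots> \<le> (s * norm (f x))\<^sup>2 + (t * norm (g x))\<^sup>2" by (rule sum_squares_bound)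
      finally show "\<bar>2 * s * t * (f x \<bullet> g x)\<bar> \<le> s\<^sup>2 * (norm (f x))\<^sup>2 + t\<^sup>2 * (norm (g x))\<^sup>2"
        by (simp add: power_mult_distrib)
    qed (use i sq_int_inner[OF assms] in auto)
    also have "\<dots> = s\<^sup>2 * A + t\<^sup>2 * B" using i by (simp add: A_def B_def)
    finally show ?thesis .
  qed
  \<comment> \<open>For \<open>A > 0\<close> the weights \<open>c\<close> and \<open>A\<close> give
    the bound. For \<open>A = 0\<close> a positive \<open>c\<close> is refuted by the weights
    \<open>B + 1\<close> and \<open>c\<close>, which yield
    \<open>2 (B + 1) c^2 \<le> c^2 B\<close>.\<close>
  have "c\<^sup>2 \<le> A * B"
  proof (cases "A = 0")
    case True
    have "c \<le> 0"
    proof (rule ccontr)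
      assume "\<not> c \<le> 0"
      then have c: "0 < c" by simp
      show False using quad[of "B + 1" c] True c AB(2) by (simp add: power2_eq_square algebra_simps)
          (smt (verit) mult_nonneg_nonneg mult_pos_pos)
    qed
    then show ?thesis using AB True by simp
  next
    case False
    then have "0 < A" using AB by simp
    have "2 * c * A * c \<le> c\<^sup>2 * A + A\<^sup>2 * B" using quad[of c A] AB by simp
    then have "A * c\<^sup>2 \<le> A * (A * B)" by (simp add: power2_eq_square algebra_simps)
    then show ?thesis using \<open>0 < A\<close> by simp
  qed
  then have "c \<le> sqrt (A * B)" by (rule real_le_rsqrt)
  then show ?thesis by (simp add: c_def sq_norm_def A_def B_def real_sqrt_mult)
qed

text \<open>The derivatives are an argument instead of the chosen \<open>weak_partial\<close>, so
  that the formulas produced by chain and product rules can be used directly.\<close>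

definition H1 :: "(real^3) set \<Rightarrow> (real^3 \<Rightarrow> 'b::euclidean_space) \<Rightarrow> (3 \<Rightarrow> real^3 \<Rightarrow> 'b) \<Rightarrow> bool" where
  "H1 \<Omega> f f' \<longleftrightarrow> sq_int \<Omega> f \<and> (\<forall>i. sq_int \<Omega> (f' i) \<and> has_weak_partial \<Omega> i f (f' i))"

lemma H1D: "H1 \<Omega> f f' \<Longrightarrow> sq_int \<Omega> f" "H1 \<Omega> f f' \<Longrightarrow> sq_int \<Omega> (f' i)"
    "H1 \<Omega> f f' \<Longrightarrow> has_weak_partial \<Omega> i f (f' i)"
  by (auto simp: H1_def)

section \<open>Square integrable and Sobolev functions on a bounded domain\<close>

locale bounded_domain =
  fixes \<Omega> :: "(real^3) set"
  assumes open_domain: "open \<Omega>" and bounded_domain: "bounded \<Omega>"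
begin

abbreviation "M \<equiv> lebesgue_on \<Omega>"

lemma domain_sets: "\<Omega> \<in> sets lebesgue"
  by (rule open_sets_lebesgue[OF open_domain])

lemma domain_lmeasurable: "\<Omega> \<in> lmeasurable"
  by (rule bounded_set_imp_lmeasurable[OF bounded_domain domain_sets])

lemma integrable_const_domain: "integrable M (\<lambda>x. c :: 'b::euclidean_space)"
proof -
  interpret finite_measure M by (rule finite_measure_lebesgue_on[OF domain_lmeasurable])
  show ?thesis by simp
qed

lemma integral_const_domain: "(\<integral>x. c \<partial>M) = measure lebesgue \<Omega> * (c::real)"
proof -
  have "measure M \<Omega> = measure lebesgue \<Omega>" using domain_sets by (simp add: measure_restrict_space)
  then show ?thesis by simp
qed

lemma continuous_closure_bounded:
  fixes f :: "real^3 \<Rightarrow> 'b::euclidean_space"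
  assumes "continuous_on (closure \<Omega>) f"
  obtains B where "0 \<le> B" "\<And>x. x \<in> closure \<Omega> \<Longrightarrow> norm (f x) \<le> B"
proof -
  have "bounded (f ` closure \<Omega>)"
    using bounded_domain by (intro compact_imp_bounded compact_continuous_image assms) (simp add: compact_closure)
  then obtain B where "0 < B" "\<forall>y\<in>f ` closure \<Omega>. norm y \<le> B" unfolding bounded_pos by blast
  then show ?thesis using that[of B] by auto
qed

lemma continuous_closure_measurable:
  fixes f :: "real^3 \<Rightarrow> 'b::euclidean_space"
  assumes "continuous_on (closure \<Omega>) f"
  shows "f \<in> borel_measurable M"
proof -
  have "continuous_on \<Omega> f" using assms closure_subset by (rule continuous_on_subset)
  then show ?thesis by (intro locally_integrable_measurable open_domain locally_integrable_continuous)
qed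

lemma sq_int_bounded:
  assumes "f \<in> borel_measurable M" "AE x in M. norm (f x) \<le> B"
  shows "sq_int \<Omega> f"
proof (rule sq_int_bound[of \<Omega> "\<lambda>x. 1 :: real", where C=B])
  show "sq_int \<Omega> (\<lambda>x. 1 :: real)" by (simp add: sq_int_def integrable_const_domain)
qed (use assms in auto)

lemma sq_int_continuous:
  fixes f :: "real^3 \<Rightarrow> 'b::euclidean_space"
  assumes "continuous_on (closure \<Omega>) f"
  shows "sq_int \<Omega> f"
proof -
  obtain B where "\<And>x. x \<in> closure \<Omega> \<Longrightarrow> norm (f x) \<le> B" by (rule continuous_closure_bounded[OF assms]) blast
  then have "AE x in M. norm (f x) \<le> B" using closure_subset[of \<Omega>] by (intro AE_I2) auto
  then show ?thesis by (rule sq_int_bounded[OF continuous_closure_measurable[OF assms]])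
qed

lemma bochner_cong_AE:
  fixes f g :: "real^3 \<Rightarrow> 'b::euclidean_space"
  assumes "AE x in M. f x = g x" "has_bochner_integral M f c"
  shows "has_bochner_integral M g c"
  using lebesgue_on_integral_cong_AE[OF domain_sets assms(1)] assms(2) by (simp add: has_bochner_integral_iff)

lemma sq_int_integrable: "sq_int \<Omega> f \<Longrightarrow> integrable M f"
  using sq_int_bilinear[OF sq_int_continuous[of "\<lambda>x. 1 :: real"] _ bounded_bilinear_scaleR, of f] by simp

lemma sq_int_bilinear_bounded:
  fixes f :: "real^3 \<Rightarrow> 'b::euclidean_space" and g :: "real^3 \<Rightarrow> 'c::euclidean_space"
    and bb :: "'b \<Rightarrow> 'c \<Rightarrow> 'd::euclidean_space"
  assumes f: "f \<in> borel_measurable M" "AE x in M. norm (f x) \<le> B" and g: "sq_int \<Omega> g" and bb: "bounded_bilinear bb"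
  shows "sq_int \<Omega> (\<lambda>x. bb (f x) (g x))"
proof -
  interpret bounded_bilinear bb by fact
  obtain K where K: "0 < K" "\<And>a b. norm (bb a b) \<le> norm a * norm b * K" using pos_bounded by blast
  show ?thesis
  proof (rule sq_int_bound[OF g])
    show "(\<lambda>x. bb (f x) (g x)) \<in> borel_measurable M"
      by (rule borel_measurable_continuous_Pair[OF f(1) sq_intD(1)[OF g]])
        (intro continuous_on continuous_on_fst continuous_on_snd continuous_on_id)
    show "AE x in M. norm (bb (f x) (g x)) \<le> (B * K) * norm (g x)"
      using f(2)
    proof eventually_elim
      case (elim x)
      have "norm (f x) * norm (g x) * K \<le> B * norm (g x) * K"
        using elim K(1) by (intro mult_right_mono) auto
      with K(2)[of "f x" "g x"] show ?case by (simp add: mult_ac)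
    qed
  qed
qed

lemma sq_int_cong_AE:
  fixes f g :: "real^3 \<Rightarrow> 'b::euclidean_space"
  assumes "sq_int \<Omega> f" "AE x in M. f x = g x"
  shows "sq_int \<Omega> g"
proof (rule sq_int_bound[OF assms(1), of _ 1])
  show "g \<in> borel_measurable M" by (rule lebesgue_on_measurable_AE[OF domain_sets assms(2) sq_intD(1)[OF assms(1)]])
  show "AE x in M. norm (g x) \<le> 1 * norm (f x)" using assms(2) by eventually_elim simp
qed

text \<open>From \<open>r^2 \<le> 1 + r^p\<close> with \<open>r = norm (f x) / s\<close>, integrated
  over the domain; the scale \<open>s\<close> is free and homogeneity is restored by choosing
  it.\<close>

lemma Lp_sq_int:
  fixes f :: "real^3 \<Rightarrow> 'b::euclidean_space"
  assumes f: "f \<in> Lp p \<Omega>" and p: "2 \<le> p"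
  shows "sq_int \<Omega> f" "(\<integral>x. (norm (f x))\<^sup>2 \<partial>M) \<le> (1 + measure lebesgue \<Omega>) * (Lp_norm p \<Omega> f)\<^sup>2"
proof -
  define I where "I = (\<integral>x. norm (f x) powr p \<partial>M)"
  have m: "f \<in> borel_measurable M" and ip: "integrable M (\<lambda>x. norm (f x) powr p)" using f by (auto simp: Lp_def)
  have le: "(norm (f x))\<^sup>2 \<le> s\<^sup>2 * (1 + norm (f x) powr p / s powr p)" if s: "0 < s" for x s
  proof (cases "norm (f x) \<le> s")
    case True
    then have "(norm (f x))\<^sup>2 \<le> s\<^sup>2" by (intro power_mono) auto
    also have "s\<^sup>2 \<le> s\<^sup>2 * (1 + norm (f x) powr p / s powr p)"
      using mult_left_mono[of 1 "1 + norm (f x) powr p / s powr p" "s\<^sup>2"] by simp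
    finally show ?thesis .
  next
    case False
    define r where "r = norm (f x) / s"
    have r: "1 \<le> r" using False s by (simp add: r_def)
    have "r\<^sup>2 = r powr 2" using r by simp
    also have "\<dots> \<le> r powr p" using r p by (intro powr_mono) auto
    also have "\<dots> = norm (f x) powr p / s powr p" using s by (simp add: r_def powr_divide)
    finally have "s\<^sup>2 * r\<^sup>2 \<le> s\<^sup>2 * (1 + norm (f x) powr p / s powr p)" by (intro mult_left_mono) auto
    moreover have "s\<^sup>2 * r\<^sup>2 = (norm (f x))\<^sup>2" using s by (simp add: r_def power_divide)
    ultimately show ?thesis by simp
  qed
  have is1: "integrable M (\<lambda>x. s\<^sup>2 * (1 + norm (f x) powr p / s powr p))" for s
    using ip integrable_const_domain[of "1::real"] by auto
  show sq: "sq_int \<Omega> f"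
    unfolding sq_int_def using m le[of 1] is1[of 1] by (auto intro!: Bochner_Integration.integrable_bound[OF is1[of 1]])
  have bnd: "(\<integral>x. (norm (f x))\<^sup>2 \<partial>M) \<le> s\<^sup>2 * (measure lebesgue \<Omega> + I / s powr p)" if s: "0 < s" for s
  proof -
    have "(\<integral>x. (norm (f x))\<^sup>2 \<partial>M) \<le> (\<integral>x. s\<^sup>2 * (1 + norm (f x) powr p / s powr p) \<partial>M)"
      using sq_intD(2)[OF sq] is1 le[OF s] by (intro integral_mono) auto
    also have "\<dots> = s\<^sup>2 * (measure lebesgue \<Omega> + I / s powr p)"
      using ip integrable_const_domain[of "1::real"] integral_const_domain[of 1] by (simp add: I_def)
    finally show ?thesis .
  qed
  have I0: "0 \<le> I" by (simp add: I_def)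
  \<comment> \<open>Taking the \<open>Lp\<close> norm itself for \<open>s\<close> makes
    \<open>I / s powr p\<close> equal to 1; a vanishing norm is treated apart.\<close>
  show "(\<integral>x. (norm (f x))\<^sup>2 \<partial>M) \<le> (1 + measure lebesgue \<Omega>) * (Lp_norm p \<Omega> f)\<^sup>2"
  proof (cases "I = 0")
    case False
    then have n: "0 < Lp_norm p \<Omega> f" using I0 by (simp add: Lp_norm_def I_def)
    have "Lp_norm p \<Omega> f powr p = I" using I0 p by (simp add: Lp_norm_def I_def powr_powr)
    then show ?thesis using bnd[OF n] False by (simp add: mult.commute add.commute)
  next
    case True
    have "AE x in M. norm (f x) powr p = 0"
      using integral_nonneg_eq_0_iff_AE[OF ip] True by (simp add: I_def)
    then have "(\<integral>x. (norm (f x))\<^sup>2 \<partial>M) = 0" by (intro integral_eq_zero_AE) (auto elim!: eventually_mono)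
    then show ?thesis by simp
  qed
qed

lemma Lp_cong_AE:
  fixes f g :: "real^3 \<Rightarrow> 'b::euclidean_space"
  assumes "AE x in M. f x = g x" "f \<in> Lp p \<Omega>"
  shows "g \<in> Lp p \<Omega>"
proof -
  have "AE x in M. norm (f x) powr p = norm (g x) powr p" using assms(1) by eventually_elim simp
  from lebesgue_on_integral_cong_AE(2)[OF domain_sets this] show ?thesis
    using assms(2) lebesgue_on_measurable_AE[OF domain_sets assms(1)] by (simp add: Lp_def)
qed

lemma Sobolev_cong_AE:
  fixes f g :: "real^3 \<Rightarrow> 'b::euclidean_space"
  assumes "AE x in M. f x = g x" "f \<in> Sobolev k p \<Omega>"
  shows "g \<in> Sobolev k p \<Omega>"
  using assms
proof (cases k)
  case (Suc j)
  then show ?thesis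
    using assms Lp_cong_AE[OF assms(1)] has_weak_partial_cong_AE[OF open_domain _ assms(1)]
    by (auto intro: always_eventually) (metis (mono_tags, lifting) AE_I2)
qed (use Lp_cong_AE in auto)

text \<open>Since \<open>Sobolev\<close> is invariant on null sets, membership passes from the
  derivative that is known to exist to the one selected by \<open>weak_partial\<close>.\<close>

lemma Sobolev_SucD:
  fixes f :: "real^3 \<Rightarrow> 'b::euclidean_space"
  assumes "f \<in> Sobolev (Suc k) p \<Omega>"
  shows "f \<in> Lp p \<Omega>" "has_weak_partial \<Omega> i f (weak_partial \<Omega> i f)" "weak_partial \<Omega> i f \<in> Sobolev k p \<Omega>"
proof -
  show "f \<in> Lp p \<Omega>" using assms by simp
  obtain g where g: "g \<in> Sobolev k p \<Omega>" "has_weak_partial \<Omega> i f g" using assms by auto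
  show "has_weak_partial \<Omega> i f (weak_partial \<Omega> i f)" by (rule weak_partial_eq(1)[OF open_domain g(2)])
  have "AE x in M. g x = weak_partial \<Omega> i f x"
    using weak_partial_eq(2)[OF open_domain g(2)] by eventually_elim simp
  then show "weak_partial \<Omega> i f \<in> Sobolev k p \<Omega>" using g(1) by (rule Sobolev_cong_AE)
qed

lemma Sobolev_Lp: "f \<in> Sobolev k p \<Omega> \<Longrightarrow> f \<in> Lp p \<Omega>"
  by (cases k) auto

lemma Sobolev_H1:
  fixes f :: "real^3 \<Rightarrow> 'b::euclidean_space"
  assumes "f \<in> Sobolev (Suc k) p \<Omega>" "2 \<le> p"
  shows "H1 \<Omega> f (\<lambda>i. weak_partial \<Omega> i f)"
  unfolding H1_def using Sobolev_SucD[OF assms(1)] Lp_sq_int(1)[OF _ assms(2)] Sobolev_Lp by blast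

lemma H1_locally_integrable:
  assumes "sq_int \<Omega> f" "sq_int \<Omega> g"
  shows "locally_integrable_on (\<lambda>x. norm (f x) * norm (g x)) \<Omega>"
  by (rule locally_integrable_integrable[OF sq_int_prod[OF assms] open_domain])

text \<open>Both summands of the derivative are products of two square integrable factors. This
  gives integrability only, and the integration by parts lemmas are shaped accordingly.\<close>

lemma H1_bilinear:
  fixes f :: "real^3 \<Rightarrow> 'b::euclidean_space" and g :: "real^3 \<Rightarrow> 'c::euclidean_space"
    and bb :: "'b \<Rightarrow> 'c \<Rightarrow> 'd::euclidean_space"
  assumes "H1 \<Omega> f f'" "H1 \<Omega> g g'" and bb: "bounded_bilinear bb"
  shows "has_weak_partial \<Omega> i (\<lambda>x. bb (f x) (g x)) (\<lambda>x. bb (f x) (g' i x) + bb (f' i x) (g x))"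
    and "integrable M (\<lambda>x. bb (f x) (g' i x) + bb (f' i x) (g x))"
  by (intro has_weak_partial_bilinear[OF open_domain bb] H1D[OF assms(1)] H1D[OF assms(2)] H1_locally_integrable)
    (intro Bochner_Integration.integrable_add sq_int_bilinear bb H1D[OF assms(1)] H1D[OF assms(2)])

lemma weak_partial_integrable:
  fixes f :: "real^3 \<Rightarrow> 'b::euclidean_space"
  assumes "has_weak_partial \<Omega> i f g" "integrable M g"
  shows "has_weak_partial \<Omega> i f (weak_partial \<Omega> i f)" "integrable M (weak_partial \<Omega> i f)"
  using weak_partial_eq[OF open_domain assms(1)] lebesgue_on_integral_cong_AE(2)[OF domain_sets, of "weak_partial \<Omega> i f" g] assms(2)
  by auto

lemma H1_compose:
  fixes f :: "real^3 \<Rightarrow> 'b::euclidean_space" and G :: "'b \<Rightarrow> 'c::euclidean_space"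
  assumes f: "H1 \<Omega> f f'" and B: "0 \<le> B" "\<And>x. x \<in> \<Omega> \<Longrightarrow> norm (f x - c) \<le> B"
    and G: "\<And>y. norm (y - c) \<le> B \<Longrightarrow> (G has_derivative G' y) (at y)" "\<And>v. continuous_on (cball c B) (\<lambda>y. G' y v)"
  shows "H1 \<Omega> (\<lambda>x. G (f x)) (\<lambda>i x. G' (f x) (f' i x))"
  unfolding H1_def
proof (intro conjI allI)
  have mf: "f \<in> borel_measurable M" by (rule sq_intD(1)[OF H1D(1)[OF f]])
  have fS: "f x \<in> cball c B" if "x \<in> \<Omega>" for x using B(2)[OF that] by (simp add: dist_norm norm_minus_commute)
  have bounded_comp: "h \<circ> f \<in> borel_measurable M \<and> (\<exists>K. \<forall>x\<in>\<Omega>. norm (h (f x)) \<le> K)"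
    if "continuous_on (cball c B) h" for h :: "'b \<Rightarrow> 'c"
  proof
    show "h \<circ> f \<in> borel_measurable M"
      using measurable_continuous_compose[OF closed_cball that mf] fS by (simp add: comp_def)
    have "bounded (h ` cball c B)" by (intro compact_imp_bounded compact_continuous_image that compact_cball)
    then obtain K where "\<forall>y\<in>cball c B. norm (h y) \<le> K" unfolding bounded_iff by auto
    then show "\<exists>K. \<forall>x\<in>\<Omega>. norm (h (f x)) \<le> K" using fS by blast
  qed
  have contG: "continuous_on (cball c B) G"
    by (rule continuous_at_imp_continuous_on) (auto intro!: has_derivative_continuous[OF G(1)] simp: dist_norm norm_minus_commute)
  show "sq_int \<Omega> (\<lambda>x. G (f x))"
  proof -
    obtain K where "\<forall>x\<in>\<Omega>. norm (G (f x)) \<le> K" and m: "(\<lambda>x. G (f x)) \<in> borel_measurable M"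
      using bounded_comp[OF contG] by (auto simp: comp_def)
    then have "AE x in M. norm (G (f x)) \<le> K" by (intro AE_I2) auto
    then show ?thesis by (rule sq_int_bounded[OF m])
  qed
  fix i
  show "has_weak_partial \<Omega> i (\<lambda>x. G (f x)) (\<lambda>x. G' (f x) (f' i x))"
    by (rule has_weak_partial_chain_bounded[OF open_domain H1D(3)[OF f] B G])
  \<comment> \<open>Continuity is available for \<open>G' y b\<close> with fixed direction
    \<open>b\<close>, hence the expansion of the varying direction in the basis.\<close>
  have "sq_int \<Omega> (\<lambda>x. \<Sum>b\<in>Basis. (f' i x \<bullet> b) *\<^sub>R G' (f x) b)"
  proof (rule sq_int_sum)
    fix b :: 'b
    obtain K where "\<forall>x\<in>\<Omega>. norm (G' (f x) b) \<le> K" and m: "(\<lambda>x. G' (f x) b) \<in> borel_measurable M"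
      using bounded_comp[OF G(2)[of b]] by (auto simp: comp_def)
    then have "AE x in M. norm (G' (f x) b) \<le> K" by (intro AE_I2) auto
    from sq_int_bilinear_bounded[OF m this sq_int_linear[OF H1D(2)[OF f] bounded_linear_inner_left[of b]]
        bounded_bilinear.flip[OF bounded_bilinear_scaleR]]
    show "sq_int \<Omega> (\<lambda>x. (f' i x \<bullet> b) *\<^sub>R G' (f x) b)" .
  qed
  then show "sq_int \<Omega> (\<lambda>x. G' (f x) (f' i x))"
  proof (rule sq_int_cong_AE, intro AE_I2)
    fix x assume "x \<in> space M"
    then have lin: "linear (G' (f x))" using B(2) has_derivative_linear[OF G(1)] by simp
    show "(\<Sum>b\<in>Basis. (f' i x \<bullet> b) *\<^sub>R G' (f x) b) = G' (f x) (f' i x)"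
      using linear_sum[OF lin, of "\<lambda>b. (f' i x \<bullet> b) *\<^sub>R b" Basis] linear_scale[OF lin] by (simp add: euclidean_representation)
  qed
qed

lemma H1_compose_C1:
  fixes f :: "real^3 \<Rightarrow> 'b::euclidean_space" and G :: "'b \<Rightarrow> 'c::euclidean_space"
  assumes f: "H1 \<Omega> f f'" "continuous_on (closure \<Omega>) f" and G: "Ck_on (Suc k) G UNIV"
  obtains g where "H1 \<Omega> (\<lambda>x. G (f x)) g"
proof -
  obtain G' where G': "\<And>x. (G has_derivative G' x) (at x)" "\<And>v. continuous_on UNIV (\<lambda>x. G' x v)"
    using Ck_on_le[OF G, of "Suc 0"] by auto
  obtain B where "0 \<le> B" "\<And>x. x \<in> closure \<Omega> \<Longrightarrow> norm (f x) \<le> B" by (rule continuous_closure_bounded[OF f(2)]) blast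
  from H1_compose[OF f(1) this(1), of 0 G G'] this(2) G' closure_subset[of \<Omega>] continuous_on_subset[OF G'(2)] show ?thesis
    by (intro that) auto
qed

lemma H1_Pair:
  assumes "H1 \<Omega> f f'" "H1 \<Omega> g g'"
  shows "H1 \<Omega> (\<lambda>x. (f x, g x)) (\<lambda>i x. (f' i x, g' i x))"
proof -
  have L: "bounded_linear (\<lambda>a::'a. (a, 0::'b))" "bounded_linear (\<lambda>b::'b. (0::'a, b))"
    by (intro bounded_linear_Pair bounded_linear_ident bounded_linear_zero)+
  have sq: "sq_int \<Omega> (\<lambda>x. (h x, k x))" if "sq_int \<Omega> h" "sq_int \<Omega> k" for h :: "real^3 \<Rightarrow> 'a" and k :: "real^3 \<Rightarrow> 'b"
    using sq_int_add[OF sq_int_linear[OF that(1) L(1)] sq_int_linear[OF that(2) L(2)]] by simp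
  have "has_weak_partial \<Omega> i (\<lambda>x. (f x, g x)) (\<lambda>x. (f' i x, g' i x))" for i
    using has_weak_partial_add[OF open_domain has_weak_partial_linear[OF open_domain H1D(3)[OF assms(1), of i] L(1)]
        has_weak_partial_linear[OF open_domain H1D(3)[OF assms(2), of i] L(2)]] by simp
  then show ?thesis using sq H1D[OF assms(1)] H1D[OF assms(2)] by (simp add: H1_def)
qed

section \<open>Integrals that vanish by boundary or solenoidality conditions\<close>

text \<open>Statements of the form \<open>has_bochner_integral M h 0\<close> bundle integrability with a vanishing integral.\<close>

lemma zero_boundary_parts:
  fixes v A :: "real^3 \<Rightarrow> 'b::euclidean_space"
  assumes v: "H1 \<Omega> v v'" "zero_on_boundary \<Omega> v" and A: "sq_int \<Omega> A" "has_weak_partial \<Omega> i A A'" "integrable M A'"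
  shows "has_bochner_integral M (\<lambda>x. v x \<bullet> A' x + v' i x \<bullet> A x) 0"
proof -
  obtain g where g: "continuous_on (closure \<Omega>) g" "AE x in M. g x = v x" "\<And>x. x \<in> frontier \<Omega> \<Longrightarrow> g x = 0"
    using v(2) by (auto simp: zero_on_boundary_def continuous_representative_def)
  have g': "AE x in M. v x = g x" using g(2) by eventually_elim simp
  have wg: "has_weak_partial \<Omega> i g (v' i)"
    by (rule has_weak_partial_cong_AE[OF open_domain H1D(3)[OF v(1)] g']) simp
  have comp: "has_bochner_integral M (\<lambda>x. (g x \<bullet> b) * (A' x \<bullet> b) + (v' i x \<bullet> b) * (A x \<bullet> b)) 0" for b
  proof -
    have L: "bounded_linear (\<lambda>a :: 'b. a \<bullet> b)" by (rule bounded_linear_inner_left)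
    have cb: "continuous_on (closure \<Omega>) (\<lambda>x. g x \<bullet> b)" by (intro continuous_intros g(1))
    have i1: "integrable M (\<lambda>x. (g x \<bullet> b) * (A' x \<bullet> b))"
      by (rule integrable_continuous_mult[OF bounded_domain cb _ domain_sets]) (use A(3) in auto)
    have i2: "integrable M (\<lambda>x. (v' i x \<bullet> b) * (A x \<bullet> b))"
      by (intro sq_int_mult sq_int_linear[OF _ L] H1D(2)[OF v(1)] A(1))
    show ?thesis
      unfolding has_bochner_integral_iff
      using i1 i2 zero_boundary_integration_by_parts[OF open_domain bounded_domain cb _
          has_weak_partial_linear[OF open_domain wg L] has_weak_partial_linear[OF open_domain A(2) L] i1 i2] g(3)
      by auto
  qed
  have "has_bochner_integral M (\<lambda>x. \<Sum>b\<in>Basis. (g x \<bullet> b) * (A' x \<bullet> b) + (v' i x \<bullet> b) * (A x \<bullet> b)) (\<Sum>b\<in>(Basis :: 'b set). 0)"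
    by (intro has_bochner_integral_sum comp)
  then have "has_bochner_integral M (\<lambda>x. g x \<bullet> A' x + v' i x \<bullet> A x) 0"
    by (simp add: sum.distrib euclidean_inner[symmetric])
  moreover have "AE x in M. g x \<bullet> A' x + v' i x \<bullet> A x = v x \<bullet> A' x + v' i x \<bullet> A x"
    using g(2) by eventually_elim simp
  ultimately show ?thesis
    by (rule bochner_cong_AE[rotated])
qed

text \<open>The scalar divergence theorem in every coordinate \<open>b\<close>. The derivatives
  \<open>D j\<close> may be merely integrable, so their products with \<open>w\<close> carry an
  integrability condition of their own.\<close>

lemma zero_flux_parts:
  fixes w :: "real^3 \<Rightarrow> 'b::euclidean_space" and A :: "real^3 \<Rightarrow> 'b^3"
  assumes bd: "Ck_boundary (Suc k) \<Omega>" and A: "zero_normal_component_on_boundary \<Omega> A"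
    and D: "\<And>j. has_weak_partial \<Omega> j (\<lambda>x. A x $ j) (D j)" "\<And>j. integrable M (D j)"
    and w: "H1 \<Omega> w w'" and wD: "\<And>b j. integrable M (\<lambda>x. (w x \<bullet> b) * (D j x \<bullet> b))"
  shows "has_bochner_integral M (\<lambda>x. \<Sum>j\<in>UNIV. w x \<bullet> D j x + w' j x \<bullet> (A x $ j)) 0"
proof -
  obtain G where G: "continuous_on (closure \<Omega>) G" "AE x in M. G x = A x"
    "\<And>x. x \<in> frontier \<Omega> \<Longrightarrow> (\<Sum>j\<in>UNIV. (outward_normal \<Omega> x $ j) *\<^sub>R (G x $ j)) = 0"
    using A by (auto simp: zero_normal_component_on_boundary_def continuous_representative_def)
  have comp: "has_bochner_integral M (\<lambda>x. \<Sum>j\<in>UNIV. (w x \<bullet> b) * (D j x \<bullet> b) + (w' j x \<bullet> b) * (G x $ j \<bullet> b)) 0" for b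
  proof -
    have L: "bounded_linear (\<lambda>a :: 'b. a \<bullet> b)" by (rule bounded_linear_inner_left)
    have cb: "continuous_on (closure \<Omega>) (\<lambda>x. G x $ j \<bullet> b)" for j by (intro continuous_intros G(1))
    have wG: "has_weak_partial \<Omega> j (\<lambda>x. G x $ j \<bullet> b) (\<lambda>x. D j x \<bullet> b)" for j
    proof (rule has_weak_partial_linear[OF open_domain _ L], rule has_weak_partial_cong_AE[OF open_domain D(1)])
      show "AE x in M. A x $ j = G x $ j" using G(2) by eventually_elim simp
    qed simp
    have nu: "(\<Sum>j\<in>UNIV. outward_normal \<Omega> x $ j * (G x $ j \<bullet> b)) = 0" if "x \<in> frontier \<Omega>" for x
      using arg_cong[OF G(3)[OF that], of "\<lambda>a. a \<bullet> b"] by (simp add: inner_sum_left)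
    have i1: "integrable M (\<lambda>x. D j x \<bullet> b)" for j using D(2) by simp
    have i2: "integrable M (\<lambda>x. w x \<bullet> b)" "integrable M (\<lambda>x. w' j x \<bullet> b)" for j
      using sq_int_integrable[OF H1D(1)[OF w]] sq_int_integrable[OF H1D(2)[OF w]] by auto
    have i3: "integrable M (\<lambda>x. (G x $ j \<bullet> b) * (w' j x \<bullet> b))" for j
      by (rule integrable_continuous_mult[OF bounded_domain cb i2(2) domain_sets])
    show ?thesis
      unfolding has_bochner_integral_iff
      using divergence_theorem_zero_flux[OF open_domain bounded_domain bd cb nu wG i1
          has_weak_partial_linear[OF open_domain H1D(3)[OF w] L] i2 wD] wD i3
      by (auto simp: mult.commute)
  qed
  have "has_bochner_integral M (\<lambda>x. \<Sum>b\<in>Basis. \<Sum>j\<in>UNIV. (w x \<bullet> b) * (D j x \<bullet> b) + (w' j x \<bullet> b) * (G x $ j \<bullet> b)) (\<Sum>b\<in>(Basis :: 'b set). 0)"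
    by (intro has_bochner_integral_sum comp)
  moreover have "(\<Sum>b\<in>Basis. \<Sum>j\<in>UNIV. (w x \<bullet> b) * (D j x \<bullet> b) + (w' j x \<bullet> b) * (G x $ j \<bullet> b)) =
      (\<Sum>j\<in>UNIV. w x \<bullet> D j x + w' j x \<bullet> (G x $ j))" for x
    by (subst sum.swap) (simp add: sum.distrib euclidean_inner[symmetric])
  ultimately have "has_bochner_integral M (\<lambda>x. \<Sum>j\<in>UNIV. w x \<bullet> D j x + w' j x \<bullet> (G x $ j)) 0" by simp
  moreover have "AE x in M. (\<Sum>j\<in>UNIV. w x \<bullet> D j x + w' j x \<bullet> (G x $ j)) = (\<Sum>j\<in>UNIV. w x \<bullet> D j x + w' j x \<bullet> (A x $ j))"
    using G(2) by eventually_elim simp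
  ultimately show ?thesis
    by (rule bochner_cong_AE[rotated])
qed

text \<open>An element of \<open>Lp_sigma\<close> is \<open>f\<close> minus a gradient, and the weak
  Neumann problem says that \<open>f\<close> and this gradient have the same pairing with all test
  gradients. The vanishing normal component is encoded in this orthogonality.\<close>

lemma solenoidal_parts:
  fixes \<psi> :: "real^3 \<Rightarrow> real"
  assumes u: "u \<in> Lp_sigma p \<Omega>" and p: "2 \<le> p"
    and \<psi>: "\<And>i. has_weak_partial \<Omega> i \<psi> (\<psi>' i)" "\<And>i. sq_int \<Omega> (\<psi>' i)"
  shows "has_bochner_integral M (\<lambda>x. \<Sum>i\<in>UNIV. u x $ i * \<psi>' i x) 0"
proof -
  define q where "q = p / (p - 1)"
  \<comment> \<open>The dual exponent is at most 2, so square integrable derivatives belong to the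
    test gradients of the Neumann problem.\<close>
  have q: "0 < q" "q \<le> 2" using p by (auto simp: q_def field_simps)
  have Lq: "\<psi>' i \<in> Lp q \<Omega>" for i
    unfolding Lp_def
  proof (intro CollectI conjI sq_intD(1)[OF \<psi>(2)])
    have [measurable]: "\<psi>' i \<in> borel_measurable M" by (rule sq_intD(1)[OF \<psi>(2)])
    show "integrable M (\<lambda>x. norm (\<psi>' i x) powr q)"
    proof (rule Bochner_Integration.integrable_bound)
      show "integrable M (\<lambda>x. 1 + (norm (\<psi>' i x))\<^sup>2)"
        using integrable_const_domain[of "1::real"] sq_intD(2)[OF \<psi>(2)] by auto
      have "norm (\<psi>' i x) powr q \<le> 1 + (norm (\<psi>' i x))\<^sup>2" for x
      proof (cases "norm (\<psi>' i x) \<le> 1")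
        case True
        then have "norm (\<psi>' i x) powr q \<le> 1" using q by (intro powr_le1) auto
        then show ?thesis by (simp add: add_increasing2)
      next
        case False
        then have "norm (\<psi>' i x) powr q \<le> norm (\<psi>' i x) powr 2" using q by (intro powr_mono) auto
        then show ?thesis using False by simp
      qed
      then show "AE x in M. norm (norm (\<psi>' i x) powr q) \<le> norm (1 + (norm (\<psi>' i x))\<^sup>2)"
        by (intro AE_I2) simp
    qed measurable
  qed
  have \<psi>H: "\<psi> \<in> homogeneous_H1 q \<Omega>"
    using has_weak_partialD(1)[OF \<psi>(1)] \<psi>(1) Lq by (auto simp: homogeneous_H1_def)
  obtain f h where f: "f \<in> Lp p \<Omega>" and h: "h \<in> homogeneous_H1 p \<Omega>"
    and uf: "AE x in M. u x = f x - weak_grad \<Omega> h x"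
    and eq: "\<forall>\<psi>\<in>homogeneous_H1 (p / (p - 1)) \<Omega>. (\<integral>x. f x \<bullet> weak_grad \<Omega> \<psi> x \<partial>M) = (\<integral>x. weak_grad \<Omega> h x \<bullet> weak_grad \<Omega> \<psi> x \<partial>M)"
    using u by (auto simp: Lp_sigma_def Helmholtz_projection_def)
  have u2: "sq_int \<Omega> u" using u Lp_sq_int(1)[OF _ p] by (auto simp: Lp_sigma_def)
  have f2: "sq_int \<Omega> f" by (rule Lp_sq_int(1)[OF f p])
  have h2: "sq_int \<Omega> (weak_grad \<Omega> h)"
  proof (rule sq_int_cong_AE)
    have "bounded_linear (\<lambda>a :: real^3. - a)" by (rule bounded_linear_minus[OF bounded_linear_ident])
    from sq_int_add[OF f2 sq_int_linear[OF u2 this]] show "sq_int \<Omega> (\<lambda>x. f x + - u x)" .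
    show "AE x in M. f x + - u x = weak_grad \<Omega> h x" using uf by eventually_elim simp
  qed
  have ae: "AE x in M. \<forall>i\<in>UNIV. weak_partial \<Omega> i \<psi> x = \<psi>' i x"
    by (rule AE_finite_allI) (auto intro: weak_partial_eq(2)[OF open_domain \<psi>(1)])
  have g: "AE x in M. (\<chi> i. \<psi>' i x) = weak_grad \<Omega> \<psi> x"
    using ae by eventually_elim (simp add: weak_grad_def vec_eq_iff)
  have sqv: "sq_int \<Omega> (\<lambda>x. \<chi> i. \<psi>' i x)"
  proof -
    have "sq_int \<Omega> (\<lambda>x. \<Sum>i\<in>UNIV. \<psi>' i x *\<^sub>R (axis i 1 :: real^3))"
      by (intro sq_int_sum sq_int_linear[OF \<psi>(2)] bounded_linear_scaleR_left)
    moreover have "(\<lambda>x. \<Sum>i\<in>UNIV. \<psi>' i x *\<^sub>R (axis i 1 :: real^3)) = (\<lambda>x. \<chi> i. \<psi>' i x)"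
      by (auto simp: fun_eq_iff vec_eq_iff sum_component axis_def if_distrib cong: if_cong)
    ultimately show ?thesis by simp
  qed
  have \<psi>2: "sq_int \<Omega> (weak_grad \<Omega> \<psi>)" by (rule sq_int_cong_AE[OF sqv g])
  have "has_bochner_integral M (\<lambda>x. f x \<bullet> weak_grad \<Omega> \<psi> x - weak_grad \<Omega> h x \<bullet> weak_grad \<Omega> \<psi> x) 0"
    using sq_int_inner[OF f2 \<psi>2] sq_int_inner[OF h2 \<psi>2] eq \<psi>H by (simp add: has_bochner_integral_iff q_def)
  moreover have "AE x in M. f x \<bullet> weak_grad \<Omega> \<psi> x - weak_grad \<Omega> h x \<bullet> weak_grad \<Omega> \<psi> x = (\<Sum>i\<in>UNIV. u x $ i * \<psi>' i x)"
    using uf g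
  proof eventually_elim
    case (elim x)
    have "f x \<bullet> weak_grad \<Omega> \<psi> x - weak_grad \<Omega> h x \<bullet> weak_grad \<Omega> \<psi> x = u x \<bullet> (\<chi> i. \<psi>' i x)"
      using elim by (simp add: inner_diff_left)
    then show ?case by (simp add: inner_vec_def)
  qed
  ultimately show ?thesis
    by (rule bochner_cong_AE[rotated])
qed

end

section \<open>Identities at a fixed time\<close>

lemma norm_vec_squared: "(norm (v :: 'b::real_inner^3))\<^sup>2 = (\<Sum>i\<in>UNIV. v $ i \<bullet> v $ i)"
  by (simp add: power2_norm_eq_inner inner_vec_def)

lemma bounded_bilinear_matrix_vector: "bounded_bilinear ((*v) :: real^3^3 \<Rightarrow> real^3 \<Rightarrow> real^3)"
  unfolding bilinear_conv_bounded_bilinear[symmetric] bilinear_def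
  by (auto intro!: linearI simp: matrix_vector_right_distrib matrix_vector_mult_add_rdistrib matrix_vector_mult_scaleR
      scaleR_matrix_vector_assoc)

lemma bounded_bilinear_matrix_transpose: "bounded_bilinear (\<lambda>A B :: real^3^3. A ** transpose B)"
  unfolding bilinear_conv_bounded_bilinear[symmetric] bilinear_def
  by (auto intro!: linearI simp: vec_eq_iff matrix_matrix_mult_def transpose_def sum.distrib algebra_simps sum_distrib_left)

lemma continuous_state_components:
  assumes "continuous_on S z"
  shows "continuous_on S (vel z)" "continuous_on S (dfm z)" "continuous_on S (tmp z)" "continuous_on S (mag z)"
  unfolding vel_def[abs_def] dfm_def[abs_def] tmp_def[abs_def] mag_def[abs_def]
  by (intro continuous_intros assms)+

context bounded_domain
begin

lemma Sobolev_two: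
  fixes f :: "real^3 \<Rightarrow> 'b::euclidean_space"
  assumes "f \<in> Sobolev (Suc (Suc k)) p \<Omega>" "2 \<le> p"
  shows "H1 \<Omega> f (\<lambda>i. weak_partial \<Omega> i f)"
    "H1 \<Omega> (weak_partial \<Omega> i f) (\<lambda>j. weak_partial \<Omega> j (weak_partial \<Omega> i f))"
  using Sobolev_H1[OF assms] Sobolev_H1[OF Sobolev_SucD(3)[OF assms(1)] assms(2)] by auto

lemma H1_vec:
  fixes f :: "3 \<Rightarrow> real^3 \<Rightarrow> real"
  assumes "\<And>i. H1 \<Omega> (f i) (f' i)"
  shows "H1 \<Omega> (\<lambda>x. \<chi> i. f i x) (\<lambda>j x. \<chi> i. f' i j x)"
proof -
  have eq: "(\<lambda>x. \<Sum>i\<in>UNIV. h i x *\<^sub>R (axis i 1 :: real^3)) = (\<lambda>x. \<chi> i. h i x)" for h :: "3 \<Rightarrow> real^3 \<Rightarrow> real"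
    by (auto simp: fun_eq_iff vec_eq_iff sum_component axis_def if_distrib cong: if_cong)
  show ?thesis
    unfolding H1_def eq[symmetric]
    by (intro conjI allI sq_int_sum sq_int_linear[OF H1D(1)[OF assms]] sq_int_linear[OF H1D(2)[OF assms]]
        has_weak_partial_sum[OF open_domain] has_weak_partial_linear[OF open_domain H1D(3)[OF assms]] bounded_linear_scaleR_left)
qed

lemma weak_div_scaled_grad:
  "weak_div \<Omega> (\<lambda>y. c y *\<^sub>R weak_grad \<Omega> v y) x = (\<Sum>j\<in>UNIV. weak_partial \<Omega> j (\<lambda>y. c y *\<^sub>R weak_partial \<Omega> j v y) x)"
  by (simp add: weak_div_def weak_grad_def)

text \<open>Integration by parts for the field \<open>c (\<theta>) grad v\<close>: it is square
  integrable since \<open>\<theta>\<close> is bounded, its divergence is integrable by the product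
  rule, and \<open>v\<close> vanishes on the boundary.\<close>

lemma diffusion_zero:
  fixes v :: "real^3 \<Rightarrow> 'b::euclidean_space" and \<theta> :: "real^3 \<Rightarrow> real"
  assumes c: "Ck_on (Suc n) c UNIV" and \<theta>: "H1 \<Omega> \<theta> \<theta>'" "continuous_on (closure \<Omega>) \<theta>"
    and v: "v \<in> Sobolev (Suc (Suc k)) p \<Omega>" "2 \<le> p" "zero_on_boundary \<Omega> v"
  shows "has_bochner_integral M (\<lambda>x. v x \<bullet> weak_div \<Omega> (\<lambda>y. c (\<theta> y) *\<^sub>R weak_grad \<Omega> v y) x
    + c (\<theta> x) * (norm (weak_grad \<Omega> v x))\<^sup>2) 0"
proof -
  note Hv = Sobolev_two[OF v(1,2)]
  obtain g where g: "H1 \<Omega> (\<lambda>x. c (\<theta> x)) g" by (rule H1_compose_C1[OF \<theta> c]) blast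
  have "continuous_on UNIV c" using Ck_on_le[OF c, of 0] by simp
  then have cc: "continuous_on (closure \<Omega>) (\<lambda>x. c (\<theta> x))" by (rule continuous_on_compose2[OF _ \<theta>(2)]) auto
  obtain B where B: "\<And>x. x \<in> closure \<Omega> \<Longrightarrow> norm (c (\<theta> x)) \<le> B" by (rule continuous_closure_bounded[OF cc]) blast
  let ?A = "\<lambda>j y. c (\<theta> y) *\<^sub>R weak_partial \<Omega> j v y"
  have "AE x in M. norm (c (\<theta> x)) \<le> B" using B closure_subset[of \<Omega>] by (intro AE_I2) auto
  then have sA: "sq_int \<Omega> (?A j)" for j
    by (rule sq_int_bilinear_bounded[OF continuous_closure_measurable[OF cc] _ H1D(2)[OF Hv(1)] bounded_bilinear_scaleR])
  note wA = weak_partial_integrable[OF H1_bilinear[OF g Hv(2) bounded_bilinear_scaleR]]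
  have "has_bochner_integral M (\<lambda>x. \<Sum>j\<in>UNIV. v x \<bullet> weak_partial \<Omega> j (?A j) x + weak_partial \<Omega> j v x \<bullet> ?A j x) (\<Sum>j\<in>(UNIV::3 set). 0)"
    by (intro has_bochner_integral_sum zero_boundary_parts[OF Hv(1) v(3) sA] wA)
  moreover have "(norm (weak_grad \<Omega> v x))\<^sup>2 = (\<Sum>j\<in>UNIV. weak_partial \<Omega> j v x \<bullet> weak_partial \<Omega> j v x)" for x
    by (simp add: norm_vec_squared weak_grad_def)
  ultimately show ?thesis
    by (simp add: weak_div_scaled_grad inner_sum_right sum.distrib sum_distrib_left)
qed

text \<open>\<open>v \<bullet> advection \<Omega> u v\<close> is \<open>u\<close> paired with the
  gradient of \<open>|v|^2 / 2\<close>; boundedness of \<open>v\<close> makes this gradient square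
  integrable.\<close>

lemma advection_zero:
  fixes v :: "real^3 \<Rightarrow> 'b::euclidean_space"
  assumes u: "u \<in> Lp_sigma p \<Omega>" "2 \<le> p" and v: "H1 \<Omega> v (\<lambda>i. weak_partial \<Omega> i v)" "continuous_on (closure \<Omega>) v"
  shows "has_bochner_integral M (\<lambda>x. v x \<bullet> advection \<Omega> u v x) 0"
proof -
  let ?d = "\<lambda>i. weak_partial \<Omega> i v"
  obtain B where B: "\<And>x. x \<in> closure \<Omega> \<Longrightarrow> norm (v x) \<le> B" by (rule continuous_closure_bounded[OF v(2)]) blast
  then have "AE x in M. norm (v x) \<le> B" using closure_subset[of \<Omega>] by (intro AE_I2) auto
  then have s: "sq_int \<Omega> (\<lambda>x. v x \<bullet> ?d i x)" for i
    by (rule sq_int_bilinear_bounded[OF continuous_closure_measurable[OF v(2)] _ H1D(2)[OF v(1)] bounded_bilinear_inner])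
  have "has_weak_partial \<Omega> i (\<lambda>x. (1/2) *\<^sub>R (v x \<bullet> v x)) (\<lambda>x. (1/2) *\<^sub>R (v x \<bullet> ?d i x + ?d i x \<bullet> v x))" for i
    by (rule has_weak_partial_linear[OF open_domain H1_bilinear(1)[OF v(1) v(1) bounded_bilinear_inner] bounded_linear_scaleR_right])
  then have "has_weak_partial \<Omega> i (\<lambda>x. (1/2) *\<^sub>R (v x \<bullet> v x)) (\<lambda>x. v x \<bullet> ?d i x)" for i
    by (simp add: inner_commute)
  from solenoidal_parts[OF u this s] show ?thesis
    by (simp add: advection_def inner_sum_right)
qed

end

section \<open>The magnetoviscoelastic system at one time\<close>

locale MVE_slice = bounded_domain \<Omega> for \<Omega> +
  fixes p :: real and k :: nat and \<mu>vis \<kappa> \<alpha> \<beta> :: "real \<Rightarrow> real" and K :: "state \<Rightarrow> real^3^3"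
    and z z' :: "real^3 \<Rightarrow> state" and \<pi> :: "real^3 \<Rightarrow> real"
  assumes p: "2 \<le> p" and bd: "Ck_boundary (Suc k) \<Omega>"
    and coefficients: "Ck_on (Suc 0) \<mu>vis UNIV" "Ck_on (Suc 0) \<kappa> UNIV" "Ck_on (Suc 0) K UNIV"
    and zX1: "z \<in> X1 p \<Omega>" and z_cont: "continuous_on (closure \<Omega>) z" and z'X0: "z' \<in> X0 p \<Omega>"
    and pressure: "\<pi> \<in> homogeneous_H1 p \<Omega>"
    and equations: "MVE_equations \<Omega> \<mu>vis \<kappa> \<alpha> \<beta> K z' z \<pi>" and bc: "MVE_boundary_conditions \<Omega> K z"
begin

abbreviation "d \<equiv> weak_partial \<Omega>"
abbreviation "u \<equiv> vel z"
abbreviation "F \<equiv> dfm z"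
abbreviation "\<theta> \<equiv> tmp z"
abbreviation "mg \<equiv> mag z"
abbreviation "Lap \<equiv> weak_laplacian \<Omega> mg"

lemmas cont = continuous_state_components[OF z_cont]

lemma regularity:
  "u \<in> Sobolev (Suc (Suc 0)) p \<Omega>" "F \<in> Sobolev (Suc (Suc 0)) p \<Omega>" "\<theta> \<in> Sobolev (Suc (Suc 0)) p \<Omega>"
  "mg \<in> Sobolev (Suc (Suc (Suc 0))) p \<Omega>" "u \<in> Lp_sigma p \<Omega>"
  using zX1 by (simp_all add: X1_def numeral_2_eq_2 numeral_3_eq_3 del: Sobolev.simps)

lemmas Hu = Sobolev_two[OF regularity(1) p] and HF = Sobolev_two[OF regularity(2) p]
  and H\<theta> = Sobolev_two[OF regularity(3) p] and Hm = Sobolev_two[OF regularity(4) p]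

lemma bounds_AE:
  fixes f :: "real^3 \<Rightarrow> 'b::euclidean_space"
  assumes "continuous_on (closure \<Omega>) f"
  obtains B where "AE x in M. norm (f x) \<le> B"
proof -
  obtain B where "\<And>x. x \<in> closure \<Omega> \<Longrightarrow> norm (f x) \<le> B" by (rule continuous_closure_bounded[OF assms]) blast
  then show ?thesis using closure_subset[of \<Omega>] by (intro that[of B] AE_I2) auto
qed

text \<open>Read off the Neumann condition, which provides a representative of the gradient that is
  continuous up to the boundary.\<close>

lemma grad_mag_bounded:
  obtains B where "\<And>i. AE x in M. norm (d i mg x) \<le> B"
proof -
  obtain G where G: "continuous_on (closure \<Omega>) G" "AE x in M. G x = weak_grad \<Omega> mg x"
    using bc by (auto simp: MVE_boundary_conditions_def zero_normal_component_on_boundary_def continuous_representative_def)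
  obtain B where B: "AE x in M. norm (G x) \<le> B" by (rule bounds_AE[OF G(1)])
  have "AE x in M. norm (d i mg x) \<le> B" for i
    using G(2) B
  proof eventually_elim
    case (elim x)
    then show ?case using Finite_Cartesian_Product.norm_nth_le[of "weak_grad \<Omega> mg x" i] by (simp add: weak_grad_def)
  qed
  then show ?thesis by (rule that)
qed

lemma bounded_sq_int:
  fixes f :: "real^3 \<Rightarrow> 'b::euclidean_space" and g :: "real^3 \<Rightarrow> 'c::euclidean_space" and bb :: "'b \<Rightarrow> 'c \<Rightarrow> 'd::euclidean_space"
  assumes "continuous_on (closure \<Omega>) f" "sq_int \<Omega> g" "bounded_bilinear bb"
  shows "sq_int \<Omega> (\<lambda>x. bb (f x) (g x))"
proof -
  obtain B where B: "AE x in M. norm (f x) \<le> B" by (rule bounds_AE[OF assms(1)])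
  show ?thesis by (rule sq_int_bilinear_bounded[OF continuous_closure_measurable[OF assms(1)] B assms(2,3)])
qed

lemma pressure_zero: "has_bochner_integral M (\<lambda>x. u x \<bullet> weak_grad \<Omega> \<pi> x) 0"
proof -
  have "has_weak_partial \<Omega> i \<pi> (d i \<pi>) \<and> sq_int \<Omega> (d i \<pi>)" for i
  proof -
    obtain g where g: "g \<in> Lp p \<Omega>" "has_weak_partial \<Omega> i \<pi> g" using pressure by (auto simp: homogeneous_H1_def)
    have "AE x in M. g x = d i \<pi> x" using weak_partial_eq(2)[OF open_domain g(2)] by eventually_elim simp
    then show ?thesis
      using weak_partial_eq(1)[OF open_domain g(2)] sq_int_cong_AE[OF Lp_sq_int(1)[OF g(1) p]] by blast
  qed
  then have "has_bochner_integral M (\<lambda>x. \<Sum>i\<in>UNIV. u x $ i * d i \<pi> x) 0"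
    by (intro solenoidal_parts[OF regularity(5) p, where \<psi>=\<pi>]) auto
  then show ?thesis by (simp add: inner_vec_def weak_grad_def)
qed

lemma mixed_partials: "AE x in M. \<forall>i j. d j (d i mg) x = d i (d j mg) x"
proof -
  have "AE x in M. d j (d i mg) x = d i (d j mg) x" for i j
    by (rule has_weak_partial_unique[OF open_domain has_weak_partial_commute[OF open_domain H1D(3)[OF Hm(1)]
        H1D(3)[OF Hm(1)] H1D(3)[OF Hm(2)]] H1D(3)[OF Hm(2)], THEN AE_mp]) (auto intro!: AE_I2)
  then show ?thesis by (simp add: AE_all_countable)
qed

text \<open>After exchanging mixed derivatives the inner sum is the gradient of
  \<open>|grad m|^2 / 2\<close>, which acts like a pressure. The Laplacian term is the one that
  meets the advection of the magnetization.\<close>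

lemma stress_divergence:
  "AE x in M. weak_div \<Omega> (\<lambda>y. (\<chi> i j. d i mg y \<bullet> d j mg y)) x =
     (\<chi> l. Lap x \<bullet> d l mg x + (\<Sum>j\<in>UNIV. d j mg x \<bullet> d l (d j mg) x))"
proof -
  let ?R = "\<lambda>j y. \<chi> l. d j mg y \<bullet> d l mg y"
  let ?D = "\<lambda>j y. \<chi> l. d j mg y \<bullet> d j (d l mg) y + d j (d j mg) y \<bullet> d l mg y"
  have w: "has_weak_partial \<Omega> j (?R j) (?D j)" for j
  proof (rule has_weak_partial_componentwise[OF open_domain])
    fix b :: "real^3" assume "b \<in> Basis"
    then obtain l where b: "b = axis l 1" by (auto simp: Basis_vec_def)
    show "has_weak_partial \<Omega> j (\<lambda>x. ?R j x \<bullet> b) (\<lambda>x. ?D j x \<bullet> b)"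
      using H1_bilinear(1)[OF Hm(2) Hm(2) bounded_bilinear_inner, of j j l] by (simp add: b inner_axis)
  qed
  have "AE x in M. \<forall>j\<in>UNIV. d j (?R j) x = ?D j x"
    by (rule AE_finite_allI) (auto intro: weak_partial_eq(2)[OF open_domain w])
  then show ?thesis
    using mixed_partials
  proof eventually_elim
    case (elim x)
    have "weak_div \<Omega> (\<lambda>y. (\<chi> i j. d i mg y \<bullet> d j mg y)) x = (\<Sum>j\<in>UNIV. ?D j x)"
      using elim(1) by (simp add: weak_div_def)
    also have "\<dots> = (\<chi> l. Lap x \<bullet> d l mg x + (\<Sum>j\<in>UNIV. d j mg x \<bullet> d l (d j mg) x))"
    proof -
      have "d j (d l mg) x = d l (d j mg) x" for j l using elim(2) by (rule allE) (erule allE)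
      then show ?thesis
        by (subst vec_eq_iff) (simp add: sum_component sum.distrib weak_laplacian_def weak_div_def weak_grad_def inner_sum_left
            inner_sum_right inner_commute add.commute)
    qed
    finally show ?case .
  qed
qed

text \<open>Boundedness of the first derivatives makes the gradient of \<open>|grad m|^2 / 2\<close>
  square integrable, as the solenoidal pairing requires.\<close>

lemma stress_zero: "has_bochner_integral M (\<lambda>x. \<Sum>l\<in>UNIV. u x $ l * (\<Sum>j\<in>UNIV. d j mg x \<bullet> d l (d j mg) x)) 0"
proof (rule solenoidal_parts[OF regularity(5) p])
  obtain B where B: "\<And>i. AE x in M. norm (d i mg x) \<le> B" by (rule grad_mag_bounded) blast
  fix l :: 3
  have "has_weak_partial \<Omega> l (\<lambda>x. (1/2) *\<^sub>R (d j mg x \<bullet> d j mg x))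
      (\<lambda>x. (1/2) *\<^sub>R (d j mg x \<bullet> d l (d j mg) x + d l (d j mg) x \<bullet> d j mg x))" for j
    by (rule has_weak_partial_linear[OF open_domain H1_bilinear(1)[OF Hm(2) Hm(2) bounded_bilinear_inner] bounded_linear_scaleR_right])
  then have "has_weak_partial \<Omega> l (\<lambda>x. (1/2) *\<^sub>R (d j mg x \<bullet> d j mg x)) (\<lambda>x. d j mg x \<bullet> d l (d j mg) x)" for j
    by (simp add: inner_commute)
  then show "has_weak_partial \<Omega> l (\<lambda>x. \<Sum>j\<in>UNIV. (1/2) *\<^sub>R (d j mg x \<bullet> d j mg x)) (\<lambda>x. \<Sum>j\<in>UNIV. d j mg x \<bullet> d l (d j mg) x)"
    by (intro has_weak_partial_sum[OF open_domain])
  show "sq_int \<Omega> (\<lambda>x. \<Sum>j\<in>UNIV. d j mg x \<bullet> d l (d j mg) x)"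
    by (intro sq_int_sum sq_int_bilinear_bounded[OF _ B H1D(2)[OF Hm(2)] bounded_bilinear_inner] sq_intD(1)[OF H1D(1)[OF Hm(2)]])
qed

text \<open>Since \<open>u\<close> vanishes on the boundary, the work of the elastic stress turns
  into the contraction of the velocity gradient with \<open>F\<close> times its transpose; the
  stretching term of the \<open>F\<close> equation produces the same quantity.\<close>

lemma elastic_zero: "has_bochner_integral M (\<lambda>x. u x \<bullet> weak_div \<Omega> (\<lambda>y. F y ** transpose (F y)) x
    + (\<Sum>j\<in>UNIV. d j u x \<bullet> (F x ** transpose (F x)) $ j)) 0"
proof -
  let ?R = "\<lambda>j y. (F y ** transpose (F y)) $ j"
  note H = H1_bilinear[OF HF(1) HF(1) bounded_bilinear_matrix_transpose]
  have w: "has_weak_partial \<Omega> j (?R j) (d j (?R j))" "integrable M (d j (?R j))" for j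
    using weak_partial_integrable[OF has_weak_partial_linear[OF open_domain H(1)[of j] bounded_linear_vec_nth[of j]]
        integrable_bounded_linear[OF bounded_linear_vec_nth[of j] H(2)[of j]]] by auto
  have s: "sq_int \<Omega> (?R j)" for j
    by (rule sq_int_linear[OF bounded_sq_int[OF cont(2) H1D(1)[OF HF(1)] bounded_bilinear_matrix_transpose] bounded_linear_vec_nth])
  have zb: "zero_on_boundary \<Omega> u" using bc by (simp add: MVE_boundary_conditions_def)
  have "has_bochner_integral M (\<lambda>x. \<Sum>j\<in>UNIV. u x \<bullet> d j (?R j) x + d j u x \<bullet> ?R j x) (\<Sum>j\<in>(UNIV::3 set). 0)"
    by (intro has_bochner_integral_sum zero_boundary_parts[OF Hu(1) zb s] w)
  then show ?thesis by (simp add: weak_div_def inner_sum_right sum.distrib)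
qed

lemma heat_flux_partials:
  "has_weak_partial \<Omega> j (\<lambda>x. heat_flux \<Omega> K z x $ j) (d j (\<lambda>x. heat_flux \<Omega> K z x $ j))"
  "integrable M (d j (\<lambda>x. heat_flux \<Omega> K z x $ j))"
proof -
  have "H1 \<Omega> (\<lambda>x. (u x, F x, \<theta> x, mg x)) (\<lambda>i x. (d i u x, d i F x, d i \<theta> x, d i mg x))"
    by (intro H1_Pair Hu(1) HF(1) H\<theta>(1) Hm(1))
  moreover have "(\<lambda>x. (u x, F x, \<theta> x, mg x)) = z" by (simp add: fun_eq_iff vel_def dfm_def tmp_def mag_def)
  ultimately have "H1 \<Omega> z (\<lambda>i x. (d i u x, d i F x, d i \<theta> x, d i mg x))" by simp
  from H1_compose_C1[OF this z_cont coefficients(3)] obtain g where g: "H1 \<Omega> (\<lambda>x. K (z x)) g" by blast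
  have "H1 \<Omega> (\<lambda>x. \<chi> i. d i \<theta> x) (\<lambda>j x. \<chi> i. d j (d i \<theta>) x)" by (rule H1_vec[OF H\<theta>(2)])
  then have G: "H1 \<Omega> (weak_grad \<Omega> \<theta>) (\<lambda>j x. \<chi> i. d j (d i \<theta>) x)" by (simp add: weak_grad_def[abs_def])
  have L: "bounded_linear (\<lambda>v :: real^3. - v $ j)" by (rule bounded_linear_minus[OF bounded_linear_vec_nth])
  note H = H1_bilinear[OF g G bounded_bilinear_matrix_vector]
  show "has_weak_partial \<Omega> j (\<lambda>x. heat_flux \<Omega> K z x $ j) (d j (\<lambda>x. heat_flux \<Omega> K z x $ j))"
    "integrable M (d j (\<lambda>x. heat_flux \<Omega> K z x $ j))"
    using weak_partial_integrable[OF has_weak_partial_linear[OF open_domain H(1)[of j] L] integrable_bounded_linear[OF L H(2)[of j]]]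
    by (simp_all add: heat_flux_def)
qed

text \<open>The divergence of the flux is only integrable, so the weight \<open>w\<close> is taken
  continuous up to the boundary. The weights used are 1 for the energy and
  \<open>1 / \<theta>\<close> for the entropy.\<close>

lemma heat_zero:
  fixes w :: "real^3 \<Rightarrow> real"
  assumes w: "H1 \<Omega> w w'" "continuous_on (closure \<Omega>) w"
  shows "has_bochner_integral M (\<lambda>x. w x * weak_div \<Omega> (heat_flux \<Omega> K z) x + (\<Sum>j\<in>UNIV. w' j x * heat_flux \<Omega> K z x $ j)) 0"
proof -
  have zn: "zero_normal_component_on_boundary \<Omega> (heat_flux \<Omega> K z)" using bc by (simp add: MVE_boundary_conditions_def)
  have "integrable M (\<lambda>x. (w x * b) * (d j (\<lambda>x. heat_flux \<Omega> K z x $ j) x * b))" for b :: real and j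
  proof -
    have cb: "continuous_on (closure \<Omega>) (\<lambda>x. w x * b * b)" by (intro continuous_intros w(2))
    show ?thesis
      using integrable_continuous_mult[OF bounded_domain cb heat_flux_partials(2)[of j] domain_sets] by (simp add: mult_ac)
  qed
  then show ?thesis
    using zero_flux_parts[OF bd zn heat_flux_partials w(1)] by (simp add: weak_div_def sum.distrib sum_distrib_left)
qed

text \<open>Where the test function \<open>- Lap m\<close> comes from: the last component of
  \<open>X0\<close> is a first order Sobolev space, so the gradient of the time derivative exists,
  and the Neumann condition removes the boundary term.\<close>

lemma exchange_zero: "has_bochner_integral M (\<lambda>x. (\<Sum>j\<in>UNIV. d j mg x \<bullet> d j (mag z') x) + mag z' x \<bullet> Lap x) 0"
proof -
  have zn: "zero_normal_component_on_boundary \<Omega> (weak_grad \<Omega> mg)" using bc by (simp add: MVE_boundary_conditions_def)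
  have "mag z' \<in> Sobolev (Suc 0) p \<Omega>" using z'X0 by (simp add: X0_def)
  then have H: "H1 \<Omega> (mag z') (\<lambda>i. d i (mag z'))" by (rule Sobolev_H1[OF _ p])
  have D: "has_weak_partial \<Omega> j (\<lambda>x. weak_grad \<Omega> mg x $ j) (d j (d j mg))" for j
    using H1D(3)[OF Hm(2)] by (simp add: weak_grad_def)
  have "has_bochner_integral M (\<lambda>x. \<Sum>j\<in>UNIV. mag z' x \<bullet> d j (d j mg) x + d j (mag z') x \<bullet> (weak_grad \<Omega> mg x $ j)) 0"
    by (rule zero_flux_parts[OF bd zn D sq_int_integrable[OF H1D(2)[OF Hm(2)]] H])
      (intro sq_int_mult sq_int_linear[OF H1D(1)[OF H]] sq_int_linear[OF H1D(2)[OF Hm(2)]] bounded_linear_inner_left)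
  then show ?thesis
    by (simp add: sum.distrib weak_laplacian_def weak_div_def weak_grad_def inner_sum_right inner_commute add.commute)
qed

text \<open>The constraint \<open>|m|^2 = 1\<close> differentiated twice; the first derivative
  \<open>m \<bullet> d i m = 0\<close> is itself differentiated weakly.\<close>

lemma mag_orthogonality:
  assumes unit: "AE x in M. norm (mg x) = 1"
  shows "AE x in M. mg x \<bullet> Lap x = - (norm (weak_grad \<Omega> mg x))\<^sup>2"
proof -
  have e1: "AE x in M. mg x \<bullet> d i mg x = 0" for i
  proof -
    have w: "has_weak_partial \<Omega> i (\<lambda>x. mg x \<bullet> mg x) (\<lambda>x. mg x \<bullet> d i mg x + d i mg x \<bullet> mg x)"
      by (rule H1_bilinear(1)[OF Hm(1) Hm(1) bounded_bilinear_inner])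
    have "AE x in M. mg x \<bullet> mg x = 1" using unit by eventually_elim (simp add: norm_eq_1)
    from has_weak_partial_cong_AE[OF open_domain w this, of "\<lambda>x. mg x \<bullet> d i mg x + d i mg x \<bullet> mg x"]
    have "AE x in M. mg x \<bullet> d i mg x + d i mg x \<bullet> mg x = 0"
      by (intro has_weak_partial_unique[OF open_domain _ has_weak_partial_const[OF open_domain]]) auto
    then show ?thesis by eventually_elim (simp add: inner_commute)
  qed
  have "AE x in M. mg x \<bullet> d i (d i mg) x + d i mg x \<bullet> d i mg x = 0" for i
  proof -
    have w: "has_weak_partial \<Omega> i (\<lambda>x. mg x \<bullet> d i mg x) (\<lambda>x. mg x \<bullet> d i (d i mg) x + d i mg x \<bullet> d i mg x)"
      by (rule H1_bilinear(1)[OF Hm(1) Hm(2) bounded_bilinear_inner])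
    from has_weak_partial_cong_AE[OF open_domain w e1, of "\<lambda>x. mg x \<bullet> d i (d i mg) x + d i mg x \<bullet> d i mg x"]
    show ?thesis
      by (intro has_weak_partial_unique[OF open_domain _ has_weak_partial_zero]) auto
  qed
  then have "AE x in M. \<forall>i\<in>UNIV. mg x \<bullet> d i (d i mg) x + d i mg x \<bullet> d i mg x = 0" by (intro AE_finite_allI) auto
  then show ?thesis
  proof eventually_elim
    case (elim x)
    have "mg x \<bullet> Lap x + (norm (weak_grad \<Omega> mg x))\<^sup>2 = (\<Sum>i\<in>UNIV. mg x \<bullet> d i (d i mg) x + d i mg x \<bullet> d i mg x)"
      by (simp add: weak_laplacian_def weak_div_def weak_grad_def inner_sum_right norm_vec_squared sum.distrib)
    then show ?case using elim by simp
  qed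
qed

text \<open>For a unit vector, Lagrange's formula gives \<open>m x (m x L) = (m . L) m - L\<close>,
  so the left side is \<open>g^2 - |L|^2\<close>; expanding the square on the right with
  \<open>m . L = - g\<close> gives the same.\<close>

lemma cross_tension:
  fixes m L :: "real^3"
  assumes "norm m = 1" "m \<bullet> L = - g"
  shows "cross3 m (cross3 m L) \<bullet> L = - (norm (L + g *\<^sub>R m))\<^sup>2"
proof -
  have "m \<bullet> m = 1" using assms(1) by (simp add: norm_eq_1)
  have "cross3 m (cross3 m L) \<bullet> L = (m \<bullet> L) * (m \<bullet> L) - L \<bullet> L"
    using \<open>m \<bullet> m = 1\<close> by (simp add: Lagrange inner_diff_left inner_diff_right inner_commute)
  moreover have "(norm (L + g *\<^sub>R m))\<^sup>2 = L \<bullet> L + 2 * g * (m \<bullet> L) + g * g"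
    using \<open>m \<bullet> m = 1\<close> by (simp add: power2_norm_eq_inner inner_add_left inner_add_right inner_commute)
  ultimately show ?thesis using assms(2) by (simp add: algebra_simps)
qed

lemma stretching_identity: "F x \<bullet> (transpose (weak_grad \<Omega> u x) ** F x) = (\<Sum>j\<in>UNIV. d j u x \<bullet> (F x ** transpose (F x)) $ j)"
  by (simp add: inner_vec_def matrix_matrix_mult_def transpose_def weak_grad_def sum_3 algebra_simps)

text \<open>Ten integrals vanish for separate reasons; once the equations are inserted their signed
  sum is pointwise the tested time derivative. The pressure, the transport terms and the gradient
  part of the stress are among the vanishing ones.\<close>

lemma energy_identity:
  "has_bochner_integral M (\<lambda>x. vel z' x \<bullet> u x + dfm z' x \<bullet> F x + tmp z' x + (\<Sum>j\<in>UNIV. d j (mag z') x \<bullet> d j mg x)) 0"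
proof -
  note zb = bc[unfolded MVE_boundary_conditions_def]
  let ?P1 = "\<lambda>x. u x \<bullet> advection \<Omega> u u x"
  let ?P2 = "\<lambda>x. u x \<bullet> weak_div \<Omega> (\<lambda>y. \<mu>vis (\<theta> y) *\<^sub>R weak_grad \<Omega> u y) x + \<mu>vis (\<theta> x) * (norm (weak_grad \<Omega> u x))\<^sup>2"
  let ?P3 = "\<lambda>x. u x \<bullet> weak_grad \<Omega> \<pi> x"
  let ?P4 = "\<lambda>x. \<Sum>l\<in>UNIV. u x $ l * (\<Sum>j\<in>UNIV. d j mg x \<bullet> d l (d j mg) x)"
  let ?P5 = "\<lambda>x. u x \<bullet> weak_div \<Omega> (\<lambda>y. F y ** transpose (F y)) x + (\<Sum>j\<in>UNIV. d j u x \<bullet> (F x ** transpose (F x)) $ j)"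
  let ?P6 = "\<lambda>x. F x \<bullet> advection \<Omega> u F x"
  let ?P7 = "\<lambda>x. F x \<bullet> weak_div \<Omega> (\<lambda>y. \<kappa> (\<theta> y) *\<^sub>R weak_grad \<Omega> F y) x + \<kappa> (\<theta> x) * (norm (weak_grad \<Omega> F x))\<^sup>2"
  let ?P8 = "\<lambda>x. \<Sum>j\<in>UNIV. u x $ j * d j \<theta> x"
  \<comment> \<open>The instance of \<open>heat_zero\<close> with weight 1, whose derivative 0 is
    kept in the shape of that lemma.\<close>
  let ?P9 = "\<lambda>x. 1 * weak_div \<Omega> (heat_flux \<Omega> K z) x + (\<Sum>j\<in>UNIV. 0 * heat_flux \<Omega> K z x $ j)"
  let ?P10 = "\<lambda>x. (\<Sum>j\<in>UNIV. d j mg x \<bullet> d j (mag z') x) + mag z' x \<bullet> Lap x"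
  have H1one: "H1 \<Omega> (\<lambda>x. 1 :: real) (\<lambda>j x. 0)"
    by (simp add: H1_def has_weak_partial_const[OF open_domain] sq_int_continuous)
  have P9: "has_bochner_integral M ?P9 0" by (rule heat_zero[OF H1one]) simp
  have P8: "has_bochner_integral M ?P8 0" by (rule solenoidal_parts[OF regularity(5) p H1D(3)[OF H\<theta>(1)] H1D(2)[OF H\<theta>(1)]])
  have P2: "has_bochner_integral M ?P2 0" and P7: "has_bochner_integral M ?P7 0"
    using zb by (auto intro: diffusion_zero[OF coefficients(1) H\<theta>(1) cont(3) regularity(1) p]
        diffusion_zero[OF coefficients(2) H\<theta>(1) cont(3) regularity(2) p])
  \<comment> \<open>The signs are those of the terms when each equation is solved for the time
    derivative; \<open>?P10\<close> trades the pairing with the Laplacian for the pairing of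
    gradients.\<close>
  have "has_bochner_integral M (\<lambda>x. ?P2 x - ?P1 x - ?P3 x - ?P4 x + ?P5 x - ?P6 x + ?P7 x - ?P8 x - ?P9 x + ?P10 x)
      (0 - 0 - 0 - 0 + 0 - 0 + 0 - 0 - 0 + 0)"
    by (intro has_bochner_integral_add has_bochner_integral_diff P2 P7 P8 P9
        advection_zero[OF regularity(5) p Hu(1) cont(1)] advection_zero[OF regularity(5) p HF(1) cont(2)]
        pressure_zero stress_zero elastic_zero exchange_zero)
  then have "has_bochner_integral M (\<lambda>x. ?P2 x - ?P1 x - ?P3 x - ?P4 x + ?P5 x - ?P6 x + ?P7 x - ?P8 x - ?P9 x + ?P10 x) 0"
    by simp
  note eqs = equations[unfolded MVE_equations_def Let_def]
  have "AE x in M. norm (mg x) = 1" using eqs by eventually_elim simp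
  note orth = mag_orthogonality[OF this]
  have "AE x in M. ?P2 x - ?P1 x - ?P3 x - ?P4 x + ?P5 x - ?P6 x + ?P7 x - ?P8 x - ?P9 x + ?P10 x =
      vel z' x \<bullet> u x + dfm z' x \<bullet> F x + tmp z' x + (\<Sum>j\<in>UNIV. d j (mag z') x \<bullet> d j mg x)"
    using eqs stress_divergence orth
  proof eventually_elim
    case (elim x)
    \<comment> \<open>Stretching, relaxation heat and the work of the stress against the transport
      of \<open>m\<close>: each of the three occurs twice with opposite signs. The viscous terms are
      already balanced inside \<open>?P2\<close> and \<open>?P7\<close>.\<close>
    let ?S = "\<Sum>j\<in>UNIV. d j u x \<bullet> (F x ** transpose (F x)) $ j"
    let ?T = "\<alpha> (\<theta> x) * (norm (tension \<Omega> mg x))\<^sup>2"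
    let ?C = "\<Sum>l\<in>UNIV. u x $ l * (Lap x \<bullet> d l mg x)"
    note e = elim(1)
    have "vel z' x = weak_div \<Omega> (\<lambda>y. \<mu>vis (\<theta> y) *\<^sub>R weak_grad \<Omega> u y) x - advection \<Omega> u u x - weak_grad \<Omega> \<pi> x
        - weak_div \<Omega> (\<lambda>y. (\<chi> i j. d i mg y \<bullet> d j mg y)) x + weak_div \<Omega> (\<lambda>y. F y ** transpose (F y)) x"
      using e by (simp add: algebra_simps)
    moreover have "u x \<bullet> weak_div \<Omega> (\<lambda>y. (\<chi> i j. d i mg y \<bullet> d j mg y)) x = ?C + ?P4 x"
      unfolding elim(2) by (simp add: inner_vec_def distrib_left sum.distrib)
    ultimately have 1: "vel z' x \<bullet> u x = u x \<bullet> weak_div \<Omega> (\<lambda>y. \<mu>vis (\<theta> y) *\<^sub>R weak_grad \<Omega> u y) x - ?P1 x - ?P3 x - (?C + ?P4 x)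
        + u x \<bullet> weak_div \<Omega> (\<lambda>y. F y ** transpose (F y)) x"
      by (simp only: inner_add_right inner_diff_right inner_commute[of _ "u x"])
    have "dfm z' x = weak_div \<Omega> (\<lambda>y. \<kappa> (\<theta> y) *\<^sub>R weak_grad \<Omega> F y) x - advection \<Omega> u F x + transpose (weak_grad \<Omega> u x) ** F x"
      using e by (simp add: algebra_simps)
    then have 2: "dfm z' x \<bullet> F x = F x \<bullet> weak_div \<Omega> (\<lambda>y. \<kappa> (\<theta> y) *\<^sub>R weak_grad \<Omega> F y) x - ?P6 x + ?S"
      by (simp only: inner_add_right inner_diff_right inner_commute[of _ "F x"] stretching_identity)
    have 3: "tmp z' x = - ?P8 x - ?P9 x + (\<mu>vis (\<theta> x) * (norm (weak_grad \<Omega> u x))\<^sup>2 + \<kappa> (\<theta> x) * (norm (weak_grad \<Omega> F x))\<^sup>2 + ?T)"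
      using e by (simp add: advection_def)
    have "mag z' x = - (\<alpha> (\<theta> x) *\<^sub>R cross3 (mg x) (cross3 (mg x) (Lap x))) - \<beta> (\<theta> x) *\<^sub>R cross3 (mg x) (Lap x) - advection \<Omega> u mg x"
      using e by (simp add: algebra_simps)
    then have "mag z' x \<bullet> Lap x = - (\<alpha> (\<theta> x) * (cross3 (mg x) (cross3 (mg x) (Lap x)) \<bullet> Lap x)) - \<beta> (\<theta> x) * (cross3 (mg x) (Lap x) \<bullet> Lap x)
        - advection \<Omega> u mg x \<bullet> Lap x"
      by (simp add: inner_diff_left)
    also have "cross3 (mg x) (cross3 (mg x) (Lap x)) \<bullet> Lap x = - (norm (tension \<Omega> mg x))\<^sup>2"
      unfolding tension_def using e elim(3) by (intro cross_tension) auto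
    \<comment> \<open>The precession term is orthogonal to the Laplacian, so the coefficient
      \<open>\<beta>\<close> does no work.\<close>
    also have "cross3 (mg x) (Lap x) \<bullet> Lap x = 0" by (simp add: dot_cross_self)
    also have "advection \<Omega> u mg x \<bullet> Lap x = ?C"
      by (subst inner_commute) (simp add: advection_def inner_sum_right)
    finally have 4: "mag z' x \<bullet> Lap x = ?T - ?C" by simp
    have "(\<Sum>j\<in>UNIV. d j (mag z') x \<bullet> d j mg x) = (\<Sum>j\<in>UNIV. d j mg x \<bullet> d j (mag z') x)" by (simp add: inner_commute)
    then show ?case using 1 2 3 4 by linarith
  qed
  then show ?thesis using \<open>has_bochner_integral M (\<lambda>x. ?P2 x - ?P1 x - ?P3 x - ?P4 x + ?P5 x - ?P6 x + ?P7 x - ?P8 x - ?P9 x + ?P10 x) 0\<close>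
    by (rule bochner_cong_AE)
qed

text \<open>Test the heat equation with \<open>1 / \<theta>\<close>; the advective term is \<open>u \<cdot> \<nabla> ln \<theta>\<close>.\<close>

lemma entropy_inequality:
  assumes \<theta>low: "0 < c" "\<And>x. x \<in> closure \<Omega> \<Longrightarrow> c \<le> \<theta> x"
    and nonneg: "\<And>s. 0 \<le> \<mu>vis s" "\<And>s. 0 \<le> \<kappa> s" "\<And>s. 0 \<le> \<alpha> s" "\<And>y \<xi>. 0 \<le> \<xi> \<bullet> (K y *v \<xi>)"
  shows "integrable M (\<lambda>x. tmp z' x / \<theta> x)" "0 \<le> (\<integral>x. tmp z' x / \<theta> x \<partial>M)"
proof -
  obtain B where B: "0 \<le> B" "\<And>x. x \<in> closure \<Omega> \<Longrightarrow> norm (\<theta> x) \<le> B" by (rule continuous_closure_bounded[OF cont(3)]) blast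
  \<comment> \<open>With centre \<open>a\<close> and radius \<open>r\<close> the ball is the
    interval from \<open>c\<close> to \<open>c + \<bar>B - c\<bar>\<close>: it contains the values
    of \<open>\<theta>\<close> and stays away from 0, where the inverse and the logarithm are
    singular.\<close>
  define r where "r = \<bar>B - c\<bar> / 2"
  define a where "a = c + r"
  have near: "norm (\<theta> x - a) \<le> r" if "x \<in> \<Omega>" for x
    using \<theta>low(2)[of x] B(2)[of x] that closure_subset[of \<Omega>] by (auto simp: a_def r_def abs_if field_simps split: if_splits)
  have pos: "0 < y" if "norm (y - a) \<le> r" for y using that \<theta>low(1) by (auto simp: a_def)
  have pos': "0 < y" if "y \<in> cball a r" for y using pos[of y] that by (simp add: dist_norm norm_minus_commute)
  have r0: "0 \<le> r" by (simp add: r_def)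
  have Hinv: "H1 \<Omega> (\<lambda>x. inverse (\<theta> x)) (\<lambda>i x. - (inverse (\<theta> x) * d i \<theta> x * inverse (\<theta> x)))"
  proof (rule H1_compose[OF H\<theta>(1) r0 near, where G=inverse and G'="\<lambda>y v. - (inverse y * v * inverse y)"])
    show "(inverse has_derivative (\<lambda>v. - (inverse y * v * inverse y))) (at y)" if "norm (y - a) \<le> r" for y
      using Deriv.has_derivative_inverse[OF _ has_derivative_ident, of y UNIV] pos[OF that] by simp
    show "continuous_on (cball a r) (\<lambda>y. - (inverse y * v * inverse y))" for v
      using pos' by (intro continuous_intros) force+
  qed
  have Hln: "H1 \<Omega> (\<lambda>x. ln (\<theta> x)) (\<lambda>i x. d i \<theta> x * inverse (\<theta> x))"
  proof (rule H1_compose[OF H\<theta>(1) r0 near, where G=ln and G'="\<lambda>y v. v * inverse y"])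
    show "(ln has_derivative (\<lambda>v. v * inverse y)) (at y)" if "norm (y - a) \<le> r" for y
      using DERIV_ln[OF pos[OF that]] by (simp add: has_field_derivative_def mult.commute[of _ "inverse y"])
    show "continuous_on (cball a r) (\<lambda>y. v * inverse y)" for v
      using pos' by (intro continuous_intros) force+
  qed
  have \<theta>0: "\<theta> x \<noteq> 0" if "x \<in> closure \<Omega>" for x using \<theta>low(1) \<theta>low(2)[OF that] by auto
  have ci: "continuous_on (closure \<Omega>) (\<lambda>x. inverse (\<theta> x))" by (intro continuous_intros cont(3)) (use \<theta>0 in auto)
  let ?A = "\<lambda>x. \<Sum>j\<in>UNIV. u x $ j * (d j \<theta> x * inverse (\<theta> x))"
  let ?Q = "\<lambda>x. inverse (\<theta> x) * weak_div \<Omega> (heat_flux \<Omega> K z) x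
      + (\<Sum>j\<in>UNIV. - (inverse (\<theta> x) * d j \<theta> x * inverse (\<theta> x)) * heat_flux \<Omega> K z x $ j)"
  have A: "has_bochner_integral M ?A 0" by (rule solenoidal_parts[OF regularity(5) p H1D(3)[OF Hln] H1D(2)[OF Hln]])
  have Q: "has_bochner_integral M ?Q 0" by (rule heat_zero[OF Hinv ci])
  have "integrable M (tmp z')" using z'X0 by (auto simp: X0_def intro: sq_int_integrable Lp_sq_int(1)[OF _ p])
  then have "integrable M (\<lambda>x. inverse (\<theta> x) * tmp z' x)"
    by (rule integrable_continuous_mult[OF bounded_domain ci _ domain_sets])
  then show int: "integrable M (\<lambda>x. tmp z' x / \<theta> x)" by (simp add: divide_inverse mult.commute)
  \<comment> \<open>Adding the two integrals that vanish turns the integrand into the entropy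
    production rate, which is nonnegative pointwise.\<close>
  have "AE x in M. 0 \<le> tmp z' x / \<theta> x + ?A x + ?Q x"
    using equations[unfolded MVE_equations_def Let_def] AE_space
  proof eventually_elim
    case (elim x)
    then have x: "0 < \<theta> x" using \<theta>low(1) \<theta>low(2)[of x] closure_subset[of \<Omega>] by auto
    let ?D = "\<mu>vis (\<theta> x) * (norm (weak_grad \<Omega> u x))\<^sup>2 + \<kappa> (\<theta> x) * (norm (weak_grad \<Omega> F x))\<^sup>2 + \<alpha> (\<theta> x) * (norm (tension \<Omega> mg x))\<^sup>2"
    have t: "tmp z' x = ?D - (\<Sum>j\<in>UNIV. u x $ j * d j \<theta> x) - weak_div \<Omega> (heat_flux \<Omega> K z) x"
      using elim(1) by (simp add: advection_def)
    have "(\<Sum>j\<in>UNIV. d j \<theta> x * heat_flux \<Omega> K z x $ j) = - (weak_grad \<Omega> \<theta> x \<bullet> (K (z x) *v weak_grad \<Omega> \<theta> x))"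
      by (simp add: inner_vec_def heat_flux_def weak_grad_def sum_negf)
    moreover have "?Q x = inverse (\<theta> x) * weak_div \<Omega> (heat_flux \<Omega> K z) x
        - (inverse (\<theta> x))\<^sup>2 * (\<Sum>j\<in>UNIV. d j \<theta> x * heat_flux \<Omega> K z x $ j)"
      by (simp add: sum_distrib_left sum_negf power2_eq_square mult_ac)
    moreover have "?A x = inverse (\<theta> x) * (\<Sum>j\<in>UNIV. u x $ j * d j \<theta> x)"
      by (simp add: sum_distrib_left mult_ac)
    ultimately have "tmp z' x / \<theta> x + ?A x + ?Q x =
        inverse (\<theta> x) * ?D + (inverse (\<theta> x))\<^sup>2 * (weak_grad \<Omega> \<theta> x \<bullet> (K (z x) *v weak_grad \<Omega> \<theta> x))"
      by (simp only: t divide_inverse) (simp add: algebra_simps)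
    also have "\<dots> \<ge> 0" using x nonneg by (intro add_nonneg_nonneg mult_nonneg_nonneg) auto
    finally show ?case .
  qed
  then have "0 \<le> (\<integral>x. tmp z' x / \<theta> x + ?A x + ?Q x \<partial>M)" by (rule integral_nonneg_AE)
  also have "\<dots> = (\<integral>x. tmp z' x / \<theta> x \<partial>M)"
    using has_bochner_integral_add[OF has_bochner_integral_add[OF has_bochner_integral_integrable[OF int] A] Q]
    by (simp add: has_bochner_integral_iff)
  finally show "0 \<le> (\<integral>x. tmp z' x / \<theta> x \<partial>M)" .
qed

end

section \<open>Energy and entropy along the flow\<close>

text \<open>The fields that enter energy and entropy: the magnetization contributes through its
  gradient alone.\<close>

definition state_jet :: "(real^3) set \<Rightarrow> (real^3 \<Rightarrow> state) \<Rightarrow> real^3 \<Rightarrow> (real^3) \<times> (real^3^3) \<times> real \<times> (real^3^3)" where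
  "state_jet \<Omega> a x = (vel a x, dfm a x, tmp a x, weak_grad \<Omega> (mag a) x)"

text \<open>\<open>X0\<close> with \<open>Lp\<close> in place of \<open>Lp_sigma\<close>: the linear
  space in the role of \<open>Y\<close> in \<open>bounded_functional\<close>.\<close>

definition state_Lp :: "real \<Rightarrow> (real^3) set \<Rightarrow> (real^3 \<Rightarrow> state) set" where
  "state_Lp p \<Omega> = {a. vel a \<in> Lp p \<Omega> \<and> dfm a \<in> Lp p \<Omega> \<and> tmp a \<in> Lp p \<Omega> \<and> mag a \<in> Sobolev (Suc 0) p \<Omega>}"

lemma X0_state_Lp: "X0 p \<Omega> \<subseteq> state_Lp p \<Omega>"
  by (auto simp: X0_def state_Lp_def Lp_sigma_def)

lemma Lp_add:
  fixes f g :: "real^3 \<Rightarrow> 'b::euclidean_space"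
  assumes f: "f \<in> Lp p \<Omega>" and g: "g \<in> Lp p \<Omega>" and p: "0 \<le> p"
  shows "(\<lambda>x. f x + g x) \<in> Lp p \<Omega>"
proof -
  let ?M = "lebesgue_on \<Omega>"
  have m[measurable]: "f \<in> borel_measurable ?M" "g \<in> borel_measurable ?M"
    using f g by (auto simp: Lp_def)
  have le: "norm (f x + g x) powr p \<le> 2 powr p * (norm (f x) powr p + norm (g x) powr p)" for x
  proof -
    have "norm (f x + g x) \<le> 2 * max (norm (f x)) (norm (g x))" using norm_triangle_ineq[of "f x" "g x"] by simp
    then have "norm (f x + g x) powr p \<le> (2 * max (norm (f x)) (norm (g x))) powr p" using p by (intro powr_mono2) auto
    also have "\<dots> = 2 powr p * max (norm (f x)) (norm (g x)) powr p" by (simp add: powr_mult)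
    also have "\<dots> \<le> 2 powr p * (norm (f x) powr p + norm (g x) powr p)" by (auto simp: max_def)
    finally show ?thesis .
  qed
  have "integrable ?M (\<lambda>x. 2 powr p * (norm (f x) powr p + norm (g x) powr p))"
    using f g by (simp add: Lp_def)
  then have "integrable ?M (\<lambda>x. norm (f x + g x) powr p)"
    by (rule Bochner_Integration.integrable_bound) (use le in \<open>auto intro!: AE_I2\<close>)
  then show ?thesis by (simp add: Lp_def)
qed

lemma Lp_scaleR:
  fixes f :: "real^3 \<Rightarrow> 'b::euclidean_space"
  assumes f: "f \<in> Lp p \<Omega>"
  shows "(\<lambda>x. c *\<^sub>R f x) \<in> Lp p \<Omega>"
  using f by (auto simp: Lp_def powr_mult)

lemma sq_norm_nonneg: "0 \<le> sq_norm \<Omega> f"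
  by (simp add: sq_norm_def)

lemma sq_norm_mono:
  assumes "sq_int \<Omega> f" "sq_int \<Omega> g" "0 \<le> c" "AE x in lebesgue_on \<Omega>. norm (f x) \<le> c * norm (g x)"
  shows "sq_norm \<Omega> f \<le> c * sq_norm \<Omega> g"
proof -
  let ?M = "lebesgue_on \<Omega>"
  have "AE x in ?M. (norm (f x))\<^sup>2 \<le> c\<^sup>2 * (norm (g x))\<^sup>2"
    using assms(4)
  proof eventually_elim
    case (elim x)
    from power_mono[OF this norm_ge_zero, of 2] show ?case by (simp add: power_mult_distrib)
  qed
  then have "(\<integral>x. (norm (f x))\<^sup>2 \<partial>?M) \<le> (\<integral>x. c\<^sup>2 * (norm (g x))\<^sup>2 \<partial>?M)"
    using assms(1,2) by (intro integral_mono_AE) (auto simp: sq_int_def)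
  from real_sqrt_le_mono[OF this] show ?thesis using assms(3) by (simp add: sq_norm_def real_sqrt_mult)
qed

text \<open>Expanding the square leaves a cross term that Cauchy-Schwarz bounds by the product of
  the norms.\<close>

lemma sq_norm_triangle:
  assumes "sq_int \<Omega> f" "sq_int \<Omega> g"
  shows "sq_norm \<Omega> (\<lambda>x. f x + g x) \<le> sq_norm \<Omega> f + sq_norm \<Omega> g"
proof -
  let ?M = "lebesgue_on \<Omega>"
  note i = sq_intD(2)[OF assms(1)] sq_intD(2)[OF assms(2)] sq_int_inner[OF assms]
  have "(\<integral>x. (norm (f x + g x))\<^sup>2 \<partial>?M)
      = (\<integral>x. (norm (f x))\<^sup>2 + (norm (g x))\<^sup>2 + 2 * (f x \<bullet> g x) \<partial>?M)"
    by (intro Bochner_Integration.integral_cong) (auto simp: power2_norm_eq_inner inner_add_left inner_add_right inner_commute)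
  also have "\<dots> = (sq_norm \<Omega> f)\<^sup>2 + (sq_norm \<Omega> g)\<^sup>2 + 2 * (\<integral>x. f x \<bullet> g x \<partial>?M)"
    using i by (simp add: sq_norm_def)
  also have "\<dots> \<le> (sq_norm \<Omega> f + sq_norm \<Omega> g)\<^sup>2"
    using sq_norm_Cauchy_Schwarz[OF assms] by (simp add: power2_sum)
  finally show ?thesis
    unfolding sq_norm_def[of _ "\<lambda>x. f x + g x"] by (rule real_le_lsqrt[rotated]) (auto intro: add_nonneg_nonneg sq_norm_nonneg)
qed

lemma sq_int_diff:
  assumes "sq_int \<Omega> f" "sq_int \<Omega> g"
  shows "sq_int \<Omega> (\<lambda>x. f x - g x)"
  using sq_int_add[OF assms(1) sq_int_linear[OF assms(2) bounded_linear_minus[OF bounded_linear_ident]]] by simp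

lemma sq_int_Pair:
  fixes f :: "real^3 \<Rightarrow> 'b::euclidean_space" and g :: "real^3 \<Rightarrow> 'c::euclidean_space"
  assumes "sq_int \<Omega> f" "sq_int \<Omega> g"
  shows "sq_int \<Omega> (\<lambda>x. (f x, g x))"
  using sq_int_add[OF sq_int_linear[OF assms(1) bounded_linear_Pair[OF bounded_linear_ident bounded_linear_zero]]
      sq_int_linear[OF assms(2) bounded_linear_Pair[OF bounded_linear_zero bounded_linear_ident]]] by simp

context bounded_domain
begin

lemma sq_int_weak_grad:
  fixes f :: "real^3 \<Rightarrow> 'b::euclidean_space"
  assumes "\<And>i. sq_int \<Omega> (weak_partial \<Omega> i f)"
  shows "sq_int \<Omega> (weak_grad \<Omega> f)"
proof -
  have "linear (axis i :: 'b \<Rightarrow> 'b^3)" for i by (rule linearI) (auto simp: axis_def vec_eq_iff)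
  then have "bounded_linear (axis i :: 'b \<Rightarrow> 'b^3)" for i by (simp add: linear_conv_bounded_linear)
  then have "sq_int \<Omega> (\<lambda>x. \<Sum>i\<in>(UNIV::3 set). axis i (weak_partial \<Omega> i f x))"
    by (rule sq_int_sum[OF sq_int_linear[OF assms]])
  moreover have "(\<lambda>x. \<Sum>i\<in>(UNIV::3 set). axis i (weak_partial \<Omega> i f x)) = weak_grad \<Omega> f"
    by (auto simp: fun_eq_iff vec_eq_iff weak_grad_def sum_component axis_def if_distrib cong: if_cong)
  ultimately show ?thesis by simp
qed

lemma state_Lp_add:
  assumes a: "a \<in> state_Lp p \<Omega>" and b: "b \<in> state_Lp p \<Omega>" and p: "2 \<le> p"
  shows "(\<lambda>x. a x + b x) \<in> state_Lp p \<Omega>" "AE x in M. state_jet \<Omega> (\<lambda>x. a x + b x) x = state_jet \<Omega> a x + state_jet \<Omega> b x"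
proof -
  have c: "vel (\<lambda>x. a x + b x) = (\<lambda>x. vel a x + vel b x)" "dfm (\<lambda>x. a x + b x) = (\<lambda>x. dfm a x + dfm b x)"
    "tmp (\<lambda>x. a x + b x) = (\<lambda>x. tmp a x + tmp b x)" "mag (\<lambda>x. a x + b x) = (\<lambda>x. mag a x + mag b x)"
    by (simp_all add: fun_eq_iff vel_def dfm_def tmp_def mag_def)
  have ma: "mag a \<in> Sobolev (Suc 0) p \<Omega>" and mb: "mag b \<in> Sobolev (Suc 0) p \<Omega>" using a b by (auto simp: state_Lp_def)
  have w: "has_weak_partial \<Omega> i (\<lambda>x. mag a x + mag b x) (\<lambda>x. weak_partial \<Omega> i (mag a) x + weak_partial \<Omega> i (mag b) x)" for i
    by (rule has_weak_partial_add[OF open_domain Sobolev_SucD(2)[OF ma] Sobolev_SucD(2)[OF mb]])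
  have "weak_partial \<Omega> i (mag a) \<in> Lp p \<Omega>" "weak_partial \<Omega> i (mag b) \<in> Lp p \<Omega>" for i
    using Sobolev_SucD(3)[OF ma] Sobolev_SucD(3)[OF mb] by simp_all
  then have m: "(\<lambda>x. weak_partial \<Omega> i (mag a) x + weak_partial \<Omega> i (mag b) x) \<in> Lp p \<Omega>" for i
    using p by (intro Lp_add) auto
  have "(\<lambda>x. mag a x + mag b x) \<in> Lp p \<Omega>" using Sobolev_SucD(1)[OF ma] Sobolev_SucD(1)[OF mb] p by (intro Lp_add) auto
  then have "(\<lambda>x. mag a x + mag b x) \<in> Sobolev (Suc 0) p \<Omega>" using w m by auto
  then show "(\<lambda>x. a x + b x) \<in> state_Lp p \<Omega>"
    using a b p by (auto simp: state_Lp_def c intro!: Lp_add simp del: Sobolev.simps)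
  have "AE x in M. \<forall>i\<in>UNIV. weak_partial \<Omega> i (\<lambda>x. mag a x + mag b x) x = weak_partial \<Omega> i (mag a) x + weak_partial \<Omega> i (mag b) x"
    by (intro AE_finite_allI weak_partial_eq(2)[OF open_domain w]) simp
  then show "AE x in M. state_jet \<Omega> (\<lambda>x. a x + b x) x = state_jet \<Omega> a x + state_jet \<Omega> b x"
    by eventually_elim (simp add: state_jet_def c weak_grad_def vec_eq_iff)
qed

lemma state_Lp_scaleR:
  assumes a: "a \<in> state_Lp p \<Omega>"
  shows "(\<lambda>x. c *\<^sub>R a x) \<in> state_Lp p \<Omega>" "AE x in M. state_jet \<Omega> (\<lambda>x. c *\<^sub>R a x) x = c *\<^sub>R state_jet \<Omega> a x"
proof -
  have c: "vel (\<lambda>x. c *\<^sub>R a x) = (\<lambda>x. c *\<^sub>R vel a x)" "dfm (\<lambda>x. c *\<^sub>R a x) = (\<lambda>x. c *\<^sub>R dfm a x)"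
    "tmp (\<lambda>x. c *\<^sub>R a x) = (\<lambda>x. c *\<^sub>R tmp a x)" "mag (\<lambda>x. c *\<^sub>R a x) = (\<lambda>x. c *\<^sub>R mag a x)"
    by (simp_all add: fun_eq_iff vel_def dfm_def tmp_def mag_def)
  have ma: "mag a \<in> Sobolev (Suc 0) p \<Omega>" using a by (auto simp: state_Lp_def)
  have w: "has_weak_partial \<Omega> i (\<lambda>x. c *\<^sub>R mag a x) (\<lambda>x. c *\<^sub>R weak_partial \<Omega> i (mag a) x)" for i
    by (rule has_weak_partial_linear[OF open_domain Sobolev_SucD(2)[OF ma] bounded_linear_scaleR_right])
  have m: "(\<lambda>x. c *\<^sub>R weak_partial \<Omega> i (mag a) x) \<in> Lp p \<Omega>" for i
    using Sobolev_SucD(3)[OF ma, of i] by (simp add: Lp_scaleR)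
  have "(\<lambda>x. c *\<^sub>R mag a x) \<in> Lp p \<Omega>" by (rule Lp_scaleR[OF Sobolev_SucD(1)[OF ma]])
  then have "(\<lambda>x. c *\<^sub>R mag a x) \<in> Sobolev (Suc 0) p \<Omega>" using w m by auto
  moreover have "(\<lambda>x. c *\<^sub>R tmp a x) \<in> Lp p \<Omega>" using a by (intro Lp_scaleR) (simp add: state_Lp_def)
  ultimately show "(\<lambda>x. c *\<^sub>R a x) \<in> state_Lp p \<Omega>"
    using a unfolding state_Lp_def mem_Collect_eq c by (intro conjI Lp_scaleR) auto
  have "AE x in M. \<forall>i\<in>UNIV. weak_partial \<Omega> i (\<lambda>x. c *\<^sub>R mag a x) x = c *\<^sub>R weak_partial \<Omega> i (mag a) x"
    by (intro AE_finite_allI weak_partial_eq(2)[OF open_domain w]) simp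
  then show "AE x in M. state_jet \<Omega> (\<lambda>x. c *\<^sub>R a x) x = c *\<^sub>R state_jet \<Omega> a x"
    by eventually_elim (simp only: state_jet_def c weak_grad_def, simp add: vec_eq_iff)
qed

lemma state_Lp_sq_int:
  assumes a: "a \<in> state_Lp p \<Omega>" and p: "2 \<le> p"
  shows "sq_int \<Omega> (vel a)" "sq_int \<Omega> (dfm a)" "sq_int \<Omega> (tmp a)" "sq_int \<Omega> (weak_partial \<Omega> i (mag a))"
    "sq_int \<Omega> (weak_grad \<Omega> (mag a))" "sq_int \<Omega> (state_jet \<Omega> a)"
proof -
  have ma: "mag a \<in> Sobolev (Suc 0) p \<Omega>" using a by (auto simp: state_Lp_def)
  show 1: "sq_int \<Omega> (vel a)" "sq_int \<Omega> (dfm a)" "sq_int \<Omega> (tmp a)"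
    using a by (auto simp: state_Lp_def intro: Lp_sq_int(1)[OF _ p])
  have "weak_partial \<Omega> i (mag a) \<in> Lp p \<Omega>" for i using Sobolev_SucD(3)[OF ma] by simp
  then have 2: "sq_int \<Omega> (weak_partial \<Omega> i (mag a))" for i by (rule Lp_sq_int(1)[OF _ p])
  then show "sq_int \<Omega> (weak_partial \<Omega> i (mag a))" .
  show 3: "sq_int \<Omega> (weak_grad \<Omega> (mag a))" by (rule sq_int_weak_grad[OF 2])
  show "sq_int \<Omega> (state_jet \<Omega> a)"
    unfolding state_jet_def[abs_def] by (intro sq_int_Pair 1 3)
qed

lemma norm_state_jet: "(norm (state_jet \<Omega> a x))\<^sup>2 = (norm (vel a x))\<^sup>2 + (norm (dfm a x))\<^sup>2 + (norm (tmp a x))\<^sup>2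
    + (\<Sum>i\<in>UNIV. (norm (weak_partial \<Omega> i (mag a) x))\<^sup>2)"
proof -
  have "(norm (weak_grad \<Omega> (mag a) x))\<^sup>2 = (\<Sum>i\<in>UNIV. (norm (weak_partial \<Omega> i (mag a) x))\<^sup>2)"
    using norm_vec_squared[of "weak_grad \<Omega> (mag a) x"] unfolding power2_norm_eq_inner weak_grad_def vec_lambda_beta .
  then show ?thesis by (simp add: state_jet_def norm_Pair add_nonneg_nonneg sum_nonneg)
qed

text \<open>The constant of \<open>Lp_sq_int\<close> passes to the whole jet, because the squares of
  the component norms sum to at most the square of their sum.\<close>

lemma sq_norm_state_jet:
  assumes a: "a \<in> state_Lp p \<Omega>" and p: "2 \<le> p"
  shows "sq_norm \<Omega> (state_jet \<Omega> a) \<le> sqrt (1 + measure lebesgue \<Omega>) * X0_norm p \<Omega> a"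
proof -
  let ?N = "\<lambda>f :: real^3 \<Rightarrow> real^3. Lp_norm p \<Omega> f" and ?c = "1 + measure lebesgue \<Omega>"
  have ma: "mag a \<in> Sobolev (Suc 0) p \<Omega>" using a by (auto simp: state_Lp_def)
  have mi: "weak_partial \<Omega> i (mag a) \<in> Lp p \<Omega>" for i using Sobolev_SucD(3)[OF ma] by simp
  have La: "vel a \<in> Lp p \<Omega>" "dfm a \<in> Lp p \<Omega>" "tmp a \<in> Lp p \<Omega>" using a by (auto simp: state_Lp_def)
  note i = state_Lp_sq_int[OF a p]
  have "(\<integral>x. (norm (state_jet \<Omega> a x))\<^sup>2 \<partial>M) = (\<integral>x. (norm (vel a x))\<^sup>2 \<partial>M) + (\<integral>x. (norm (dfm a x))\<^sup>2 \<partial>M)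
      + (\<integral>x. (norm (tmp a x))\<^sup>2 \<partial>M) + (\<Sum>i\<in>UNIV. \<integral>x. (norm (weak_partial \<Omega> i (mag a) x))\<^sup>2 \<partial>M)"
    unfolding norm_state_jet using i(1-4)[THEN sq_intD(2)] by simp
  also have "\<dots> \<le> ?c * (Lp_norm p \<Omega> (vel a))\<^sup>2 + ?c * (Lp_norm p \<Omega> (dfm a))\<^sup>2 + ?c * (Lp_norm p \<Omega> (tmp a))\<^sup>2
      + (\<Sum>i\<in>UNIV. ?c * (Lp_norm p \<Omega> (weak_partial \<Omega> i (mag a)))\<^sup>2)"
    by (intro add_mono sum_mono Lp_sq_int(2)[OF _ p] La mi)
  also have "\<dots> = ?c * ((Lp_norm p \<Omega> (vel a))\<^sup>2 + (Lp_norm p \<Omega> (dfm a))\<^sup>2 + (Lp_norm p \<Omega> (tmp a))\<^sup>2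
      + (\<Sum>i\<in>UNIV. (Lp_norm p \<Omega> (weak_partial \<Omega> i (mag a)))\<^sup>2))"
    by (simp add: distrib_left sum_distrib_left)
  also have "\<dots> \<le> ?c * (X0_norm p \<Omega> a)\<^sup>2"
  proof (intro mult_left_mono)
    have sq: "x\<^sup>2 + y\<^sup>2 \<le> (x + y)\<^sup>2" if "0 \<le> x" "0 \<le> y" for x y :: real using that by (simp add: power2_sum)
    have sq3: "x\<^sup>2 + y\<^sup>2 + w\<^sup>2 \<le> (x + y + w)\<^sup>2" if "0 \<le> x" "0 \<le> y" "0 \<le> w" for x y w :: real
      using sq[of x y] sq[of "x + y" w] that by linarith
    have n: "0 \<le> Lp_norm p \<Omega> (f :: real^3 \<Rightarrow> 'b::euclidean_space)" for f by (simp add: Lp_norm_def)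
    let ?n = "\<lambda>i. Lp_norm p \<Omega> (weak_partial \<Omega> i (mag a))"
    have "(\<Sum>i\<in>UNIV. (?n i)\<^sup>2) \<le> (\<Sum>i\<in>UNIV. ?n i)\<^sup>2"
      unfolding sum_3 by (intro sq3 n)
    also have "\<dots> \<le> (Lp_norm p \<Omega> (mag a) + (\<Sum>i\<in>UNIV. ?n i))\<^sup>2" by (intro power_mono) (simp_all add: n sum_nonneg)
    finally have S: "(\<Sum>i\<in>UNIV. (?n i)\<^sup>2) \<le> (Sobolev_norm 1 p \<Omega> (mag a))\<^sup>2" by simp
    have n1: "0 \<le> Sobolev_norm 1 p \<Omega> (mag a)" by (simp add: n sum_nonneg)
    show "(Lp_norm p \<Omega> (vel a))\<^sup>2 + (Lp_norm p \<Omega> (dfm a))\<^sup>2 + (Lp_norm p \<Omega> (tmp a))\<^sup>2 + (\<Sum>i\<in>UNIV. (?n i)\<^sup>2) \<le> (X0_norm p \<Omega> a)\<^sup>2"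
      using sq3[OF n n n, of "vel a" "dfm a" "tmp a"] S
        sq[of "Lp_norm p \<Omega> (vel a) + Lp_norm p \<Omega> (dfm a) + Lp_norm p \<Omega> (tmp a)", OF _ n1] n[of "vel a"] n[of "dfm a"] n[of "tmp a"]
      unfolding X0_norm_def by linarith
  qed (simp add: measure_nonneg)
  finally have "sqrt (\<integral>x. (norm (state_jet \<Omega> a x))\<^sup>2 \<partial>M) \<le> sqrt (?c * (X0_norm p \<Omega> a)\<^sup>2)" by (rule real_sqrt_le_mono)
  moreover have "0 \<le> X0_norm p \<Omega> a" by (simp add: X0_norm_def Lp_norm_def sum_nonneg)
  ultimately show ?thesis by (simp add: sq_norm_def real_sqrt_mult)
qed

text \<open>Cauchy-Schwarz in L2 followed by the bound of the jet in \<open>X0_norm\<close>; the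
  summand 1 makes the constant positive, as the locale demands.\<close>

lemma jet_functional:
  assumes p: "2 \<le> p" and v: "sq_int \<Omega> v"
  shows "bounded_functional (X0 p \<Omega>) (state_Lp p \<Omega>) (X0_norm p \<Omega>) (\<lambda>a. \<integral>x. state_jet \<Omega> a x \<bullet> v x \<partial>M)
    (sqrt (1 + measure lebesgue \<Omega>) * sq_norm \<Omega> v + 1)"
proof
  have N0: "0 \<le> X0_norm p \<Omega> a" for a by (simp add: X0_norm_def Lp_norm_def sum_nonneg)
  show "X0 p \<Omega> \<subseteq> state_Lp p \<Omega>" by (rule X0_state_Lp)
  have "(\<lambda>x. 0 :: 'b::euclidean_space) \<in> Lp p \<Omega>" by (simp add: Lp_def)
  moreover from this have "(\<lambda>x. 0) \<in> Sobolev (Suc 0) p \<Omega>" by (simp add: Lp_def) (intro allI exI[of _ "\<lambda>x. 0"], simp add: has_weak_partial_zero)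
  ultimately show "(\<lambda>x. 0) \<in> state_Lp p \<Omega>"
    by (simp add: state_Lp_def vel_def[abs_def] dfm_def[abs_def] tmp_def[abs_def] mag_def[abs_def] Lp_def del: Sobolev.simps)
  note i = sq_int_inner[OF state_Lp_sq_int(6)[OF _ p] v]
  fix a b assume a: "a \<in> state_Lp p \<Omega>"
  show "(\<lambda>x. c *\<^sub>R a x) \<in> state_Lp p \<Omega> \<and> (\<integral>x. state_jet \<Omega> (\<lambda>x. c *\<^sub>R a x) x \<bullet> v x \<partial>M) = c * (\<integral>x. state_jet \<Omega> a x \<bullet> v x \<partial>M)" for c
  proof -
    have "AE x in M. state_jet \<Omega> (\<lambda>x. c *\<^sub>R a x) x \<bullet> v x = c * (state_jet \<Omega> a x \<bullet> v x)"
      using state_Lp_scaleR(2)[OF a, of c] by eventually_elim simp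
    from lebesgue_on_integral_cong_AE(1)[OF domain_sets this] show ?thesis using state_Lp_scaleR(1)[OF a] by simp
  qed
  have "\<bar>\<integral>x. state_jet \<Omega> a x \<bullet> v x \<partial>M\<bar> \<le> sq_norm \<Omega> (state_jet \<Omega> a) * sq_norm \<Omega> v"
    by (rule sq_norm_Cauchy_Schwarz[OF state_Lp_sq_int(6)[OF a p] v])
  also have "\<dots> \<le> (sqrt (1 + measure lebesgue \<Omega>) * X0_norm p \<Omega> a) * sq_norm \<Omega> v"
    by (intro mult_right_mono sq_norm_state_jet[OF a p] sq_norm_nonneg)
  also have "\<dots> \<le> (sqrt (1 + measure lebesgue \<Omega>) * sq_norm \<Omega> v + 1) * X0_norm p \<Omega> a"
    using N0[of a] by (simp add: algebra_simps)
  finally show "\<bar>\<integral>x. state_jet \<Omega> a x \<bullet> v x \<partial>M\<bar> \<le> (sqrt (1 + measure lebesgue \<Omega>) * sq_norm \<Omega> v + 1) * X0_norm p \<Omega> a" .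
  assume b: "b \<in> state_Lp p \<Omega>"
  have "AE x in M. state_jet \<Omega> (\<lambda>x. a x + b x) x \<bullet> v x = state_jet \<Omega> a x \<bullet> v x + state_jet \<Omega> b x \<bullet> v x"
    using state_Lp_add(2)[OF a b p] by eventually_elim (simp add: inner_add_left)
  from lebesgue_on_integral_cong_AE(1)[OF domain_sets this]
  show "(\<lambda>x. a x + b x) \<in> state_Lp p \<Omega> \<and> (\<integral>x. state_jet \<Omega> (\<lambda>x. a x + b x) x \<bullet> v x \<partial>M)
      = (\<integral>x. state_jet \<Omega> a x \<bullet> v x \<partial>M) + (\<integral>x. state_jet \<Omega> b x \<bullet> v x \<partial>M)"
    using state_Lp_add(1)[OF a b p] i[OF a] i[OF b] by simp
next
  show "0 < sqrt (1 + measure lebesgue \<Omega>) * sq_norm \<Omega> v + 1"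
    by (intro add_nonneg_pos mult_nonneg_nonneg sq_norm_nonneg) auto
qed

definition jet_dist :: "(real^3 \<Rightarrow> state) \<Rightarrow> (real^3 \<Rightarrow> state) \<Rightarrow> real" where
  "jet_dist a b = sq_norm \<Omega> (\<lambda>x. state_jet \<Omega> a x - state_jet \<Omega> b x)"

lemma jet_dist_basic: "jet_dist a a = 0" "jet_dist a b = jet_dist b a" "0 \<le> jet_dist a b"
  by (simp_all add: jet_dist_def sq_norm_def norm_minus_commute)

lemma jet_dist_triangle:
  assumes "a \<in> state_Lp p \<Omega>" "b \<in> state_Lp p \<Omega>" "c \<in> state_Lp p \<Omega>" "2 \<le> p"
  shows "jet_dist a c \<le> jet_dist a b + jet_dist b c"
  using sq_norm_triangle[OF sq_int_diff[OF state_Lp_sq_int(6)[OF assms(1,4)] state_Lp_sq_int(6)[OF assms(2,4)]]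
      sq_int_diff[OF state_Lp_sq_int(6)[OF assms(2,4)] state_Lp_sq_int(6)[OF assms(3,4)]]]
  by (simp add: jet_dist_def)

text \<open>Selected weak derivatives are additive almost everywhere only, so the difference of the
  jets is replaced by the jet of the difference under the integral.\<close>

lemma jet_dist_X0_norm:
  assumes a: "a \<in> state_Lp p \<Omega>" and b: "b \<in> state_Lp p \<Omega>" and p: "2 \<le> p"
  shows "jet_dist a b \<le> sqrt (1 + measure lebesgue \<Omega>) * X0_norm p \<Omega> (\<lambda>x. a x - b x)"
proof -
  have nb: "(\<lambda>x. (-1) *\<^sub>R b x) \<in> state_Lp p \<Omega>" by (rule state_Lp_scaleR(1)[OF b])
  have d: "(\<lambda>x. a x - b x) \<in> state_Lp p \<Omega>" using state_Lp_add(1)[OF a nb p] by simp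
  have "AE x in M. state_jet \<Omega> (\<lambda>x. a x + (-1) *\<^sub>R b x) x = state_jet \<Omega> a x - state_jet \<Omega> b x"
    using state_Lp_add(2)[OF a nb p] state_Lp_scaleR(2)[OF b, of "-1"] by eventually_elim simp
  then have "AE x in M. (norm (state_jet \<Omega> a x - state_jet \<Omega> b x))\<^sup>2 = (norm (state_jet \<Omega> (\<lambda>x. a x - b x) x))\<^sup>2"
    by eventually_elim simp
  from lebesgue_on_integral_cong_AE(1)[OF domain_sets this]
  have "jet_dist a b = sq_norm \<Omega> (state_jet \<Omega> (\<lambda>x. a x - b x))" by (simp add: jet_dist_def sq_norm_def)
  then show ?thesis using sq_norm_state_jet[OF d p] by simp
qed

end

section \<open>Monotone quantities along curves of states\<close>

locale state_flow = bounded_domain \<Omega> for \<Omega> +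
  fixes p T :: real and z z' :: "real \<Rightarrow> real^3 \<Rightarrow> state"
  assumes p: "2 \<le> p" and deriv: "has_weak_time_derivative (X0 p \<Omega>) (X0_norm p \<Omega>) {0<..<T} z z'"
    and state: "\<And>t. 0 \<le> t \<Longrightarrow> t < T \<Longrightarrow> z t \<in> X0 p \<Omega>"
    and cont: "\<And>t. 0 \<le> t \<Longrightarrow> t < T \<Longrightarrow> ((\<lambda>s. X0_norm p \<Omega> (\<lambda>x. z s x - z t x)) \<longlongrightarrow> 0) (at t within {0..<T})"
begin

abbreviation "N \<equiv> X0_norm p \<Omega>"
abbreviation "jet \<equiv> state_jet \<Omega>"
abbreviation "D s t \<equiv> jet_dist (z s) (z t)"

lemma state': "0 \<le> t \<Longrightarrow> t < T \<Longrightarrow> z t \<in> state_Lp p \<Omega>"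
  using state X0_state_Lp by blast

lemmas jet_sq_int = state_Lp_sq_int(6)[OF state' p]

lemma N_nonneg: "0 \<le> N a"
  by (simp add: X0_norm_def Lp_norm_def sum_nonneg)

lemma jet_continuous:
  assumes t: "0 \<le> t" "t < T" and e: "0 < e"
  obtains \<delta> where "0 < \<delta>" "\<And>s. 0 \<le> s \<Longrightarrow> s < T \<Longrightarrow> \<bar>s - t\<bar> < \<delta> \<Longrightarrow> D s t < e"
proof -
  define C0 where "C0 = sqrt (1 + measure lebesgue \<Omega>)"
  have C0: "0 < C0" by (simp add: C0_def add_pos_nonneg)
  have "0 < e / C0" using e C0 by simp
  from tendstoD[OF cont[OF t] this] obtain \<delta> where \<delta>: "0 < \<delta>"
    and \<delta>': "\<And>s. s \<in> {0..<T} \<Longrightarrow> s \<noteq> t \<and> dist s t < \<delta> \<Longrightarrow> dist (N (\<lambda>x. z s x - z t x)) 0 < e / C0"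
    unfolding eventually_at by blast
  have "D s t < e" if s: "0 \<le> s" "s < T" "\<bar>s - t\<bar> < \<delta>" for s
  proof (cases "s = t")
    case False
    have "D s t \<le> C0 * N (\<lambda>x. z s x - z t x)"
      unfolding C0_def by (rule jet_dist_X0_norm[OF state'[OF s(1,2)] state'[OF t] p])
    also have "N (\<lambda>x. z s x - z t x) < e / C0" using \<delta>'[of s] s False by (simp add: dist_real_def abs_less_iff)
    then have "C0 * N (\<lambda>x. z s x - z t x) < e" using C0 by (simp add: pos_less_divide_eq mult.commute)
    finally show ?thesis .
  qed (use e in \<open>simp add: jet_dist_basic\<close>)
  then show ?thesis using that[OF \<delta>] by simp
qed

lemma derivative_L1:
  assumes "0 < s" "t < T"
  shows "AE \<tau> in lebesgue_on {s..t}. z' \<tau> \<in> X0 p \<Omega>" "integrable (lebesgue_on {s..t}) (\<lambda>\<tau>. N (z' \<tau>))"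
proof -
  have sub: "{s..t} \<subseteq> {0<..<T}" using assms by auto
  have "z' \<in> L1_loc_in (X0 p \<Omega>) N {0<..<T}" using deriv by (simp add: has_weak_time_derivative_def)
  then have *: "strongly_measurable (X0 p \<Omega>) N {s..t} z'" "integrable (lebesgue_on {s..t}) (\<lambda>\<tau>. N (z' \<tau>))"
    using sub unfolding L1_loc_in_def mem_Collect_eq by blast+
  show "integrable (lebesgue_on {s..t}) (\<lambda>\<tau>. N (z' \<tau>))" by (rule *(2))
  obtain q where "AE \<tau> in lebesgue_on {s..t}. z' \<tau> \<in> X0 p \<Omega> \<and> (\<lambda>n. N (\<lambda>x. q n \<tau> x - z' \<tau> x)) \<longlonglongrightarrow> 0"
    using *(1) unfolding strongly_measurable_def by (elim exE conjE)
  then show "AE \<tau> in lebesgue_on {s..t}. z' \<tau> \<in> X0 p \<Omega>" by eventually_elim simp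
qed

text \<open>The test field is fixed in time, which makes the pairing a bounded linear functional
  covered by the fundamental theorem above.\<close>

lemma jet_increment:
  assumes v: "sq_int \<Omega> v" and st: "0 < s" "s \<le> t" "t < T"
  shows "integrable (lebesgue_on {s..t}) (\<lambda>\<tau>. \<integral>x. jet (z' \<tau>) x \<bullet> v x \<partial>M)"
    "(\<integral>x. (jet (z t) x - jet (z s) x) \<bullet> v x \<partial>M) = (\<integral>\<tau>. (\<integral>x. jet (z' \<tau>) x \<bullet> v x \<partial>M) \<partial>lebesgue_on {s..t})"
proof -
  interpret l: bounded_functional "X0 p \<Omega>" "state_Lp p \<Omega>" N "\<lambda>a. \<integral>x. jet a x \<bullet> v x \<partial>M" "sqrt (1 + measure lebesgue \<Omega>) * sq_norm \<Omega> v + 1"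
    by (rule jet_functional[OF p v])
  have c: "((\<lambda>s. N (\<lambda>x. z s x - z t x)) \<longlongrightarrow> 0) (at t)" if t: "0 < t" "t < T" for t
  proof -
    have "((\<lambda>s. N (\<lambda>x. z s x - z t x)) \<longlongrightarrow> 0) (at t within {0<..<T})"
      by (rule tendsto_within_subset[OF cont]) (use t in auto)
    moreover have "at t within {0<..<T} = at t" by (rule at_within_open) (use t in auto)
    ultimately show ?thesis by simp
  qed
  have "z t \<in> X0 p \<Omega>" if "0 < t" "t < T" for t using state that by simp
  note w = l.weak_time_derivative[OF deriv this c st]
  show "integrable (lebesgue_on {s..t}) (\<lambda>\<tau>. \<integral>x. jet (z' \<tau>) x \<bullet> v x \<partial>M)" by (rule w(1))
  have "(\<integral>x. (jet (z t) x - jet (z s) x) \<bullet> v x \<partial>M) = (\<integral>x. jet (z t) x \<bullet> v x \<partial>M) - (\<integral>x. jet (z s) x \<bullet> v x \<partial>M)"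
    unfolding inner_diff_left
    by (rule Bochner_Integration.integral_diff) (use st in \<open>auto intro!: sq_int_inner jet_sq_int v\<close>)
  then show "(\<integral>x. (jet (z t) x - jet (z s) x) \<bullet> v x \<partial>M) = (\<integral>\<tau>. (\<integral>x. jet (z' \<tau>) x \<bullet> v x \<partial>M) \<partial>lebesgue_on {s..t})"
    using w(2) by simp
qed

text \<open>Along short time steps the test field \<open>v s t\<close> may be exchanged for the test field \<open>w \<tau>\<close> of the
  running time, at the cost of an arbitrarily small multiple of the integral of \<open>N (z' \<tau>)\<close>; these
  estimates add up. At time \<open>0\<close>, where the time derivative need not be integrable, continuity is used.\<close>

lemma flow_mono:
  fixes Ef :: "real \<Rightarrow> real" and w :: "real \<Rightarrow> real^3 \<Rightarrow> (real^3) \<times> (real^3^3) \<times> real \<times> (real^3^3)"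
    and v :: "real \<Rightarrow> real \<Rightarrow> real^3 \<Rightarrow> (real^3) \<times> (real^3^3) \<times> real \<times> (real^3^3)"
  assumes ab: "0 \<le> a" "a \<le> b" "b < T"
    and w: "\<And>t. 0 \<le> t \<Longrightarrow> t < T \<Longrightarrow> sq_int \<Omega> (w t)"
    and v: "\<And>s t. 0 \<le> s \<Longrightarrow> s \<le> t \<Longrightarrow> t < T \<Longrightarrow> sq_int \<Omega> (v s t)"
    and C: "0 \<le> C" and near: "\<And>s \<tau> t. 0 \<le> s \<Longrightarrow> s \<le> \<tau> \<Longrightarrow> \<tau> \<le> t \<Longrightarrow> t < T \<Longrightarrow>
      sq_norm \<Omega> (\<lambda>x. v s t x - w \<tau> x) \<le> C * (D s \<tau> + D t \<tau>)"
    and increment: "\<And>s t. 0 \<le> s \<Longrightarrow> s \<le> t \<Longrightarrow> t < T \<Longrightarrow> (\<integral>x. (jet (z t) x - jet (z s) x) \<bullet> v s t x \<partial>M) \<le> Ef t - Ef s"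
    and sign: "\<And>s t. 0 < s \<Longrightarrow> s \<le> t \<Longrightarrow> t < T \<Longrightarrow> AE \<tau> in lebesgue_on {s..t}. 0 \<le> (\<integral>x. jet (z' \<tau>) x \<bullet> w \<tau> x \<partial>M)"
  shows "Ef a \<le> Ef b"
proof -
  let ?J = "\<lambda>\<tau> f. \<integral>x. jet (z' \<tau>) x \<bullet> f x \<partial>M"
  define C0 where "C0 = sqrt (1 + measure lebesgue \<Omega>)"
  have C0: "0 \<le> C0" by (simp add: C0_def)
  define I where "I s t = (\<integral>\<tau>. N (z' \<tau>) \<partial>lebesgue_on {s..t})" for s t
  have I0: "0 \<le> I s t" for s t unfolding I_def by (rule Bochner_Integration.integral_nonneg) (rule N_nonneg)
  have Iadd: "I s u = I s t + I t u" if "0 < s" "s \<le> t" "t \<le> u" "u < T" for s t u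
  proof -
    note i = derivative_L1(2)[OF that(1,4)] derivative_L1(2)[of s t] derivative_L1(2)[of t u]
    have "(\<lambda>\<tau>. N (z' \<tau>)) integrable_on {s..u}" by (rule integrable_on_lebesgue_on[OF i(1)]) simp
    from Henstock_Kurzweil_Integration.integral_combine[OF that(2,3) this] show ?thesis
      unfolding I_def using that i by (simp add: lebesgue_integral_eq_integral)
  qed
  have pos: "Ef a \<le> Ef b" if ab: "0 < a" "a \<le> b" "b < T" for a b
  proof -
    have "Ef a - Ef b \<le> \<epsilon> * I a b" if \<epsilon>: "0 < \<epsilon>" for \<epsilon>
    proof -
      \<comment> \<open>The 4 arises from the two distances in \<open>near\<close>, each at most
        \<open>2 * \<eta>\<close> by the triangle inequality through \<open>x\<close>. The summand 1
        covers a vanishing \<open>C\<close>.\<close>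
      define \<eta> where "\<eta> = \<epsilon> / (4 * C0 * C + 1)"
      have \<eta>: "0 < \<eta>" using \<epsilon> C0 C by (simp add: \<eta>_def add_nonneg_pos)
      have \<eta>\<epsilon>: "C0 * (C * (4 * \<eta>)) \<le> \<epsilon>"
      proof -
        have "\<epsilon> * (4 * C0 * C) \<le> \<epsilon> * (4 * C0 * C + 1)" using \<epsilon> by simp
        then show ?thesis using C0 C by (simp add: \<eta>_def pos_divide_le_eq add_nonneg_pos mult_ac)
      qed
      \<comment> \<open>Bisection: the estimate adds up over adjacent intervals and holds on short
        intervals around every point. The trivial premises stem from the restriction of the property
        to subintervals of \<open>{a..b}\<close>.\<close>
      have "a \<le> a \<longrightarrow> b \<le> b \<longrightarrow> Ef a - Ef b \<le> \<epsilon> * I a b"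
        using ab(2)
      proof (rule Bolzano[where P="\<lambda>s t. a \<le> s \<longrightarrow> t \<le> b \<longrightarrow> Ef s - Ef t \<le> \<epsilon> * I s t"])
        fix s t u assume *: "a \<le> s \<longrightarrow> t \<le> b \<longrightarrow> Ef s - Ef t \<le> \<epsilon> * I s t" "a \<le> t \<longrightarrow> u \<le> b \<longrightarrow> Ef t - Ef u \<le> \<epsilon> * I t u"
          "s \<le> t" "t \<le> u"
        show "a \<le> s \<longrightarrow> u \<le> b \<longrightarrow> Ef s - Ef u \<le> \<epsilon> * I s u"
        proof (intro impI)
          assume "a \<le> s" "u \<le> b"
          then show "Ef s - Ef u \<le> \<epsilon> * I s u" using * ab Iadd[of s t u] by (simp add: distrib_left)
        qed
      next
        fix x assume x: "a \<le> x" "x \<le> b"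
        have x': "0 \<le> x" "x < T" using x ab by auto
        obtain \<delta> where \<delta>: "0 < \<delta>" "\<And>s. 0 \<le> s \<Longrightarrow> s < T \<Longrightarrow> \<bar>s - x\<bar> < \<delta> \<Longrightarrow> D s x < \<eta>"
          by (rule jet_continuous[OF x' \<eta>]) blast
        have "Ef s - Ef t \<le> \<epsilon> * I s t" if st: "s \<le> x" "x \<le> t" "t - s < \<delta>" "a \<le> s" "t \<le> b" for s t
        proof -
          have st': "0 < s" "s \<le> t" "t < T" using st ab by auto
          note vst = v[of s t]
          have close: "D r \<tau> \<le> 2 * \<eta>" if "r \<in> {s..t}" "\<tau> \<in> {s..t}" for r \<tau>
          proof -
            have b: "0 \<le> r" "r < T" "\<bar>r - x\<bar> < \<delta>" "0 \<le> \<tau>" "\<tau> < T" "\<bar>\<tau> - x\<bar> < \<delta>" using that st st' by auto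
            have "D r \<tau> \<le> D r x + D x \<tau>" by (rule jet_dist_triangle[OF state'[OF b(1,2)] state'[OF x'] state'[OF b(4,5)] p])
            then show ?thesis using \<delta>(2)[OF b(1-3)] \<delta>(2)[OF b(4-6)] jet_dist_basic(2)[of "z x" "z \<tau>"] by linarith
          qed
          \<comment> \<open>The field \<open>v s t\<close> is split into \<open>w \<tau>\<close>,
            which contributes a nonnegative amount by \<open>sign\<close>, and a difference of small
            L2 norm.\<close>
          have "AE \<tau> in lebesgue_on {s..t}. - \<epsilon> * N (z' \<tau>) \<le> ?J \<tau> (v s t)"
            using sign[OF st'] derivative_L1(1)[OF st'(1,3)] AE_space
          proof eventually_elim
            case (elim \<tau>)
            then have \<tau>: "s \<le> \<tau>" "\<tau> \<le> t" and zY: "z' \<tau> \<in> state_Lp p \<Omega>" using X0_state_Lp by auto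
            then have \<tau>': "0 \<le> \<tau>" "\<tau> < T" using st' by auto
            have sv: "sq_int \<Omega> (v s t)" using st' by (intro v) auto
            note j = state_Lp_sq_int(6)[OF zY p]
            note sd = sq_int_diff[OF sv w[OF \<tau>']]
            have "?J \<tau> (v s t) = (\<integral>x. jet (z' \<tau>) x \<bullet> w \<tau> x + jet (z' \<tau>) x \<bullet> (v s t x - w \<tau> x) \<partial>M)"
              by (simp add: inner_diff_right)
            also have "\<dots> = ?J \<tau> (w \<tau>) + ?J \<tau> (\<lambda>x. v s t x - w \<tau> x)"
              by (rule Bochner_Integration.integral_add[OF sq_int_inner[OF j w[OF \<tau>']] sq_int_inner[OF j sd]])
            finally have split: "?J \<tau> (v s t) = \<dots>" .
            have "\<bar>?J \<tau> (\<lambda>x. v s t x - w \<tau> x)\<bar> \<le> sq_norm \<Omega> (jet (z' \<tau>)) * sq_norm \<Omega> (\<lambda>x. v s t x - w \<tau> x)"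
              by (rule sq_norm_Cauchy_Schwarz[OF j sd])
            also have "\<dots> \<le> (C0 * N (z' \<tau>)) * (C * (D s \<tau> + D t \<tau>))"
              unfolding C0_def using st' \<tau> by (intro mult_mono sq_norm_state_jet[OF zY p] near sq_norm_nonneg mult_nonneg_nonneg N_nonneg) auto
            also have "\<dots> \<le> (C0 * N (z' \<tau>)) * (C * (4 * \<eta>))"
              using close[of s \<tau>] close[of t \<tau>] \<tau> st' C C0 N_nonneg by (intro mult_left_mono mult_nonneg_nonneg) auto
            also have "\<dots> = (C0 * (C * (4 * \<eta>))) * N (z' \<tau>)" by simp
            also have "\<dots> \<le> \<epsilon> * N (z' \<tau>)" by (rule mult_right_mono[OF \<eta>\<epsilon> N_nonneg])
            finally show ?case using split elim(1) by linarith
          qed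
          then have "(\<integral>\<tau>. - \<epsilon> * N (z' \<tau>) \<partial>lebesgue_on {s..t}) \<le> (\<integral>\<tau>. ?J \<tau> (v s t) \<partial>lebesgue_on {s..t})"
            using derivative_L1(2)[OF st'(1,3)] jet_increment(1)[OF vst st'] st' by (intro integral_mono_AE) auto
          also have "\<dots> \<le> Ef t - Ef s"
            using jet_increment(2)[OF vst st'] increment[of s t] st' by simp
          finally show ?thesis by (simp add: I_def)
        qed
        then show "\<exists>d>0. \<forall>s t. s \<le> x \<and> x \<le> t \<and> t - s < d \<longrightarrow> a \<le> s \<longrightarrow> t \<le> b \<longrightarrow> Ef s - Ef t \<le> \<epsilon> * I s t"
          using \<delta>(1) by blast
      qed
      then show ?thesis by simp
    qed
    note small = this
    show ?thesis
    proof (rule field_le_epsilon)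
      fix e :: real assume e: "0 < e"
      have "Ef a - Ef b \<le> e / (I a b + 1) * I a b" using I0[of a b] e by (intro small) simp
      also have "\<dots> \<le> e" using I0[of a b] e by (simp add: pos_divide_le_eq add_nonneg_pos mult_left_mono)
      finally show "Ef a \<le> Ef b + e" by simp
    qed
  qed
  show ?thesis
  proof (cases "a = 0 \<and> a < b")
    case False
    then show ?thesis using ab pos[of a b] by (cases "a = b") auto
  next
    case True
    then have b: "a = 0" "0 < b" by auto
    show ?thesis
    proof (rule field_le_epsilon)
      fix e :: real assume e: "0 < e"
      define W where "W = sq_norm \<Omega> (w 0)"
      have W: "0 \<le> W" by (simp add: W_def sq_norm_nonneg)
      \<comment> \<open>The cap 1 bounds \<open>D s 0\<close>, so the norm of \<open>v 0 s\<close>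
        is at most \<open>C + W\<close>; the quotient then limits the loss between 0 and
        \<open>s\<close> to \<open>e\<close>.\<close>
      define \<eta> where "\<eta> = min 1 (e / (C + W + 1))"
      have \<eta>: "0 < \<eta>" "\<eta> \<le> 1" "\<eta> * (C + W + 1) \<le> e"
        using e C W by (auto simp: \<eta>_def min_def pos_divide_le_eq pos_le_divide_eq add_nonneg_pos)
      have T: "0 \<le> (0::real)" "0 < T" using ab b by auto
      obtain \<delta> where \<delta>: "0 < \<delta>" "\<And>s. 0 \<le> s \<Longrightarrow> s < T \<Longrightarrow> \<bar>s - 0\<bar> < \<delta> \<Longrightarrow> D s 0 < \<eta>"
        by (rule jet_continuous[OF T \<eta>(1)]) blast
      define s where "s = min b (\<delta> / 2)"
      have s: "0 < s" "s \<le> b" "s < T" "s < \<delta>" using \<delta>(1) b ab by (auto simp: s_def)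
      have Ds: "D s 0 \<le> \<eta>" "0 \<le> D s 0" using \<delta>(2)[of s] s by (auto simp: jet_dist_basic)
      have sv: "sq_int \<Omega> (v 0 s)" and sw: "sq_int \<Omega> (w 0)" using s T by (auto intro: v w)
      have "sq_norm \<Omega> (\<lambda>x. (v 0 s x - w 0 x) + w 0 x) \<le> sq_norm \<Omega> (\<lambda>x. v 0 s x - w 0 x) + W"
        unfolding W_def by (rule sq_norm_triangle[OF sq_int_diff[OF sv sw] sw])
      also have "sq_norm \<Omega> (\<lambda>x. v 0 s x - w 0 x) \<le> C * (D 0 0 + D s 0)" using s by (intro near) auto
      also have "\<dots> \<le> C * 1" using Ds \<eta> C by (intro mult_left_mono) (auto simp: jet_dist_basic)
      finally have nv: "sq_norm \<Omega> (v 0 s) \<le> C + W" by simp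
      have "\<bar>\<integral>x. (jet (z s) x - jet (z 0) x) \<bullet> v 0 s x \<partial>M\<bar> \<le> D s 0 * sq_norm \<Omega> (v 0 s)"
        unfolding jet_dist_def using s T by (intro sq_norm_Cauchy_Schwarz sq_int_diff jet_sq_int sv) auto
      also have "\<dots> \<le> \<eta> * (C + W + 1)" using Ds nv \<eta> by (intro mult_mono sq_norm_nonneg) auto
      finally have "- e \<le> Ef s - Ef 0" using increment[of 0 s] s \<eta>(3) by linarith
      then show "Ef a \<le> Ef b + e" using pos[OF s(1,2) ab(3)] b by simp
    qed
  qed
qed

end

section \<open>Energy and entropy of a flow of the system\<close>

locale MVE_flow = state_flow \<Omega> p T z z' for \<Omega> p T z z' +
  fixes k :: nat and \<mu>vis \<kappa> \<alpha> \<beta> :: "real \<Rightarrow> real" and K :: "state \<Rightarrow> real^3^3" and \<pi> :: "real \<Rightarrow> real^3 \<Rightarrow> real"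
  assumes slice: "\<And>s t. 0 < s \<Longrightarrow> s \<le> t \<Longrightarrow> t < T \<Longrightarrow>
      AE \<tau> in lebesgue_on {s..t}. MVE_slice \<Omega> p k \<mu>vis \<kappa> \<alpha> \<beta> K (z \<tau>) (z' \<tau>) (\<pi> \<tau>)"
    and z_cont: "\<And>t. 0 \<le> t \<Longrightarrow> t < T \<Longrightarrow> continuous_on (closure \<Omega>) (z t)"
begin

text \<open>The gradient of the energy density with respect to the jet; the temperature enters
  linearly and gives the constant 1.\<close>

definition energy_field :: "(real^3 \<Rightarrow> state) \<Rightarrow> real^3 \<Rightarrow> (real^3) \<times> (real^3^3) \<times> real \<times> (real^3^3)" where
  "energy_field a x = (vel a x, dfm a x, 1, weak_grad \<Omega> (mag a) x)"

lemma energy_field_sq_int: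
  assumes "a \<in> state_Lp p \<Omega>"
  shows "sq_int \<Omega> (energy_field a)"
  unfolding energy_field_def[abs_def]
  by (intro sq_int_Pair state_Lp_sq_int[OF assms p] sq_int_continuous continuous_on_const)

text \<open>The constant third component cancels in the difference, so the energy field is Lipschitz
  in the jet with constant 1.\<close>

lemma energy_field_diff:
  assumes a: "a \<in> state_Lp p \<Omega>" and b: "b \<in> state_Lp p \<Omega>"
  shows "sq_norm \<Omega> (\<lambda>x. (1/2) *\<^sub>R (energy_field a x - energy_field b x)) \<le> 1/2 * jet_dist a b"
  unfolding jet_dist_def
proof (rule sq_norm_mono)
  show "sq_int \<Omega> (\<lambda>x. (1/2) *\<^sub>R (energy_field a x - energy_field b x))"
    by (rule sq_int_linear[OF sq_int_diff[OF energy_field_sq_int[OF a] energy_field_sq_int[OF b]] bounded_linear_scaleR_right])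
  show "sq_int \<Omega> (\<lambda>x. jet a x - jet b x)"
    by (rule sq_int_diff[OF state_Lp_sq_int(6)[OF a p] state_Lp_sq_int(6)[OF b p]])
  have "norm (energy_field a x - energy_field b x) \<le> norm (jet a x - jet b x)" for x
    unfolding energy_field_def state_jet_def norm_Pair diff_Pair by (intro real_sqrt_le_mono add_mono power_mono) auto
  then show "AE x in M. norm ((1/2) *\<^sub>R (energy_field a x - energy_field b x)) \<le> 1/2 * norm (jet a x - jet b x)"
    by (intro AE_I2) simp
qed simp

lemma energy_integrable:
  assumes "0 \<le> t" "t < T"
  shows "integrable M (energy_density \<Omega> (z t))"
proof -
  note i = state_Lp_sq_int[OF state'[OF assms] p]
  show ?thesis unfolding energy_density_def[abs_def]
    using sq_intD(2)[OF i(1)] sq_intD(2)[OF i(2)] sq_intD(2)[OF i(5)] sq_int_integrable[OF i(3)] by simp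
qed

text \<open>The midpoint rule is exact for a quadratic density: the product of \<open>b - a\<close>
  with \<open>(a + b) / 2\<close> is the difference of the halved squares.\<close>

lemma energy_increment:
  assumes st: "0 \<le> s" "s < T" "0 \<le> t" "t < T"
  shows "(\<integral>x. (jet (z t) x - jet (z s) x) \<bullet> ((1/2) *\<^sub>R (energy_field (z s) x + energy_field (z t) x)) \<partial>M)
    = total_energy \<Omega> (z t) - total_energy \<Omega> (z s)"
proof -
  have sq: "(b - a) \<bullet> (a + b) / 2 = (norm b)\<^sup>2 / 2 - (norm a)\<^sup>2 / 2" for a b :: "'b::real_inner"
    by (simp add: power2_norm_eq_inner inner_diff_left inner_diff_right inner_add_right inner_commute field_simps)
  have "(jet (z t) x - jet (z s) x) \<bullet> ((1/2) *\<^sub>R (energy_field (z s) x + energy_field (z t) x))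
      = energy_density \<Omega> (z t) x - energy_density \<Omega> (z s) x" for x
    by (simp add: state_jet_def energy_field_def energy_density_def sq)
  then show ?thesis
    using energy_integrable[OF st(1,2)] energy_integrable[OF st(3,4)] by (simp add: total_energy_def)
qed

lemma energy_sign:
  assumes "0 < s" "s \<le> t" "t < T"
  shows "AE \<tau> in lebesgue_on {s..t}. (\<integral>x. jet (z' \<tau>) x \<bullet> energy_field (z \<tau>) x \<partial>M) = 0"
  using slice[OF assms]
proof eventually_elim
  case (elim \<tau>)
  have "jet (z' \<tau>) x \<bullet> energy_field (z \<tau>) x = vel (z' \<tau>) x \<bullet> vel (z \<tau>) x + dfm (z' \<tau>) x \<bullet> dfm (z \<tau>) x + tmp (z' \<tau>) x
      + (\<Sum>j\<in>UNIV. weak_partial \<Omega> j (mag (z' \<tau>)) x \<bullet> weak_partial \<Omega> j (mag (z \<tau>)) x)" for x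
  proof -
    have "weak_grad \<Omega> (mag (z' \<tau>)) x \<bullet> weak_grad \<Omega> (mag (z \<tau>)) x
        = (\<Sum>j\<in>UNIV. weak_partial \<Omega> j (mag (z' \<tau>)) x \<bullet> weak_partial \<Omega> j (mag (z \<tau>)) x)"
      unfolding weak_grad_def inner_vec_def[of "vec_lambda _"] vec_lambda_beta ..
    then show ?thesis by (simp add: state_jet_def energy_field_def)
  qed
  then show ?case using MVE_slice.energy_identity[OF elim] by (simp add: has_bochner_integral_iff)
qed

lemma energy_conservation:
  assumes ab: "0 \<le> a" "a \<le> b" "b < T"
  shows "total_energy \<Omega> (z a) = total_energy \<Omega> (z b)"
proof -
  let ?v = "\<lambda>s t x. (1/2) *\<^sub>R (energy_field (z s) x + energy_field (z t) x)"
  let ?w = "\<lambda>\<tau>. energy_field (z \<tau>)"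
  have w: "sq_int \<Omega> (?w t)" if "0 \<le> t" "t < T" for t by (rule energy_field_sq_int[OF state'[OF that]])
  have v: "sq_int \<Omega> (?v s t)" if "0 \<le> s" "s \<le> t" "t < T" for s t
    using that by (intro sq_int_linear[OF sq_int_add[OF w w] bounded_linear_scaleR_right]) auto
  have near: "sq_norm \<Omega> (\<lambda>x. ?v s t x - ?w \<tau> x) \<le> 1/2 * (D s \<tau> + D t \<tau>)"
    if *: "0 \<le> s" "s \<le> \<tau>" "\<tau> \<le> t" "t < T" for s t \<tau>
  proof -
    have Y: "z s \<in> state_Lp p \<Omega>" "z \<tau> \<in> state_Lp p \<Omega>" "z t \<in> state_Lp p \<Omega>" using * by (auto intro: state')
    have q: "sq_int \<Omega> (\<lambda>x. (1/2) *\<^sub>R (energy_field a x - energy_field b x))" if "a \<in> state_Lp p \<Omega>" "b \<in> state_Lp p \<Omega>" for a b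
      by (rule sq_int_linear[OF sq_int_diff[OF energy_field_sq_int[OF that(1)] energy_field_sq_int[OF that(2)]] bounded_linear_scaleR_right])
    have h: "?v s t x - ?w \<tau> x = (1/2) *\<^sub>R (energy_field (z s) x - ?w \<tau> x) + (1/2) *\<^sub>R (energy_field (z t) x - ?w \<tau> x)" for x
    proof -
      have half: "(1/2) *\<^sub>R ?w \<tau> x + (1/2) *\<^sub>R ?w \<tau> x = ?w \<tau> x" by (simp flip: scaleR_add_left)
      have "?v s t x - ((1/2) *\<^sub>R ?w \<tau> x + (1/2) *\<^sub>R ?w \<tau> x)
          = (1/2) *\<^sub>R (energy_field (z s) x - ?w \<tau> x) + (1/2) *\<^sub>R (energy_field (z t) x - ?w \<tau> x)"
        by (simp add: scaleR_add_right scaleR_diff_right)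
      then show ?thesis unfolding half .
    qed
    show ?thesis unfolding h
      using order_trans[OF sq_norm_triangle[OF q[OF Y(1,2)] q[OF Y(3,2)]] add_mono[OF energy_field_diff[OF Y(1,2)] energy_field_diff[OF Y(3,2)]]]
      by (simp only: distrib_left)
  qed
  \<comment> \<open>Monotonicity is applied to the energy and to its negative. Both are possible
    because the increment formula and the tested identity are equalities.\<close>
  have "\<sigma> * total_energy \<Omega> (z a) \<le> \<sigma> * total_energy \<Omega> (z b)" if \<sigma>: "\<bar>\<sigma>\<bar> = 1" for \<sigma> :: real
  proof (rule flow_mono[where w="\<lambda>t x. \<sigma> *\<^sub>R ?w t x" and v="\<lambda>s t x. \<sigma> *\<^sub>R ?v s t x" and C="1/2"
        and Ef="\<lambda>t. \<sigma> * total_energy \<Omega> (z t)", OF ab])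
    show "sq_int \<Omega> (\<lambda>x. \<sigma> *\<^sub>R ?w t x)" if "0 \<le> t" "t < T" for t
      by (rule sq_int_linear[OF w[OF that] bounded_linear_scaleR_right])
    show "sq_int \<Omega> (\<lambda>x. \<sigma> *\<^sub>R ?v s t x)" if "0 \<le> s" "s \<le> t" "t < T" for s t
      by (rule sq_int_linear[OF v[OF that] bounded_linear_scaleR_right])
    show "sq_norm \<Omega> (\<lambda>x. \<sigma> *\<^sub>R ?v s t x - \<sigma> *\<^sub>R ?w \<tau> x) \<le> 1/2 * (D s \<tau> + D t \<tau>)"
      if "0 \<le> s" "s \<le> \<tau>" "\<tau> \<le> t" "t < T" for s \<tau> t
    proof -
      have "norm (\<sigma> *\<^sub>R f - \<sigma> *\<^sub>R g) = norm (f - g)" for f g :: "(real^3) \<times> (real^3^3) \<times> real \<times> (real^3^3)"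
        using \<sigma> norm_scaleR[of \<sigma> "f - g"] by (simp add: scaleR_diff_right)
      then show ?thesis using near[OF that] unfolding sq_norm_def by (simp only:)
    qed
    show "(\<integral>x. (jet (z t) x - jet (z s) x) \<bullet> (\<sigma> *\<^sub>R ?v s t x) \<partial>M) \<le> \<sigma> * total_energy \<Omega> (z t) - \<sigma> * total_energy \<Omega> (z s)"
      if "0 \<le> s" "s \<le> t" "t < T" for s t
      using energy_increment[of s t] that unfolding inner_scaleR_right integral_mult_right_zero by (simp add: right_diff_distrib)
    show "AE \<tau> in lebesgue_on {s..t}. 0 \<le> (\<integral>x. jet (z' \<tau>) x \<bullet> (\<sigma> *\<^sub>R ?w \<tau> x) \<partial>M)" if "0 < s" "s \<le> t" "t < T" for s t
      using energy_sign[OF that] by eventually_elim simp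
  qed auto
  from this[of 1] this[of "-1"] show ?thesis by simp
qed

lemma entropy_integrable:
  assumes t: "0 \<le> t" "t < T" and pos: "\<And>x. x \<in> closure \<Omega> \<Longrightarrow> 0 < tmp (z t) x"
  shows "integrable M (entropy_density (z t))"
proof -
  have "continuous_on (closure \<Omega>) (\<lambda>x. 1 + ln (tmp (z t) x))"
    by (intro continuous_intros continuous_state_components(3)[OF z_cont[OF t]]) (use pos in force)
  from sq_int_integrable[OF sq_int_continuous[OF this]] show ?thesis unfolding entropy_density_def[abs_def] .
qed

text \<open>By concavity of the logarithm the tangent at the later state bounds the increment from
  below, so the test field of a time step is taken at its end.\<close>

lemma entropy_mono:
  assumes ab: "0 \<le> a" "a \<le> b" "b < T"
    and low: "0 < c" "\<And>t x. 0 \<le> t \<Longrightarrow> t < T \<Longrightarrow> x \<in> closure \<Omega> \<Longrightarrow> c \<le> tmp (z t) x"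
    and nonneg: "\<And>s. 0 \<le> \<mu>vis s" "\<And>s. 0 \<le> \<kappa> s" "\<And>s. 0 \<le> \<alpha> s" "\<And>y \<xi>. 0 \<le> \<xi> \<bullet> (K y *v \<xi>)"
  shows "total_entropy \<Omega> (z a) \<le> total_entropy \<Omega> (z b)"
proof -
  let ?w = "\<lambda>\<tau> x. (0 :: real^3, 0 :: real^3^3, inverse (tmp (z \<tau>) x), 0 :: real^3^3)"
  have pos: "0 < tmp (z t) x" if "0 \<le> t" "t < T" "x \<in> closure \<Omega>" for t x using low(1) low(2)[OF that] by simp
  have w: "sq_int \<Omega> (?w t)" if t: "0 \<le> t" "t < T" for t
    by (intro sq_int_continuous continuous_intros continuous_state_components(3)[OF z_cont[OF t]]) (use pos[OF t] in force)
  show ?thesis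
  \<comment> \<open>\<open>1 / c\<^sup>2\<close> is the Lipschitz constant of the inverse on the
    values above \<open>c\<close>.\<close>
  proof (rule flow_mono[where w="?w" and v="\<lambda>s t. ?w t" and C="1 / c\<^sup>2" and Ef="\<lambda>t. total_entropy \<Omega> (z t)", OF ab w])
    show "sq_int \<Omega> (?w t)" if "0 \<le> s" "s \<le> t" "t < T" for s t using that by (intro w) auto
    show "sq_norm \<Omega> (\<lambda>x. ?w t x - ?w \<tau> x) \<le> 1 / c\<^sup>2 * (D s \<tau> + D t \<tau>)" if *: "0 \<le> s" "s \<le> \<tau>" "\<tau> \<le> t" "t < T" for s \<tau> t
    proof -
      have t: "0 \<le> t" "t < T" and \<tau>: "0 \<le> \<tau>" "\<tau> < T" using * by auto
      have "sq_norm \<Omega> (\<lambda>x. ?w t x - ?w \<tau> x) \<le> 1 / c\<^sup>2 * D t \<tau>"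
        unfolding jet_dist_def
      proof (rule sq_norm_mono[OF sq_int_diff[OF w[OF t] w[OF \<tau>]] sq_int_diff[OF jet_sq_int[OF t] jet_sq_int[OF \<tau>]]])
        have "norm (?w t x - ?w \<tau> x) \<le> 1 / c\<^sup>2 * norm (jet (z t) x - jet (z \<tau>) x)" if x: "x \<in> \<Omega>" for x
        proof -
          have xc: "x \<in> closure \<Omega>" using x closure_subset[of \<Omega>] by auto
          let ?a = "tmp (z t) x" and ?b = "tmp (z \<tau>) x"
          note p' = pos[OF t xc] pos[OF \<tau> xc]
          have "norm (?w t x - ?w \<tau> x) = \<bar>inverse ?a - inverse ?b\<bar>" by (simp add: norm_Pair)
          also have "\<dots> = \<bar>?a - ?b\<bar> / (?a * ?b)"
            using p' by (simp add: inverse_diff_inverse abs_mult divide_simps abs_minus_commute)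
          also have "\<dots> \<le> \<bar>?a - ?b\<bar> / c\<^sup>2"
            unfolding power2_eq_square using low(1) low(2)[OF t xc] low(2)[OF \<tau> xc] by (intro divide_left_mono mult_mono mult_pos_pos) auto
          also have "\<bar>?a - ?b\<bar> = norm (fst (snd (snd (jet (z t) x - jet (z \<tau>) x))))" by (simp add: state_jet_def)
          also have "\<dots> \<le> norm (jet (z t) x - jet (z \<tau>) x)"
            by (cases "jet (z t) x - jet (z \<tau>) x")
              (simp only: fst_conv snd_conv order_trans[OF norm_fst_le order_trans[OF norm_snd_le norm_snd_le]])
          finally show ?thesis by (simp add: divide_right_mono)
        qed
        then show "AE x in M. norm (?w t x - ?w \<tau> x) \<le> 1 / c\<^sup>2 * norm (jet (z t) x - jet (z \<tau>) x)" by (intro AE_I2) simp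
      qed simp
      also have "\<dots> \<le> 1 / c\<^sup>2 * (D s \<tau> + D t \<tau>)" by (intro mult_left_mono) (simp_all add: jet_dist_basic)
      finally show ?thesis .
    qed
    show "(\<integral>x. (jet (z t) x - jet (z s) x) \<bullet> ?w t x \<partial>M) \<le> total_entropy \<Omega> (z t) - total_entropy \<Omega> (z s)"
      if *: "0 \<le> s" "s \<le> t" "t < T" for s t
    proof -
      have t: "0 \<le> t" "t < T" and s: "0 \<le> s" "s < T" using * by auto
      note i = entropy_integrable[OF t pos[OF t]] entropy_integrable[OF s pos[OF s]]
      have "(jet (z t) x - jet (z s) x) \<bullet> ?w t x \<le> entropy_density (z t) x - entropy_density (z s) x" if x: "x \<in> \<Omega>" for x
      proof -
        have xc: "x \<in> closure \<Omega>" using x closure_subset[of \<Omega>] by auto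
        let ?a = "tmp (z s) x" and ?b = "tmp (z t) x"
        note p' = pos[OF s xc] pos[OF t xc]
        \<comment> \<open>With \<open>?a\<close> the earlier and \<open>?b\<close> the later
          temperature this is the tangent bound
          \<open>(b - a) / b \<le> ln b - ln a\<close>.\<close>
        have "ln (?a / ?b) \<le> ?a / ?b - 1" using p' by (intro ln_le_minus_one) simp
        then show ?thesis using p' by (simp add: state_jet_def entropy_density_def ln_div field_simps)
      qed
      then have "(\<integral>x. (jet (z t) x - jet (z s) x) \<bullet> ?w t x \<partial>M) \<le> (\<integral>x. entropy_density (z t) x - entropy_density (z s) x \<partial>M)"
        using i by (intro integral_mono_AE sq_int_inner[OF sq_int_diff[OF jet_sq_int[OF t] jet_sq_int[OF s]] w[OF t]] AE_I2) auto
      then show ?thesis using i by (simp add: total_entropy_def)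
    qed
    show "AE \<tau> in lebesgue_on {s..t}. 0 \<le> (\<integral>x. jet (z' \<tau>) x \<bullet> ?w \<tau> x \<partial>M)" if st: "0 < s" "s \<le> t" "t < T" for s t
      using slice[OF st] AE_space
    proof eventually_elim
      case (elim \<tau>)
      then have \<tau>: "0 \<le> \<tau>" "\<tau> < T" using st by auto
      show ?case using MVE_slice.entropy_inequality(2)[OF elim(1) low(1) low(2)[OF \<tau>] nonneg]
        by (simp add: state_jet_def divide_inverse)
    qed
  qed (use low(1) in auto)
qed

end

section \<open>From solutions to flows, and the theorem\<close>

lemma MVE_flow_solution:
  assumes domain: "open \<Omega>" "bounded \<Omega>" "Ck_boundary (Suc k) \<Omega>" and p: "2 \<le> p"
    and coefficients: "Ck_on (Suc 0) \<mu>vis UNIV" "Ck_on (Suc 0) \<kappa> UNIV" "Ck_on (Suc 0) K UNIV"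
    and solution: "MVE_solution p \<mu> \<Omega> \<mu>vis \<kappa> \<alpha> \<beta> K z0 Tp z \<pi>" and T: "0 < T" "ereal T < Tp"
  shows "MVE_flow \<Omega> p T z (weak_time_derivative (X0 p \<Omega>) (X0_norm p \<Omega>) {0<..<T} z) k \<mu>vis \<kappa> \<alpha> \<beta> K \<pi>"
proof -
  note sol = solution[unfolded MVE_solution_def]
  let ?z' = "weak_time_derivative (X0 p \<Omega>) (X0_norm p \<Omega>) {0<..<T} z"
  have lt: "ereal t < Tp" if "t < T" for t using less_trans[of "ereal t" "ereal T" Tp] that T(2) by simp
  have E: "z \<in> E1 p \<mu> \<Omega> T" and PI: "\<pi> \<in> weighted_Lp (homogeneous_H1 p \<Omega>) (homogeneous_H1_norm p \<Omega>) p \<mu> T"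
    and eq: "AE t in lebesgue_on {0<..<T}. MVE_equations \<Omega> \<mu>vis \<kappa> \<alpha> \<beta> K (?z' t) (z t) (\<pi> t) \<and> MVE_boundary_conditions \<Omega> K (z t)"
    using sol T by auto
  obtain g where g: "has_weak_time_derivative (X0 p \<Omega>) (X0_norm p \<Omega>) {0<..<T} z g"
    using E by (auto simp: E1_def weighted_W1p_def)
  interpret state_flow \<Omega> p T z ?z'
  proof
    show "has_weak_time_derivative (X0 p \<Omega>) (X0_norm p \<Omega>) {0<..<T} z ?z'"
      unfolding weak_time_derivative_def by (rule someI[of "\<lambda>g. has_weak_time_derivative (X0 p \<Omega>) (X0_norm p \<Omega>) {0<..<T} z g", OF g])
    show "z t \<in> X0 p \<Omega>" if "0 \<le> t" "t < T" for t using sol lt that by blast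
    show "((\<lambda>s. X0_norm p \<Omega> (\<lambda>x. z s x - z t x)) \<longlongrightarrow> 0) (at t within {0..<T})" if "0 \<le> t" "t < T" for t
    proof (rule tendsto_within_subset)
      show "((\<lambda>s. X0_norm p \<Omega> (\<lambda>x. z s x - z t x)) \<longlongrightarrow> 0) (at t within {s. 0 \<le> s \<and> ereal s < Tp})"
        using sol lt that by blast
    qed (use lt in auto)
  qed fact+
  show ?thesis
  proof
    show zc: "continuous_on (closure \<Omega>) (z t)" if "0 \<le> t" "t < T" for t using sol lt that by blast
    fix s t assume st: "0 < s" "s \<le> t" "t < T"
    have sub: "AE \<tau> in lebesgue_on {s..t}. Q \<tau>" if "AE \<tau> in lebesgue_on {0<..<T}. Q \<tau>" for Q
      by (rule AE_lebesgue_on_subset[OF that]) (use st in auto)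
    \<comment> \<open>Strong measurability includes membership in the carrier almost everywhere.
      This is how the spatial regularity of the state and of the pressure reaches single
      times.\<close>
    have mem: "AE \<tau> in lebesgue_on {0<..<T}. f \<tau> \<in> X" if "f \<in> weighted_Lp X NX p \<mu> T"
      for X NX and f :: "real \<Rightarrow> real^3 \<Rightarrow> 'b::euclidean_space"
    proof -
      have "strongly_measurable X NX {0<..<T} f" using that by (simp add: weighted_Lp_def)
      then obtain q where "AE \<tau> in lebesgue_on {0<..<T}. f \<tau> \<in> X \<and> (\<lambda>n. NX (\<lambda>x. q n \<tau> x - f \<tau> x)) \<longlonglongrightarrow> 0"
        unfolding strongly_measurable_def by (elim exE conjE)
      then show ?thesis by eventually_elim simp
    qed
    have "z \<in> weighted_Lp (X1 p \<Omega>) (X1_norm p \<Omega>) p \<mu> T" using E by (simp add: E1_def)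
    note z1 = sub[OF mem[OF this]] and p1 = sub[OF mem[OF PI]]
    show "AE \<tau> in lebesgue_on {s..t}. MVE_slice \<Omega> p k \<mu>vis \<kappa> \<alpha> \<beta> K (z \<tau>) (?z' \<tau>) (\<pi> \<tau>)"
      using z1 p1 sub[OF eq] derivative_L1(1)[OF st(1,3)] AE_space
    proof eventually_elim
      case (elim \<tau>)
      then have "continuous_on (closure \<Omega>) (z \<tau>)" using st by (intro zc) auto
      then show ?case using elim domain p coefficients by unfold_locales auto
    qed
  qed
qed

text \<open>An equality of functions, not just almost everywhere: both sides select from the same
  predicate.\<close>

lemma weak_partial_cong:
  fixes f g :: "real^3 \<Rightarrow> 'b::euclidean_space"
  assumes \<Omega>: "open \<Omega>" and eq: "\<And>x. x \<in> \<Omega> \<Longrightarrow> f x = g x"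
  shows "weak_partial \<Omega> i f = weak_partial \<Omega> i g"
proof -
  have AE: "AE x in lebesgue_on \<Omega>. f x = g x" "AE x in lebesgue_on \<Omega>. g x = f x" using eq by (auto intro!: AE_I2)
  have "has_weak_partial \<Omega> i f h = has_weak_partial \<Omega> i g h" for h
    by (rule iffI; erule has_weak_partial_cong_AE[OF \<Omega>]) (simp_all add: AE)
  then show ?thesis by (simp add: weak_partial_def)
qed

theorem proposition2p1:
  fixes \<Omega> :: "(real^3) set"
    and \<mu>vis \<kappa> \<alpha> \<beta> :: "real \<Rightarrow> real"
    and K :: "state \<Rightarrow> real^3^3"
    and \<mu>low \<kappa>low \<alpha>low clow p \<mu> :: real
    and z0 :: "real^3 \<Rightarrow> state"
    and Tp :: ereal
    and z :: "real \<Rightarrow> real^3 \<Rightarrow> state"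
    and \<pi> :: "real \<Rightarrow> real^3 \<Rightarrow> real"
  assumes domain: "open \<Omega>" "connected \<Omega>" "\<Omega> \<noteq> {}" "bounded \<Omega>" "Ck_boundary 3 \<Omega>"
    and smooth: "Ck_on 5 \<mu>vis UNIV" "Ck_on 5 \<kappa> UNIV" "Ck_on 5 \<alpha> UNIV" "Ck_on 5 \<beta> UNIV"
      "Ck_on 5 K UNIV"
    and sym: "\<And>y. transpose (K y) = K y"
    and constants_pos: "\<mu>low > 0" "\<kappa>low > 0" "\<alpha>low > 0" "clow > 0"
    and lower_bounds: "\<And>s. \<mu>vis s \<ge> \<mu>low" "\<And>s. \<kappa> s \<ge> \<kappa>low" "\<And>s. \<alpha> s \<ge> \<alpha>low"
      "\<And>y \<xi>. \<xi> \<bullet> (K y *v \<xi>) \<ge> clow * (\<xi> \<bullet> \<xi>)"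
    and exponents: "p > 5" "1 / 2 + 5 / (2 * p) < \<mu>" "\<mu> \<le> 1"
    and initial: "z0 \<in> state_manifold p \<mu> \<Omega> K"
    and solution: "maximal_MVE_solution p \<mu> \<Omega> \<mu>vis \<kappa> \<alpha> \<beta> K z0 Tp z \<pi>"
    and temperature_bound: "\<And>t x. 0 \<le> t \<Longrightarrow> ereal t < Tp \<Longrightarrow> x \<in> closure \<Omega> \<Longrightarrow>
      tmp (z t) x \<ge> (INF y\<in>closure \<Omega>. tmp z0 y)"
  shows "(\<forall>t\<ge>0. ereal t < Tp \<longrightarrow>
            integrable (lebesgue_on \<Omega>) (energy_density \<Omega> (z t)) \<and>
            total_energy \<Omega> (z t) = total_energy \<Omega> z0)
       \<and> (\<forall>t\<ge>0. ereal t < Tp \<longrightarrow> integrable (lebesgue_on \<Omega>) (entropy_density (z t)))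
       \<and> (\<forall>s t. 0 \<le> s \<longrightarrow> s \<le> t \<longrightarrow> ereal t < Tp \<longrightarrow>
            total_entropy \<Omega> (z s) \<le> total_entropy \<Omega> (z t))
       \<and> (\<forall>t>0. ereal t < Tp \<longrightarrow>
            (\<forall>x\<in>\<Omega>. entropy_production_rate \<Omega> \<mu>vis \<kappa> \<alpha> K (z t) x \<ge> 0))"
proof -
  have sol: "MVE_solution p \<mu> \<Omega> \<mu>vis \<kappa> \<alpha> \<beta> K z0 Tp z \<pi>" using solution by (simp add: maximal_MVE_solution_def)
  have flow: "MVE_flow \<Omega> p T z (weak_time_derivative (X0 p \<Omega>) (X0_norm p \<Omega>) {0<..<T} z) 2 \<mu>vis \<kappa> \<alpha> \<beta> K \<pi>"
    if "0 < T" "ereal T < Tp" for T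
  proof (rule MVE_flow_solution[OF domain(1,4) _ _ _ _ _ sol that])
    show "Ck_boundary (Suc 2) \<Omega>" using domain(5) by (simp add: numeral_3_eq_3 numeral_2_eq_2)
    show "Ck_on (Suc 0) \<mu>vis UNIV" by (rule Ck_on_le[OF smooth(1)]) simp
    show "Ck_on (Suc 0) \<kappa> UNIV" by (rule Ck_on_le[OF smooth(2)]) simp
    show "Ck_on (Suc 0) K UNIV" by (rule Ck_on_le[OF smooth(5)]) simp
  qed (use exponents in simp)
  \<comment> \<open>A flow lives on a bounded interval that is open at its end, and
    \<open>Tp\<close> may be infinite; hence a real time strictly between \<open>t\<close> and
    \<open>Tp\<close>.\<close>
  have later: "\<exists>T. 0 < T \<and> t < T \<and> ereal T < Tp" if t: "0 \<le> t" "ereal t < Tp" for t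
  proof -
    obtain T where "ereal t < ereal T" "ereal T < Tp" using ereal_dense2[OF t(2)] by (elim exE conjE)
    then show ?thesis using t(1) by (intro exI[of _ T]) simp
  qed
  have nonneg: "0 \<le> \<mu>vis s" "0 \<le> \<kappa> s" "0 \<le> \<alpha> s" "0 \<le> \<xi> \<bullet> (K y *v \<xi>)" for s y \<xi>
    using constants_pos lower_bounds(1)[of s] lower_bounds(2)[of s] lower_bounds(3)[of s]
      order_trans[OF mult_nonneg_nonneg[of clow "\<xi> \<bullet> \<xi>"] lower_bounds(4)[of \<xi> y]] by auto
  \<comment> \<open>The minimum of the initial temperature, attained on the compact closure and
    therefore positive.\<close>
  obtain c where c: "0 < c" "\<And>t x. 0 \<le> t \<Longrightarrow> ereal t < Tp \<Longrightarrow> x \<in> closure \<Omega> \<Longrightarrow> c \<le> tmp (z t) x"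
  proof -
    have z0: "continuous_on (closure \<Omega>) z0" "\<And>x. x \<in> closure \<Omega> \<Longrightarrow> 0 < tmp z0 x"
      using initial by (auto simp: state_manifold_def)
    have "compact (closure \<Omega>)" "closure \<Omega> \<noteq> {}" using domain by auto
    from continuous_attains_inf[OF this continuous_state_components(3)[OF z0(1)]]
    obtain y where y: "y \<in> closure \<Omega>" "\<And>x. x \<in> closure \<Omega> \<Longrightarrow> tmp z0 y \<le> tmp z0 x" by blast
    have "tmp z0 y \<le> (INF y\<in>closure \<Omega>. tmp z0 y)" using y by (intro cINF_greatest) auto
    then have "tmp z0 y \<le> tmp (z t) x" if "0 \<le> t" "ereal t < Tp" "x \<in> closure \<Omega>" for t x
      using temperature_bound[OF that] by (rule order_trans)
    with z0(2)[OF y(1)] show ?thesis by (rule that)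
  qed
  \<comment> \<open>The states agree at every point of the domain, so the selected weak derivatives
    are the same functions and the densities agree pointwise.\<close>
  have initial_energy: "total_energy \<Omega> (z 0) = total_energy \<Omega> z0"
  proof -
    have eq: "z 0 x = z0 x" if "x \<in> \<Omega>" for x using sol that closure_subset[of \<Omega>] by (auto simp: MVE_solution_def)
    have "weak_partial \<Omega> i (mag (z 0)) = weak_partial \<Omega> i (mag z0)" for i
      by (rule weak_partial_cong[OF domain(1)]) (simp add: mag_def eq)
    then have "energy_density \<Omega> (z 0) x = energy_density \<Omega> z0 x" if "x \<in> \<Omega>" for x
      using eq[OF that] by (simp add: energy_density_def weak_grad_def vel_def dfm_def tmp_def)
    then show ?thesis unfolding total_energy_def by (intro Bochner_Integration.integral_cong) auto
  qed
  have energy: "integrable (lebesgue_on \<Omega>) (energy_density \<Omega> (z t)) \<and> total_energy \<Omega> (z t) = total_energy \<Omega> z0"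
    if t: "0 \<le> t" "ereal t < Tp" for t
  proof -
    obtain T where T: "0 < T" "t < T" "ereal T < Tp" using later[OF t] by blast
    from flow[OF T(1,3)] interpret MVE_flow \<Omega> p T z "weak_time_derivative (X0 p \<Omega>) (X0_norm p \<Omega>) {0<..<T} z" 2 \<mu>vis \<kappa> \<alpha> \<beta> K \<pi> .
    show ?thesis using energy_integrable[OF t(1) T(2)] energy_conservation[OF order.refl t(1) T(2)] initial_energy by simp
  qed
  have entropy: "integrable (lebesgue_on \<Omega>) (entropy_density (z t)) \<and> total_entropy \<Omega> (z s) \<le> total_entropy \<Omega> (z t)"
    if st: "0 \<le> s" "s \<le> t" "ereal t < Tp" for s t
  proof -
    have t0: "0 \<le> t" using st by simp
    obtain T where T: "0 < T" "t < T" "ereal T < Tp" using later[OF t0 st(3)] by blast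
    have low: "c \<le> tmp (z r) x" if "0 \<le> r" "r < T" "x \<in> closure \<Omega>" for r x
    proof (rule c(2)[OF that(1) _ that(3)])
      have "ereal r < ereal T" using that by simp
      then show "ereal r < Tp" using T(3) by (rule less_trans)
    qed
    from flow[OF T(1,3)] interpret MVE_flow \<Omega> p T z "weak_time_derivative (X0 p \<Omega>) (X0_norm p \<Omega>) {0<..<T} z" 2 \<mu>vis \<kappa> \<alpha> \<beta> K \<pi> .
    show ?thesis
      by (intro conjI entropy_integrable[OF t0 T(2)] less_le_trans[OF c(1) low[OF t0 T(2)]]
          entropy_mono[OF st(1,2) T(2) c(1) low nonneg])
  qed
  \<comment> \<open>Positivity of the temperature and the signs of the coefficients decide for any
    values of the derivatives, so the bound holds at every point and time, whichever representatives
    \<open>weak_partial\<close> selects.\<close>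
  have rate: "0 \<le> entropy_production_rate \<Omega> \<mu>vis \<kappa> \<alpha> K (z t) x" if t: "0 \<le> t" "ereal t < Tp" and x: "x \<in> \<Omega>" for t x
  proof -
    have pos: "0 < tmp (z t) x" using c(1) c(2)[OF t, of x] x closure_subset[of \<Omega>] by fastforce
    have "heat_flux \<Omega> K (z t) x \<bullet> weak_grad \<Omega> (tmp (z t)) x \<le> 0"
      using nonneg(4)[of "weak_grad \<Omega> (tmp (z t)) x" "z t x"] by (simp add: heat_flux_def inner_commute)
    then have "heat_flux \<Omega> K (z t) x \<bullet> weak_grad \<Omega> (tmp (z t)) x / tmp (z t) x \<le> 0"
      using pos by (rule divide_nonpos_pos)
    moreover have "0 \<le> \<mu>vis (tmp (z t) x) * (norm (weak_grad \<Omega> (vel (z t)) x))\<^sup>2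
        + \<kappa> (tmp (z t) x) * (norm (weak_grad \<Omega> (dfm (z t)) x))\<^sup>2 + \<alpha> (tmp (z t) x) * (norm (tension \<Omega> (mag (z t)) x))\<^sup>2"
      by (intro add_nonneg_nonneg mult_nonneg_nonneg nonneg) auto
    ultimately show ?thesis unfolding entropy_production_rate_def using pos by (intro mult_nonneg_nonneg) auto
  qed
  show ?thesis
  proof (intro conjI allI impI ballI)
    show "integrable (lebesgue_on \<Omega>) (entropy_density (z t))" if "0 \<le> t" "ereal t < Tp" for t
      using entropy[OF that(1) order.refl that(2)] by (rule conjunct1)
  qed (simp_all add: energy entropy rate)
qed

end
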